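(* Let $A\in\operatorname{M}_n(\mathbb{Z})$ be non-singular with irreducible characteristic polynomial $h_A$, let $\lambda$ be an eigenvalue of $A$, $K=\mathbb{Q}(\lambda)$, and let $\mathbf{u}=(u_1,\ldots,u_n)^t\in(\mathcal{O}_K)^n$ be an eigenvector of $A$ for $\lambda$. The map $\phi:\mathbb{A}_{K,\lambda}\to\widehat{G_A}$ sending $(\eta_{\mathfrak p})_{\mathfrak p}$ to the character $$\chi(\mathbf{x})=\prod_{\mathfrak p\in\mathcal{S}_\infty\cup\mathcal{S}_\lambda}e^{2\pi i\Lambda_{\mathfrak p}(\eta_{\mathfrak p}\mu(\mathbf{x}))},\qquad \mathbf{x}\in G_A,$$ is onto, and $\ker\phi=Y_A(\mathbf{u},\lambda)$ (embedded diagonally). Hence $\widehat{G_A}\cong\mathbb{A}_{K,\lambda}/Y_A(\mathbf{u},\lambda)$.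
   Context: $G_A=\{A^k\mathbf{x}\mid\mathbf{x}\in\mathbb{Z}^n,k\in\mathbb{Z}\}\subseteq\mathbb{Q}^n$ with the discrete topology, and $\widehat{G_A}$ its Pontryagin dual. Let $\sigma_1=\mathrm{id},\sigma_2,\ldots,\sigma_n$ be the embeddings of $K$ into $\overline{\mathbb{Q}}$. Every $\mathbf{x}\in G_A$ can be written uniquely as $\mathbf{x}=\sum_{i=1}^n\sigma_i(x_1\mathbf{u})$ with $x_1\in K$, and $\mu(\mathbf{x})=x_1$ (an injective homomorphism $G_A\to K$). $\mathcal{S}_\lambda$ is the set of prime ideals of $\mathcal{O}_K$ dividing $\lambda$, $\mathcal{S}_\infty$ the set of infinite places of $K$, $K_{\mathfrak p}$ the completion, and $\mathbb{A}_{K,\lambda}=\prod_{\mathfrak p\in\mathcal{S}_\infty\cup\mathcal{S}_\lambda}K_{\mathfrak p}$, with $K$ embedded diagonally. For complex $\mathfrak p$, $\Lambda_{\mathfrak p}(\xi)=-2\operatorname{Re}(\xi)$; for real $\mathfrak p$, $\Lambda_{\mathfrak p}(\xi)=-\xi$; for finite $\mathfrak p$ above $p$, $\Lambda_{\mathfrak p}(\xi)=\{\operatorname{Tr}_{K_{\mathfrak p}/\mathbb{Q}_p}\xi\}_p$, where for $y\in\mathbb{Q}_p$, $\{y\}_p\in\mathbb{Z}[1/p]\cap[0,1)$ is its fractional part, i.e. $y-\{y\}_p\in\mathbb{Z}_p$. $Y_A(\mathbf{u},\lambda)=\{m_1\lambda^{k_1}u_1+\cdots+m_n\lambda^{k_n}u_n\mid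 m_i,k_i\in\mathbb{Z}\}\subseteq K$. *)

theory Defs
  imports
    "HOL-Algebra.Algebra"
    "HOL-Algebra.Algebraic_Closure_Type"
    "HOL-Analysis.Function_Topology"
    "HOL-Analysis.Abstract_Metric_Spaces"
    "HOL-Computational_Algebra.Primes"
    "Jordan_Normal_Form.Char_Poly"
begin

unbundle no vec_syntax

section \<open>Number fields inside the complex numbers\<close>

text \<open>
  Number fields are subsets of the complex numbers, and the algebraic closure of the rationals is
  replaced by the complex numbers: an embedding of a number field into the latter automatically
  has algebraic values.
\<close>

definition subring_of_C :: "complex set \<Rightarrow> complex ring"
  where "subring_of_C S = ring_of_type_algebra\<lparr>carrier := S\<rparr>"

definition simple_ext :: "complex \<Rightarrow> complex set"
  where "simple_ext l = generate_field (ring_of_type_algebra :: complex ring) {l}"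

definition integers_of :: "complex set \<Rightarrow> complex set"
  where "integers_of K = {x \<in> K. algebraic_int x}"

abbreviation ring_of_integers :: "complex set \<Rightarrow> complex ring"
  where "ring_of_integers K \<equiv> subring_of_C (integers_of K)"

text \<open>Embeddings are made extensional so that each one is represented by a single function.\<close>

definition embeddings :: "complex set \<Rightarrow> (complex \<Rightarrow> complex) set"
  where "embeddings K =
    Ring.ring_hom (subring_of_C K) (ring_of_type_algebra :: complex ring) \<inter> extensional K"

section \<open>Places and absolute values\<close>

text \<open>
  A finite place is a prime ideal of the ring of integers; an infinite place is a class
  of embeddings modulo complex conjugation.
\<close>

datatype place = Fin_place "complex set" | Inf_place "(complex \<Rightarrow> complex) set"

definition infinite_places :: "complex set \<Rightarrow> place set"
  where "infinite_places K =
    {Inf_place {\<sigma>, restrict (\<lambda>x. cnj (\<sigma> x)) K} | \<sigma>. \<sigma> \<in> embeddings K}"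

definition places_dividing :: "complex set \<Rightarrow> complex \<Rightarrow> place set"
  where "places_dividing K l =
    {Fin_place P | P. primeideal P (ring_of_integers K) \<and> P divides\<^bsub>ideals_set (ring_of_integers K)\<^esub> (PIdl\<^bsub>ring_of_integers K\<^esub> l)}"

definition ideal_ord :: "complex set \<Rightarrow> complex set \<Rightarrow> complex \<Rightarrow> nat"
  where "ideal_ord K P a = (GREATEST k::nat. a \<in> P [^]\<^bsub>ideals_set (ring_of_integers K)\<^esub> k)"

definition padic_val :: "complex set \<Rightarrow> complex set \<Rightarrow> complex \<Rightarrow> int"
  where "padic_val K P x = (THE k. \<exists>a \<in> integers_of K - {0}. \<exists>b \<in> integers_of K - {0}.
    x = a / b \<and> k = int (ideal_ord K P a) - int (ideal_ord K P b))"

text \<open>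
  The base 2 is immaterial: every base greater than 1 gives the same Cauchy sequences, the same
  null sequences, the same unit ball and the same topology.
\<close>

definition padic_abs :: "complex set \<Rightarrow> complex set \<Rightarrow> complex \<Rightarrow> real"
  where "padic_abs K P x = (if x = 0 then 0 else 2 powi (- padic_val K P x))"

text \<open>Both members of a class of embeddings give the same absolute value.\<close>

fun place_abs :: "complex set \<Rightarrow> place \<Rightarrow> complex \<Rightarrow> real" where
  "place_abs K (Fin_place P) x = padic_abs K P x"
| "place_abs K (Inf_place s) x = the_elem ((\<lambda>\<sigma>. cmod (\<sigma> x)) ` s)"

section \<open>Completions\<close>

text \<open>The completion is the ring of Cauchy sequences modulo the ideal of null sequences.\<close>

definition cauchy_ring :: "complex set \<Rightarrow> (complex \<Rightarrow> real) \<Rightarrow> (nat \<Rightarrow> complex) ring"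
  where "cauchy_ring K v =
    \<lparr>carrier = {x. (\<forall>n. x n \<in> K) \<and>
                   (\<forall>e>0. \<exists>N. \<forall>m\<ge>N. \<forall>n\<ge>N. v (x m - x n) < e)},
     monoid.mult = (\<lambda>x y n. x n * y n), monoid.one = (\<lambda>_. 1),
     ring.zero = (\<lambda>_. 0), ring.add = (\<lambda>x y n. x n + y n)\<rparr>"

definition null_seqs :: "complex set \<Rightarrow> (complex \<Rightarrow> real) \<Rightarrow> (nat \<Rightarrow> complex) set"
  where "null_seqs K v = {x \<in> carrier (cauchy_ring K v). (\<lambda>n. v (x n)) \<longlonglongrightarrow> 0}"

definition completion :: "complex set \<Rightarrow> (complex \<Rightarrow> real) \<Rightarrow> (nat \<Rightarrow> complex) set ring"
  where "completion K v = cauchy_ring K v Quot null_seqs K v"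

definition completion_embed ::
    "complex set \<Rightarrow> (complex \<Rightarrow> real) \<Rightarrow> complex \<Rightarrow> (nat \<Rightarrow> complex) set"
  where "completion_embed K v a = null_seqs K v +>\<^bsub>cauchy_ring K v\<^esub> (\<lambda>_. a)"

definition completion_abs :: "(complex \<Rightarrow> real) \<Rightarrow> (nat \<Rightarrow> complex) set \<Rightarrow> real"
  where "completion_abs v \<xi> = (THE r. \<forall>x \<in> \<xi>. (\<lambda>n. v (x n)) \<longlonglongrightarrow> r)"

text \<open>
  The case distinction makes the distance nonnegative and symmetric on the whole type, as the
  library's metric spaces require.
\<close>

definition completion_dist ::
    "complex set \<Rightarrow> (complex \<Rightarrow> real) \<Rightarrow> (nat \<Rightarrow> complex) set \<Rightarrow> (nat \<Rightarrow> complex) set \<Rightarrow> real"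
  where "completion_dist K v \<xi> \<zeta> =
    (if \<xi> \<in> carrier (completion K v) \<and> \<zeta> \<in> carrier (completion K v)
     then completion_abs v (\<xi> \<ominus>\<^bsub>completion K v\<^esub> \<zeta>) else 0)"

definition completion_topology ::
    "complex set \<Rightarrow> (complex \<Rightarrow> real) \<Rightarrow> (nat \<Rightarrow> complex) set topology"
  where "completion_topology K v =
    Metric_space.mtopology (carrier (completion K v)) (completion_dist K v)"

section \<open>The local maps to the reals\<close>

definition Qp_abs :: "nat \<Rightarrow> complex \<Rightarrow> real"
  where "Qp_abs p = padic_abs \<rat> (PIdl\<^bsub>ring_of_integers \<rat>\<^esub> (of_nat p))"

definition Qp :: "nat \<Rightarrow> (nat \<Rightarrow> complex) set ring"
  where "Qp p = completion \<rat> (Qp_abs p)"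

definition Zp :: "nat \<Rightarrow> (nat \<Rightarrow> complex) set set"
  where "Zp p = {y \<in> carrier (Qp p). completion_abs (Qp_abs p) y \<le> 1}"

definition padic_frac :: "nat \<Rightarrow> (nat \<Rightarrow> complex) set \<Rightarrow> real"
  where "padic_frac p y =
    (THE r. 0 \<le> r \<and> r < 1 \<and> (\<exists>(a::int) k::nat. r = of_int a / of_nat p ^ k) \<and>
            y \<ominus>\<^bsub>Qp p\<^esub> completion_embed \<rat> (Qp_abs p) (of_real r) \<in> Zp p)"

text \<open>
  The trace of the finite field extension \<open>L\<close> of its subfield \<open>F\<close>: the trace of the
  matrix \<open>M\<close> of multiplication by \<open>\<xi>\<close> in any basis \<open>bs\<close>.
\<close>

definition ext_trace :: "('a, 'b) ring_scheme \<Rightarrow> 'a set \<Rightarrow> 'a \<Rightarrow> 'a"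
  where "ext_trace L F \<xi> = (THE t. \<exists>bs M.
    set bs \<subseteq> carrier L \<and> ring.independent L F bs \<and> ring.Span L F bs = carrier L \<and>
    (\<forall>i<length bs. \<forall>j<length bs. M i j \<in> F) \<and>
    (\<forall>j<length bs. \<xi> \<otimes>\<^bsub>L\<^esub> bs ! j = ring.combine L (map (\<lambda>i. M i j) [0..<length bs]) bs) \<and>
    t = (\<Oplus>\<^bsub>L\<^esub> i \<in> {..<length bs}. M i i))"

text \<open>
  A Cauchy sequence of rationals for the absolute value of \<open>p\<close> is one for every prime ideal
  above \<open>p\<close>, which embeds \<open>Qp p\<close> into the completion at such a prime ideal.
\<close>

definition Qp_to_completion ::
    "complex set \<Rightarrow> (complex \<Rightarrow> real) \<Rightarrow> (nat \<Rightarrow> complex) set \<Rightarrow> (nat \<Rightarrow> complex) set"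
  where "Qp_to_completion K v y = y <+>\<^bsub>cauchy_ring K v\<^esub> null_seqs K v"

definition local_trace ::
    "complex set \<Rightarrow> (complex \<Rightarrow> real) \<Rightarrow> nat \<Rightarrow> (nat \<Rightarrow> complex) set \<Rightarrow> (nat \<Rightarrow> complex) set"
  where "local_trace K v p \<xi> = (THE y. y \<in> carrier (Qp p) \<and>
    Qp_to_completion K v y =
      ext_trace (completion K v) (Qp_to_completion K v ` carrier (Qp p)) \<xi>)"

text \<open>The continuous extension of an embedding to the completion at its infinite place.\<close>

definition extend_embedding :: "(complex \<Rightarrow> complex) \<Rightarrow> (nat \<Rightarrow> complex) set \<Rightarrow> complex"
  where "extend_embedding \<sigma> \<xi> = (THE z. \<forall>x \<in> \<xi>. (\<lambda>n. \<sigma> (x n)) \<longlonglongrightarrow> z)"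

definition real_place :: "complex set \<Rightarrow> (complex \<Rightarrow> complex) set \<Rightarrow> bool"
  where "real_place K s \<longleftrightarrow> (\<forall>\<sigma>\<in>s. \<sigma> ` K \<subseteq> \<real>)"

text \<open>
  At an infinite place the completion is identified with the real or complex numbers by
  extending an embedding in the class; conjugate embeddings give the same real part.
\<close>

fun Lam :: "complex set \<Rightarrow> place \<Rightarrow> (nat \<Rightarrow> complex) set \<Rightarrow> real" where
  "Lam K (Fin_place P) \<xi> =
    (let p = (THE p::nat. Factorial_Ring.prime p \<and> of_nat p \<in> P)
     in padic_frac p (local_trace K (place_abs K (Fin_place P)) p \<xi>))"
| "Lam K (Inf_place s) \<xi> =
    (let x = the_elem ((\<lambda>\<sigma>. Re (extend_embedding \<sigma> \<xi>)) ` s)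
     in if real_place K s then - x else - 2 * x)"

section \<open>The product of completions\<close>

definition S_places :: "complex \<Rightarrow> place set"
  where "S_places l = infinite_places (simple_ext l) \<union> places_dividing (simple_ext l) l"

definition local_field :: "complex \<Rightarrow> place \<Rightarrow> (nat \<Rightarrow> complex) set ring"
  where "local_field l v = completion (simple_ext l) (place_abs (simple_ext l) v)"

definition local_embed :: "complex \<Rightarrow> place \<Rightarrow> complex \<Rightarrow> (nat \<Rightarrow> complex) set"
  where "local_embed l v = completion_embed (simple_ext l) (place_abs (simple_ext l) v)"

definition adele_group :: "complex \<Rightarrow> (place \<Rightarrow> (nat \<Rightarrow> complex) set) monoid"
  where "adele_group l = product_group (S_places l) (\<lambda>v. add_monoid (local_field l v))"

definition adele_topology :: "complex \<Rightarrow> (place \<Rightarrow> (nat \<Rightarrow> complex) set) topology"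
  where "adele_topology l = product_topology
    (\<lambda>v. completion_topology (simple_ext l) (place_abs (simple_ext l) v)) (S_places l)"

definition diag :: "complex \<Rightarrow> complex \<Rightarrow> place \<Rightarrow> (nat \<Rightarrow> complex) set"
  where "diag l a = (\<lambda>v \<in> S_places l. local_embed l v a)"

section \<open>Pontryagin duals and quotients of topological groups\<close>

definition circle_group :: "complex monoid"
  where "circle_group = \<lparr>carrier = sphere 0 1, monoid.mult = (*), monoid.one = 1\<rparr>"

definition pontryagin_dual :: "('a, 'b) monoid_scheme \<Rightarrow> 'a topology \<Rightarrow> ('a \<Rightarrow> complex) monoid"
  where "pontryagin_dual G T =
    \<lparr>carrier = {f \<in> hom G circle_group. f \<in> extensional (carrier G) \<and>
                  continuous_map T (top_of_set (sphere 0 1)) f},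
     monoid.mult = (\<lambda>f g. \<lambda>x \<in> carrier G. f x * g x),
     monoid.one = (\<lambda>x \<in> carrier G. 1)\<rparr>"

text \<open>The compact-open topology.\<close>

definition dual_topology ::
    "('a, 'b) monoid_scheme \<Rightarrow> 'a topology \<Rightarrow> ('a \<Rightarrow> complex) topology"
  where "dual_topology G T = topology_generated_by
    {{f \<in> carrier (pontryagin_dual G T). f ` C \<subseteq> U} | C U. compactin T C \<and> open U}"

definition quotient_group_topology ::
    "('a, 'b) monoid_scheme \<Rightarrow> 'a topology \<Rightarrow> 'a set \<Rightarrow> 'a set topology"
  where "quotient_group_topology G T H = topology (\<lambda>U. U \<subseteq> carrier (G Mod H) \<and>
    openin T {x \<in> carrier G. H #>\<^bsub>G\<^esub> x \<in> U})"

section \<open>The group of an integer matrix and its characters\<close>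

definition G_set :: "int mat \<Rightarrow> rat vec set"
  where "G_set A =
    {(map_mat rat_of_int A [^]\<^bsub>ring_mat TYPE(rat) (dim_row A) ()\<^esub> k) *\<^sub>v map_vec rat_of_int x
      | x k. x \<in> carrier_vec (dim_row A) \<and> k \<in> (UNIV :: int set)}"

definition G_group :: "int mat \<Rightarrow> rat vec monoid"
  where "G_group A = (monoid_vec TYPE(rat) (dim_row A))\<lparr>carrier := G_set A\<rparr>"

definition mu :: "complex \<Rightarrow> complex vec \<Rightarrow> rat vec \<Rightarrow> complex"
  where "mu l u x = (THE x1. x1 \<in> simple_ext l \<and>
    (\<forall>j<dim_vec u. of_rat (x $ j) = (\<Sum>\<sigma>\<in>embeddings (simple_ext l). \<sigma> (x1 * u $ j))))"

definition phi ::
    "int mat \<Rightarrow> complex vec \<Rightarrow> complex \<Rightarrow> (place \<Rightarrow> (nat \<Rightarrow> complex) set) \<Rightarrow> rat vec \<Rightarrow> complex"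
  where "phi A u l \<eta> = (\<lambda>x \<in> G_set A. \<Prod>v\<in>S_places l.
    exp (2 * of_real pi * \<i> *
      of_real (Lam (simple_ext l) v (\<eta> v \<otimes>\<^bsub>local_field l v\<^esub> local_embed l v (mu l u x)))))"

definition Y_set :: "complex vec \<Rightarrow> complex \<Rightarrow> complex set"
  where "Y_set u l =
    {\<Sum>i<dim_vec u. of_int (m i) * l powi (k i) * u $ i | (m :: nat \<Rightarrow> int) (k :: nat \<Rightarrow> int). True}"

abbreviation G_dual :: "int mat \<Rightarrow> (rat vec \<Rightarrow> complex) monoid"
  where "G_dual A \<equiv> pontryagin_dual (G_group A) (discrete_topology (G_set A))"

abbreviation G_dual_topology :: "int mat \<Rightarrow> (rat vec \<Rightarrow> complex) topology"
  where "G_dual_topology A \<equiv> dual_topology (G_group A) (discrete_topology (G_set A))"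

end

theory Submission
  imports Defs
begin

text \<open>
  Let \<open>w\<close> be the basis of \<open>K\<close> dual to \<open>u\<close> for the trace form.  Then \<open>\<mu>\<close> identifies \<open>G\<^sub>A\<close> with the union of
  the lattices \<open>l\<^sup>-\<^sup>k \<Sum> \<int> w\<^sub>j\<close>, and \<open>Y\<close> is the union of the lattices \<open>l\<^sup>-\<^sup>k \<Sum> \<int> u\<^sub>j\<close>.

  Reciprocity: if \<open>Tr (x l\<^sup>m)\<close> is an integer for large \<open>m\<close>, then the local values \<open>\<Lambda>(x)\<close> add up to an
  integer.  The infinite places contribute \<open>- Tr x\<close>, and the local traces at the primes dividing \<open>l\<close>
  are approximated by global traces \<open>Tr (\<epsilon> x)\<close> with \<open>\<epsilon>\<close> close to 1 at one prime and to 0 at the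
  others.  Hence \<open>Y\<close> lies in the kernel.  Conversely, translate an element of the kernel by \<open>Y\<close> until
  its finite components are small; its infinite components then come from the lattice \<open>\<Sum> \<int> u\<^sub>j\<close>,
  and once these are removed its finite components are divisible by all powers of \<open>l\<close>.

  A character is realized by lifting its values on \<open>l\<^sup>-\<^sup>r w\<^sub>j\<close> to real numbers.  The lift at \<open>r = 0\<close> gives
  the infinite components, and the integers by which successive lifts fail to be compatible are the
  digits of an \<open>l\<close>-adic series giving the finite components.  The components are as small as
  the lifts, so the map is open.
\<close>

section \<open>Linear algebra and algebraic integers\<close>

text \<open>No factorization theory of ideals enters. The integers of \<open>K\<close> lie in
  \<open>(1/d) \<Sum> \<int> u\<^sub>j\<close> for some \<open>d\<close>, so their residues modulo a
  nonzero integer are finite in number; pigeonhole on powers then gives maximality of the primes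
  above \<open>l\<close>, invertibility of these primes, and integral closure in the form needed.

  The obstacle to reciprocity is that the places in use miss the primes above a prime number q that
  do not divide \<open>l\<close>, while the global trace sees all of them. Powers of
  \<open>l\<close> are eventually periodic modulo \<open>q ^ s\<close>, so for suitable
  \<open>M\<close> the element \<open>l ^ M\<close> is nearly idempotent: close to 0 at the primes
  dividing \<open>l\<close>, close to 1 at the others above q. Now \<open>x * l ^ M\<close> has
  integral trace by hypothesis, and \<open>x * (1 - l ^ M)\<close> feels only the primes dividing
  \<open>l\<close>.

  The level \<open>k\<close> in the realization of characters serves openness. The lifts are
  prescribed on \<open>l\<^sup>-\<^sup>k w\<^sub>j\<close>, so the digit series starts at
  \<open>l ^ k\<close> and is small at every finite place, since \<open>l\<close> has absolute value
  at most 1/2 there; the infinite components are then controlled by the size of the lifts.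
  Surjectivity uses level 0.\<close>

lemma square_inverse:
  fixes G :: "nat \<Rightarrow> nat \<Rightarrow> 'a::field"
  assumes ker: "\<And>c. (\<And>i. i < n \<Longrightarrow> (\<Sum>j<n. G i j * c j) = 0) \<Longrightarrow> \<forall>j<n. c j = 0"
  shows "\<exists>H. (\<forall>i<n. \<forall>j<n. (\<Sum>k<n. G i k * H k j) = (if i = j then 1 else 0)) \<and>
    (\<forall>i<n. \<forall>j<n. (\<Sum>k<n. H i k * G k j) = (if i = j then 1 else 0))"
proof -
  define M where "M = mat n n (\<lambda>(i, j). G i j)"
  have M: "M \<in> carrier_mat n n" by (simp add: M_def)
  have "det M \<noteq> 0"
  proof
    assume "det M = 0"
    then obtain v where v: "v \<in> carrier_vec n" "v \<noteq> 0\<^sub>v n" "M *\<^sub>v v = 0\<^sub>v n"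
      using det_0_iff_vec_prod_zero_field[OF M] by auto
    have "(\<Sum>j<n. G i j * v $ j) = 0" if "i < n" for i
    proof -
      have "(M *\<^sub>v v) $ i = 0" using v that by simp
      thus ?thesis using that v(1) by (simp add: M_def scalar_prod_def atLeast0LessThan)
    qed
    from ker[OF this] have "v = 0\<^sub>v n" using v(1) by (intro eq_vecI) auto
    with v show False by simp
  qed
  from det_non_zero_imp_unit[OF M this, of "()"]
  obtain B where B: "B \<in> carrier_mat n n" "B * M = 1\<^sub>m n" "M * B = 1\<^sub>m n"
    unfolding Units_def ring_mat_def by auto
  show ?thesis
  proof (intro exI[of _ "\<lambda>i j. B $$ (i, j)"] conjI allI impI)
    fix i j assume ij: "i < n" "j < n"
    have "(M * B) $$ (i, j) = (if i = j then 1 else 0)" using B ij by simp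
    thus "(\<Sum>k<n. G i k * B $$ (k, j)) = (if i = j then 1 else 0)"
      using ij B(1) by (simp add: M_def scalar_prod_def atLeast0LessThan)
  next
    fix i j assume ij: "i < n" "j < n"
    have "(B * M) $$ (i, j) = (if i = j then 1 else 0)" using B ij by simp
    thus "(\<Sum>k<n. B $$ (i, k) * G k j) = (if i = j then 1 else 0)"
      using ij B(1) by (simp add: M_def scalar_prod_def atLeast0LessThan)
  qed
qed

section \<open>Algebraic integers form a ring\<close>

interpretation zmod: Modules.module "\<lambda>(c::int) (x::complex). of_int c * x"
  by unfold_locales (auto simp: algebra_simps)

lemma zspan_mult:
  assumes "x \<in> zmod.span S" "y \<in> zmod.span T" "\<And>a b. a \<in> S \<Longrightarrow> b \<in> T \<Longrightarrow> a * b \<in> zmod.span U"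
  shows "x * y \<in> zmod.span U"
  using assms(1)
proof (induction rule: zmod.span_induct_alt)
  case base
  then show ?case by (simp add: zmod.span_zero)
next
  case (step c a x)
  have "a * y \<in> zmod.span U"
    using assms(2)
  proof (induction rule: zmod.span_induct_alt)
    case base
    then show ?case by (simp add: zmod.span_zero)
  next
    case (step d b y)
    have "of_int d * (a * b) \<in> zmod.span U"
      by (intro zmod.span_scale assms(3) step.hyps \<open>a \<in> S\<close>)
    from zmod.span_add[OF this step.IH] show ?case by (simp add: algebra_simps)
  qed
  from zmod.span_add[OF zmod.span_scale[OF this, of c] step.IH]
  show ?case by (simp add: algebra_simps)
qed

text \<open>Multiplication by \<open>x\<close> on the generators is given by an integer matrix, and
  the list of generators is an eigenvector of that matrix for \<open>x\<close>; the nonzero member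
  \<open>b0\<close> keeps it from being the zero vector. The characteristic polynomial is the
  required monic equation.\<close>

lemma algebraic_int_stable_lattice:
  fixes x :: complex
  assumes "finite B" "b0 \<in> B" "b0 \<noteq> 0" "\<And>b. b \<in> B \<Longrightarrow> x * b \<in> zmod.span B"
  shows "algebraic_int x"
proof -
  define n where "n = card B"
  obtain f where f: "bij_betw f {..<n} B"
    using ex_bij_betw_nat_finite[OF assms(1)] by (auto simp: n_def atLeast0LessThan)
  have "\<forall>b\<in>B. \<exists>c. x * b = (\<Sum>a\<in>B. of_int (c a) * a)"
    using assms(4) unfolding zmod.span_finite[OF assms(1)] by blast
  then obtain c where c: "\<And>b. b \<in> B \<Longrightarrow> x * b = (\<Sum>a\<in>B. of_int (c b a) * a)"
    by metis
  define M where "M = mat n n (\<lambda>(i, j). c (f i) (f j))"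
  have M: "M \<in> carrier_mat n n" by (simp add: M_def)
  let ?M = "map_mat complex_of_int M"
  have M': "?M \<in> carrier_mat n n" using M by simp
  define v where "v = vec n f"
  have fB: "f i \<in> B" if "i < n" for i using f that by (auto simp: bij_betw_def)
  have "eigenvector ?M v x"
    unfolding eigenvector_def
  proof (intro conjI)
    show "v \<in> carrier_vec (dim_row ?M)" using M by (simp add: v_def)
    obtain i where i: "i < n" "f i = b0" using f assms(2) by (auto simp: bij_betw_def)
    hence "v $ i \<noteq> 0" using assms(3) by (simp add: v_def)
    thus "v \<noteq> 0\<^sub>v (dim_row ?M)" using i M by auto
    show "?M *\<^sub>v v = x \<cdot>\<^sub>v v"
    proof (rule eq_vecI)
      fix i assume "i < dim_vec (x \<cdot>\<^sub>v v)"
      hence i: "i < n" by (simp add: v_def)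
      have "(?M *\<^sub>v v) $ i = (\<Sum>j<n. of_int (c (f i) (f j)) * f j)"
        using i by (simp add: M_def v_def scalar_prod_def atLeast0LessThan)
      also have "\<dots> = (\<Sum>a\<in>B. of_int (c (f i) a) * a)"
        by (rule sum.reindex_bij_betw[OF f])
      also have "\<dots> = x * f i" using c[OF fB[OF i]] by simp
      finally show "(?M *\<^sub>v v) $ i = (x \<cdot>\<^sub>v v) $ i" using i by (simp add: v_def)
    qed (simp add: M_def v_def)
  qed
  hence "eigenvalue ?M x" unfolding eigenvalue_def by blast
  hence "poly (char_poly ?M) x = 0" using eigenvalue_root_char_poly[OF M'] by simp
  moreover have "char_poly ?M = map_poly of_int (char_poly M)"
    by (rule of_int_hom.char_poly_hom[OF M])
  moreover have "lead_coeff (char_poly M) = 1"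
    using degree_monic_char_poly[OF M] by auto
  ultimately show ?thesis unfolding algebraic_int_altdef_ipoly by metis
qed

text \<open>The monic equation writes \<open>x ^ N\<close> through lower powers. Multiplied by
  \<open>x ^ d\<close> it lowers the exponent \<open>d + N\<close>, so strong induction brings every
  power into the span.\<close>

lemma algebraic_int_powers_span:
  fixes x :: complex
  assumes "algebraic_int x"
  obtains N where "N > 0" "\<And>k. x ^ k \<in> zmod.span ((\<lambda>i. x ^ i) ` {..<N})"
proof -
  obtain p :: "int poly" where p: "poly (map_poly of_int p) x = 0" "lead_coeff p = 1"
    using assms unfolding algebraic_int_altdef_ipoly by blast
  define N where "N = degree p"
  have "N \<noteq> 0"
  proof
    assume "N = 0"
    hence "p = [:1:]" using p(2) by (auto simp: N_def elim!: degree_eq_zeroE)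
    with p(1) show False by simp
  qed
  let ?S = "(\<lambda>i. x ^ i) ` {..<N}"
  have eq: "x ^ N = - (\<Sum>i<N. of_int (coeff p i) * x ^ i)"
  proof -
    have deg: "degree (map_poly of_int p :: complex poly) = N"
      by (simp add: N_def)
    have "0 = (\<Sum>i\<le>N. of_int (coeff p i) * x ^ i)"
      using p(1) unfolding poly_altdef deg by simp
    also have "\<dots> = (\<Sum>i<N. of_int (coeff p i) * x ^ i) + x ^ N"
      using p(2) by (simp add: lessThan_Suc_atMost[symmetric] N_def)
    finally show ?thesis by (simp add: eq_neg_iff_add_eq_0 add.commute)
  qed
  have base: "x ^ i \<in> zmod.span ?S" if "i < N" for i
    using that by (intro zmod.span_base) auto
  have "x ^ k \<in> zmod.span ?S" for k
  proof (induction k rule: less_induct)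
    case (less k)
    show ?case
    proof (cases "k < N")
      case True
      then show ?thesis by (rule base)
    next
      case False
      define d where "d = k - N"
      have k: "k = d + N" using False by (simp add: d_def)
      have "x ^ k = - (\<Sum>i<N. of_int (coeff p i) * x ^ (d + i))"
        by (simp add: k power_add eq sum_distrib_left sum_negf algebra_simps)
      moreover have "(\<Sum>i<N. of_int (coeff p i) * x ^ (d + i)) \<in> zmod.span ?S"
        by (intro zmod.span_sum zmod.span_scale less.IH) (auto simp: k)
      ultimately show ?thesis using zmod.span_neg by fastforce
    qed
  qed
  with \<open>N \<noteq> 0\<close> show thesis by (intro that[of N]) auto
qed

text \<open>The monomials in \<open>x\<close> and \<open>y\<close> with exponents below the two
  degrees generate a group stable under both numbers, hence under their sum and product. This
  reduces ring closure to \<open>algebraic_int_stable_lattice\<close>.\<close>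

lemma algebraic_int_two_lattice:
  fixes x y :: complex
  assumes "algebraic_int x" "algebraic_int y"
  obtains B where "finite B" "1 \<in> B" "\<And>b. b \<in> B \<Longrightarrow> x * b \<in> zmod.span B"
    "\<And>b. b \<in> B \<Longrightarrow> y * b \<in> zmod.span B"
proof -
  obtain N where N: "N > 0" "\<And>k. x ^ k \<in> zmod.span ((\<lambda>i. x ^ i) ` {..<N})"
    using algebraic_int_powers_span[OF assms(1)] by blast
  obtain M where M: "M > 0" "\<And>k. y ^ k \<in> zmod.span ((\<lambda>i. y ^ i) ` {..<M})"
    using algebraic_int_powers_span[OF assms(2)] by blast
  define B where "B = (\<lambda>(i, j). x ^ i * y ^ j) ` ({..<N} \<times> {..<M})"
  have all: "x ^ i * y ^ j \<in> zmod.span B" for i j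
    by (rule zmod.span_base[THEN zspan_mult[OF N(2) M(2)]]) (auto simp: B_def)
  show thesis
  proof (rule that[of B])
    show "finite B" by (simp add: B_def)
    have "x ^ 0 * y ^ 0 \<in> B" unfolding B_def using N(1) M(1) by (intro image_eqI[of _ _ "(0, 0)"]) auto
    thus "1 \<in> B" by simp
    fix b assume "b \<in> B"
    then obtain i j where b: "b = x ^ i * y ^ j" by (auto simp: B_def)
    show "x * b \<in> zmod.span B" using all[of "Suc i" j] by (simp add: b algebra_simps)
    show "y * b \<in> zmod.span B" using all[of i "Suc j"] by (simp add: b algebra_simps)
  qed
qed

lemma algebraic_int_add [intro]:
  fixes x y :: complex
  assumes "algebraic_int x" "algebraic_int y"
  shows "algebraic_int (x + y)"
proof -
  obtain B where "finite B" "1 \<in> B" "\<And>b. b \<in> B \<Longrightarrow> x * b \<in> zmod.span B"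
    "\<And>b. b \<in> B \<Longrightarrow> y * b \<in> zmod.span B"
    using algebraic_int_two_lattice[OF assms] by blast
  thus ?thesis
    by (intro algebraic_int_stable_lattice[of B 1]) (auto simp: distrib_right intro: zmod.span_add)
qed

lemma algebraic_int_mult [intro]:
  fixes x y :: complex
  assumes "algebraic_int x" "algebraic_int y"
  shows "algebraic_int (x * y)"
proof -
  obtain B where B: "finite B" "1 \<in> B" "\<And>b. b \<in> B \<Longrightarrow> x * b \<in> zmod.span B"
    "\<And>b. b \<in> B \<Longrightarrow> y * b \<in> zmod.span B"
    using algebraic_int_two_lattice[OF assms] by blast
  have "x * y * b \<in> zmod.span B" if "b \<in> B" for b
    using zspan_mult[of x "{x}" "y * b" B B] B(3) B(4)[OF that]
    by (auto simp: mult.assoc intro: zmod.span_base)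
  with B show ?thesis
    by (intro algebraic_int_stable_lattice[of B 1]) auto
qed

lemma algebraic_int_diff [intro]:
  fixes x y :: complex
  shows "algebraic_int x \<Longrightarrow> algebraic_int y \<Longrightarrow> algebraic_int (x - y)"
  using algebraic_int_add[of x "- y"] by auto

lemma algebraic_int_sum:
  fixes f :: "'a \<Rightarrow> complex"
  shows "(\<And>i. i \<in> I \<Longrightarrow> algebraic_int (f i)) \<Longrightarrow> algebraic_int (\<Sum>i\<in>I. f i)"
  by (induction I rule: infinite_finite_induct) auto

section \<open>Subfields of the complex numbers\<close>

locale complex_subfield =
  fixes K :: "complex set"
  assumes one_K [simp]: "1 \<in> K"
    and diff_K [simp]: "\<And>x y. x \<in> K \<Longrightarrow> y \<in> K \<Longrightarrow> x - y \<in> K"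
    and mult_K [simp]: "\<And>x y. x \<in> K \<Longrightarrow> y \<in> K \<Longrightarrow> x * y \<in> K"
    and inverse_K [simp]: "\<And>x. x \<in> K \<Longrightarrow> inverse x \<in> K"
begin

lemma zero_K [simp]: "0 \<in> K"
  using diff_K[of 1 1] by simp

lemma uminus_K [simp]: "x \<in> K \<Longrightarrow> - x \<in> K"
  using diff_K[of 0 x] by simp

lemma add_K [simp]: "x \<in> K \<Longrightarrow> y \<in> K \<Longrightarrow> x + y \<in> K"
  using diff_K[of x "- y"] by simp

lemma divide_K [simp]: "x \<in> K \<Longrightarrow> y \<in> K \<Longrightarrow> x / y \<in> K"
  by (simp add: divide_inverse)

lemma power_K [simp]: "x \<in> K \<Longrightarrow> x ^ k \<in> K"
  by (induction k) auto

lemma power_int_K [simp]: "x \<in> K \<Longrightarrow> x powi k \<in> K"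
  by (simp add: power_int_def)

lemma of_nat_K [simp]: "of_nat k \<in> K"
  by (induction k) auto

lemma of_int_K [simp]: "of_int k \<in> K"
  by (cases k) auto

lemma of_rat_K [simp]: "of_rat q \<in> K"
  by (cases q) (simp add: of_rat_rat)

lemma Rats_subset_K: "x \<in> \<rat> \<Longrightarrow> x \<in> K"
  by (auto elim!: Rats_cases)

lemma sum_K: "(\<And>i. i \<in> I \<Longrightarrow> f i \<in> K) \<Longrightarrow> (\<Sum>i\<in>I. f i) \<in> K"
  by (induction I rule: infinite_finite_induct) auto

lemma sum_K_simp [simp]: "(\<And>i. i \<in> I =simp=> f i \<in> K) \<Longrightarrow> (\<Sum>i\<in>I. f i) \<in> K"
  by (rule sum_K) (simp add: simp_implies_def)

definition Oint :: "complex set" where "Oint = integers_of K"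

lemma Oint_iff: "x \<in> Oint \<longleftrightarrow> x \<in> K \<and> algebraic_int x"
  by (auto simp: Oint_def integers_of_def)

lemma Oint_K: "x \<in> Oint \<Longrightarrow> x \<in> K" by (simp add: Oint_iff)

lemma Oint_0 [simp]: "0 \<in> Oint" and Oint_1 [simp]: "1 \<in> Oint"
  by (auto simp: Oint_iff int_imp_algebraic_int)

lemma Oint_of_int [simp]: "of_int k \<in> Oint" and Oint_of_nat [simp]: "of_nat m \<in> Oint"
  by (auto simp: Oint_iff int_imp_algebraic_int)

lemma Oint_add [simp]: "x \<in> Oint \<Longrightarrow> y \<in> Oint \<Longrightarrow> x + y \<in> Oint"
  and Oint_diff [simp]: "x \<in> Oint \<Longrightarrow> y \<in> Oint \<Longrightarrow> x - y \<in> Oint"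
  and Oint_mult [simp]: "x \<in> Oint \<Longrightarrow> y \<in> Oint \<Longrightarrow> x * y \<in> Oint"
  by (auto simp: Oint_iff)

lemma Oint_uminus [simp]: "x \<in> Oint \<Longrightarrow> - x \<in> Oint"
  by (auto simp: Oint_iff)

lemma Oint_power [simp]: "x \<in> Oint \<Longrightarrow> x ^ k \<in> Oint"
  by (induction k) auto

lemma Oint_sum: "(\<And>i. i \<in> I \<Longrightarrow> f i \<in> Oint) \<Longrightarrow> (\<Sum>i\<in>I. f i) \<in> Oint"
  by (induction I rule: infinite_finite_induct) auto

lemma Oint_sum_simp [simp]: "(\<And>i. i \<in> I =simp=> f i \<in> Oint) \<Longrightarrow> (\<Sum>i\<in>I. f i) \<in> Oint"
  by (rule Oint_sum) (simp add: simp_implies_def)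

lemma Oint_prod: "(\<And>i. i \<in> I \<Longrightarrow> f i \<in> Oint) \<Longrightarrow> (\<Prod>i\<in>I. f i) \<in> Oint"
  by (induction I rule: infinite_finite_induct) auto

text \<open>Transitivity of integrality: \<open>x\<close> is a root of X^j - X^i - y with integral
  y. Pigeonhole on the powers of \<open>x\<close> produces exactly this shape.\<close>

lemma Oint_root:
  assumes "x \<in> K" "i < j" "x ^ j - x ^ i \<in> Oint"
  shows "x \<in> Oint"
proof -
  define p :: "complex poly" where "p = monom 1 j - monom 1 i"
  have deg: "degree p = j"
    unfolding p_def diff_conv_add_uminus using assms(2)
    by (subst degree_add_eq_left) (auto simp: degree_monom_eq)
  have "algebraic_int x"
  proof (rule algebraic_int_root)
    show "algebraic_int (x ^ j - x ^ i)" using assms(3) by (simp add: Oint_iff)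
    show "poly p x = x ^ j - x ^ i" by (simp add: p_def poly_monom)
    show "lead_coeff p = 1" unfolding deg using assms(2) by (simp add: p_def)
  qed (use assms(2) deg in \<open>auto simp: p_def coeff_monom\<close>)
  with assms(1) show ?thesis by (simp add: Oint_iff)
qed

abbreviation OR :: "complex ring" where "OR \<equiv> ring_of_integers K"

lemma OR_simps [simp]: "carrier OR = Oint" "monoid.mult OR = (*)" "monoid.one OR = 1"
  "ring.zero OR = 0" "ring.add OR = (+)"
  by (simp_all add: subring_of_C_def ring_of_type_algebra_def Oint_def)

lemma cring_OR: "cring OR"
proof (rule cringI)
  show "abelian_group OR"
    by (rule abelian_groupI) (auto intro: bexI[of _ "- x" for x] simp: algebra_simps)
  show "Group.comm_monoid OR"
    by (rule Group.comm_monoidI) (auto simp: algebra_simps)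
qed (auto simp: algebra_simps)

text \<open>Ideals become plain conditions on sets of complex numbers; closure under negation comes
  from multiplication by -1.\<close>

lemma ideal_OR_iff:
  "ideal I OR \<longleftrightarrow> I \<subseteq> Oint \<and> 0 \<in> I \<and> (\<forall>x\<in>I. \<forall>y\<in>I. x + y \<in> I) \<and> (\<forall>a\<in>Oint. \<forall>x\<in>I. a * x \<in> I)"
  (is "_ \<longleftrightarrow> ?R")
proof
  interpret cring OR by (rule cring_OR)
  assume I: "ideal I OR"
  interpret ideal I OR by (rule I)
  show ?R using a_subset zero_closed a_closed I_l_closed by auto
next
  interpret cring OR by (rule cring_OR)
  assume R: ?R
  have minv: "\<ominus>\<^bsub>OR\<^esub> x = - x" if "x \<in> Oint" for x
    using that minus_equality[of "- x" x] by simp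
  show "ideal I OR"
  proof (rule idealI)
    show "subgroup I (add_monoid OR)"
    proof (rule add.subgroupI)
      fix a assume "a \<in> I"
      moreover from this have "- 1 * a \<in> I" using R by (metis Oint_1 Oint_uminus)
      ultimately show "\<ominus>\<^bsub>OR\<^esub> a \<in> I" using R minv by auto
    qed (use R in auto)
  next
    fix a x assume "a \<in> I" "x \<in> carrier OR"
    hence "x * a \<in> I" using R by simp
    thus "x \<otimes>\<^bsub>OR\<^esub> a \<in> I" "a \<otimes>\<^bsub>OR\<^esub> x \<in> I" by (simp_all add: mult.commute)
  qed (rule ring_axioms)
qed

end

section \<open>The field generated by one complex number\<close>

lemma inv_type_algebra:
  "x \<noteq> 0 \<Longrightarrow> inv\<^bsub>(ring_of_type_algebra :: complex ring)\<^esub> x = inverse x"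
proof -
  interpret cring "ring_of_type_algebra :: complex ring" by (rule cring_from_type_algebra)
  assume "x \<noteq> 0"
  thus ?thesis by (intro comm_inv_char) (auto simp: ring_of_type_algebra_def)
qed

lemma uminus_type_algebra: "\<ominus>\<^bsub>(ring_of_type_algebra :: complex ring)\<^esub> x = - x"
proof -
  interpret cring "ring_of_type_algebra :: complex ring" by (rule cring_from_type_algebra)
  show ?thesis by (intro minus_equality) (auto simp: ring_of_type_algebra_def)
qed

lemma simple_ext_complex_subfield: "complex_subfield (simple_ext l)"
proof -
  let ?R = "ring_of_type_algebra :: complex ring"
  let ?K = "generate_field ?R {l}"
  have neg: "- x \<in> ?K" if "x \<in> ?K" for x
    using generate_field.a_inv[OF that] by (simp add: uminus_type_algebra)
  have add: "x + y \<in> ?K" if "x \<in> ?K" "y \<in> ?K" for x y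
    using generate_field.eng_add[OF that] by (simp add: ring_of_type_algebra_def)
  have one: "1 \<in> ?K"
    using generate_field.one[of ?R "{l}"] by (simp add: ring_of_type_algebra_def)
  have inv: "inverse x \<in> ?K" if "x \<in> ?K" for x
  proof (cases "x = 0")
    case True thus ?thesis using that by simp
  next
    case False thus ?thesis
      using generate_field.m_inv[OF that] inv_type_algebra by (simp add: ring_of_type_algebra_def)
  qed
  show ?thesis
    unfolding simple_ext_def
  proof
    fix x y assume "x \<in> ?K" "y \<in> ?K"
    thus "x - y \<in> ?K" using add[of x "- y"] neg by simp
    show "x * y \<in> ?K" using generate_field.eng_mult[OF \<open>x \<in> ?K\<close> \<open>y \<in> ?K\<close>] 
      by (simp add: ring_of_type_algebra_def)
  qed (use one inv in auto)
qed

lemma simple_ext_self: "l \<in> simple_ext l"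
  unfolding simple_ext_def by (rule generate_field.incl) simp

lemma simple_ext_least:
  assumes "complex_subfield E" "l \<in> E"
  shows "simple_ext l \<subseteq> E"
proof
  interpret complex_subfield E by fact
  fix x assume "x \<in> simple_ext l"
  thus "x \<in> E" unfolding simple_ext_def
  proof (induction rule: generate_field.induct)
    case (m_inv h)
    then show ?case by (subst inv_type_algebra) (auto simp: ring_of_type_algebra_def)
  next
    case (a_inv h)
    then show ?case by (simp add: uminus_type_algebra)
  qed (use assms(2) in \<open>auto simp: ring_of_type_algebra_def\<close>)
qed

lemma Rats_complex_subfield: "complex_subfield \<rat>"
  by unfold_locales auto

section \<open>The number field of an irreducible integer matrix\<close>

locale integer_matrix =
  fixes A :: "int mat" and n :: nat and l :: complex and u :: "complex vec"
  assumes A_carrier: "A \<in> carrier_mat n n"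
    and det_A: "det A \<noteq> 0"
    and irreducible_A: "Factorial_Ring.irreducible (map_poly rat_of_int (char_poly A))"
    and eigenvalue_l: "eigenvalue (map_mat complex_of_int A) l"
    and eigenvector_u: "eigenvector (map_mat complex_of_int A) u l"
    and u_Oint: "\<forall>i<n. u $ i \<in> integers_of (simple_ext l)"
begin

abbreviation K :: "complex set" where "K \<equiv> simple_ext l"

sublocale complex_subfield "simple_ext l"
  by (rule simple_ext_complex_subfield)

abbreviation h :: "rat poly" where "h \<equiv> map_poly rat_of_int (char_poly A)"
abbreviation (input) rpoly :: "rat poly \<Rightarrow> complex \<Rightarrow> complex"
  where "rpoly g x \<equiv> poly (map_poly of_rat g) x"
abbreviation Emb :: "(complex \<Rightarrow> complex) set" where "Emb \<equiv> embeddings (simple_ext l)"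

lemma l_K [simp]: "l \<in> K" by (rule simple_ext_self)

lemma u_O [simp]: "i < n \<Longrightarrow> u $ i \<in> Oint"
  using u_Oint by (simp add: Oint_def)

lemma u_K [simp]: "i < n \<Longrightarrow> u $ i \<in> K"
  by (simp add: Oint_K)

lemma dim_u [simp]: "dim_vec u = n"
  using eigenvector_u A_carrier by (simp add: eigenvector_def carrier_vecD)

lemma u_nonzero: "\<exists>i<n. u $ i \<noteq> 0"
proof (rule ccontr)
  assume "\<not> ?thesis"
  hence "u = 0\<^sub>v n" by (intro eq_vecI) auto
  thus False using eigenvector_u A_carrier by (simp add: eigenvector_def)
qed

lemma l_mult_u: "i < n \<Longrightarrow> l * u $ i = (\<Sum>j<n. of_int (A $$ (i, j)) * u $ j)"
proof -
  assume i: "i < n"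
  have "map_mat complex_of_int A *\<^sub>v u = l \<cdot>\<^sub>v u"
    using eigenvector_u by (simp add: eigenvector_def)
  from arg_cong[OF this, of "\<lambda>v. vec_index v i"] show ?thesis
    using i A_carrier by (simp add: scalar_prod_def atLeast0LessThan)
qed

lemma char_poly_monic [simp]: "degree (char_poly A) = n" "lead_coeff (char_poly A) = 1"
  using degree_monic_char_poly[OF A_carrier] by auto

lemma degree_h: "degree h = n"
  by simp

lemma h_nonzero: "h \<noteq> 0" 
  using irreducible_A by auto

lemma n_pos: "n > 0"
proof (rule ccontr)
  assume "\<not> n > 0"
  hence "degree h = 0" by simp
  hence "is_unit h" using h_nonzero by (simp add: is_unit_iff_degree)
  thus False using irreducible_A by (simp add: Factorial_Ring.irreducible_def)
qed

lemma map_h: "map_poly of_rat h = (map_poly of_int (char_poly A) :: complex poly)"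
  by (subst map_poly_map_poly) (auto simp: o_def)

lemma h_root: "rpoly h l = 0"
proof -
  have M: "map_mat complex_of_int A \<in> carrier_mat n n" using A_carrier by simp
  have "poly (char_poly (map_mat complex_of_int A)) l = 0"
    using eigenvalue_l eigenvalue_root_char_poly[OF M] by simp
  thus ?thesis unfolding map_h of_int_hom.char_poly_hom[OF A_carrier] .
qed

lemma l_O [simp]: "l \<in> Oint"
  using h_root char_poly_monic(2) unfolding map_h
  by (auto simp: Oint_iff algebraic_int_altdef_ipoly)

lemma rpoly_simps [simp]:
  "rpoly (f + g) x = rpoly f x + rpoly g x" "rpoly (f * g) x = rpoly f x * rpoly g x"
  "rpoly 1 x = 1" "rpoly 0 x = 0" "rpoly (- f) x = - rpoly f x" "rpoly (f - g) x = rpoly f x - rpoly g x"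
  "rpoly [:q:] x = of_rat q"
proof -
  interpret map_poly_comm_ring_hom "of_rat :: rat \<Rightarrow> complex" ..
  show "rpoly (f + g) x = rpoly f x + rpoly g x" "rpoly (f * g) x = rpoly f x * rpoly g x"
    "rpoly 1 x = 1" "rpoly 0 x = 0" "rpoly (- f) x = - rpoly f x" "rpoly (f - g) x = rpoly f x - rpoly g x"
    by (simp_all add: hom_add hom_mult hom_uminus hom_minus)
  show "rpoly [:q:] x = of_rat q"
    by (cases "q = 0") (auto simp: poly_altdef)
qed

text \<open>Irreducibility makes \<open>h\<close> the minimal polynomial of each of its roots: if
  \<open>h\<close> did not divide \<open>g\<close>, a Bezout identity between them would evaluate to
  0 = 1.\<close>

lemma rpoly_zero_iff: "rpoly h x = 0 \<Longrightarrow> rpoly g x = 0 \<longleftrightarrow> h dvd g"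
proof
  assume x: "rpoly h x = 0" and g: "rpoly g x = 0"
  show "h dvd g"
  proof (rule ccontr)
    assume "\<not> h dvd g"
    hence "coprime h g" using irreducible_A
      by (metis prime_elem_imp_coprime irreducible_imp_prime_elem)
    then obtain a b where "a * h + b * g = 1"
      using bezout_coefficients_fst_snd[of h g] by (metis coprime_iff_gcd_eq_1)
    hence "rpoly (a * h + b * g) x = rpoly 1 x" by simp
    thus False unfolding rpoly_simps using x g by simp
  qed
qed (auto elim!: dvdE)

text \<open>The values of polynomials at \<open>l\<close> already form a field, because Bezout
  inverts modulo \<open>h\<close>. Consequently an embedding is determined by the image of
  \<open>l\<close>.\<close>

lemma K_iff: "x \<in> K \<longleftrightarrow> (\<exists>g. x = rpoly g l)"
proof
  have "complex_subfield (range (\<lambda>g. rpoly g l))"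
  proof
    show "1 \<in> range (\<lambda>g. rpoly g l)" by (intro image_eqI[of _ _ 1]) auto
    fix x y assume "x \<in> range (\<lambda>g. rpoly g l)" "y \<in> range (\<lambda>g. rpoly g l)"
    then obtain f g where fg: "x = rpoly f l" "y = rpoly g l" by auto
    show "x - y \<in> range (\<lambda>g. rpoly g l)" by (intro image_eqI[of _ _ "f - g"]) (auto simp: fg)
    show "x * y \<in> range (\<lambda>g. rpoly g l)" by (intro image_eqI[of _ _ "f * g"]) (auto simp: fg)
  next
    fix x assume "x \<in> range (\<lambda>g. rpoly g l)"
    then obtain f where f: "x = rpoly f l" by auto
    show "inverse x \<in> range (\<lambda>g. rpoly g l)"
    proof (cases "h dvd f")
      case True
      hence "x = 0" using f rpoly_zero_iff[OF h_root] by simp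
      thus ?thesis by (intro image_eqI[of _ _ 0]) auto
    next
      case False
      hence "coprime h f" using irreducible_A
        by (metis prime_elem_imp_coprime irreducible_imp_prime_elem)
      then obtain a b where "a * h + b * f = 1"
        using bezout_coefficients_fst_snd[of h f] by (metis coprime_iff_gcd_eq_1)
      hence "rpoly (a * h + b * f) l = rpoly 1 l" by simp
      hence "rpoly b l * x = 1" unfolding rpoly_simps using h_root f by simp
      hence "inverse x = rpoly b l" by (metis inverse_unique mult.commute)
      thus ?thesis by blast
    qed
  qed
  moreover have "l \<in> range (\<lambda>g. rpoly g l)"
    by (intro image_eqI[of _ _ "[:0, 1:]"]) auto
  ultimately show "x \<in> K \<Longrightarrow> \<exists>g. x = rpoly g l" using simple_ext_least by blast
next
  assume "\<exists>g. x = rpoly g l"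
  then obtain g where "x = rpoly g l" by auto
  thus "x \<in> K" by (simp add: poly_altdef)
qed

section \<open>Embeddings of K\<close>

lemma emb_simps:
  assumes "\<sigma> \<in> Emb"
  shows "x \<in> K \<Longrightarrow> y \<in> K \<Longrightarrow> \<sigma> (x + y) = \<sigma> x + \<sigma> y"
    and "x \<in> K \<Longrightarrow> y \<in> K \<Longrightarrow> \<sigma> (x * y) = \<sigma> x * \<sigma> y" and "\<sigma> 1 = 1"
  using assms unfolding embeddings_def
  by (auto simp: Ring.ring_hom_def subring_of_C_def ring_of_type_algebra_def)

lemma emb_0: "\<sigma> \<in> Emb \<Longrightarrow> \<sigma> 0 = 0"
  using emb_simps(1)[of \<sigma> 0 0] by simp

lemma emb_minus: "\<sigma> \<in> Emb \<Longrightarrow> x \<in> K \<Longrightarrow> \<sigma> (- x) = - \<sigma> x"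
  using emb_simps(1)[of \<sigma> x "- x"] emb_0[of \<sigma>] by (simp add: eq_neg_iff_add_eq_0 add.commute)

lemma emb_diff: "\<sigma> \<in> Emb \<Longrightarrow> x \<in> K \<Longrightarrow> y \<in> K \<Longrightarrow> \<sigma> (x - y) = \<sigma> x - \<sigma> y"
  using emb_simps(1)[of \<sigma> x "- y"] emb_minus by simp

lemma emb_sum: "\<sigma> \<in> Emb \<Longrightarrow> (\<And>i. i \<in> I =simp=> f i \<in> K) \<Longrightarrow> \<sigma> (\<Sum>i\<in>I. f i) = (\<Sum>i\<in>I. \<sigma> (f i))"
  unfolding simp_implies_def
  by (induction I rule: infinite_finite_induct) (auto simp: emb_0 emb_simps sum_K)

lemma emb_power: "\<sigma> \<in> Emb \<Longrightarrow> x \<in> K \<Longrightarrow> \<sigma> (x ^ k) = \<sigma> x ^ k"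
  by (induction k) (auto simp: emb_simps)

lemma emb_inverse: "\<sigma> \<in> Emb \<Longrightarrow> x \<in> K \<Longrightarrow> \<sigma> (inverse x) = inverse (\<sigma> x)"
proof (cases "x = 0")
  case False
  assume a: "\<sigma> \<in> Emb" "x \<in> K"
  have "\<sigma> x * \<sigma> (inverse x) = 1"
    using emb_simps(2)[OF a(1), of x "inverse x"] emb_simps(3)[OF a(1)] a False by simp
  thus ?thesis by (simp add: inverse_unique)
qed (simp add: emb_0)

lemma emb_of_nat: "\<sigma> \<in> Emb \<Longrightarrow> \<sigma> (of_nat m) = of_nat m"
  by (induction m) (auto simp: emb_0 emb_simps)

lemma emb_of_int: "\<sigma> \<in> Emb \<Longrightarrow> \<sigma> (of_int m) = of_int m"
  by (cases m) (auto simp: emb_of_nat emb_minus emb_diff emb_simps)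

lemma emb_of_rat: "\<sigma> \<in> Emb \<Longrightarrow> \<sigma> (of_rat q) = of_rat q"
  by (cases q) (auto simp: of_rat_rat divide_inverse emb_simps emb_inverse emb_of_int)

lemma emb_rpoly: "\<sigma> \<in> Emb \<Longrightarrow> x \<in> K \<Longrightarrow> \<sigma> (rpoly g x) = rpoly g (\<sigma> x)"
  by (simp add: poly_altdef emb_sum emb_simps emb_power emb_of_rat)

lemma emb_eq_0_iff: "\<sigma> \<in> Emb \<Longrightarrow> x \<in> K \<Longrightarrow> \<sigma> x = 0 \<longleftrightarrow> x = 0"
  using emb_simps(2)[of \<sigma> x "inverse x"] emb_simps(3)[of \<sigma>] emb_0 by (cases "x = 0") auto

lemma emb_algebraic_int: 
  assumes "\<sigma> \<in> Emb" "x \<in> Oint" shows "algebraic_int (\<sigma> x)"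
proof -
  obtain p :: "int poly" where p: "poly (map_poly of_int p) x = 0" "lead_coeff p = 1"
    using assms(2) unfolding Oint_iff algebraic_int_altdef_ipoly by blast
  have "poly (map_poly of_int p) (\<sigma> x) = \<sigma> (poly (map_poly of_int p) x)"
    using assms Oint_K by (simp add: poly_altdef emb_sum emb_simps emb_power emb_of_int)
  with p assms show ?thesis unfolding algebraic_int_altdef_ipoly by (auto simp: emb_0)
qed

text \<open>The substitution of \<open>a\<close> for \<open>l\<close>. For a root \<open>a\<close>
  of \<open>h\<close> the choice of the polynomial does not matter, since two choices differ by a
  multiple of \<open>h\<close>.\<close>

definition root_emb :: "complex \<Rightarrow> complex \<Rightarrow> complex" where
  "root_emb a = (\<lambda>x\<in>K. rpoly (SOME g. x = rpoly g l) a)"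

lemma root_emb_rpoly:
  assumes "rpoly h a = 0" shows "root_emb a (rpoly g l) = rpoly g a"
proof -
  have K: "rpoly g l \<in> K" using K_iff by blast
  define f where "f = (SOME f. rpoly g l = rpoly f l)"
  have "rpoly g l = rpoly f l" unfolding f_def by (rule someI[of _ g]) simp
  hence "rpoly (g - f) l = 0" by simp
  hence "h dvd (g - f)" using rpoly_zero_iff[OF h_root] by blast
  hence "rpoly (g - f) a = 0" using rpoly_zero_iff[OF assms] by blast
  thus ?thesis using K by (simp add: root_emb_def f_def)
qed

lemma root_emb_Emb:
  assumes "rpoly h a = 0" shows "root_emb a \<in> Emb" "root_emb a l = a"
proof -
  have add: "root_emb a (x + y) = root_emb a x + root_emb a y"
    and mult: "root_emb a (x * y) = root_emb a x * root_emb a y" if "x \<in> K" "y \<in> K" for x y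
  proof -
    obtain f g where "x = rpoly f l" "y = rpoly g l" using \<open>x \<in> K\<close> \<open>y \<in> K\<close> K_iff by blast
    thus "root_emb a (x + y) = root_emb a x + root_emb a y"
      "root_emb a (x * y) = root_emb a x * root_emb a y"
      using root_emb_rpoly[OF assms, of "f + g"] root_emb_rpoly[OF assms, of "f * g"]
        root_emb_rpoly[OF assms, of f] root_emb_rpoly[OF assms, of g] by simp_all
  qed
  have "root_emb a 1 = 1" using root_emb_rpoly[OF assms, of 1] by simp
  with add mult show "root_emb a \<in> Emb"
    unfolding embeddings_def Ring.ring_hom_def
    by (auto simp: subring_of_C_def ring_of_type_algebra_def root_emb_def)
  show "root_emb a l = a" using root_emb_rpoly[OF assms, of "[:0, 1:]"] by simp
qed

lemma emb_root: "\<sigma> \<in> Emb \<Longrightarrow> rpoly h (\<sigma> l) = 0"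
  using emb_rpoly[of \<sigma> l h] h_root emb_0[of \<sigma>] by simp

lemma emb_eqI:
  assumes "\<sigma> \<in> Emb" "\<tau> \<in> Emb" "\<sigma> l = \<tau> l"
  shows "\<sigma> = \<tau>"
proof (rule extensionalityI[of _ K])
  show "\<sigma> \<in> extensional K" "\<tau> \<in> extensional K" using assms by (auto simp: embeddings_def)
  fix x assume "x \<in> K"
  then obtain g where "x = rpoly g l" using K_iff by blast
  thus "\<sigma> x = \<tau> x" using assms by (simp add: emb_rpoly)
qed

lemma Emb_bij: "bij_betw (\<lambda>\<sigma>. \<sigma> l) Emb {a. rpoly h a = 0}"
  unfolding bij_betw_def
proof
  show "inj_on (\<lambda>\<sigma>. \<sigma> l) Emb" by (auto intro!: inj_onI emb_eqI)
  show "(\<lambda>\<sigma>. \<sigma> l) ` Emb = {a. rpoly h a = 0}"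
  proof
    show "(\<lambda>\<sigma>. \<sigma> l) ` Emb \<subseteq> {a. rpoly h a = 0}" using emb_root by blast
    show "{a. rpoly h a = 0} \<subseteq> (\<lambda>\<sigma>. \<sigma> l) ` Emb"
    proof
      fix a assume "a \<in> {a. rpoly h a = 0}"
      hence "rpoly h a = 0" by blast
      from root_emb_Emb[OF this] show "a \<in> (\<lambda>\<sigma>. \<sigma> l) ` Emb" by (intro image_eqI[of _ _ "root_emb a"]) auto
    qed
  qed
qed

text \<open>A double root would be a root of the derivative, so \<open>h\<close> would divide a
  nonzero polynomial of smaller degree. Hence \<open>h\<close> is separable and has as many roots as
  its degree.\<close>

lemma card_roots: "card {a. rpoly h a = 0} = n"
proof -
  let ?p = "map_poly of_rat h :: complex poly"
  have deg: "degree ?p = n" by simp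
  have "rsquarefree ?p"
    unfolding rsquarefree_roots
  proof (intro allI notI, elim conjE)
    fix a assume a: "poly ?p a = 0" "poly (pderiv ?p) a = 0"
    have "pderiv ?p = map_poly of_rat (pderiv h)" by (simp add: of_rat_hom.map_poly_pderiv)
    hence "h dvd pderiv h" using a rpoly_zero_iff[of a "pderiv h"] by simp
    moreover have "pderiv h \<noteq> 0" using n_pos degree_h pderiv_eq_0_iff[of h] by linarith
    moreover have "degree (pderiv h) < degree h" using n_pos by (simp add: degree_pderiv)
    ultimately show False by (meson dvd_imp_degree_le not_le)
  qed
  from arg_cong[OF complex_poly_decompose_rsquarefree[OF this], of degree]
  have "degree (\<Prod>z | poly ?p z = 0. [:- z, 1:]) = n"
    using deg char_poly_monic(2) by (simp add: map_h)
  thus ?thesis by (subst (asm) degree_prod_eq_sum_degree) auto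
qed

lemma finite_Emb [simp]: "finite Emb" and card_Emb: "card Emb = n"
proof -
  have "finite {a. rpoly h a = 0}" using card_roots n_pos by (intro card_ge_0_finite) linarith
  thus "finite Emb" using bij_betw_finite[OF Emb_bij] by simp
  show "card Emb = n" using bij_betw_same_card[OF Emb_bij] card_roots by simp
qed

text \<open>Independence of characters. A relation on powers of \<open>l\<close> extends to all
  complex polynomials in the conjugates of \<open>l\<close>; the polynomial that vanishes at every
  conjugate other than \<open>\<tau> l\<close> isolates \<open>z \<tau>\<close>.\<close>

lemma emb_independent:
  assumes "\<And>x. x \<in> K \<Longrightarrow> (\<Sum>\<sigma>\<in>Emb. z \<sigma> * \<sigma> x) = 0" "\<tau> \<in> Emb"
  shows "z \<tau> = 0"
proof -
  have pow: "(\<Sum>\<sigma>\<in>Emb. z \<sigma> * \<sigma> l ^ k) = 0" for k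
    using assms(1)[of "l ^ k"] by (simp add: emb_power)
  have poly: "(\<Sum>\<sigma>\<in>Emb. z \<sigma> * poly g (\<sigma> l)) = 0" for g :: "complex poly"
  proof -
    have "(\<Sum>\<sigma>\<in>Emb. z \<sigma> * poly g (\<sigma> l)) = (\<Sum>i\<le>degree g. coeff g i * (\<Sum>\<sigma>\<in>Emb. z \<sigma> * \<sigma> l ^ i))"
      unfolding poly_altdef sum_distrib_left
      by (subst sum.swap) (auto intro!: sum.cong simp: algebra_simps)
    thus ?thesis using pow by simp
  qed
  define g where "g = (\<Prod>\<sigma>\<in>Emb - {\<tau>}. [:- \<sigma> l, 1:])"
  have "poly g (\<sigma> l) = 0" if "\<sigma> \<in> Emb - {\<tau>}" for \<sigma>
    unfolding g_def poly_prod using that by (intro prod_zero bexI[of _ \<sigma>]) auto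
  hence "(\<Sum>\<sigma>\<in>Emb. z \<sigma> * poly g (\<sigma> l)) = z \<tau> * poly g (\<tau> l)"
    using assms(2) by (subst sum.remove[of _ \<tau>]) auto
  moreover have "poly g (\<tau> l) \<noteq> 0"
    unfolding g_def poly_prod using assms(2) emb_eqI[of \<tau>] by (subst prod_zero_iff) auto
  ultimately show ?thesis using poly[of g] by auto
qed

end

context integer_matrix
begin

section \<open>The trace form\<close>

definition Tr :: "complex \<Rightarrow> complex" where "Tr x = (\<Sum>\<sigma>\<in>Emb. \<sigma> x)"

lemma Tr_add: "x \<in> K \<Longrightarrow> y \<in> K \<Longrightarrow> Tr (x + y) = Tr x + Tr y"
  by (simp add: Tr_def emb_simps sum.distrib)

lemma Tr_0 [simp]: "Tr 0 = 0"
  by (simp add: Tr_def emb_0)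

lemma Tr_diff: "x \<in> K \<Longrightarrow> y \<in> K \<Longrightarrow> Tr (x - y) = Tr x - Tr y"
  by (simp add: Tr_def emb_diff sum_subtractf)

lemma Tr_minus: "x \<in> K \<Longrightarrow> Tr (- x) = - Tr x"
  by (simp add: Tr_def emb_minus sum_negf)

lemma Tr_of_rat_mult: "x \<in> K \<Longrightarrow> Tr (of_rat q * x) = of_rat q * Tr x"
  by (simp add: Tr_def emb_simps emb_of_rat sum_distrib_left)

lemma Tr_of_int_mult: "x \<in> K \<Longrightarrow> Tr (of_int m * x) = of_int m * Tr x"
  using Tr_of_rat_mult[of x "of_int m"] by simp

lemma Tr_of_nat_mult: "x \<in> K \<Longrightarrow> Tr (of_nat m * x) = of_nat m * Tr x"
  using Tr_of_rat_mult[of x "of_nat m"] by simp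

lemma Tr_sum: "(\<And>i. i \<in> I =simp=> f i \<in> K) \<Longrightarrow> Tr (\<Sum>i\<in>I. f i) = (\<Sum>i\<in>I. Tr (f i))"
  unfolding simp_implies_def
  by (induction I rule: infinite_finite_induct) (auto simp: Tr_add sum_K)

lemma Tr_1: "Tr 1 = of_nat n"
  by (simp add: Tr_def emb_simps card_Emb)

text \<open>The rational span \<open>S\<close> of the entries of the eigenvector is stable under
  \<open>l\<close> because the rows of \<open>A\<close> express \<open>l * u $ i\<close>. So it is
  stable under K, and being nonzero it is all of K.\<close>

lemma u_span:
  assumes "x \<in> K"
  obtains q :: "nat \<Rightarrow> rat" where "x = (\<Sum>j<n. of_rat (q j) * u $ j)"
proof -
  define S where "S = {\<Sum>j<n. of_rat (q j) * u $ j | q. True}"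
  have add: "x + y \<in> S" if xy: "x \<in> S" "y \<in> S" for x y
  proof -
    obtain p q where "x = (\<Sum>j<n. of_rat (p j) * u $ j)" "y = (\<Sum>j<n. of_rat (q j) * u $ j)"
      using xy by (auto simp: S_def)
    hence "x + y = (\<Sum>j<n. of_rat (p j + q j) * u $ j)"
      by (simp add: of_rat_add algebra_simps sum.distrib)
    thus ?thesis unfolding S_def by (intro CollectI exI[of _ "\<lambda>j. p j + q j"]) auto
  qed
  have zero: "0 \<in> S" unfolding S_def by (auto intro: exI[of _ "\<lambda>_. 0"])
  have sum: "(\<Sum>i\<in>I. f i) \<in> S" if "\<And>i. i \<in> I \<Longrightarrow> f i \<in> S" for I :: "nat set" and f
    using that by (induction I rule: infinite_finite_induct) (auto intro: add zero)
  have scale: "of_rat r * x \<in> S" if x: "x \<in> S" for x r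
  proof -
    obtain p where "x = (\<Sum>j<n. of_rat (p j) * u $ j)"
      using x by (auto simp: S_def)
    hence "of_rat r * x = (\<Sum>j<n. of_rat (r * p j) * u $ j)"
      by (simp add: of_rat_mult algebra_simps sum_distrib_left)
    thus ?thesis unfolding S_def by (intro CollectI exI[of _ "\<lambda>j. r * p j"]) auto
  qed
  have uS: "u $ i \<in> S" if "i < n" for i
    unfolding S_def using that
    by (auto intro!: exI[of _ "\<lambda>j. if j = i then 1 else 0"] simp: if_distrib[of of_rat] mult_delta_left cong: if_cong)
  have lS: "l * x \<in> S" if x: "x \<in> S" for x
  proof -
    obtain p where p: "x = (\<Sum>j<n. of_rat (p j) * u $ j)"
      using x by (auto simp: S_def)
    have luS: "l * u $ i \<in> S" if "i < n" for i
      unfolding l_mult_u[OF that] using uS scale[of _ "of_int m" for m]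
      by (intro sum) auto
    have "l * x = (\<Sum>j<n. of_rat (p j) * (l * u $ j))" by (simp add: p sum_distrib_left algebra_simps)
    also have "\<dots> \<in> S" by (intro sum scale luS) auto
    finally show ?thesis .
  qed
  have pow: "l ^ k * x \<in> S" if "x \<in> S" for x k
    by (induction k) (use that lS in \<open>auto simp: mult.assoc\<close>)
  have KS: "y * x \<in> S" if "y \<in> K" "x \<in> S" for x y
  proof -
    obtain g where "y = poly (map_poly of_rat g) l" using K_iff \<open>y \<in> K\<close> by blast
    hence "y * x = (\<Sum>i\<le>degree g. of_rat (coeff g i) * (l ^ i * x))"
      by (simp add: poly_altdef sum_distrib_right mult.assoc)
    also have "\<dots> \<in> S" by (intro sum scale pow that)
    finally show ?thesis .
  qed
  obtain i where i: "i < n" "u $ i \<noteq> 0" using u_nonzero by blast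
  have "x * inverse (u $ i) * u $ i \<in> S" using i assms by (intro KS uS) auto
  hence "x \<in> S" using i by (simp add: mult.assoc)
  thus thesis using that by (auto simp: S_def)
qed

text \<open>A kernel vector of the matrix of conjugates of the \<open>u $ i\<close> would be a
  linear relation between the embeddings, first on the \<open>u $ i\<close> and then, since these
  span, on K.\<close>

lemma emb_matrix_inverse:
  obtains f :: "nat \<Rightarrow> complex \<Rightarrow> complex" and V where "bij_betw f {..<n} Emb"
    and "\<And>i j. i < n \<Longrightarrow> j < n \<Longrightarrow> (\<Sum>k<n. f k (u $ i) * V k j) = (if i = j then 1 else 0)"
    and "\<And>i j. i < n \<Longrightarrow> j < n \<Longrightarrow> (\<Sum>k<n. V i k * f j (u $ k)) = (if i = j then 1 else 0)"
proof -
  obtain f where f: "bij_betw f {..<n} Emb"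
    using ex_bij_betw_nat_finite[OF finite_Emb] by (auto simp: card_Emb atLeast0LessThan)
  have fE: "f k \<in> Emb" if "k < n" for k using f that by (auto simp: bij_betw_def)
  have ker: "\<forall>j<n. c j = 0" if c: "\<And>i. i < n \<Longrightarrow> (\<Sum>j<n. f j (u $ i) * c j) = 0" for c
  proof (intro allI impI)
    fix j assume j: "j < n"
    define z where "z = c \<circ> the_inv_into {..<n} f"
    have z: "z (f i) = c i" if "i < n" for i
      using f that by (simp add: z_def the_inv_into_f_f bij_betw_def)
    have "(\<Sum>\<sigma>\<in>Emb. z \<sigma> * \<sigma> x) = 0" if x: "x \<in> K" for x
    proof -
      obtain q where q: "x = (\<Sum>j<n. of_rat (q j) * u $ j)" using u_span[OF x] by blast
      have "(\<Sum>\<sigma>\<in>Emb. z \<sigma> * \<sigma> x) = (\<Sum>i<n. z (f i) * f i x)"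
        by (rule sum.reindex_bij_betw[OF f, symmetric])
      also have "\<dots> = (\<Sum>i<n. \<Sum>j<n. of_rat (q j) * (f i (u $ j) * c i))"
        by (simp add: q fE emb_sum emb_simps emb_of_rat sum_distrib_left z algebra_simps)
      also have "\<dots> = (\<Sum>j<n. of_rat (q j) * (\<Sum>i<n. f i (u $ j) * c i))"
        by (subst sum.swap) (simp add: sum_distrib_left)
      also have "\<dots> = 0" using c by simp
      finally show ?thesis .
    qed
    from emb_independent[OF this fE[OF j]] show "c j = 0" using z j by simp
  qed
  obtain V where "\<And>i j. i < n \<Longrightarrow> j < n \<Longrightarrow> (\<Sum>k<n. f k (u $ i) * V k j) = (if i = j then 1 else 0)"
    "\<And>i j. i < n \<Longrightarrow> j < n \<Longrightarrow> (\<Sum>k<n. V i k * f j (u $ k)) = (if i = j then 1 else 0)"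
    using square_inverse[of n "\<lambda>i j. f j (u $ i)", OF ker] by blast
  with f show thesis using that by blast
qed

lemma u_independent:
  assumes "(\<Sum>j<n. of_rat (q j) * u $ j) = 0" "j < n"
  shows "q j = 0"
proof -
  obtain f V where fV: "bij_betw f {..<n} Emb"
    "\<And>i j. i < n \<Longrightarrow> j < n \<Longrightarrow> (\<Sum>k<n. f k (u $ i) * V k j) = (if i = j then 1 else 0)"
    by (rule emb_matrix_inverse) blast
  have fE: "f k \<in> Emb" if "k < n" for k using fV that by (auto simp: bij_betw_def)
  have 0: "(\<Sum>i<n. of_rat (q i) * f k (u $ i)) = 0" if "k < n" for k
    using arg_cong[OF assms(1), of "f k"] fE[OF that]
    by (simp add: emb_sum emb_simps emb_of_rat emb_0)
  have "0 = (\<Sum>k<n. (\<Sum>i<n. of_rat (q i) * f k (u $ i)) * V k j)"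
    using 0 by simp
  also have "\<dots> = (\<Sum>i<n. of_rat (q i) * (\<Sum>k<n. f k (u $ i) * V k j))"
    unfolding sum_distrib_right sum_distrib_left by (subst sum.swap) (simp add: mult.assoc)
  also have "\<dots> = of_rat (q j)"
    using fV(2) assms(2) by (simp add: mult_delta_right)
  finally show ?thesis by simp
qed

text \<open>The matrix of conjugates diagonalizes multiplication by \<open>x\<close>, whose matrix
  \<open>M\<close> on the \<open>u $ i\<close> is rational. The sum of the conjugates of
  \<open>x\<close> is therefore the trace of \<open>M\<close>.\<close>

lemma Tr_rational: 
  assumes "x \<in> K" shows "Tr x \<in> \<rat>"
proof -
  obtain f V where fV: "bij_betw f {..<n} Emb"
    "\<And>i j. i < n \<Longrightarrow> j < n \<Longrightarrow> (\<Sum>k<n. f k (u $ i) * V k j) = (if i = j then 1 else 0)"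
    "\<And>i j. i < n \<Longrightarrow> j < n \<Longrightarrow> (\<Sum>k<n. V i k * f j (u $ k)) = (if i = j then 1 else 0)"
    by (rule emb_matrix_inverse) blast
  have fE: "f k \<in> Emb" if "k < n" for k using fV that by (auto simp: bij_betw_def)
  have "\<forall>i\<in>{..<n}. \<exists>q. x * u $ i = (\<Sum>j<n. of_rat (q j) * u $ j)"
    using u_span assms by (metis mult_K u_K lessThan_iff)
  then obtain M where M: "\<And>i. i < n \<Longrightarrow> x * u $ i = (\<Sum>j<n. of_rat (M i j) * u $ j)"
    by (metis lessThan_iff)
  have fx: "f k x = (\<Sum>j<n. \<Sum>i<n. of_rat (M j i) * (f k (u $ i) * V k j))" if k: "k < n" for k
  proof -
    have "f k x = (\<Sum>j<n. V k j * f k (u $ j)) * f k x" using fV(3)[OF k k] by simp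
    also have "\<dots> = (\<Sum>j<n. V k j * f k (x * u $ j))"
      using fE[OF k] assms by (simp add: sum_distrib_left sum_distrib_right emb_simps algebra_simps)
    also have "\<dots> = (\<Sum>j<n. \<Sum>i<n. of_rat (M j i) * (f k (u $ i) * V k j))"
      using fE[OF k] by (simp add: M emb_sum emb_simps emb_of_rat sum_distrib_left algebra_simps)
    finally show ?thesis .
  qed
  have "Tr x = (\<Sum>k<n. f k x)"
    unfolding Tr_def by (rule sum.reindex_bij_betw[OF fV(1), symmetric])
  also have "\<dots> = (\<Sum>k<n. \<Sum>j<n. \<Sum>i<n. of_rat (M j i) * (f k (u $ i) * V k j))"
    using fx by simp
  also have "\<dots> = (\<Sum>j<n. \<Sum>i<n. of_rat (M j i) * (\<Sum>k<n. f k (u $ i) * V k j))"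
    unfolding sum_distrib_left by (subst sum.swap, intro sum.cong refl sum.swap)
  also have "\<dots> = of_rat (\<Sum>j<n. M j j)"
    using fV(2) by (simp add: of_rat_sum mult_delta_right)
  finally show ?thesis by simp
qed

lemma Tr_Oint: "x \<in> Oint \<Longrightarrow> Tr x \<in> \<int>"
  unfolding Tr_def using Tr_rational[OF Oint_K, of x] 
  by (intro rational_algebraic_int_is_int algebraic_int_sum emb_algebraic_int) (auto simp: Tr_def)

text \<open>An element orthogonal to every \<open>u $ i\<close> is orthogonal to all of K, in
  particular to its own inverse; but the trace of 1 is \<open>n\<close>, which is positive.\<close>

lemma Tr_nondegenerate:
  assumes "y \<in> K" "\<And>i. i < n \<Longrightarrow> Tr (u $ i * y) = 0"
  shows "y = 0"
proof (rule ccontr)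
  assume "y \<noteq> 0"
  obtain q where q: "inverse y = (\<Sum>j<n. of_rat (q j) * u $ j)"
    using u_span[of "inverse y"] assms(1) by auto
  have "Tr 1 = Tr (\<Sum>j<n. of_rat (q j) * (u $ j * y))"
    using \<open>y \<noteq> 0\<close> by (simp add: sum_distrib_right[symmetric] q[symmetric] mult.assoc[symmetric])
  also have "\<dots> = 0"
    using assms by (simp add: Tr_sum Tr_of_rat_mult)
  finally show False using n_pos by (simp add: Tr_1)
qed

text \<open>The Gram matrix \<open>g\<close> of the trace form on \<open>u\<close> is rational and
  has trivial kernel by nondegeneracy, so its inverse gives the coefficients of the dual
  basis.\<close>

lemma dual_basis_exists:
  "\<exists>w. (\<forall>j<n. w j \<in> K) \<and> (\<forall>i<n. \<forall>j<n. Tr (u $ i * w j) = (if i = j then 1 else 0))"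
proof -
  have "\<exists>q. Tr (u $ i * u $ j) = of_rat q" if "i < n" "j < n" for i j
    using Tr_rational[of "u $ i * u $ j"] that by (auto elim!: Rats_cases)
  note rat = this
  define g where "g i j = (SOME q. Tr (u $ i * u $ j) = of_rat q)" for i j
  have g: "Tr (u $ i * u $ j) = of_rat (g i j)" if "i < n" "j < n" for i j
    unfolding g_def using someI_ex[OF rat[OF that]] .
  have ker: "\<forall>j<n. c j = 0" if c: "\<And>i. i < n \<Longrightarrow> (\<Sum>j<n. g i j * c j) = 0" for c
  proof -
    define y where "y = (\<Sum>j<n. of_rat (c j) * u $ j)"
    have y: "y \<in> K" unfolding y_def by auto
    have "Tr (u $ i * y) = 0" if i: "i < n" for i
    proof -
      have "Tr (u $ i * y) = Tr (\<Sum>j<n. of_rat (c j) * (u $ i * u $ j))"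
        by (simp add: y_def sum_distrib_left algebra_simps)
      also have "\<dots> = (\<Sum>j<n. of_rat (c j) * of_rat (g i j))"
        using i by (simp add: Tr_sum Tr_of_rat_mult g)
      also have "\<dots> = of_rat (\<Sum>j<n. g i j * c j)"
        by (simp add: of_rat_sum of_rat_mult mult.commute)
      finally show ?thesis using c i by simp
    qed
    hence "y = 0" by (rule Tr_nondegenerate[OF y])
    hence "(\<Sum>j<n. of_rat (c j) * u $ j) = 0" by (simp add: y_def)
    from u_independent[OF this] show ?thesis by simp
  qed
  obtain H where H: "\<And>i j. i < n \<Longrightarrow> j < n \<Longrightarrow> (\<Sum>k<n. g i k * H k j) = (if i = j then 1 else 0)"
    using square_inverse[of n g, OF ker] by blast
  show ?thesis
  proof (intro exI[of _ "\<lambda>j. \<Sum>k<n. of_rat (H k j) * u $ k"] conjI allI impI)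
    fix i j assume ij: "i < n" "j < n"
    have "Tr (u $ i * (\<Sum>k<n. of_rat (H k j) * u $ k)) = Tr (\<Sum>k<n. of_rat (H k j) * (u $ i * u $ k))"
      by (simp add: sum_distrib_left algebra_simps)
    also have "\<dots> = (\<Sum>k<n. of_rat (H k j) * of_rat (g i k))"
      using ij by (simp add: Tr_sum Tr_of_rat_mult g)
    also have "\<dots> = of_rat (\<Sum>k<n. g i k * H k j)"
      by (simp add: of_rat_sum of_rat_mult mult.commute)
    finally show "Tr (u $ i * (\<Sum>k<n. of_rat (H k j) * u $ k)) = (if i = j then 1 else 0)"
      using H ij by simp
  qed auto
qed

definition w :: "nat \<Rightarrow> complex" where
  "w = (SOME w. (\<forall>j<n. w j \<in> K) \<and> (\<forall>i<n. \<forall>j<n. Tr (u $ i * w j) = (if i = j then 1 else 0)))"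

lemma w_K [simp]: "j < n \<Longrightarrow> w j \<in> K"
  and Tr_u_w: "i < n \<Longrightarrow> j < n \<Longrightarrow> Tr (u $ i * w j) = (if i = j then 1 else 0)"
  using someI_ex[OF dual_basis_exists] unfolding w_def[symmetric] by blast+

lemma u_expansion: 
  assumes "x \<in> K" shows "x = (\<Sum>j<n. Tr (x * w j) * u $ j)"
proof -
  obtain q where q: "x = (\<Sum>j<n. of_rat (q j) * u $ j)" using u_span[OF assms] by blast
  have "Tr (x * w i) = of_rat (q i)" if i: "i < n" for i
  proof -
    have "Tr (x * w i) = Tr (\<Sum>j<n. of_rat (q j) * (u $ j * w i))"
      by (simp add: q sum_distrib_right mult.assoc)
    also have "\<dots> = of_rat (q i)"
      using i by (simp add: Tr_sum Tr_of_rat_mult Tr_u_w mult_delta_right)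
    finally show ?thesis .
  qed
  thus ?thesis using q by simp
qed

lemma w_expansion: 
  assumes "x \<in> K" shows "x = (\<Sum>j<n. Tr (x * u $ j) * w j)"
proof -
  define y where "y = (\<Sum>j<n. Tr (x * u $ j) * w j)"
  have r: "Tr (x * u $ j) \<in> K" if "j < n" for j
    using that assms by (intro Rats_subset_K[OF Tr_rational]) auto
  have y: "y \<in> K" unfolding y_def using r by auto
  have "Tr (u $ i * (x - y)) = 0" if i: "i < n" for i
  proof -
    have rj: "Tr (Tr (x * u $ j) * z) = Tr (x * u $ j) * Tr z" if "j < n" "z \<in> K" for j z
      using Tr_rational[of "x * u $ j"] that assms by (auto elim!: Rats_cases simp: Tr_of_rat_mult)
    have "Tr (u $ i * y) = Tr (\<Sum>j<n. Tr (x * u $ j) * (u $ i * w j))"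
      by (simp add: y_def sum_distrib_left algebra_simps)
    also have "\<dots> = (\<Sum>j<n. Tr (x * u $ j) * Tr (u $ i * w j))"
      using i r by (subst Tr_sum) (auto simp: rj)
    also have "\<dots> = Tr (u $ i * x)"
      using i by (simp add: Tr_u_w mult_delta_left mult.commute)
    finally show ?thesis using i assms y by (simp add: right_diff_distrib Tr_diff)
  qed
  hence "x - y = 0" by (rule Tr_nondegenerate[rotated]) (use assms y in simp_all)
  hence "x = y" by (rule eq_iff_diff_eq_0[THEN iffD2])
  thus ?thesis unfolding y_def .
qed

section \<open>Finiteness of residue rings\<close>

lemma Ints_Oint: "z \<in> \<int> \<Longrightarrow> z \<in> Oint"
  by (auto elim: Ints_cases)

lemma common_denominator:
  assumes "finite S" and "S \<subseteq> K"
  obtains m where "m > (0::nat)" "\<And>x. x \<in> S \<Longrightarrow> of_nat m * x \<in> Oint"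
proof -
  define D where "D = {x. \<exists>m::nat. m > 0 \<and> of_nat m * x \<in> Oint}"
  have sum: "(\<Sum>j\<in>I. f j) \<in> D" if "\<And>j. j \<in> I \<Longrightarrow> f j \<in> D" for I :: "nat set" and f
    using that
  proof (induction I rule: infinite_finite_induct)
    case (insert i I)
    then obtain a b :: nat where "a > 0" "of_nat a * f i \<in> Oint" "b > 0" "of_nat b * (\<Sum>j\<in>I. f j) \<in> Oint"
      unfolding D_def by blast
    moreover from this(2,4) have "of_nat b * (of_nat a * f i) + of_nat a * (of_nat b * (\<Sum>j\<in>I. f j)) \<in> Oint"
      by (rule Oint_add[OF Oint_mult[OF Oint_of_nat] Oint_mult[OF Oint_of_nat]])
    ultimately show ?case unfolding D_def using insert
      by (intro CollectI exI[of _ "a * b"]) (simp add: algebra_simps)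
  qed (auto simp: D_def)
  have scale: "of_rat q * u $ j \<in> D" if "j < n" for q j
  proof (cases q)
    case (Fract a b)
    hence "of_nat (nat b) * (of_rat q * u $ j) = of_int a * u $ j" by (simp add: of_rat_rat)
    moreover have "of_int a * u $ j \<in> Oint" using that by (intro Oint_mult Oint_of_int u_O)
    ultimately have "of_nat (nat b) * (of_rat q * u $ j) \<in> Oint" by (simp only:)
    thus ?thesis unfolding D_def using Fract(2) by (intro CollectI exI[of _ "nat b"]) simp
  qed
  have single: "\<exists>m::nat. m > 0 \<and> of_nat m * x \<in> Oint" if x: "x \<in> K" for x
  proof -
    obtain q where "x = (\<Sum>j<n. of_rat (q j) * u $ j)" using u_span[OF x] by blast
    thus ?thesis using sum[of "{..<n}" "\<lambda>j. of_rat (q j) * u $ j"] scale unfolding D_def by auto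
  qed
  have "\<exists>m::nat. m > 0 \<and> (\<forall>x\<in>S. of_nat m * x \<in> Oint)"
    using assms
  proof (induction S rule: finite_induct)
    case empty
    show ?case by (rule exI[of _ 1]) simp
  next
    case (insert x S)
    then obtain m where m: "m > (0::nat)" "\<forall>x\<in>S. of_nat m * x \<in> Oint" by blast
    obtain k where k: "k > (0::nat)" "of_nat k * x \<in> Oint" using single insert.prems by blast
    have "of_nat (k * m) * y \<in> Oint" if "y \<in> insert x S" for y
    proof (cases "y = x")
      case True
      have "of_nat m * (of_nat k * x) \<in> Oint" using k by simp
      thus ?thesis using True by (simp add: algebra_simps)
    next
      case False
      hence "of_nat k * (of_nat m * y) \<in> Oint" using m that by simp
      thus ?thesis by (simp add: algebra_simps)
    qed
    thus ?case using m(1) k(1) by (intro exI[of _ "k * m"]) auto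
  qed
  thus thesis using that by blast
qed

lemma Oint_divides_nat:
  assumes "a \<in> Oint" "a \<noteq> 0"
  obtains m :: nat and b where "m > 0" "b \<in> Oint" "of_nat m = a * b"
proof -
  obtain m :: nat where "m > 0" "of_nat m * inverse a \<in> Oint"
    using common_denominator[of "{inverse a}"] assms(1) Oint_K by auto
  thus thesis using assms(2) by (intro that[of m "of_nat m * inverse a"]) auto
qed

text \<open>The coordinates of an integer in \<open>u\<close> are its traces against
  \<open>w\<close>. A common denominator \<open>d\<close> of the \<open>w j\<close> turns these into
  traces of integers.\<close>

lemma Oint_lattice:
  obtains d :: nat where "d > 0"
    "\<And>x. x \<in> Oint \<Longrightarrow> \<exists>c. of_nat d * x = (\<Sum>j<n. of_int (c j) * u $ j)"
proof -
  obtain d :: nat where d: "d > 0" "\<And>x. x \<in> w ` {..<n} \<Longrightarrow> of_nat d * x \<in> Oint"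
    by (rule common_denominator[of "w ` {..<n}"]) auto
  have "\<exists>c. of_nat d * x = (\<Sum>j<n. of_int (c j) * u $ j)" if x: "x \<in> Oint" for x
  proof -
    have "\<exists>c::int. of_nat d * Tr (x * w j) = of_int c" if j: "j < n" for j
    proof -
      have "of_nat d * Tr (x * w j) = Tr (x * (of_nat d * w j))"
        using x j Oint_K by (simp flip: Tr_of_nat_mult add: algebra_simps)
      also have "\<dots> \<in> \<int>" by (intro Tr_Oint Oint_mult[OF x d(2)]) (use j in auto)
      finally show ?thesis by (auto elim: Ints_cases)
    qed
    hence "\<forall>j\<in>{..<n}. \<exists>c::int. of_nat d * Tr (x * w j) = of_int c" by simp
    from bchoice[OF this] obtain c
      where c: "\<And>j. j < n \<Longrightarrow> of_nat d * Tr (x * w j) = of_int (c j)" by auto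
    have "of_nat d * x = of_nat d * (\<Sum>j<n. Tr (x * w j) * u $ j)"
      by (rule arg_cong[OF u_expansion[OF Oint_K[OF x]]])
    also have "\<dots> = (\<Sum>j<n. of_nat d * Tr (x * w j) * u $ j)"
      by (simp add: sum_distrib_left mult.assoc)
    also have "\<dots> = (\<Sum>j<n. of_int (c j) * u $ j)" using c by simp
    finally show ?thesis by blast
  qed
  thus thesis using d that by blast
qed

text \<open>Some natural number \<open>m\<close> is a multiple of \<open>a\<close>, and the
  coordinates of \<open>d * x\<close> in the lattice of the \<open>u $ j\<close> leave only finitely
  many possibilities modulo \<open>m * d\<close>.\<close>

lemma finite_residues:
  assumes "a \<in> Oint" "a \<noteq> 0"
  obtains R where "finite R" "R \<subseteq> Oint" "\<And>x. x \<in> Oint \<Longrightarrow> \<exists>y\<in>R. \<exists>z\<in>Oint. x - y = a * z"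
proof -
  obtain m b where m: "m > 0" "b \<in> Oint" "of_nat m = a * b" using Oint_divides_nat[OF assms] by blast
  obtain d where d: "d > 0" "\<And>x. x \<in> Oint \<Longrightarrow> \<exists>c. of_nat d * x = (\<Sum>j<n. of_int (c j) * u $ j)"
    using that by (rule Oint_lattice)
  hence "\<forall>x\<in>Oint. \<exists>c. of_nat d * x = (\<Sum>j<n. of_int (c j) * u $ j)" by blast
  from bchoice[OF this] obtain c
    where c: "\<And>x. x \<in> Oint \<Longrightarrow> of_nat d * x = (\<Sum>j<n. of_int (c x j) * u $ j)" by blast
  \<comment> \<open>The factor \<open>d\<close> in the modulus pays for the coordinates belonging to
    \<open>d * x\<close>: after \<open>d\<close> is cancelled, a multiple of \<open>m\<close>, hence
    of \<open>a\<close>, is left.\<close>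
  define \<kappa> where "\<kappa> x = (\<lambda>j\<in>{..<n}. c x j mod int (m * d))" for x
  have pos: "int (m * d) > 0" using m(1) d(1) by simp
  have "\<kappa> x \<in> {..<n} \<rightarrow>\<^sub>E {0..<int (m * d)}" for x
    unfolding \<kappa>_def restrict_PiE_iff
    using pos_mod_bound[OF pos] pos_mod_sign[OF pos] by (simp only: atLeastLessThan_iff) blast
  hence "\<kappa> ` Oint \<subseteq> {..<n} \<rightarrow>\<^sub>E {0..<int (m * d)}" by (rule image_subsetI)
  hence fin: "finite (\<kappa> ` Oint)" by (rule finite_subset) (simp add: finite_PiE)
  define r where "r k = (SOME x. x \<in> Oint \<and> \<kappa> x = k)" for k
  have r: "r (\<kappa> x) \<in> Oint" "\<kappa> (r (\<kappa> x)) = \<kappa> x" if "x \<in> Oint" for x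
  proof -
    have "r (\<kappa> x) \<in> Oint \<and> \<kappa> (r (\<kappa> x)) = \<kappa> x"
      unfolding r_def by (rule someI[of "\<lambda>y. y \<in> Oint \<and> \<kappa> y = \<kappa> x" x]) (simp add: that)
    thus "r (\<kappa> x) \<in> Oint" "\<kappa> (r (\<kappa> x)) = \<kappa> x" by blast+
  qed
  show thesis
  proof (rule that[of "r ` \<kappa> ` Oint"])
    show "finite (r ` \<kappa> ` Oint)" using fin by blast
    show "r ` \<kappa> ` Oint \<subseteq> Oint" using r(1) by auto
    fix x assume x: "x \<in> Oint"
    define y where "y = r (\<kappa> x)"
    have y: "y \<in> Oint" "\<kappa> y = \<kappa> x" unfolding y_def by (rule r[OF x])+
    define e where "e j = (c x j - c y j) div int (m * d)" for j
    have e: "c x j - c y j = int (m * d) * e j" if "j < n" for j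
    proof -
      have "c x j mod int (m * d) = c y j mod int (m * d)"
        using fun_cong[OF y(2), of j] that by (simp add: \<kappa>_def)
      hence "int (m * d) dvd c x j - c y j" by (simp only: mod_eq_dvd_iff)
      thus ?thesis unfolding e_def by (simp only: dvd_mult_div_cancel)
    qed
    have "of_nat d * (x - y) = (\<Sum>j<n. of_int (c x j - c y j) * u $ j)"
      unfolding right_diff_distrib c[OF x] c[OF y(1)] by (simp add: left_diff_distrib sum_subtractf)
    also have "\<dots> = (\<Sum>j<n. of_int (int (m * d) * e j) * u $ j)"
      by (intro sum.cong refl) (simp only: e lessThan_iff)
    also have "\<dots> = of_nat d * (of_nat m * (\<Sum>j<n. of_int (e j) * u $ j))"
      by (simp add: sum_distrib_left mult_ac)
    finally have "x - y = of_nat m * (\<Sum>j<n. of_int (e j) * u $ j)" using d(1) by simp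
    also have "\<dots> = a * (b * (\<Sum>j<n. of_int (e j) * u $ j))" using m(3) by simp
    finally have "x - y = a * (b * (\<Sum>j<n. of_int (e j) * u $ j))" .
    moreover have "b * (\<Sum>j<n. of_int (e j) * u $ j) \<in> Oint" using m(2) by simp
    moreover have "y \<in> r ` \<kappa> ` Oint" using x by (simp add: y_def)
    ultimately show "\<exists>y\<in>r ` \<kappa> ` Oint. \<exists>z\<in>Oint. x - y = a * z" by blast
  qed
qed

end

section \<open>Pigeonhole on residues\<close>

context integer_matrix
begin

text \<open>Applied to a sequence of powers this yields a relation between two powers modulo
  \<open>a\<close>. Such relations prove maximality of primes, integrality, and the near idempotence
  of powers of \<open>l\<close>.\<close>

lemma residue_pigeonhole:
  assumes "a \<in> Oint" "a \<noteq> 0" "\<And>k::nat. f k \<in> Oint"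
  obtains i j where "i < j" "\<exists>z\<in>Oint. f j - f i = a * z"
proof -
  obtain R where R: "finite R" "R \<subseteq> Oint" "\<And>x. x \<in> Oint \<Longrightarrow> \<exists>y\<in>R. \<exists>z\<in>Oint. x - y = a * z"
    using finite_residues[OF assms(1,2)] by blast
  define \<rho> where "\<rho> x = (SOME y. y \<in> R \<and> (\<exists>z\<in>Oint. x - y = a * z))" for x
  have \<rho>: "\<rho> x \<in> R \<and> (\<exists>z\<in>Oint. x - \<rho> x = a * z)" if "x \<in> Oint" for x
  proof -
    have "\<exists>y. y \<in> R \<and> (\<exists>z\<in>Oint. x - y = a * z)" using R(3)[OF that] by blast
    from someI_ex[OF this] show ?thesis unfolding \<rho>_def .
  qed
  have "\<not> inj (\<lambda>k. \<rho> (f k))"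
  proof
    assume "inj (\<lambda>k. \<rho> (f k))"
    hence "infinite (range (\<lambda>k. \<rho> (f k)))" by (rule range_inj_infinite)
    moreover have "range (\<lambda>k. \<rho> (f k)) \<subseteq> R" using \<rho>[OF assms(3)] by auto
    ultimately show False using finite_subset[OF _ R(1)] by simp
  qed
  then obtain i' j' where ij': "i' \<noteq> j'" "\<rho> (f i') = \<rho> (f j')" by (auto simp: inj_def)
  have "\<exists>i j. i < j \<and> \<rho> (f i) = \<rho> (f j)"
  proof (cases "i' < j'")
    case True
    thus ?thesis using ij'(2) by blast
  next
    case False
    hence "j' < i'" using ij'(1) by simp
    thus ?thesis using ij'(2)[symmetric] by blast
  qed
  then obtain i j where ij: "i < j" "\<rho> (f i) = \<rho> (f j)" by blast
  obtain y where y: "y \<in> Oint" "f i - \<rho> (f i) = a * y" using \<rho>[OF assms(3), of i] by blast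
  obtain z where z: "z \<in> Oint" "f j - \<rho> (f j) = a * z" using \<rho>[OF assms(3), of j] by blast
  have "f j - f i = (f j - \<rho> (f j)) - (f i - \<rho> (f i))" using ij(2) by simp
  also have "\<dots> = a * (z - y)" unfolding y(2) z(2) by (simp add: right_diff_distrib)
  finally have "\<exists>z\<in>Oint. f j - f i = a * z" using Oint_diff[OF z(1) y(1)] by (rule bexI)
  thus thesis by (rule that[OF ij(1)])
qed

text \<open>Pigeonhole modulo \<open>a\<^sup>2\<close> makes \<open>x\<close> a root of \<open>X ^ j - X ^ i - y\<close> with integral \<open>y\<close>.\<close>

lemma almost_integral:
  assumes "a \<in> Oint" "a \<noteq> 0" "x \<in> K" "\<And>k. a * x ^ k \<in> Oint"
  shows "x \<in> Oint"
proof -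
  obtain i j where ij: "i < j" "\<exists>z\<in>Oint. a * x ^ j - a * x ^ i = (a * a) * z"
    by (rule residue_pigeonhole[of "a * a" "\<lambda>k. a * x ^ k"]) (use assms in auto)
  from ij(2) obtain z where z: "z \<in> Oint" "a * x ^ j - a * x ^ i = (a * a) * z" by (rule bexE)
  have "a * (x ^ j - x ^ i) = a * (a * z)" using z(2) by (simp add: right_diff_distrib mult.assoc)
  hence "x ^ j - x ^ i = a * z" using assms(2) by simp
  hence "x ^ j - x ^ i \<in> Oint" using assms(1) z(1) by simp
  thus ?thesis using Oint_root assms(3) ij(1) by blast
qed

end

section \<open>Valuations at invertible maximal ideals\<close>

text \<open>
  Here \<open>t\<close> is an inverse uniformizer: multiplication by \<open>t\<close> maps \<open>P\<close> into the ring of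
  integers but not into \<open>P\<close>.  All powers of \<open>P\<close> are read off from the powers of \<open>t\<close>.
\<close>

lemma two_powi_le_iff: "(2::real) powi a \<le> 2 powi b \<longleftrightarrow> a \<le> b"
proof (cases "a \<le> b")
  case True
  thus ?thesis using power_int_increasing[of a b "2::real"] by simp
next
  case False
  thus ?thesis using power_int_strict_increasing[of b a "2::real"] by simp
qed

text \<open>The properties of a single prime from which its valuation is built.
  \<open>t_bounded\<close> makes orders of nonzero integers finite, and \<open>quotient\<close>
  supplies natural denominators. The locale is used both for the primes of K dividing
  \<open>l\<close> and for a prime number in the rationals, with \<open>t = 1 / p\<close>.\<close>

locale prime_place = complex_subfield K for K :: "complex set" +
  fixes P :: "complex set" and t :: complex
  assumes P_prime: "primeideal P OR"
    and t_K [simp]: "t \<in> K"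
    and t_P: "\<And>x. x \<in> P \<Longrightarrow> t * x \<in> Oint"
    and t_not_P: "\<exists>p\<in>P. t * p \<notin> P"
    and P_maximal: "\<And>a. a \<in> Oint \<Longrightarrow> a \<notin> P \<Longrightarrow> \<exists>b\<in>Oint. 1 - a * b \<in> P"
    and t_bounded: "\<And>a. a \<in> Oint \<Longrightarrow> a \<noteq> 0 \<Longrightarrow> \<exists>k. t ^ k * a \<notin> Oint"
    and quotient: "\<And>x. x \<in> K \<Longrightarrow> \<exists>m::nat. m > 0 \<and> of_nat m * x \<in> Oint"
begin

lemma P_ideal: "ideal P OR"
  using P_prime by (rule primeideal.axioms)

lemma P_Oint: "x \<in> P \<Longrightarrow> x \<in> Oint" and P_0 [simp]: "0 \<in> P"
  and P_add: "x \<in> P \<Longrightarrow> y \<in> P \<Longrightarrow> x + y \<in> P"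
  and P_mult: "a \<in> Oint \<Longrightarrow> x \<in> P \<Longrightarrow> a * x \<in> P"
  using P_ideal unfolding ideal_OR_iff by blast+

lemma P_K: "x \<in> P \<Longrightarrow> x \<in> K"
  by (simp add: P_Oint Oint_K)

lemma P_1: "1 \<notin> P"
proof
  assume "1 \<in> P"
  hence "P = carrier OR" using P_mult[of _ 1] P_Oint by auto
  thus False using primeideal.I_notcarr[OF P_prime] by simp
qed

lemma P_primeD: "x \<in> Oint \<Longrightarrow> y \<in> Oint \<Longrightarrow> x * y \<in> P \<Longrightarrow> x \<in> P \<or> y \<in> P"
  using primeideal.I_prime[OF P_prime, of x y] by simp

lemma notP_power: "x \<in> Oint \<Longrightarrow> x \<notin> P \<Longrightarrow> x ^ k \<notin> P"
proof (induction k)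
  case (Suc k)
  thus ?case using P_primeD[of x "x ^ k"] by auto
qed (simp add: P_1)

text \<open>A uniformizer matching \<open>t\<close>: the product \<open>t * \<pi>\<close> is
  integral and lies outside \<open>P\<close>, hence is a unit at \<open>P\<close>.\<close>

definition \<pi> :: complex where "\<pi> = (SOME p. p \<in> P \<and> t * p \<notin> P)"

lemma pi_P: "\<pi> \<in> P" and t_pi_notP: "t * \<pi> \<notin> P"
  using someI_ex[of "\<lambda>p. p \<in> P \<and> t * p \<notin> P"] t_not_P unfolding \<pi>_def by blast+

lemma pi_O [simp]: "\<pi> \<in> Oint" and t_pi_O [simp]: "t * \<pi> \<in> Oint"
  using pi_P P_Oint t_P by blast+

lemma t_nz [simp]: "t \<noteq> 0" and pi_nz [simp]: "\<pi> \<noteq> 0"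
  using t_pi_notP by auto

text \<open>An inverse \<open>y\<close> of \<open>s\<close> modulo \<open>P\<close> is refined to
  arbitrary precision: the powers of \<open>1 - s * y\<close> again have the form
  \<open>1 - s * z\<close>.\<close>

lemma coprime_power:
  assumes "s \<in> Oint" "s \<notin> P"
  obtains q z where "q \<in> P" "z \<in> Oint" "1 - s * z = q ^ i"
proof -
  obtain y where y: "y \<in> Oint" "1 - s * y \<in> P" using P_maximal assms by blast
  have "\<exists>z\<in>Oint. (1 - s * y) ^ i = 1 - s * z"
  proof (induction i)
    case 0
    show ?case by (rule bexI[of _ 0]) auto
  next
    case (Suc i)
    then obtain z where z: "z \<in> Oint" "(1 - s * y) ^ i = 1 - s * z" by blast
    have "(1 - s * y) ^ Suc i = 1 - s * (y + z - y * s * z)"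
      unfolding power_Suc z(2) by (simp add: algebra_simps)
    thus ?case using z(1) y(1) assms(1) by (intro bexI[of _ "y + z - y * s * z"]) auto
  qed
  then obtain z where "z \<in> Oint" "(1 - s * y) ^ i = 1 - s * z" by blast
  thus thesis using that[of "1 - s * y" z] y by simp
qed

text \<open>Integrality in two tests, away from \<open>P\<close> by the multiplier \<open>s\<close>
  and at \<open>P\<close> by the powers of its elements. The identity
  \<open>1 = s * z + q ^ i\<close> joins them.\<close>

lemma Oint_local:
  assumes "s \<in> Oint" "s \<notin> P" "s * b \<in> Oint" "\<And>q. q \<in> P \<Longrightarrow> q ^ i * b \<in> Oint"
  shows "b \<in> Oint"
proof -
  obtain q z where q: "q \<in> P" "z \<in> Oint" "1 - s * z = q ^ i"
    using coprime_power[OF assms(1,2)] by blast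
  have "b = (1 - s * z) * b + z * (s * b)" by (simp add: algebra_simps)
  also have "\<dots> \<in> Oint"
    unfolding q(3) by (rule Oint_add[OF assms(4)[OF q(1)] Oint_mult[OF q(2) assms(3)]])
  finally show ?thesis .
qed

lemma t_power_le:
  assumes "a \<in> Oint" "t ^ k * a \<in> Oint" "i \<le> k"
  shows "t ^ i * a \<in> Oint"
proof (rule Oint_local)
  \<comment> \<open>The multiplier outside \<open>P\<close> is a power of the local unit
    \<open>t * \<pi>\<close>: it supplies the missing factors of \<open>t\<close> and leaves
    harmless factors of \<open>\<pi>\<close>.\<close>
  show "(t * \<pi>) ^ (k - i) \<in> Oint" by simp
  show "(t * \<pi>) ^ (k - i) \<notin> P" using t_pi_notP by (intro notP_power) auto
  have "(t * \<pi>) ^ (k - i) * (t ^ i * a) = \<pi> ^ (k - i) * (t ^ (k - i + i) * a)"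
    unfolding power_add by (simp add: power_mult_distrib algebra_simps)
  also have "\<dots> \<in> Oint" using assms by simp
  finally show "(t * \<pi>) ^ (k - i) * (t ^ i * a) \<in> Oint" .
  fix q assume "q \<in> P"
  hence "(t * q) ^ i * a \<in> Oint" using t_P assms(1) by simp
  thus "q ^ i * (t ^ i * a) \<in> Oint" by (simp add: power_mult_distrib algebra_simps)
qed

text \<open>Because \<open>t\<close> behaves as an inverse of \<open>P\<close>, multiplication by
  \<open>t ^ k\<close> detects the k-th power of \<open>P\<close>. One inclusion follows factor by
  factor; for the other, a factor from \<open>P\<close> must be split off.\<close>

lemma ideal_power_iff:
  "a \<in> P [^]\<^bsub>ideals_set OR\<^esub> (k::nat) \<longleftrightarrow> a \<in> Oint \<and> t ^ k * a \<in> Oint"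
proof (induction k arbitrary: a)
  case 0
  show ?case by (simp add: nat_pow_def ideals_set_def)
next
  case (Suc k)
  let ?Q = "P [^]\<^bsub>ideals_set OR\<^esub> k"
  have eq: "P [^]\<^bsub>ideals_set OR\<^esub> Suc k = ideal_prod OR ?Q P"
    by (simp add: nat_pow_def ideals_set_def)
  show ?case
  proof
    assume "a \<in> P [^]\<^bsub>ideals_set OR\<^esub> Suc k"
    hence "a \<in> ideal_prod OR ?Q P" by (simp only: eq)
    thus "a \<in> Oint \<and> t ^ Suc k * a \<in> Oint"
    proof (induction a rule: ideal_prod.induct)
      case (prod i j)
      hence "i \<in> Oint" "t ^ k * i \<in> Oint" "j \<in> Oint" "t * j \<in> Oint"
        using Suc.IH P_Oint t_P by blast+
      hence "i * j \<in> Oint" "(t ^ k * i) * (t * j) \<in> Oint" by simp_all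
      thus ?case by (simp add: algebra_simps)
    next
      case (sum x y)
      thus ?case by (simp add: distrib_left)
    qed
  next
    assume a: "a \<in> Oint \<and> t ^ Suc k * a \<in> Oint"
    have "t ^ k * a \<in> Oint" using t_power_le[of a "Suc k" k] a by simp
    hence aQ: "a \<in> ?Q" using Suc.IH a by blast
    have "t * a \<in> Oint" using t_power_le[of a "Suc k" 1] a by simp
    hence taQ: "t * a \<in> ?Q" using Suc.IH[of "t * a"] a by (simp add: algebra_simps)
    \<comment> \<open>Write \<open>a\<close> as
      \<open>(t * a) * (y * \<pi>) + a * (1 - t * \<pi> * y)\<close>. The left factors
      \<open>t * a\<close> and \<open>a\<close> lie in the k-th power, the right factors in
      \<open>P\<close>.\<close>
    obtain y where y: "y \<in> Oint" "1 - (t * \<pi>) * y \<in> P" using P_maximal t_pi_notP t_pi_O by blast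
    have "(t * a) * (y * \<pi>) \<in> ideal_prod OR ?Q P"
      using ideal_prod.prod[OF taQ P_mult[OF y(1) pi_P], of OR] by simp
    moreover have "a * (1 - (t * \<pi>) * y) \<in> ideal_prod OR ?Q P"
      using ideal_prod.prod[OF aQ y(2), of OR] by simp
    ultimately have "(t * a) * (y * \<pi>) + a * (1 - (t * \<pi>) * y) \<in> ideal_prod OR ?Q P"
      using ideal_prod.sum[of "(t * a) * (y * \<pi>)" OR ?Q P "a * (1 - (t * \<pi>) * y)"] by simp
    thus "a \<in> P [^]\<^bsub>ideals_set OR\<^esub> Suc k" unfolding eq by (simp add: algebra_simps)
  qed
qed

lemma t_mult_notP:
  assumes "y \<in> Oint" "y \<notin> P" shows "t * y \<notin> Oint"
proof
  assume "t * y \<in> Oint"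
  hence "(t * y) * \<pi> \<in> P" using P_mult pi_P by blast
  hence "y * (t * \<pi>) \<in> P" by (simp add: algebra_simps)
  thus False using P_primeD assms t_pi_notP t_pi_O by blast
qed

text \<open>The order is the exponent just before \<open>t ^ m * a\<close> first fails to be
  integral; \<open>t_bounded\<close> guarantees a failure.\<close>

lemma ord_exists:
  assumes "a \<in> Oint" "a \<noteq> 0"
  obtains k where "t ^ k * a \<in> Oint" "t ^ k * a \<notin> P"
proof -
  obtain m where "t ^ m * a \<notin> Oint" using t_bounded assms by blast
  define m where "m = (LEAST m. t ^ m * a \<notin> Oint)"
  have m: "t ^ m * a \<notin> Oint" unfolding m_def by (rule LeastI) fact
  obtain k where k: "m = Suc k" using m assms(1) by (cases m) auto
  have kO: "t ^ k * a \<in> Oint" using not_less_Least[of k "\<lambda>m. t ^ m * a \<notin> Oint"] k m_def by auto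
  moreover have "t ^ k * a \<notin> P" using t_P[of "t ^ k * a"] m k by (auto simp: mult.assoc)
  ultimately show thesis by (rule that)
qed

lemma ideal_ord_eq:
  assumes "a \<in> Oint" "t ^ k * a \<in> Oint" "t ^ k * a \<notin> P"
  shows "ideal_ord K P a = k"
  unfolding ideal_ord_def ideal_power_iff
proof (rule Greatest_equality)
  show "a \<in> Oint \<and> t ^ k * a \<in> Oint" using assms by blast
  fix m assume m: "a \<in> Oint \<and> t ^ m * a \<in> Oint"
  show "m \<le> k"
  proof (rule ccontr)
    assume "\<not> m \<le> k"
    hence "t ^ Suc k * a \<in> Oint" using t_power_le[of a m "Suc k"] m by simp
    thus False using t_mult_notP[OF assms(2,3)] by (simp add: mult.assoc)
  qed
qed

section \<open>The localization at P, its units, and the valuation\<close>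

definition OP :: "complex set" where "OP = {s / r | s r. s \<in> Oint \<and> r \<in> Oint - P}"
definition UP :: "complex set" where "UP = {s / r | s r. s \<in> Oint - P \<and> r \<in> Oint - P}"

lemma notP_mult: "s \<in> Oint - P \<Longrightarrow> r \<in> Oint - P \<Longrightarrow> s * r \<in> Oint - P"
  using P_primeD by auto

lemma notP_nz: "s \<in> Oint - P \<Longrightarrow> s \<noteq> 0"
  by auto

lemma UP_mult: "x \<in> UP \<Longrightarrow> y \<in> UP \<Longrightarrow> x * y \<in> UP"
proof -
  assume "x \<in> UP" "y \<in> UP"
  then obtain a b c d where "x = a / b" "y = c / d" "a \<in> Oint - P" "b \<in> Oint - P" "c \<in> Oint - P" "d \<in> Oint - P"
    unfolding UP_def by blast
  thus ?thesis unfolding UP_def using notP_mult[of a c] notP_mult[of b d]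
    by (intro CollectI exI[of _ "a * c"] exI[of _ "b * d"]) auto
qed

lemma UP_inverse: "x \<in> UP \<Longrightarrow> inverse x \<in> UP"
proof -
  assume "x \<in> UP"
  then obtain s r where "x = s / r" "s \<in> Oint - P" "r \<in> Oint - P" unfolding UP_def by blast
  thus ?thesis unfolding UP_def by (intro CollectI exI[of _ r] exI[of _ s]) simp
qed

lemma UP_OP: "x \<in> UP \<Longrightarrow> x \<in> OP"
  unfolding UP_def OP_def by blast

lemma notP_UP: "s \<in> Oint \<Longrightarrow> s \<notin> P \<Longrightarrow> s \<in> UP"
  unfolding UP_def using P_1 by (intro CollectI exI[of _ s] exI[of _ 1]) auto

lemma Oint_OP: "s \<in> Oint \<Longrightarrow> s \<in> OP"
  unfolding OP_def using P_1 by (intro CollectI exI[of _ s] exI[of _ 1]) auto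

lemma OP_mult: "x \<in> OP \<Longrightarrow> y \<in> OP \<Longrightarrow> x * y \<in> OP"
proof -
  assume "x \<in> OP" "y \<in> OP"
  then obtain a b c d where "x = a / b" "y = c / d" "a \<in> Oint" "b \<in> Oint - P" "c \<in> Oint" "d \<in> Oint - P"
    unfolding OP_def by blast
  thus ?thesis unfolding OP_def using notP_mult[of b d]
    by (intro CollectI exI[of _ "a * c"] exI[of _ "b * d"]) auto
qed

lemma OP_add: "x \<in> OP \<Longrightarrow> y \<in> OP \<Longrightarrow> x + y \<in> OP"
proof -
  assume "x \<in> OP" "y \<in> OP"
  then obtain a b c d where *: "x = a / b" "y = c / d" "a \<in> Oint" "b \<in> Oint - P" "c \<in> Oint" "d \<in> Oint - P"
    unfolding OP_def by blast
  hence "x + y = (a * d + c * b) / (b * d)" using notP_nz[of b] notP_nz[of d] by (simp add: field_simps)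
  thus ?thesis unfolding OP_def using * notP_mult[of b d]
    by (intro CollectI exI[of _ "a * d + c * b"] exI[of _ "b * d"]) auto
qed

lemma t_power_notUP: "k > 0 \<Longrightarrow> t ^ k \<notin> OP"
proof
  assume k: "k > 0" and "t ^ k \<in> OP"
  then obtain s r where sr: "s \<in> Oint" "r \<in> Oint - P" "t ^ k = s / r" unfolding OP_def by blast
  hence "t ^ k * r = s" using notP_nz[of r] by simp
  hence "t ^ 1 * r \<in> Oint" using t_power_le[of r k 1] k sr by simp
  thus False using t_mult_notP sr by simp
qed

lemma K_val_exists:
  assumes "x \<in> K" "x \<noteq> 0"
  obtains a b where "a \<in> Oint - {0}" "b \<in> Oint - {0}" "x = a / b"
    "x * t powi (int (ideal_ord K P a) - int (ideal_ord K P b)) \<in> UP"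
proof -
  obtain m :: nat where m: "m > 0" "of_nat m * x \<in> Oint" using quotient assms(1) by blast
  show thesis
  proof (rule that[of "of_nat m * x" "of_nat m"])
    show "of_nat m * x \<in> Oint - {0}" "of_nat m \<in> Oint - {0}" "x = of_nat m * x / of_nat m"
      using m assms by auto
    obtain i where i: "t ^ i * (of_nat m * x) \<in> Oint" "t ^ i * (of_nat m * x) \<notin> P"
      using ord_exists[of "of_nat m * x"] m assms by auto
    obtain j where j: "t ^ j * of_nat m \<in> Oint" "t ^ j * of_nat m \<notin> P"
      using ord_exists[of "of_nat m"] m by auto
    have "x * t powi (int i - int j) = (t ^ i * (of_nat m * x)) * inverse (t ^ j * of_nat m)"
      using m by (simp add: power_int_diff divide_inverse algebra_simps)
    also have "\<dots> \<in> UP" by (intro UP_mult UP_inverse notP_UP i j)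
    finally show "x * t powi (int (ideal_ord K P (of_nat m * x)) - int (ideal_ord K P (of_nat m))) \<in> UP"
      using ideal_ord_eq[OF m(2) i] ideal_ord_eq[OF _ j] by simp
  qed
qed

lemma val_unique:
  assumes "x \<noteq> 0" "x * t powi k \<in> UP" "x * t powi m \<in> UP" shows "k = m"
proof -
  have wlog: False if "k < m" "x * t powi k \<in> UP" "x * t powi m \<in> UP" for k m
  proof -
    have "t ^ nat (m - k) = t powi (m - k)" using that by (simp add: power_int_def)
    also have "\<dots> = (x * t powi m) * inverse (x * t powi k)"
      using assms(1) by (simp add: power_int_diff field_simps)
    also have "\<dots> \<in> UP" by (intro UP_mult UP_inverse that)
    finally show False using t_power_notUP[of "nat (m - k)"] that(1) UP_OP by simp
  qed
  show ?thesis using wlog[of k m] wlog[of m k] assms(2,3) by (cases k m rule: linorder_cases) blast+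
qed

abbreviation val :: "complex \<Rightarrow> int" where "val \<equiv> padic_val K P"

text \<open>Every representation of \<open>x\<close> as a quotient of integers yields an exponent
  that makes \<open>x * t powi k\<close> a local unit, and only one exponent does. So the definite
  description in \<open>padic_val\<close> denotes, and it is computed by this exponent.\<close>

lemma val_eqI:
  assumes "x \<in> K" "x \<noteq> 0" "x * t powi k \<in> UP" shows "val x = k"
proof -
  obtain a b where ab: "a \<in> Oint - {0}" "b \<in> Oint - {0}" "x = a / b"
    "x * t powi (int (ideal_ord K P a) - int (ideal_ord K P b)) \<in> UP"
    by (rule K_val_exists[OF assms(1,2)])
  have k: "k = int (ideal_ord K P a) - int (ideal_ord K P b)"
    using val_unique[OF assms(2,3) ab(4)] .
  show ?thesis
    unfolding padic_val_def Oint_def[symmetric]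
  proof (rule the_equality)
    show "\<exists>a\<in>Oint - {0}. \<exists>b\<in>Oint - {0}. x = a / b \<and> k = int (ideal_ord K P a) - int (ideal_ord K P b)"
      using ab k by blast
    fix m assume "\<exists>a\<in>Oint - {0}. \<exists>b\<in>Oint - {0}. x = a / b \<and> m = int (ideal_ord K P a) - int (ideal_ord K P b)"
    then obtain c d where cd: "c \<in> Oint - {0}" "d \<in> Oint - {0}" "x = c / d"
      "m = int (ideal_ord K P c) - int (ideal_ord K P d)" by blast
    obtain i where i: "t ^ i * c \<in> Oint" "t ^ i * c \<notin> P" using ord_exists[of c] cd by auto
    obtain j where j: "t ^ j * d \<in> Oint" "t ^ j * d \<notin> P" using ord_exists[of d] cd by auto
    have "x * t powi (int i - int j) = (t ^ i * c) * inverse (t ^ j * d)"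
      using cd by (simp add: power_int_diff divide_inverse algebra_simps)
    also have "\<dots> \<in> UP" by (intro UP_mult UP_inverse notP_UP i j)
    finally have "int i - int j = k" using val_unique[OF assms(2) _ assms(3)] by blast
    thus "m = k" using cd(4) ideal_ord_eq[OF _ i] ideal_ord_eq[OF _ j] cd(1,2) by simp
  qed
qed

lemma val_UP: "x \<in> K \<Longrightarrow> x \<noteq> 0 \<Longrightarrow> x * t powi val x \<in> UP"
proof -
  assume x: "x \<in> K" "x \<noteq> 0"
  obtain k where k: "x * t powi k \<in> UP" by (rule K_val_exists[OF x])
  thus ?thesis using val_eqI[OF x k] by simp
qed

lemma val_mult: "x \<in> K \<Longrightarrow> y \<in> K \<Longrightarrow> x \<noteq> 0 \<Longrightarrow> y \<noteq> 0 \<Longrightarrow> val (x * y) = val x + val y"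
  using UP_mult[OF val_UP[of x] val_UP[of y]]
  by (intro val_eqI) (auto simp: power_int_add algebra_simps)

lemma val_ge_iff:
  assumes "x \<in> K" "x \<noteq> 0" shows "k \<le> val x \<longleftrightarrow> x * t powi k \<in> OP"
proof
  define y where "y = x * t powi val x"
  have y: "y \<in> UP" using val_UP[OF assms] by (simp add: y_def)
  {
    assume k: "k \<le> val x"
    define m where "m = nat (val x - k)"
    have tm: "t powi (val x - k) = t ^ m" using k by (simp add: m_def power_int_def)
    have "x * t powi k = y * inverse (t ^ m)"
      unfolding tm[symmetric] y_def by (simp add: power_int_diff field_simps)
    \<comment> \<open>The inverse of \<open>t\<close> need not be integral, but up to the local unit
      \<open>t * \<pi>\<close> it is \<open>\<pi>\<close>.\<close>
    also have "inverse (t ^ m) = \<pi> ^ m * inverse ((t * \<pi>) ^ m)"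
      by (simp add: power_mult_distrib field_simps)
    also have "y * (\<pi> ^ m * inverse ((t * \<pi>) ^ m)) \<in> OP"
      using t_pi_notP by (intro OP_mult UP_OP[OF y] Oint_OP UP_OP[OF UP_inverse[OF notP_UP]] notP_power) auto
    finally show "x * t powi k \<in> OP" .
  }
  assume xk: "x * t powi k \<in> OP"
  show "k \<le> val x"
  proof (rule ccontr)
    assume "\<not> k \<le> val x"
    define m where "m = nat (k - val x)"
    have m: "m > 0" "t powi (k - val x) = t ^ m" using \<open>\<not> k \<le> val x\<close> by (auto simp: m_def power_int_def)
    have "t ^ m = inverse y * (x * t powi k)"
      unfolding m(2)[symmetric] y_def using assms(2) by (simp add: power_int_diff field_simps)
    also have "\<dots> \<in> OP" by (intro OP_mult UP_OP UP_inverse y xk)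
    finally show False using t_power_notUP[OF m(1)] by blast
  qed
qed

section \<open>The absolute value at P\<close>

abbreviation v :: "complex \<Rightarrow> real" where "v \<equiv> padic_abs K P"

lemma v_0 [simp]: "v 0 = 0" by (simp add: padic_abs_def)

lemma v_nonneg [simp]: "v x \<ge> 0" by (simp add: padic_abs_def)

lemma v_eq_0_iff [simp]: "v x = 0 \<longleftrightarrow> x = 0"
  by (simp add: padic_abs_def)

lemma v_pos_iff [simp]: "0 < v x \<longleftrightarrow> x \<noteq> 0"
  by (simp add: padic_abs_def)

lemma v_mult: "x \<in> K \<Longrightarrow> y \<in> K \<Longrightarrow> v (x * y) = v x * v y"
  using power_int_add[of "2::real" "- val x" "- val y"] by (auto simp: padic_abs_def val_mult)

lemma v_le_iff:
  assumes "x \<in> K" shows "v x \<le> 2 powi (- k) \<longleftrightarrow> x * t powi k \<in> OP"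
proof (cases "x = 0")
  case True
  thus ?thesis using Oint_OP[of 0] by simp
next
  case False
  hence "v x \<le> 2 powi (- k) \<longleftrightarrow> k \<le> val x" by (simp add: padic_abs_def two_powi_le_iff)
  thus ?thesis using val_ge_iff[OF assms False] by simp
qed

lemma v_discrete: 
  assumes "x \<in> K" "x \<noteq> 0" obtains k :: int where "v x = 2 powi (- k)"
  using assms that by (auto simp: padic_abs_def)

text \<open>Both summands, scaled by the power of \<open>t\<close> that belongs to the larger
  absolute value, lie in the localization, which is closed under addition.\<close>

lemma v_add_le: 
  assumes "x \<in> K" "y \<in> K" shows "v (x + y) \<le> max (v x) (v y)"
proof (cases "max (v x) (v y) = 0")
  case True
  hence "v x = 0" "v y = 0" using v_nonneg[of x] v_nonneg[of y] by linarith+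
  thus ?thesis by simp
next
  case False
  define z where "z = (if v x \<le> v y then y else x)"
  have z: "z \<in> K" "v z = max (v x) (v y)" using assms by (auto simp: z_def max_def)
  hence "z \<noteq> 0" using False by auto
  then obtain k :: int where "v z = 2 powi (- k)" by (rule v_discrete[OF z(1)])
  hence k: "max (v x) (v y) = 2 powi (- k)" using z(2) by simp
  have "v x \<le> 2 powi (- k)" "v y \<le> 2 powi (- k)" unfolding k[symmetric] by auto
  hence "x * t powi k + y * t powi k \<in> OP" using v_le_iff assms by (intro OP_add) auto
  hence "(x + y) * t powi k \<in> OP" by (simp add: distrib_right)
  thus ?thesis unfolding k using v_le_iff[of "x + y" k] assms by simp
qed

lemma v_le_1_iff: "x \<in> K \<Longrightarrow> v x \<le> 1 \<longleftrightarrow> x \<in> OP"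
  using v_le_iff[of x 0] by simp

lemma v_Oint_le: "x \<in> Oint \<Longrightarrow> v x \<le> 1"
  using v_le_1_iff[of x] Oint_OP Oint_K by blast

lemma v_1 [simp]: "v 1 = 1"
  using v_mult[of 1 1] by simp

lemma v_minus: "x \<in> K \<Longrightarrow> v (- x) = v x"
proof -
  assume x: "x \<in> K"
  have "v (- 1) * v (- 1) = 1" using v_mult[of "- 1" "- 1"] by simp
  hence "v (- 1) = 1" using power2_eq_imp_eq[of "v (- 1)" 1] by (simp add: power2_eq_square)
  thus ?thesis using v_mult[of "- 1" x] x by simp
qed

lemma v_power: "x \<in> K \<Longrightarrow> v (x ^ k) = v x ^ k"
  by (induction k) (auto simp: v_mult)

lemma v_inverse: "x \<in> K \<Longrightarrow> v (inverse x) = inverse (v x)"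
proof (cases "x = 0")
  case False
  assume "x \<in> K"
  hence "v x * v (inverse x) = 1" using v_mult[of x "inverse x"] False by simp
  thus ?thesis by (simp add: inverse_unique)
qed simp

lemma v_P_le: "x \<in> P \<Longrightarrow> v x \<le> 1 / 2"
  using v_le_iff[of x 1] Oint_OP[OF t_P[of x]] P_K by (simp add: mult.commute)

lemma v_notP: "x \<in> Oint \<Longrightarrow> x \<notin> P \<Longrightarrow> v x = 1"
  using val_eqI[of x 0] notP_UP[of x] Oint_K[of x] by (cases "x = 0") (auto simp: padic_abs_def)

text \<open>For \<open>x = s / r\<close> with \<open>r\<close> outside \<open>P\<close>, replace the
  reciprocal of \<open>r\<close> by an inverse \<open>z\<close> of \<open>r\<close> modulo a high
  power of \<open>P\<close>; then \<open>s * z\<close> is the approximation.\<close>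

lemma Oint_dense:
  assumes "x \<in> K" "v x \<le> 1"
  obtains z where "z \<in> Oint" "v (x - z) \<le> (1 / 2) ^ N"
proof -
  obtain s r where sr: "s \<in> Oint" "r \<in> Oint" "r \<notin> P" "x = s / r"
    using assms v_le_1_iff by (auto simp: OP_def)
  obtain q z where q: "q \<in> P" "z \<in> Oint" "1 - r * z = q ^ N"
    using coprime_power[OF sr(2,3)] by blast
  have "r \<noteq> 0" using sr by auto
  hence "x - s * z = x * (1 - r * z)" by (simp add: sr(4) field_simps)
  hence "v (x - s * z) = v x * v q ^ N"
    unfolding q(3) using assms(1) q(1) P_K by (simp add: v_mult v_power)
  also have "\<dots> \<le> 1 * (1 / 2) ^ N"
    using assms(2) v_P_le[OF q(1)] by (intro mult_mono power_mono) auto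
  finally show thesis using that[of "s * z"] sr q by simp
qed

end

section \<open>The primes dividing the eigenvalue\<close>

context integer_matrix
begin

lemma l_nz [simp]: "l \<noteq> 0"
proof
  assume "l = 0"
  hence "eigenvalue (map_mat complex_of_int A) 0" using eigenvalue_l by simp
  then obtain x where x: "x \<in> carrier_vec n" "x \<noteq> 0\<^sub>v n" "map_mat complex_of_int A *\<^sub>v x = 0 \<cdot>\<^sub>v x"
    using A_carrier by (auto simp: eigenvalue_def eigenvector_def)
  moreover have "0 \<cdot>\<^sub>v x = 0\<^sub>v n" using x(1) by (intro eq_vecI) auto
  ultimately have "det (map_mat complex_of_int A) = 0"
    using det_0_iff_vec_prod_zero_field[of "map_mat complex_of_int A" n] A_carrier by auto
  thus False using det_A by (simp add: of_int_hom.hom_det)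
qed

definition Pl :: "complex set set" where "Pl = {P. Fin_place P \<in> places_dividing K l}"

lemma PIdl_eq: 
  assumes "a \<in> Oint" shows "PIdl\<^bsub>OR\<^esub> a = {x * a | x. x \<in> Oint}"
  unfolding cgenideal_def by simp

lemma Pl_iff:
  "P \<in> Pl \<longleftrightarrow> primeideal P OR \<and> (\<exists>c. ideal c OR \<and> PIdl\<^bsub>OR\<^esub> l = ideal_prod OR P c)"
  by (auto simp: Pl_def places_dividing_def factor_def ideals_set_def)

lemma places_dividing_eq: "places_dividing K l = Fin_place ` Pl"
  by (auto simp: Pl_def places_dividing_def)

lemma ideal_OintD:
  assumes "ideal I OR"
  shows "x \<in> I \<Longrightarrow> x \<in> Oint" "0 \<in> I" "x \<in> I \<Longrightarrow> y \<in> I \<Longrightarrow> x + y \<in> I" "a \<in> Oint \<Longrightarrow> x \<in> I \<Longrightarrow> a * x \<in> I"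
  using assms unfolding ideal_OR_iff by blast+

lemma primeideal_1: "primeideal Q OR \<Longrightarrow> 1 \<notin> Q"
proof
  assume Q: "primeideal Q OR" "1 \<in> Q"
  hence "Q = carrier OR"
    using ideal_OintD(1)[OF primeideal.axioms(1)[OF Q(1)]] ideal_OintD(4)[OF primeideal.axioms(1)[OF Q(1)], of _ 1] by auto
  thus False using primeideal.I_notcarr[OF Q(1)] by simp
qed

text \<open>Pigeonhole modulo \<open>l\<close> on the powers of \<open>a\<close> gives
  \<open>a ^ i * (1 - a * a ^ d)\<close> in \<open>P\<close>; by primality the second factor lies in
  \<open>P\<close>, so \<open>a ^ d\<close> inverts \<open>a\<close>.\<close>

lemma maximal_above:
  assumes P: "primeideal P OR" and l: "l \<in> P" and a: "a \<in> Oint" "a \<notin> P"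
  shows "\<exists>b\<in>Oint. 1 - a * b \<in> P"
proof -
  note PI = ideal_OintD[OF primeideal.axioms(1)[OF P]]
  obtain i j where ij: "i < j" "\<exists>z\<in>Oint. a ^ j - a ^ i = l * z"
    by (rule residue_pigeonhole[of l "\<lambda>k. a ^ k"]) (use a in auto)
  then obtain z where z: "z \<in> Oint" "a ^ j - a ^ i = l * z" by blast
  obtain d where d: "j = i + Suc d" using less_imp_Suc_add[OF ij(1)] by auto
  have "a ^ i * (1 - a * a ^ d) = - z * l" using z(2) unfolding d power_add by (simp add: algebra_simps)
  also have "\<dots> \<in> P" using PI(4)[of "- z" l] z(1) l by simp
  finally have in_P: "a ^ i * (1 - a * a ^ d) \<in> P" .
  have "a ^ i \<notin> P"
  proof (induction i)
    case 0
    show ?case using primeideal_1[OF P] by simp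
  next
    case (Suc i)
    thus ?case using primeideal.I_prime[OF P, of a "a ^ i"] a by auto
  qed
  hence "1 - a * a ^ d \<in> P" using primeideal.I_prime[OF P, of "a ^ i" "1 - a * a ^ d"] in_P a by auto
  thus ?thesis using a by (intro bexI[of _ "a ^ d"]) auto
qed

text \<open>The condition that needs an argument is boundedness: if all \<open>t ^ k * a\<close>
  were integral, \<open>t\<close> itself would be integral by \<open>almost_integral\<close>, and
  then \<open>t\<close> would map \<open>P\<close> into \<open>P\<close>.\<close>

lemma prime_place_of_inverse:
  assumes P: "primeideal P OR" and l: "l \<in> P" and t: "t \<in> K" "\<And>x. x \<in> P \<Longrightarrow> t * x \<in> Oint" "\<exists>x\<in>P. t * x \<notin> P"
  shows "prime_place K P t"
proof (intro prime_place.intro prime_place_axioms.intro complex_subfield_axioms)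
  note PI = ideal_OintD[OF primeideal.axioms(1)[OF P]]
  show "primeideal P OR" "t \<in> K" "\<exists>x\<in>P. t * x \<notin> P" using assms by blast+
  show "t * x \<in> Oint" if "x \<in> P" for x using t(2) that .
  show "\<exists>b\<in>Oint. 1 - a * b \<in> P" if "a \<in> Oint" "a \<notin> P" for a
    using maximal_above[OF P l that] .
  show "\<exists>m::nat. m > 0 \<and> of_nat m * x \<in> Oint" if "x \<in> K" for x
    using common_denominator[of "{x}"] that by auto
  fix a assume a: "a \<in> Oint" "a \<noteq> 0"
  show "\<exists>k. t ^ k * a \<notin> Oint"
  proof (rule ccontr)
    assume "\<nexists>k. t ^ k * a \<notin> Oint"
    hence "a * t ^ k \<in> Oint" for k by (simp add: mult.commute)
    hence "t \<in> Oint" using almost_integral[OF a t(1)] by blast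
    thus False using t(3) PI(4) by blast
  qed
qed

lemma Pl_l: "P \<in> Pl \<Longrightarrow> l \<in> P"
proof -
  assume P: "P \<in> Pl"
  interpret cring OR by (rule cring_OR)
  obtain c where c: "primeideal P OR" "ideal c OR" "PIdl\<^bsub>OR\<^esub> l = ideal_prod OR P c"
    using P unfolding Pl_iff by blast
  have "l \<in> ideal_prod OR P c" unfolding c(3)[symmetric] PIdl_eq[OF l_O] by (intro CollectI exI[of _ 1]) auto
  thus "l \<in> P" using ideal_prod_inter[OF primeideal.axioms(1)[OF c(1)] c(2)] by blast
qed

text \<open>If \<open>P * c\<close> is the principal ideal of \<open>l\<close>, every
  \<open>y / l\<close> with \<open>y\<close> in \<open>c\<close> maps \<open>P\<close> into the
  integers. If all of them mapped \<open>P\<close> into \<open>P\<close>, dividing \<open>l\<close>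
  itself by \<open>l\<close> would put 1 into \<open>P\<close>.\<close>

lemma Pl_prime_place:
  assumes "P \<in> Pl" obtains t where "prime_place K P t"
proof -
  obtain c where c: "primeideal P OR" "ideal c OR" "PIdl\<^bsub>OR\<^esub> l = ideal_prod OR P c"
    using assms unfolding Pl_iff by blast
  note PI = ideal_OintD[OF primeideal.axioms(1)[OF c(1)]] and cI = ideal_OintD[OF c(2)]
  have l_prod: "l \<in> ideal_prod OR P c"
    unfolding c(3)[symmetric] PIdl_eq[OF l_O] by (intro CollectI exI[of _ 1]) auto
  have prod_l: "\<exists>z\<in>Oint. p * y = l * z" if "p \<in> P" "y \<in> c" for p y
  proof -
    have "p * y \<in> PIdl\<^bsub>OR\<^esub> l" using ideal_prod.prod[OF that, of OR] c(3) by simp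
    thus ?thesis unfolding PIdl_eq[OF l_O] by (auto simp: mult.commute)
  qed
  have "\<exists>y\<in>c. \<exists>p\<in>P. y / l * p \<notin> P"
  proof (rule ccontr)
    assume neg: "\<not> ?thesis"
    have "x / l \<in> P" if "x \<in> ideal_prod OR P c" for x
      using that
    proof (induction x rule: ideal_prod.induct)
      case (prod p y)
      have "p * y / l = y / l * p" by simp
      thus ?case using neg prod by (auto simp: mult.commute)
    next
      case (sum x y)
      thus ?case using PI(3)[of "x / l" "y / l"] by (simp add: add_divide_distrib)
    qed
    from this[OF l_prod] show False using primeideal_1[OF c(1)] by simp
  qed
  then obtain y where y: "y \<in> c" "\<exists>p\<in>P. y / l * p \<notin> P" by blast
  have "y / l * x \<in> Oint" if x: "x \<in> P" for x
    using prod_l[OF x y(1)] by (auto simp: mult.commute)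
  hence "prime_place K P (y / l)"
    using prime_place_of_inverse[OF c(1) Pl_l[OF assms], of "y / l"] y Oint_K[OF cI(1)[OF y(1)]] by auto
  thus thesis by (rule that)
qed

text \<open>
  Among the \<open>b\<close> whose annihilator modulo \<open>l\<close> lies in \<open>P\<close>, one with maximal annihilator has
  all of \<open>P\<close> in the annihilator of a multiple: this is an associated prime argument in the finite ring
  of residues.
\<close>

lemma annihilated_residue:
  assumes P: "primeideal P OR" and l: "l \<in> P"
  obtains b where "b \<in> Oint" "\<not> (\<exists>z\<in>Oint. b = l * z)" "\<And>q. q \<in> P \<Longrightarrow> \<exists>z\<in>Oint. b * q = l * z"
proof -
  note PI = ideal_OintD[OF primeideal.axioms(1)[OF P]]
  have P1: "1 \<notin> P" by (rule primeideal_1[OF P])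
  define D where "D = {l * z | z. z \<in> Oint}"
  have D_add: "x + y \<in> D" if xy: "x \<in> D" "y \<in> D" for x y
  proof -
    obtain z z' where "x = l * z" "y = l * z'" "z \<in> Oint" "z' \<in> Oint" using xy unfolding D_def by blast
    hence "x + y = l * (z + z')" "z + z' \<in> Oint" by (auto simp: algebra_simps)
    thus ?thesis unfolding D_def by blast
  qed
  have D_mult': "a * x \<in> D" if xa: "x \<in> D" "a \<in> Oint" for x a
  proof -
    obtain z where "x = l * z" "z \<in> Oint" using xa unfolding D_def by blast
    hence "a * x = l * (a * z)" "a * z \<in> Oint" using xa(2) by (auto simp: algebra_simps)
    thus ?thesis unfolding D_def by blast
  qed
  have D_diff: "x - y \<in> D" if "x \<in> D" "y \<in> D" for x y
    using D_add[OF that(1) D_mult'[OF that(2), of "- 1"]] by simp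
  have D_P: "x \<in> P" if "x \<in> D" for x
    using that PI(4)[OF _ l] by (auto simp: D_def mult.commute)
  obtain R where R: "finite R" "R \<subseteq> Oint" "\<And>x. x \<in> Oint \<Longrightarrow> \<exists>y\<in>R. \<exists>z\<in>Oint. x - y = l * z"
    using finite_residues[of l] by auto
  have RD: "\<exists>y\<in>R. x - y \<in> D" if "x \<in> Oint" for x using R(3)[OF that] by (auto simp: D_def)
  \<comment> \<open>Annihilators modulo \<open>l\<close> are recorded through the finite set of
    representatives, so that maximality becomes a matter of cardinality. \<open>good\<close> keeps
    the annihilator inside \<open>P\<close>.\<close>
  define Ann where "Ann b = {s \<in> R. s * b \<in> D}" for b
  define good where "good b \<longleftrightarrow> b \<in> Oint \<and> (\<forall>s\<in>Oint. s * b \<in> D \<longrightarrow> s \<in> P)" for b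
  have "good 1" using D_P by (simp add: good_def)
  have "finite (Ann ` {b. good b})"
    by (rule finite_subset[of _ "Pow R"]) (use R(1) in \<open>auto simp: Ann_def\<close>)
  hence fin: "finite (card ` Ann ` {b. good b})" by (rule finite_imageI)
  obtain b where b: "good b" "\<And>b'. good b' \<Longrightarrow> card (Ann b') \<le> card (Ann b)"
  proof -
    have ne: "card ` Ann ` {b. good b} \<noteq> {}" using \<open>good 1\<close> by blast
    obtain b where "good b" "card (Ann b) = Max (card ` Ann ` {b. good b})"
      using Max_in[OF fin ne] by auto
    thus ?thesis using that[of b] Max_ge[OF fin] by auto
  qed
  have bO: "b \<in> Oint" using b(1) by (simp add: good_def)
  \<comment> \<open>If nothing outside \<open>P\<close> kills \<open>q * b\<close>, then
    \<open>q * b\<close> is good again, and by maximality it has the same annihilator as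
    \<open>b\<close>. The same follows for all \<open>q ^ k * b\<close>, so a relation between two
    powers of \<open>q\<close> modulo \<open>l\<close> puts some \<open>1 - q ^ Suc d\<close> into
    \<open>P\<close>, which is absurd.\<close>
  have step: "\<exists>s\<in>Oint - P. s * (q * b) \<in> D" if q: "q \<in> P" for q
  proof (rule ccontr)
    assume neg: "\<not> ?thesis"
    have qO: "q \<in> Oint" using PI(1) q .
    have good_q: "good (q ^ k * b) \<and> (\<forall>s\<in>Oint. s * (q ^ k * b) \<in> D \<longrightarrow> s * b \<in> D)" for k
    proof (induction k)
      case 0
      show ?case using b(1) by simp
    next
      case (Suc k)
      have qb: "good (q * b)" using neg bO qO unfolding good_def by auto
      have eq: "Ann (q * b) = Ann b"
      proof (rule card_subset_eq[symmetric])
        show "finite (Ann (q * b))" using R(1) by (simp add: Ann_def)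
        show sub: "Ann b \<subseteq> Ann (q * b)"
        proof
          fix s assume "s \<in> Ann b"
          hence "s \<in> R" "q * (s * b) \<in> D" using D_mult' qO by (auto simp: Ann_def)
          thus "s \<in> Ann (q * b)" by (simp add: Ann_def algebra_simps)
        qed
        show "card (Ann b) = card (Ann (q * b))"
          using b(2)[OF qb] card_mono[OF _ sub] R(1) by (simp add: Ann_def)
      qed
      have cancel: "s * b \<in> D" if s: "s \<in> Oint" "s * (q * b) \<in> D" for s
      proof -
        obtain r where r: "r \<in> R" "s - r \<in> D" using RD s(1) by blast
        have rO: "r \<in> Oint" using r R(2) by blast
        have "s * (q * b) - (q * b) * (s - r) \<in> D" using qO bO by (intro D_diff[OF s(2) D_mult'[OF r(2)]]) auto
        hence "r * (q * b) \<in> D" by (simp add: algebra_simps)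
        hence "r \<in> Ann b" using r(1) eq by (auto simp: Ann_def)
        hence "r * b \<in> D" by (simp add: Ann_def)
        hence "r * b + b * (s - r) \<in> D" by (rule D_add[OF _ D_mult'[OF r(2) bO]])
        thus ?thesis by (simp add: algebra_simps)
      qed
      have all: "s * b \<in> D" if s: "s \<in> Oint" "s * (q ^ Suc k * b) \<in> D" for s
      proof -
        have "(s * q) * (q ^ k * b) \<in> D" using s(2) by (simp add: algebra_simps)
        hence "(s * q) * b \<in> D" using Suc.IH s(1) qO by (metis Oint_mult)
        hence "s * (q * b) \<in> D" by (simp add: algebra_simps)
        thus ?thesis using cancel s(1) by blast
      qed
      moreover have "good (q ^ Suc k * b)" unfolding good_def
        using all b(1) qO bO unfolding good_def by auto
      ultimately show ?case by blast
    qed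
    obtain i j where ij: "i < j" "\<exists>z\<in>Oint. q ^ j - q ^ i = l * z"
      by (rule residue_pigeonhole[of l "\<lambda>k. q ^ k"]) (use qO in auto)
    obtain d where d: "j = i + Suc d" using less_imp_Suc_add[OF ij(1)] by auto
    have "q ^ j - q ^ i \<in> D" using ij(2) by (auto simp: D_def)
    hence "(- b) * (q ^ j - q ^ i) \<in> D" using bO by (intro D_mult') auto
    hence "(1 - q ^ Suc d) * (q ^ i * b) \<in> D" unfolding d power_add by (simp add: algebra_simps)
    hence "1 - q ^ Suc d \<in> P" using good_q[of i] qO unfolding good_def by (metis Oint_1 Oint_diff Oint_power)
    moreover have "q ^ d * q \<in> P" using PI(4) q qO by simp
    ultimately have "(1 - q ^ Suc d) + q ^ d * q \<in> P" by (rule PI(3))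
    thus False using P1 by (simp add: mult.commute)
  qed
  have "\<forall>q\<in>P. \<exists>s. s \<in> Oint - P \<and> s * (q * b) \<in> D" using step by blast
  from bchoice[OF this] obtain s where s: "\<And>q. q \<in> P \<Longrightarrow> s q \<in> Oint - P \<and> s q * (q * b) \<in> D" by blast
  \<comment> \<open>A single multiplier for all of \<open>P\<close>: the product of those belonging
    to the finitely many representatives inside \<open>P\<close>. It remains outside
    \<open>P\<close> by primality.\<close>
  define S where "S = prod s (R \<inter> P)"
  have "S \<in> Oint - P"
  proof -
    have "prod s Q \<in> Oint - P" if "finite Q" "Q \<subseteq> P" for Q
      using that
    proof (induction Q rule: finite_induct)
      case empty
      show ?case using P1 by simp
    next
      case (insert x Q)
      thus ?case using s[of x] primeideal.I_prime[OF P, of "s x" "prod s Q"] by auto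
    qed
    thus ?thesis using R(1) by (simp add: S_def)
  qed
  show thesis
  proof (rule that[of "S * b"])
    show "S * b \<in> Oint" using bO \<open>S \<in> Oint - P\<close> by simp
    show "\<not> (\<exists>z\<in>Oint. S * b = l * z)"
      using b(1) \<open>S \<in> Oint - P\<close> unfolding good_def D_def by auto
    fix q assume q: "q \<in> P"
    obtain r where r: "r \<in> R" "q - r \<in> D" using RD PI(1)[OF q] by blast
    have "r = q + (- 1) * (q - r)" by simp
    also have "\<dots> \<in> P" using q D_P[OF r(2)] by (intro PI(3) PI(4)) auto
    finally have rP: "r \<in> P" .
    have "S = prod s (R \<inter> P - {r}) * s r"
      unfolding S_def using R(1) r(1) rP by (simp add: prod.remove[of "R \<inter> P" r] mult.commute)
    hence "S * b * q = prod s (R \<inter> P - {r}) * (s r * (r * b)) + (S * b) * (q - r)"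
      by (simp add: algebra_simps)
    also have "\<dots> \<in> D"
    proof (rule D_add[OF D_mult' D_mult'[OF r(2)]])
      show "s r * (r * b) \<in> D" using s[OF rP] by blast
      show "prod s (R \<inter> P - {r}) \<in> Oint" using s by (intro Oint_prod) auto
      show "S * b \<in> Oint" using bO \<open>S \<in> Oint - P\<close> by simp
    qed
    finally show "\<exists>z\<in>Oint. S * b * q = l * z" by (auto simp: D_def)
  qed
qed

text \<open>With \<open>b\<close> from \<open>annihilated_residue\<close>, \<open>t = b / l\<close>
  maps \<open>P\<close> into the integers. It does not map \<open>P\<close> into itself: otherwise
  all \<open>t ^ k * l\<close> would be integral, hence \<open>t\<close> too, against the choice of
  \<open>b\<close>. The cofactor of \<open>P\<close> in the ideal of \<open>l\<close> is then the
  set \<open>c\<close> of integers that multiply \<open>P\<close> into that ideal.\<close>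

lemma maximal_Pl:
  assumes P: "primeideal P OR" and l: "l \<in> P"
  shows "P \<in> Pl"
proof -
  interpret cring OR by (rule cring_OR)
  note PI = ideal_OintD[OF primeideal.axioms(1)[OF P]]
  obtain b where b: "b \<in> Oint" "\<not> (\<exists>z\<in>Oint. b = l * z)" "\<And>q. q \<in> P \<Longrightarrow> \<exists>z\<in>Oint. b * q = l * z"
    using annihilated_residue[OF P l] by blast
  define t where "t = b / l"
  have tK: "t \<in> K" using b(1) Oint_K by (simp add: t_def)
  have tP: "t * x \<in> Oint" if "x \<in> P" for x
    using b(3)[OF that] by (auto simp: t_def)
  have "\<exists>x\<in>P. t * x \<notin> P"
  proof (rule ccontr)
    assume neg: "\<not> ?thesis"
    have "t ^ k * l \<in> P" for k
      by (induction k) (use l neg in \<open>auto simp: mult.assoc\<close>)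
    hence "l * t ^ k \<in> Oint" for k using PI(1) by (simp add: mult.commute)
    hence "t \<in> Oint" using almost_integral[OF l_O l_nz tK] by blast
    hence "\<exists>z\<in>Oint. b = l * z" by (intro bexI[of _ t]) (auto simp: t_def)
    thus False using b(2) by blast
  qed
  then obtain x where x: "x \<in> P" "t * x \<notin> P" by blast
  obtain y where y: "y \<in> Oint" "1 - (t * x) * y \<in> P" using maximal_above[OF P l tP[OF x(1)] x(2)] by blast
  define c where "c = {z \<in> Oint. \<forall>q\<in>P. \<exists>z'\<in>Oint. z * q = l * z'}"
  have cI: "ideal c OR"
    unfolding ideal_OR_iff
  proof (intro conjI ballI)
    show "c \<subseteq> Oint" by (auto simp: c_def)
    show "0 \<in> c" by (auto simp: c_def intro: bexI[of _ 0])
    fix z z' assume z: "z \<in> c" "z' \<in> c"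
    show "z + z' \<in> c" unfolding c_def
    proof (intro CollectI conjI ballI)
      show "z + z' \<in> Oint" using z by (simp add: c_def)
      fix q assume "q \<in> P"
      then obtain r r' where "r \<in> Oint" "z * q = l * r" "r' \<in> Oint" "z' * q = l * r'"
        using z unfolding c_def by blast
      thus "\<exists>r\<in>Oint. (z + z') * q = l * r" by (intro bexI[of _ "r + r'"]) (auto simp: algebra_simps)
    qed
  next
    fix a z assume z: "a \<in> Oint" "z \<in> c"
    show "a * z \<in> c" unfolding c_def
    proof (intro CollectI conjI ballI)
      show "a * z \<in> Oint" using z by (simp add: c_def)
      fix q assume "q \<in> P"
      then obtain r where "r \<in> Oint" "z * q = l * r" using z unfolding c_def by blast
      thus "\<exists>r\<in>Oint. (a * z) * q = l * r" using z(1) by (intro bexI[of _ "a * r"]) (auto simp: algebra_simps)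
    qed
  qed
  have lc: "l \<in> c" using PI(1) by (auto simp: c_def)
  have bc: "b \<in> c" using b by (simp add: c_def)
  have PO: "ideal P OR" by (rule primeideal.axioms(1)[OF P])
  have id: "ideal (ideal_prod OR P c) OR" by (rule ideal_prod_is_ideal[OF PO cI])
  \<comment> \<open>Here \<open>t * x * y\<close> is 1 modulo \<open>P\<close> and
    \<open>t * l\<close> is \<open>b\<close>, so both terms are products of an element of
    \<open>P\<close> and an element of \<open>c\<close>.\<close>
  have "l = (1 - (t * x) * y) * l + (y * x) * b" by (simp add: t_def algebra_simps)
  also have "\<dots> \<in> ideal_prod OR P c"
    using ideal_prod.prod[OF y(2) lc, of OR] ideal_prod.prod[OF PI(4)[OF y(1) x(1)] bc, of OR]
    by (intro ideal_OintD(3)[OF id]) auto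
  finally have "PIdl\<^bsub>OR\<^esub> l \<subseteq> ideal_prod OR P c"
    unfolding PIdl_eq[OF l_O] using ideal_OintD(4)[OF id] by blast
  moreover have "ideal_prod OR P c \<subseteq> PIdl\<^bsub>OR\<^esub> l"
  proof
    fix z assume "z \<in> ideal_prod OR P c"
    thus "z \<in> PIdl\<^bsub>OR\<^esub> l"
    proof (induction z rule: ideal_prod.induct)
      case (prod q z)
      then obtain r where "r \<in> Oint" "z * q = l * r" unfolding c_def by blast
      thus ?case unfolding PIdl_eq[OF l_O] by (intro CollectI exI[of _ r]) (simp add: mult.commute)
    next
      case (sum z z')
      then obtain r r' where "z = r * l" "r \<in> Oint" "z' = r' * l" "r' \<in> Oint"
        unfolding PIdl_eq[OF l_O] by blast
      thus ?case unfolding PIdl_eq[OF l_O] by (intro CollectI exI[of _ "r + r'"]) (simp add: distrib_right)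
    qed
  qed
  ultimately show ?thesis unfolding Pl_iff using P cI by blast
qed

end

section \<open>Ideals containing a given integer, and approximation at the primes dividing l\<close>

context integer_matrix
begin

text \<open>An ideal containing \<open>a\<close> is a union of residue classes modulo
  \<open>a\<close>, so it is determined by the representatives that it contains.\<close>

lemma ideals_finite_residues:
  assumes "a \<in> Oint" "a \<noteq> 0"
  obtains R where "finite R" "R \<subseteq> Oint"
    "\<And>I J. ideal I OR \<Longrightarrow> ideal J OR \<Longrightarrow> a \<in> I \<Longrightarrow> a \<in> J \<Longrightarrow> I \<inter> R \<subseteq> J \<inter> R \<Longrightarrow> I \<subseteq> J"
proof -
  obtain R where R: "finite R" "R \<subseteq> Oint" "\<And>x. x \<in> Oint \<Longrightarrow> \<exists>y\<in>R. \<exists>z\<in>Oint. x - y = a * z"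
    using finite_residues[OF assms] by blast
  show thesis
  proof (rule that[OF R(1,2)])
    fix I J assume IJ: "ideal I OR" "ideal J OR" "a \<in> I" "a \<in> J" "I \<inter> R \<subseteq> J \<inter> R"
    show "I \<subseteq> J"
    proof
      fix x assume x: "x \<in> I"
      obtain y z where yz: "y \<in> R" "z \<in> Oint" "x - y = a * z" using R(3) ideal_OintD(1)[OF IJ(1) x] by blast
      have "x + (- z) * a \<in> I"
        using ideal_OintD(3)[OF IJ(1) x ideal_OintD(4)[OF IJ(1) Oint_uminus[OF yz(2)] IJ(3)]] .
      moreover have "x + (- z) * a = y" using yz(3) by (simp add: algebra_simps)
      ultimately have "y \<in> J" using yz(1) IJ(5) by auto
      hence "y + z * a \<in> J" using ideal_OintD(3,4)[OF IJ(2)] yz(2) IJ(4) by simp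
      moreover have "y + z * a = x" using yz(3) by (simp add: algebra_simps)
      ultimately show "x \<in> J" by simp
    qed
  qed
qed

lemma Pl_primeideal: "P \<in> Pl \<Longrightarrow> primeideal P OR"
  and Pl_ideal: "P \<in> Pl \<Longrightarrow> ideal P OR"
  using Pl_iff primeideal.axioms(1) by blast+

lemma finite_Pl [simp]: "finite Pl"
proof -
  obtain R where R: "finite R" "R \<subseteq> Oint"
    "\<And>I J. ideal I OR \<Longrightarrow> ideal J OR \<Longrightarrow> l \<in> I \<Longrightarrow> l \<in> J \<Longrightarrow> I \<inter> R \<subseteq> J \<inter> R \<Longrightarrow> I \<subseteq> J"
    using ideals_finite_residues[OF l_O l_nz] by metis
  have "inj_on (\<lambda>P. P \<inter> R) Pl"
  proof (rule inj_onI)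
    fix P Q assume "P \<in> Pl" "Q \<in> Pl" "P \<inter> R = Q \<inter> R"
    thus "P = Q" using R(3)[of P Q] R(3)[of Q P] Pl_ideal Pl_l by auto
  qed
  moreover have "finite ((\<lambda>P. P \<inter> R) ` Pl)"
    by (rule finite_subset[of _ "Pow R"]) (use R(1) in auto)
  ultimately show ?thesis by (rule finite_imageD[rotated])
qed

text \<open>Among the proper ideals above \<open>I\<close>, one with the largest number of
  representatives is maximal, hence prime. Counting takes the place of Zorn's lemma.\<close>

lemma prime_above:
  assumes I: "ideal I OR" "1 \<notin> I" "a \<in> I" "a \<noteq> 0"
  obtains Q where "primeideal Q OR" "I \<subseteq> Q"
proof -
  interpret cring OR by (rule cring_OR)
  have aO: "a \<in> Oint" using ideal_OintD(1)[OF I(1,3)] .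
  obtain R where R: "finite R" "R \<subseteq> Oint"
    "\<And>I J. ideal I OR \<Longrightarrow> ideal J OR \<Longrightarrow> a \<in> I \<Longrightarrow> a \<in> J \<Longrightarrow> I \<inter> R \<subseteq> J \<inter> R \<Longrightarrow> I \<subseteq> J"
    using ideals_finite_residues[OF aO I(4)] by metis
  define good where "good J \<longleftrightarrow> ideal J OR \<and> I \<subseteq> J \<and> 1 \<notin> J" for J
  have "good I" using I by (simp add: good_def)
  have bound: "card (J \<inter> R) \<le> card R" for J using R(1) by (intro card_mono) auto
  obtain J where J: "good J" "\<And>J'. good J' \<Longrightarrow> card (J' \<inter> R) \<le> card (J \<inter> R)"
    using ex_has_greatest_nat[of good I "\<lambda>J. card (J \<inter> R)" "Suc (card R)"] \<open>good I\<close> bound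
    by (metis le_imp_less_Suc)
  have JI: "ideal J OR" "I \<subseteq> J" "1 \<notin> J" using J(1) by (auto simp: good_def)
  have max: "\<exists>j\<in>J. \<exists>z\<in>Oint. 1 = j + z * x" if x: "x \<in> Oint" "x \<notin> J" for x
  proof (rule ccontr)
    assume neg: "\<not> ?thesis"
    define J' where "J' = {j + z * x | j z. j \<in> J \<and> z \<in> Oint}"
    have "ideal J' OR"
      unfolding ideal_OR_iff
    proof (intro conjI ballI)
      show "J' \<subseteq> Oint" using ideal_OintD(1)[OF JI(1)] x(1) by (auto simp: J'_def)
      show "0 \<in> J'" unfolding J'_def using ideal_OintD(2)[OF JI(1)]
        by (intro CollectI exI[of _ 0]) auto
      fix y y' assume "y \<in> J'" "y' \<in> J'"
      then obtain j z j' z' where "y = j + z * x" "y' = j' + z' * x" "j \<in> J" "j' \<in> J" "z \<in> Oint" "z' \<in> Oint"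
        unfolding J'_def by blast
      thus "y + y' \<in> J'" unfolding J'_def using ideal_OintD(3)[OF JI(1)]
        by (intro CollectI exI[of _ "j + j'"] exI[of _ "z + z'"]) (auto simp: algebra_simps)
    next
      fix b y assume "b \<in> Oint" "y \<in> J'"
      then obtain j z where "y = j + z * x" "j \<in> J" "z \<in> Oint" unfolding J'_def by blast
      thus "b * y \<in> J'" unfolding J'_def using ideal_OintD(4)[OF JI(1)] \<open>b \<in> Oint\<close>
        by (intro CollectI exI[of _ "b * j"] exI[of _ "b * z"]) (auto simp: algebra_simps)
    qed
    moreover have sub: "J \<subseteq> J'"
    proof
      fix y assume "y \<in> J"
      thus "y \<in> J'" unfolding J'_def by (intro CollectI exI[of _ y] exI[of _ 0]) auto
    qed
    ultimately have gJ': "good J'" using JI(2) neg unfolding good_def J'_def by blast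
    have "J \<inter> R = J' \<inter> R"
      using card_seteq[of "J' \<inter> R" "J \<inter> R"] R(1) sub J(2)[OF gJ'] by blast
    moreover have "ideal J' OR" "a \<in> J'" "a \<in> J" using gJ' JI(2) I(3) by (auto simp: good_def)
    ultimately have "J' \<subseteq> J" using R(3)[OF _ JI(1)] by blast
    moreover have "x \<in> J'" unfolding J'_def using ideal_OintD(2)[OF JI(1)]
      by (intro CollectI exI[of _ 0] exI[of _ 1]) auto
    ultimately show False using x(2) by blast
  qed
  have "primeideal J OR"
  proof (rule primeidealI)
    show "ideal J OR" by fact
    show "cring OR" by (rule cring_OR)
    show "carrier OR \<noteq> J" using JI(3) by auto
    fix x y assume xy: "x \<in> carrier OR" "y \<in> carrier OR" "x \<otimes>\<^bsub>OR\<^esub> y \<in> J"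
    show "x \<in> J \<or> y \<in> J"
    proof (rule ccontr)
      assume neg: "\<not> (x \<in> J \<or> y \<in> J)"
      then obtain j z where jz: "j \<in> J" "z \<in> Oint" "1 = j + z * x" using max[of x] xy by auto
      have "y = y * (j + z * x)" using jz(3) by simp
      also have "\<dots> = y * j + z * (x * y)" by (simp add: algebra_simps)
      also have "\<dots> \<in> J" using ideal_OintD(3,4)[OF JI(1)] xy jz by simp
      finally show False using neg by blast
    qed
  qed
  thus thesis using JI(2) that by blast
qed

text \<open>Consider the denominator ideal \<open>I\<close> of \<open>z / l ^ a\<close>. It contains
  \<open>l ^ a\<close>, so a prime above a proper \<open>I\<close> would contain \<open>l\<close>
  and belong to \<open>Pl\<close>; but at such a prime the quotient is integral by hypothesis, which
  gives an element of \<open>I\<close> outside the prime.\<close>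

lemma Pl_le_power:
  assumes z: "z \<in> Oint" and le: "\<And>P. P \<in> Pl \<Longrightarrow> padic_abs K P z \<le> padic_abs K P l ^ a"
  obtains y where "y \<in> Oint" "z = l ^ a * y"
proof -
  define x where "x = z / l ^ a"
  have xK: "x \<in> K" using Oint_K[OF z] by (simp add: x_def)
  define I where "I = {c \<in> Oint. c * x \<in> Oint}"
  have I: "ideal I OR"
    unfolding ideal_OR_iff
  proof (intro conjI ballI)
    show "I \<subseteq> Oint" "0 \<in> I" by (auto simp: I_def)
    fix c d assume "c \<in> I" "d \<in> I"
    thus "c + d \<in> I" by (simp add: I_def distrib_right)
  next
    fix b c assume "b \<in> Oint" "c \<in> I"
    thus "b * c \<in> I" by (simp add: I_def mult.assoc)
  qed
  have la: "l ^ a \<in> I" using z by (simp add: I_def x_def)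
  have "1 \<in> I"
  proof (rule ccontr)
    assume "1 \<notin> I"
    have la0: "l ^ a \<noteq> 0" by simp
    obtain Q where Q: "primeideal Q OR" "I \<subseteq> Q" by (rule prime_above[OF I \<open>1 \<notin> I\<close> la la0])
    have "l \<in> Q"
    proof (rule ccontr)
      assume lQ: "l \<notin> Q"
      have "l ^ i \<notin> Q" for i
      proof (induction i)
        case 0
        show ?case using primeideal_1[OF Q(1)] by simp
      next
        case (Suc i)
        thus ?case using primeideal.I_prime[OF Q(1), of l "l ^ i"] lQ by auto
      qed
      thus False using la Q(2) by blast
    qed
    hence QPl: "Q \<in> Pl" using maximal_Pl Q(1) by blast
    obtain t where "prime_place K Q t" using Pl_prime_place[OF QPl] by blast
    then interpret pp: prime_place K Q t .
    have pos: "pp.v (l ^ a) > 0" by simp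
    have "x * l ^ a = z" by (simp add: x_def)
    hence "pp.v x * pp.v (l ^ a) = pp.v z" using pp.v_mult[OF xK, of "l ^ a"] by simp
    moreover have "pp.v z \<le> pp.v (l ^ a)" using le[OF QPl] pp.v_power[OF l_K, of a] by simp
    ultimately have "pp.v x * pp.v (l ^ a) \<le> 1 * pp.v (l ^ a)" by simp
    hence "pp.v x \<le> 1" by (rule mult_right_le_imp_le[OF _ pos])
    then obtain s r where sr: "s \<in> Oint" "r \<in> Oint" "r \<notin> Q" "x = s / r"
      using pp.v_le_1_iff[OF xK] by (auto simp: pp.OP_def)
    hence "r * x = s" using pp.P_0 by auto
    hence "r \<in> I" using sr by (simp add: I_def)
    thus False using sr Q(2) by blast
  qed
  hence "x \<in> Oint" by (simp add: I_def)
  moreover have "z = l ^ a * x" by (simp add: x_def)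
  ultimately show thesis by (rule that)
qed

text \<open>The primes containing \<open>l\<close> are maximal, so none of them is contained in
  another.\<close>

lemma Pl_separate:
  assumes "P \<in> Pl" "Q \<in> Pl" "P \<noteq> Q"
  obtains a where "a \<in> Q" "a \<notin> P"
proof (rule ccontr)
  assume "\<not> thesis"
  hence sub: "Q \<subseteq> P" using that by blast
  then obtain x where x: "x \<in> P" "x \<notin> Q" using assms(3) by blast
  have xO: "x \<in> Oint" using ideal_OintD(1)[OF Pl_ideal[OF assms(1)] x(1)] .
  obtain b where b: "b \<in> Oint" "1 - x * b \<in> Q"
    using maximal_above[OF Pl_primeideal[OF assms(2)] Pl_l[OF assms(2)] xO x(2)] by blast
  obtain t where "prime_place K P t" using Pl_prime_place[OF assms(1)] by blast
  then interpret pp: prime_place K P t .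
  have "(1 - x * b) + b * x \<in> P" using b sub x pp.P_add pp.P_mult by blast
  thus False using pp.P_1 by (simp add: mult.commute)
qed

text \<open>A product of N-th powers of elements taken from the other primes, each avoiding
  \<open>P\<close>, is small at those primes and a unit at \<open>P\<close>. Multiplying it by an
  inverse modulo a high power of \<open>P\<close> brings it close to 1 there.\<close>

lemma crt_idempotent:
  assumes P: "P \<in> Pl"
  obtains e where "e \<in> Oint" "padic_abs K P (1 - e) \<le> (1 / 2) ^ N"
    "\<And>Q. Q \<in> Pl \<Longrightarrow> Q \<noteq> P \<Longrightarrow> padic_abs K Q e \<le> (1 / 2) ^ N"
proof -
  obtain t where "prime_place K P t" using Pl_prime_place[OF P] by blast
  then interpret pp: prime_place K P t .
  have "\<forall>Q\<in>Pl - {P}. \<exists>a. a \<in> Q \<and> a \<notin> P" using Pl_separate[OF P] by (metis Diff_iff insertI1)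
  from bchoice[OF this] obtain a where a: "\<And>Q. Q \<in> Pl - {P} \<Longrightarrow> a Q \<in> Q \<and> a Q \<notin> P" by blast
  have aO: "a Q \<in> Oint" if "Q \<in> Pl - {P}" for Q
    using a[OF that] that ideal_OintD(1)[OF Pl_ideal] by blast
  define b where "b = (\<Prod>Q\<in>Pl - {P}. a Q ^ N)"
  have bO: "b \<in> Oint" unfolding b_def by (intro Oint_prod) (use aO in auto)
  have "(\<Prod>Q\<in>S. a Q ^ N) \<notin> P" if "finite S" "S \<subseteq> Pl - {P}" for S
    using that
  proof (induction S rule: finite_induct)
    case empty
    show ?case using pp.P_1 by simp
  next
    case (insert Q S)
    have "a Q ^ N \<notin> P" using a[of Q] aO[of Q] insert.prems by (intro pp.notP_power) auto
    moreover have "(\<Prod>Q\<in>S. a Q ^ N) \<in> Oint" by (intro Oint_prod Oint_power aO) (use insert.prems in blast)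
    ultimately show ?case using insert aO[of Q] pp.P_primeD[of "a Q ^ N" "\<Prod>Q\<in>S. a Q ^ N"] by auto
  qed
  hence bP: "b \<notin> P" unfolding b_def by simp
  obtain q z where qz: "q \<in> P" "z \<in> Oint" "1 - b * z = q ^ N"
    using pp.coprime_power[OF bO bP] by blast
  show thesis
  proof (rule that[of "b * z"])
    show "b * z \<in> Oint" using bO qz by simp
    show "padic_abs K P (1 - b * z) \<le> (1 / 2) ^ N"
      unfolding qz(3) using pp.v_P_le[OF qz(1)] pp.P_K[OF qz(1)] by (simp add: pp.v_power power_mono)
    fix Q assume Q: "Q \<in> Pl" "Q \<noteq> P"
    obtain t' where "prime_place K Q t'" using Pl_prime_place[OF Q(1)] by blast
    then interpret qq: prime_place K Q t' .
    define c where "c = (\<Prod>Q\<in>Pl - {P} - {Q}. a Q ^ N)"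
    have cO: "c \<in> Oint" unfolding c_def by (intro Oint_prod) (use aO in auto)
    have "b = a Q ^ N * c" unfolding b_def c_def using Q by (subst prod.remove[of _ Q]) auto
    hence "qq.v (b * z) = qq.v (a Q) ^ N * qq.v (c * z)"
      using aO[of Q] Q cO qz by (simp add: qq.v_mult qq.v_power Oint_K mult.assoc)
    also have "\<dots> \<le> (1 / 2) ^ N * 1"
      using a[of Q] Q cO qz by (intro mult_mono power_mono qq.v_P_le qq.v_Oint_le) auto
    finally show "padic_abs K Q (b * z) \<le> (1 / 2) ^ N" by simp
  qed
qed

lemma crt:
  assumes f: "\<And>P. P \<in> Pl \<Longrightarrow> f P \<in> Oint"
  obtains z where "z \<in> Oint" "\<And>P. P \<in> Pl \<Longrightarrow> padic_abs K P (f P - z) \<le> (1 / 2) ^ N"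
proof -
  have "\<forall>P\<in>Pl. \<exists>e. e \<in> Oint \<and> padic_abs K P (1 - e) \<le> (1 / 2) ^ N \<and>
    (\<forall>Q\<in>Pl. Q \<noteq> P \<longrightarrow> padic_abs K Q e \<le> (1 / 2) ^ N)"
  proof
    fix P assume P: "P \<in> Pl"
    obtain e where "e \<in> Oint" "padic_abs K P (1 - e) \<le> (1 / 2) ^ N"
      "\<And>Q. Q \<in> Pl \<Longrightarrow> Q \<noteq> P \<Longrightarrow> padic_abs K Q e \<le> (1 / 2) ^ N"
      using that by (rule crt_idempotent[OF P, of N]) blast
    thus "\<exists>e. e \<in> Oint \<and> padic_abs K P (1 - e) \<le> (1 / 2) ^ N \<and>
      (\<forall>Q\<in>Pl. Q \<noteq> P \<longrightarrow> padic_abs K Q e \<le> (1 / 2) ^ N)" by blast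
  qed
  from bchoice[OF this] obtain e where e: "\<forall>P\<in>Pl. e P \<in> Oint \<and> padic_abs K P (1 - e P) \<le> (1 / 2) ^ N \<and>
    (\<forall>Q\<in>Pl. Q \<noteq> P \<longrightarrow> padic_abs K Q (e P) \<le> (1 / 2) ^ N)" by (rule exE)
  have e1: "e P \<in> Oint" if "P \<in> Pl" for P
    using bspec[OF e that] by (rule conjunct1)
  have e2: "padic_abs K P (1 - e P) \<le> (1 / 2) ^ N" if "P \<in> Pl" for P
    using conjunct2[OF bspec[OF e that]] by (rule conjunct1)
  have e3: "padic_abs K Q (e P) \<le> (1 / 2) ^ N" if "P \<in> Pl" "Q \<in> Pl" "Q \<noteq> P" for P Q
    using conjunct2[OF conjunct2[OF bspec[OF e that(1)]]] that(2,3) by blast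
  define z where "z = (\<Sum>P\<in>Pl. e P * f P)"
  show thesis
  proof (rule that)
    show "z \<in> Oint" unfolding z_def by (intro Oint_sum Oint_mult e1 f)
    fix P assume P: "P \<in> Pl"
    obtain t where "prime_place K P t" using Pl_prime_place[OF P] by blast
    then interpret pp: prime_place K P t .
    have small: "pp.v (\<Sum>Q\<in>S. - (e Q * f Q)) \<le> (1 / 2) ^ N" if "finite S" "S \<subseteq> Pl - {P}" for S
      using that
    proof (induction S rule: finite_induct)
      case empty
      show ?case by simp
    next
      case (insert Q S)
      have Q: "Q \<in> Pl" "Q \<noteq> P" using insert.prems by auto
      have "pp.v (- (e Q * f Q)) = pp.v (e Q) * pp.v (f Q)"
        using e1[OF Q(1)] f[OF Q(1)] by (simp add: pp.v_minus pp.v_mult Oint_K)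
      also have "\<dots> \<le> (1 / 2) ^ N * 1"
        using e3[OF Q(1) P] Q(2) pp.v_Oint_le[OF f[OF Q(1)]] by (intro mult_mono) auto
      finally have *: "pp.v (- (e Q * f Q)) \<le> (1 / 2) ^ N" by simp
      have "(\<Sum>Q\<in>S. - (e Q * f Q)) \<in> K"
        using insert.prems by (intro sum_K uminus_K mult_K Oint_K e1 f) auto
      hence "pp.v (- (e Q * f Q) + (\<Sum>Q\<in>S. - (e Q * f Q))) \<le> max (pp.v (- (e Q * f Q))) (pp.v (\<Sum>Q\<in>S. - (e Q * f Q)))"
        using e1[OF Q(1)] f[OF Q(1)] by (intro pp.v_add_le) (auto simp: Oint_K)
      thus ?case using * insert by simp
    qed
    have "f P - z = (1 - e P) * f P + (\<Sum>Q\<in>Pl - {P}. - (e Q * f Q))"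
      unfolding z_def using P by (simp add: sum.remove[of Pl P] sum_negf algebra_simps)
    moreover have "pp.v ((1 - e P) * f P + (\<Sum>Q\<in>Pl - {P}. - (e Q * f Q)))
      \<le> max (pp.v ((1 - e P) * f P)) (pp.v (\<Sum>Q\<in>Pl - {P}. - (e Q * f Q)))"
      by (intro pp.v_add_le sum_K uminus_K mult_K diff_K one_K) (auto simp: Oint_K e1 f P)
    moreover have "pp.v ((1 - e P) * f P) \<le> (1 / 2) ^ N * 1"
    proof -
      have "pp.v ((1 - e P) * f P) = pp.v (1 - e P) * pp.v (f P)"
        using e1[OF P] f[OF P] by (simp add: pp.v_mult Oint_K)
      thus ?thesis using mult_mono[OF e2[OF P] pp.v_Oint_le[OF f[OF P]]] by simp
    qed
    ultimately show "pp.v (f P - z) \<le> (1 / 2) ^ N"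
      using small[of "Pl - {P}"] by simp
  qed
qed

lemma v_l_le: "P \<in> Pl \<Longrightarrow> padic_abs K P l \<le> 1 / 2"
proof -
  assume P: "P \<in> Pl"
  obtain t where "prime_place K P t" using Pl_prime_place[OF P] by blast
  then interpret pp: prime_place K P t .
  show ?thesis using pp.v_P_le[OF Pl_l[OF P]] .
qed

text \<open>A power of \<open>l\<close> clears the denominators at all these primes at once, which
  reduces the claim to integral approximation. That the denominator is a power of \<open>l\<close>
  is what later places the approximation in \<open>Y\<close>.\<close>

lemma weak_approximation:
  assumes f: "\<And>P. P \<in> Pl \<Longrightarrow> f P \<in> K"
  obtains z k where "z \<in> Oint" "\<And>P. P \<in> Pl \<Longrightarrow> padic_abs K P (f P - z / l ^ k) \<le> (1 / 2) ^ N"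
proof -
  have "\<forall>\<^sub>F k in sequentially. padic_abs K P (l ^ k * f P) < 1" if P: "P \<in> Pl" for P
  proof -
    obtain t where "prime_place K P t" using Pl_prime_place[OF P] by blast
    then interpret pp: prime_place K P t .
    have "(\<lambda>k. pp.v l ^ k * pp.v (f P)) \<longlonglongrightarrow> 0 * pp.v (f P)"
      using v_l_le[OF P] by (intro tendsto_intros LIMSEQ_power_zero) auto
    hence "\<forall>\<^sub>F k in sequentially. pp.v l ^ k * pp.v (f P) < 1" by (rule order_tendstoD) simp
    thus ?thesis using f[OF P] by (simp add: pp.v_mult pp.v_power)
  qed
  hence "\<forall>\<^sub>F k in sequentially. \<forall>P\<in>Pl. padic_abs K P (l ^ k * f P) < 1"
    by (intro eventually_ball_finite) auto
  then obtain k where k: "\<And>P. P \<in> Pl \<Longrightarrow> padic_abs K P (l ^ k * f P) < 1"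
    using eventually_happens by force
  have "\<forall>\<^sub>F M in sequentially. (1 / 2) ^ M * inverse (padic_abs K P l ^ k) < (1 / 2) ^ N" for P
  proof -
    have "(\<lambda>M. (1 / 2) ^ M * inverse (padic_abs K P l ^ k)) \<longlonglongrightarrow> 0 * inverse (padic_abs K P l ^ k)"
      by (intro tendsto_intros LIMSEQ_power_zero) auto
    thus ?thesis by (intro order_tendstoD(2)[where a = "(1 / 2) ^ N"]) auto
  qed
  hence "\<forall>\<^sub>F M in sequentially. \<forall>P\<in>Pl. (1 / 2) ^ M * inverse (padic_abs K P l ^ k) < (1 / 2) ^ N"
    by (intro eventually_ball_finite) auto
  \<comment> \<open>Dividing by \<open>l ^ k\<close> at the end enlarges the error; the finer
    precision \<open>M\<close> compensates for this at every prime.\<close>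
  then obtain M where M: "\<And>P. P \<in> Pl \<Longrightarrow> (1 / 2) ^ M * inverse (padic_abs K P l ^ k) < (1 / 2) ^ N"
    using eventually_happens by force
  have "\<forall>P\<in>Pl. \<exists>z. z \<in> Oint \<and> padic_abs K P (l ^ k * f P - z) \<le> (1 / 2) ^ M"
  proof
    fix P assume P: "P \<in> Pl"
    obtain t where "prime_place K P t" using Pl_prime_place[OF P] by blast
    then interpret pp: prime_place K P t .
    show "\<exists>z. z \<in> Oint \<and> pp.v (l ^ k * f P - z) \<le> (1 / 2) ^ M"
      using pp.Oint_dense[of "l ^ k * f P" M] f[OF P] k[OF P] by (metis l_K less_eq_real_def mult_K power_K)
  qed
  from bchoice[OF this] obtain g where g: "\<And>P. P \<in> Pl \<Longrightarrow> g P \<in> Oint \<and> padic_abs K P (l ^ k * f P - g P) \<le> (1 / 2) ^ M"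
    by blast
  obtain z where z: "z \<in> Oint" "\<And>P. P \<in> Pl \<Longrightarrow> padic_abs K P (g P - z) \<le> (1 / 2) ^ M"
    using crt[of g M thesis] g that by blast
  show thesis
  proof (rule that[OF z(1)])
    fix P assume P: "P \<in> Pl"
    obtain t where "prime_place K P t" using Pl_prime_place[OF P] by blast
    then interpret pp: prime_place K P t .
    have gK: "g P \<in> K" using g[OF P] Oint_K by blast
    have "pp.v ((l ^ k * f P - g P) + (g P - z)) \<le> max (pp.v (l ^ k * f P - g P)) (pp.v (g P - z))"
      using f[OF P] gK z(1) by (intro pp.v_add_le) (auto simp: Oint_K)
    also have "\<dots> \<le> (1 / 2) ^ M"
      using conjunct2[OF g[OF P]] z(2)[OF P] by (rule max.boundedI)
    finally have *: "pp.v (l ^ k * f P - z) \<le> (1 / 2) ^ M" by simp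
    have "f P - z / l ^ k = (l ^ k * f P - z) * inverse (l ^ k)" by (simp add: field_simps)
    hence "pp.v (f P - z / l ^ k) = pp.v (l ^ k * f P - z) * inverse (pp.v l ^ k)"
      using f[OF P] Oint_K[OF z(1)] by (simp add: pp.v_mult pp.v_inverse pp.v_power)
    also have "\<dots> \<le> (1 / 2) ^ M * inverse (pp.v l ^ k)"
      using * by (intro mult_right_mono) auto
    also have "\<dots> \<le> (1 / 2) ^ N" using M[OF P] by simp
    finally show "pp.v (f P - z / l ^ k) \<le> (1 / 2) ^ N" .
  qed
qed

text \<open>\<open>P\<close> contains a natural multiple of \<open>l\<close>, and splitting off
  prime factors ends at a prime number in \<open>P\<close>. Two different ones would put 1 into
  \<open>P\<close> by Bezout.\<close>

lemma Pl_prime_number: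
  assumes P: "P \<in> Pl"
  shows "\<exists>!p::nat. Factorial_Ring.prime p \<and> of_nat p \<in> P"
proof -
  note PP = Pl_primeideal[OF P] and PI = ideal_OintD[OF Pl_ideal[OF P]]
  have P1: "1 \<notin> P" by (rule primeideal_1[OF PP])
  obtain m b where m: "m > 0" "b \<in> Oint" "of_nat m = l * b"
    by (rule Oint_divides_nat[OF l_O l_nz])
  have "of_nat m \<in> P" using PI(4)[OF m(2) Pl_l[OF P]] m(3) by (simp add: mult.commute)
  hence ex: "\<exists>p::nat. Factorial_Ring.prime p \<and> of_nat p \<in> P" using m(1)
  proof (induction m rule: less_induct)
    case (less m)
    have "m \<noteq> 1" using less.prems P1 by auto
    then obtain p where p: "Factorial_Ring.prime p" "p dvd m" using prime_factor_nat by blast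
    then obtain k where k: "m = p * k" by (auto elim: dvdE)
    have "of_nat p \<in> P \<or> of_nat k \<in> P"
      using primeideal.I_prime[OF PP, of "of_nat p" "of_nat k"] less.prems by (simp add: k)
    moreover have "k < m" "k > 0" using less.prems p(1) k prime_gt_1_nat[OF p(1)] by (auto intro: Nat.gr0I)
    ultimately show ?case using p(1) less.IH[of k] by blast
  qed
  have "p = q" if "Factorial_Ring.prime p" "Factorial_Ring.prime q" "of_nat p \<in> P" "of_nat q \<in> P" for p q :: nat
  proof (rule ccontr)
    assume "p \<noteq> q"
    hence "coprime (int p) (int q)" using primes_coprime[OF that(1,2)] by (simp add: coprime_int_iff)
    hence "gcd (int p) (int q) = 1" by simp
    then obtain a b where "a * int p + b * int q = 1"
      using bezout_int[of "int p" "int q"] by auto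
    hence "of_int (a * int p + b * int q) = (1 :: complex)" by simp
    hence "of_int a * of_nat p + of_int b * of_nat q = (1 :: complex)" by simp
    moreover have "of_int a * of_nat p + of_int b * of_nat q \<in> P"
      using PI(3,4) that(3,4) by simp
    ultimately show False using P1 by simp
  qed
  with ex show ?thesis by blast
qed

end

section \<open>Completions\<close>

text \<open>Only the ordinary triangle inequality is assumed, so that finite and infinite places
  share one theory of the completion.\<close>

locale valued_field = complex_subfield K for K :: "complex set" +
  fixes v :: "complex \<Rightarrow> real"
  assumes v_nonneg: "\<And>x. x \<in> K \<Longrightarrow> v x \<ge> 0"
    and v_0_iff: "\<And>x. x \<in> K \<Longrightarrow> v x = 0 \<longleftrightarrow> x = 0"
    and v_mult: "\<And>x y. x \<in> K \<Longrightarrow> y \<in> K \<Longrightarrow> v (x * y) = v x * v y"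
    and v_triangle: "\<And>x y. x \<in> K \<Longrightarrow> y \<in> K \<Longrightarrow> v (x + y) \<le> v x + v y"
begin

lemma v_zero: "v 0 = 0" using v_0_iff[of 0] by simp

lemma v_one: "v 1 = 1" using v_mult[of 1 1] v_0_iff[of 1] by simp

lemma v_minus: "x \<in> K \<Longrightarrow> v (- x) = v x"
proof -
  assume x: "x \<in> K"
  have "v (- 1) * v (- 1) = 1" using v_mult[of "- 1" "- 1"] v_one by simp
  hence "v (- 1) = 1" using power2_eq_imp_eq[of "v (- 1)" 1] v_nonneg[of "- 1"] by (simp add: power2_eq_square)
  thus ?thesis using v_mult[of "- 1" x] x by simp
qed

lemma v_commute: "x \<in> K \<Longrightarrow> y \<in> K \<Longrightarrow> v (x - y) = v (y - x)"
  using v_minus[of "x - y"] by simp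

lemma v_dist_triangle: "x \<in> K \<Longrightarrow> y \<in> K \<Longrightarrow> z \<in> K \<Longrightarrow> v (x - z) \<le> v (x - y) + v (y - z)"
  using v_triangle[of "x - y" "y - z"] by simp

lemma v_abs_diff_le: "x \<in> K \<Longrightarrow> y \<in> K \<Longrightarrow> \<bar>v x - v y\<bar> \<le> v (x - y)"
  using v_triangle[of "x - y" y] v_triangle[of "y - x" x] v_commute[of x y] by simp

definition Cau :: "(nat \<Rightarrow> complex) set" where "Cau = carrier (cauchy_ring K v)"
definition Null :: "(nat \<Rightarrow> complex) set" where "Null = null_seqs K v"

lemma Cau_iff: "x \<in> Cau \<longleftrightarrow> (\<forall>n. x n \<in> K) \<and> (\<forall>e>0. \<exists>N. \<forall>m\<ge>N. \<forall>n\<ge>N. v (x m - x n) < e)"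
  by (simp add: Cau_def cauchy_ring_def)

lemma Cau_K [simp]: "x \<in> Cau \<Longrightarrow> x n \<in> K"
  by (simp add: Cau_iff)

lemma CauD: "x \<in> Cau \<Longrightarrow> e > 0 \<Longrightarrow> \<exists>N. \<forall>m\<ge>N. \<forall>n\<ge>N. v (x m - x n) < e"
  by (simp add: Cau_iff)

lemma Cau_const: "a \<in> K \<Longrightarrow> (\<lambda>_. a) \<in> Cau"
  by (simp add: Cau_iff v_zero)

lemma Null_iff: "x \<in> Null \<longleftrightarrow> x \<in> Cau \<and> (\<lambda>n. v (x n)) \<longlonglongrightarrow> 0"
  by (simp add: Null_def null_seqs_def Cau_def)

lemma Cau_v_convergent:
  assumes "x \<in> Cau" shows "convergent (\<lambda>n. v (x n))"
proof -
  have "Cauchy (\<lambda>n. v (x n))"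
  proof (rule metric_CauchyI)
    fix e :: real assume "e > 0"
    then obtain N where N: "\<forall>m\<ge>N. \<forall>n\<ge>N. v (x m - x n) < e" using CauD[OF assms] by blast
    have "dist (v (x m)) (v (x n)) < e" if "m \<ge> N" "n \<ge> N" for m n
      using N that v_abs_diff_le[of "x m" "x n"] assms by (fastforce simp: dist_real_def)
    thus "\<exists>N. \<forall>m\<ge>N. \<forall>n\<ge>N. dist (v (x m)) (v (x n)) < e" by blast
  qed
  thus ?thesis by (rule Cauchy_convergent)
qed

lemma Cau_bounded:
  assumes "x \<in> Cau" shows "\<exists>B>0. \<forall>n. v (x n) \<le> B"
proof -
  have "Bseq (\<lambda>n. v (x n))" by (rule convergent_imp_Bseq[OF Cau_v_convergent[OF assms]])
  then obtain B where "B > 0" "\<And>n. norm (v (x n)) \<le> B" by (auto elim: BseqE)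
  thus ?thesis by (intro exI[of _ B]) (simp add: abs_le_iff)
qed

lemma Cau_add: "x \<in> Cau \<Longrightarrow> y \<in> Cau \<Longrightarrow> (\<lambda>n. x n + y n) \<in> Cau"
proof -
  assume x: "x \<in> Cau" and y: "y \<in> Cau"
  have "\<exists>N. \<forall>m\<ge>N. \<forall>n\<ge>N. v (x m + y m - (x n + y n)) < e" if "e > 0" for e
  proof -
    obtain N where N: "\<forall>m\<ge>N. \<forall>n\<ge>N. v (x m - x n) < e / 2" using CauD[OF x, of "e / 2"] \<open>e > 0\<close> by auto
    obtain M where M: "\<forall>m\<ge>M. \<forall>n\<ge>M. v (y m - y n) < e / 2" using CauD[OF y, of "e / 2"] \<open>e > 0\<close> by auto
    have "v (x m + y m - (x n + y n)) < e" if "m \<ge> max N M" "n \<ge> max N M" for m n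
    proof -
      have "v ((x m - x n) + (y m - y n)) \<le> v (x m - x n) + v (y m - y n)"
        using x y by (intro v_triangle) auto
      also have "\<dots> < e / 2 + e / 2" using N M that by (intro add_strict_mono) auto
      finally show ?thesis by (simp add: algebra_simps)
    qed
    thus ?thesis by blast
  qed
  thus ?thesis using x y by (simp add: Cau_iff)
qed

lemma Cau_mult: "x \<in> Cau \<Longrightarrow> y \<in> Cau \<Longrightarrow> (\<lambda>n. x n * y n) \<in> Cau"
proof -
  assume x: "x \<in> Cau" and y: "y \<in> Cau"
  obtain B where B: "B > 0" "\<And>n. v (x n) \<le> B" using Cau_bounded[OF x] by blast
  obtain C where C: "C > 0" "\<And>n. v (y n) \<le> C" using Cau_bounded[OF y] by blast
  have "\<exists>N. \<forall>m\<ge>N. \<forall>n\<ge>N. v (x m * y m - x n * y n) < e" if e: "e > 0" for e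
  proof -
    obtain N where N: "\<forall>m\<ge>N. \<forall>n\<ge>N. v (x m - x n) < e / 2 / C" using CauD[OF x, of "e / 2 / C"] e C(1) by auto
    obtain M where M: "\<forall>m\<ge>M. \<forall>n\<ge>M. v (y m - y n) < e / 2 / B" using CauD[OF y, of "e / 2 / B"] e B(1) by auto
    have "v (x m * y m - x n * y n) < e" if "m \<ge> max N M" "n \<ge> max N M" for m n
    proof -
      have "v (x m * (y m - y n) + (x m - x n) * y n) \<le> v (x m) * v (y m - y n) + v (x m - x n) * v (y n)"
        using x y by (intro order_trans[OF v_triangle]) (auto simp: v_mult)
      also have "v (x m) * v (y m - y n) \<le> B * v (y m - y n)"
        using B x y by (intro mult_right_mono v_nonneg) auto
      also have "B * v (y m - y n) < B * (e / 2 / B)" using M B that by (intro mult_strict_left_mono) auto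
      also have "v (x m - x n) * v (y n) \<le> v (x m - x n) * C"
        using C x y by (intro mult_left_mono v_nonneg) auto
      also have "v (x m - x n) * C < e / 2 / C * C" using N C that by (intro mult_strict_right_mono) auto
      finally show ?thesis using B C by (simp add: algebra_simps)
    qed
    thus ?thesis by blast
  qed
  thus ?thesis using x y by (simp add: Cau_iff)
qed

lemma Cau_minus: "x \<in> Cau \<Longrightarrow> (\<lambda>n. - x n) \<in> Cau"
  using Cau_mult[OF Cau_const[of "- 1"]] by simp

lemma Cau_diff: "x \<in> Cau \<Longrightarrow> y \<in> Cau \<Longrightarrow> (\<lambda>n. x n - y n) \<in> Cau"
  using Cau_add[OF _ Cau_minus] by simp

lemma Null_add: "x \<in> Null \<Longrightarrow> y \<in> Null \<Longrightarrow> (\<lambda>n. x n + y n) \<in> Null"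
proof -
  assume x: "x \<in> Null" and y: "y \<in> Null"
  have "(\<lambda>n. v (x n + y n)) \<longlonglongrightarrow> 0"
  proof (rule tendsto_sandwich[of "\<lambda>_. 0" _ _ "\<lambda>n. v (x n) + v (y n)"])
    show "(\<lambda>n. v (x n) + v (y n)) \<longlonglongrightarrow> 0" using tendsto_add[of "\<lambda>n. v (x n)" 0 _ "\<lambda>n. v (y n)" 0] x y
      by (simp add: Null_iff)
  qed (use x y v_triangle v_nonneg in \<open>auto simp: Null_iff\<close>)
  thus ?thesis using x y by (simp add: Null_iff Cau_add)
qed

lemma Null_mult: "x \<in> Cau \<Longrightarrow> y \<in> Null \<Longrightarrow> (\<lambda>n. x n * y n) \<in> Null"
proof -
  assume x: "x \<in> Cau" and y: "y \<in> Null"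
  obtain B where B: "B > 0" "\<And>n. v (x n) \<le> B" using Cau_bounded[OF x] by blast
  have "(\<lambda>n. v (x n * y n)) \<longlonglongrightarrow> 0"
  proof (rule tendsto_sandwich[of "\<lambda>_. 0" _ _ "\<lambda>n. B * v (y n)"])
    show "(\<lambda>n. B * v (y n)) \<longlonglongrightarrow> 0" using tendsto_mult_left[of "\<lambda>n. v (y n)" 0 _ B] y by (simp add: Null_iff)
    show "\<forall>\<^sub>F n in sequentially. v (x n * y n) \<le> B * v (y n)"
      using B x y by (intro always_eventually allI) (simp add: Null_iff v_mult v_nonneg mult_right_mono)
  qed (use x y v_nonneg in \<open>auto simp: Null_iff\<close>)
  thus ?thesis using x y by (simp add: Null_iff Cau_mult)
qed

section \<open>The completion as a field with absolute value\<close>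

abbreviation CR :: "(nat \<Rightarrow> complex) ring" where "CR \<equiv> cauchy_ring K v"
abbreviation L :: "(nat \<Rightarrow> complex) set ring" where "L \<equiv> completion K v"

lemma CR_simps: "carrier CR = Cau" "monoid.mult CR = (\<lambda>x y n. x n * y n)" "monoid.one CR = (\<lambda>_. 1)"
  "ring.zero CR = (\<lambda>_. 0)" "ring.add CR = (\<lambda>x y n. x n + y n)"
  by (simp_all only: cauchy_ring_def Cau_def partial_object.simps monoid.simps ring.simps)

lemma cring_CR: "cring CR"
proof (rule cringI)
  show "abelian_group CR"
  proof (rule abelian_groupI)
    fix x assume "x \<in> carrier CR"
    thus "\<exists>y\<in>carrier CR. y \<oplus>\<^bsub>CR\<^esub> x = \<zero>\<^bsub>CR\<^esub>"
      by (intro bexI[of _ "\<lambda>n. - x n"]) (auto simp: CR_simps Cau_minus)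
  qed (auto simp: CR_simps Cau_add Cau_const algebra_simps)
  show "Group.comm_monoid CR"
    by (rule Group.comm_monoidI) (auto simp: CR_simps Cau_mult Cau_const algebra_simps)
qed (auto simp: CR_simps algebra_simps)

lemma ideal_Null: "ideal Null CR"
proof -
  interpret cring CR by (rule cring_CR)
  have minv: "\<ominus>\<^bsub>CR\<^esub> x = (\<lambda>n. - x n)" if "x \<in> Cau" for x
    using that minus_equality[of "\<lambda>n. - x n" x] by (simp add: CR_simps Cau_minus)
  show ?thesis
  proof (rule idealI)
    show "subgroup Null (add_monoid CR)"
    proof (rule add.subgroupI)
      show "Null \<subseteq> carrier CR" by (auto simp: Null_iff CR_simps)
      have "(\<lambda>_. 0) \<in> Null" by (simp add: Null_iff Cau_const v_zero)
      thus "Null \<noteq> {}" by blast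
      fix a assume a: "a \<in> Null"
      show "\<ominus>\<^bsub>CR\<^esub> a \<in> Null" using a Null_mult[OF Cau_const[of "- 1"] a] minv[of a] by (simp add: Null_iff)
      fix b assume "b \<in> Null"
      thus "a \<oplus>\<^bsub>CR\<^esub> b \<in> Null" using Null_add[OF a] by (simp add: CR_simps)
    qed
  next
    fix a x assume "a \<in> Null" "x \<in> carrier CR"
    thus "x \<otimes>\<^bsub>CR\<^esub> a \<in> Null" "a \<otimes>\<^bsub>CR\<^esub> x \<in> Null"
      using Null_mult[of x a] by (simp_all add: CR_simps mult.commute)
  qed (rule ring_axioms)
qed

definition cls :: "(nat \<Rightarrow> complex) \<Rightarrow> (nat \<Rightarrow> complex) set" where "cls x = Null +>\<^bsub>CR\<^esub> x"

lemma mem_cls_iff: "x \<in> Cau \<Longrightarrow> y \<in> cls x \<longleftrightarrow> y \<in> Cau \<and> (\<lambda>n. v (y n - x n)) \<longlonglongrightarrow> 0"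
proof
  assume x: "x \<in> Cau" and "y \<in> cls x"
  then obtain h where "h \<in> Null" "y = (\<lambda>n. h n + x n)"
    by (auto simp: cls_def a_r_coset_def r_coset_def CR_simps)
  thus "y \<in> Cau \<and> (\<lambda>n. v (y n - x n)) \<longlonglongrightarrow> 0" using x by (auto simp: Null_iff Cau_add)
next
  assume x: "x \<in> Cau" and y: "y \<in> Cau \<and> (\<lambda>n. v (y n - x n)) \<longlonglongrightarrow> 0"
  hence "(\<lambda>n. y n - x n) \<in> Null" by (simp add: Null_iff Cau_diff)
  thus "y \<in> cls x" unfolding cls_def a_r_coset_def r_coset_def
    by (auto simp: CR_simps intro!: bexI[of _ "\<lambda>n. y n - x n"])
qed

lemma cls_self: "x \<in> Cau \<Longrightarrow> x \<in> cls x"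
  by (simp add: mem_cls_iff v_zero)

lemma cls_eq_iff:
  assumes "x \<in> Cau" "y \<in> Cau" shows "cls x = cls y \<longleftrightarrow> (\<lambda>n. v (x n - y n)) \<longlonglongrightarrow> 0"
proof
  assume "cls x = cls y"
  thus "(\<lambda>n. v (x n - y n)) \<longlonglongrightarrow> 0" using cls_self[OF assms(1)] mem_cls_iff[OF assms(2)] by blast
next
  interpret cring CR by (rule cring_CR)
  interpret ideal Null CR by (rule ideal_Null)
  assume "(\<lambda>n. v (x n - y n)) \<longlonglongrightarrow> 0"
  hence "x \<in> cls y" using assms mem_cls_iff by blast
  thus "cls x = cls y" unfolding cls_def using a_repr_independence'[of x y] assms by (simp add: CR_simps)
qed

lemma carrier_L: "carrier L = cls ` Cau"
  by (auto simp: completion_def FactRing_def A_RCOSETS_def' Null_def cls_def CR_simps)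

lemma cls_L [simp]: "x \<in> Cau \<Longrightarrow> cls x \<in> carrier L"
  by (simp add: carrier_L)

lemma L_cases: assumes "\<xi> \<in> carrier L" obtains x where "x \<in> Cau" "\<xi> = cls x"
  using assms by (auto simp: carrier_L)

lemma L_ops:
  assumes "x \<in> Cau" "y \<in> Cau"
  shows "cls x \<oplus>\<^bsub>L\<^esub> cls y = cls (\<lambda>n. x n + y n)" "cls x \<otimes>\<^bsub>L\<^esub> cls y = cls (\<lambda>n. x n * y n)"
proof -
  interpret cring CR by (rule cring_CR)
  interpret ideal Null CR by (rule ideal_Null)
  show "cls x \<oplus>\<^bsub>L\<^esub> cls y = cls (\<lambda>n. x n + y n)"
    using a_rcos_sum[of x y] assms by (simp add: completion_def FactRing_def Null_def[symmetric] cls_def CR_simps)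
  show "cls x \<otimes>\<^bsub>L\<^esub> cls y = cls (\<lambda>n. x n * y n)"
    using rcoset_mult_add[of x y] assms by (simp add: completion_def FactRing_def Null_def[symmetric] cls_def CR_simps)
qed

lemma cring_L: "cring L"
  using ideal.quotient_is_cring[OF ideal_Null cring_CR] by (simp add: completion_def Null_def)

abbreviation emb :: "complex \<Rightarrow> (nat \<Rightarrow> complex) set" where "emb \<equiv> completion_embed K v"

lemma emb_cls: "emb a = cls (\<lambda>_. a)"
  by (simp add: completion_embed_def cls_def Null_def)

lemma L_one: "\<one>\<^bsub>L\<^esub> = emb 1"
  by (simp add: completion_def FactRing_def emb_cls cls_def Null_def[symmetric] CR_simps)

lemma L_zero: "\<zero>\<^bsub>L\<^esub> = emb 0"
proof -
  interpret cring L by (rule cring_L)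
  have "emb 0 \<oplus>\<^bsub>L\<^esub> emb 0 = emb 0" "emb 0 \<in> carrier L" by (simp_all add: emb_cls L_ops Cau_const)
  thus ?thesis using add.l_cancel_one[of "emb 0" "emb 0"] by simp
qed

lemma emb_L [simp]: "a \<in> K \<Longrightarrow> emb a \<in> carrier L"
  by (simp add: emb_cls Cau_const)

lemma emb_add: "a \<in> K \<Longrightarrow> b \<in> K \<Longrightarrow> emb (a + b) = emb a \<oplus>\<^bsub>L\<^esub> emb b"
  and emb_mult: "a \<in> K \<Longrightarrow> b \<in> K \<Longrightarrow> emb (a * b) = emb a \<otimes>\<^bsub>L\<^esub> emb b"
  by (simp_all add: emb_cls L_ops Cau_const)

lemma L_uminus: 
  assumes "x \<in> Cau" shows "\<ominus>\<^bsub>L\<^esub> cls x = cls (\<lambda>n. - x n)"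
proof -
  interpret cring L by (rule cring_L)
  have "cls (\<lambda>n. - x n) \<oplus>\<^bsub>L\<^esub> cls x = \<zero>\<^bsub>L\<^esub>" using assms by (simp add: L_ops Cau_minus L_zero emb_cls)
  thus ?thesis using assms by (intro minus_equality) (auto simp: Cau_minus)
qed

lemma L_diff: "x \<in> Cau \<Longrightarrow> y \<in> Cau \<Longrightarrow> cls x \<ominus>\<^bsub>L\<^esub> cls y = cls (\<lambda>n. x n - y n)"
  by (simp add: a_minus_def L_uminus L_ops Cau_minus)

lemma emb_uminus: "a \<in> K \<Longrightarrow> emb (- a) = \<ominus>\<^bsub>L\<^esub> emb a"
  by (simp add: emb_cls L_uminus Cau_const)

lemma emb_diff: "a \<in> K \<Longrightarrow> b \<in> K \<Longrightarrow> emb (a - b) = emb a \<ominus>\<^bsub>L\<^esub> emb b"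
  by (simp add: emb_cls L_diff Cau_const)

abbreviation labs :: "(nat \<Rightarrow> complex) set \<Rightarrow> real" where "labs \<equiv> completion_abs v"

lemma labs_cls: assumes "x \<in> Cau" shows "(\<lambda>n. v (x n)) \<longlonglongrightarrow> labs (cls x)"
proof -
  obtain r where r: "(\<lambda>n. v (x n)) \<longlonglongrightarrow> r" using Cau_v_convergent[OF assms] by (auto simp: convergent_def)
  have all: "(\<lambda>n. v (y n)) \<longlonglongrightarrow> r" if y: "y \<in> cls x" for y
  proof -
    have "y \<in> Cau" and 0: "(\<lambda>n. v (y n - x n)) \<longlonglongrightarrow> 0" using y mem_cls_iff[OF assms] by auto
    have "(\<lambda>n. v (y n) - v (x n)) \<longlonglongrightarrow> 0"
      by (rule Lim_null_comparison[OF _ 0]) (use v_abs_diff_le assms \<open>y \<in> Cau\<close> in auto)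
    from tendsto_add[OF this r] show ?thesis by simp
  qed
  have "labs (cls x) = r"
    unfolding completion_abs_def
  proof (rule the_equality)
    show "\<forall>y\<in>cls x. (\<lambda>n. v (y n)) \<longlonglongrightarrow> r" using all by blast
    fix s assume "\<forall>y\<in>cls x. (\<lambda>n. v (y n)) \<longlonglongrightarrow> s"
    thus "s = r" using cls_self[OF assms] r LIMSEQ_unique by blast
  qed
  thus ?thesis using r by simp
qed

lemma labs_emb [simp]: "a \<in> K \<Longrightarrow> labs (emb a) = v a"
  using labs_cls[OF Cau_const[of a]] LIMSEQ_unique[OF _ tendsto_const] by (auto simp: emb_cls)

lemma labs_nonneg: "\<xi> \<in> carrier L \<Longrightarrow> labs \<xi> \<ge> 0"
  by (elim L_cases) (auto intro!: LIMSEQ_le_const[OF labs_cls] v_nonneg)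

lemma labs_0_iff: "\<xi> \<in> carrier L \<Longrightarrow> labs \<xi> = 0 \<longleftrightarrow> \<xi> = \<zero>\<^bsub>L\<^esub>"
proof (elim L_cases)
  fix x assume x: "x \<in> Cau" "\<xi> = cls x"
  have "labs \<xi> = 0 \<longleftrightarrow> (\<lambda>n. v (x n)) \<longlonglongrightarrow> 0" using labs_cls[OF x(1)] x(2) LIMSEQ_unique by auto
  also have "\<dots> \<longleftrightarrow> \<xi> = \<zero>\<^bsub>L\<^esub>" using cls_eq_iff[OF x(1) Cau_const[of 0]] x by (simp add: L_zero emb_cls)
  finally show "labs \<xi> = 0 \<longleftrightarrow> \<xi> = \<zero>\<^bsub>L\<^esub>" .
qed

lemma labs_mult: "\<xi> \<in> carrier L \<Longrightarrow> \<zeta> \<in> carrier L \<Longrightarrow> labs (\<xi> \<otimes>\<^bsub>L\<^esub> \<zeta>) = labs \<xi> * labs \<zeta>"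
proof (elim L_cases)
  fix x y assume xy: "x \<in> Cau" "\<xi> = cls x" "y \<in> Cau" "\<zeta> = cls y"
  have "(\<lambda>n. v (x n * y n)) \<longlonglongrightarrow> labs (cls x) * labs (cls y)"
    using tendsto_mult[OF labs_cls[OF xy(1)] labs_cls[OF xy(3)]] xy by (simp add: v_mult)
  thus ?thesis using labs_cls[OF Cau_mult[OF xy(1,3)]] xy LIMSEQ_unique by (auto simp: L_ops)
qed

lemma labs_triangle: "\<xi> \<in> carrier L \<Longrightarrow> \<zeta> \<in> carrier L \<Longrightarrow> labs (\<xi> \<oplus>\<^bsub>L\<^esub> \<zeta>) \<le> labs \<xi> + labs \<zeta>"
proof (elim L_cases)
  fix x y assume xy: "x \<in> Cau" "\<xi> = cls x" "y \<in> Cau" "\<zeta> = cls y"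
  have "labs (cls (\<lambda>n. x n + y n)) \<le> labs (cls x) + labs (cls y)"
    by (rule LIMSEQ_le[OF labs_cls[OF Cau_add[OF xy(1,3)]] tendsto_add[OF labs_cls[OF xy(1)] labs_cls[OF xy(3)]]])
      (use xy v_triangle in auto)
  thus ?thesis using xy by (simp add: L_ops)
qed

lemma labs_uminus: "\<xi> \<in> carrier L \<Longrightarrow> labs (\<ominus>\<^bsub>L\<^esub> \<xi>) = labs \<xi>"
proof (elim L_cases)
  fix x assume x: "x \<in> Cau" "\<xi> = cls x"
  have "(\<lambda>n. v (- x n)) \<longlonglongrightarrow> labs (cls x)" using labs_cls[OF x(1)] x(1) by (simp add: v_minus)
  thus ?thesis using labs_cls[OF Cau_minus[OF x(1)]] x LIMSEQ_unique by (auto simp: L_uminus)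
qed

lemma cls_approx:
  assumes x: "x \<in> Cau" and e: "e > 0"
  obtains N where "\<And>m. m \<ge> N \<Longrightarrow> labs (cls x \<ominus>\<^bsub>L\<^esub> emb (x m)) < e"
proof -
  obtain N where N: "\<forall>m\<ge>N. \<forall>n\<ge>N. v (x m - x n) < e / 2" using CauD[OF x, of "e / 2"] e by auto
  have "labs (cls x \<ominus>\<^bsub>L\<^esub> emb (x m)) < e" if m: "m \<ge> N" for m
  proof -
    have "labs (cls (\<lambda>n. x n - x m)) \<le> e / 2"
      by (rule LIMSEQ_le_const2[OF labs_cls[OF Cau_diff[OF x Cau_const]]])
        (use N m x in \<open>auto intro!: exI[of _ N] less_imp_le\<close>)
    thus ?thesis using x e by (simp add: emb_cls L_diff Cau_const)
  qed
  thus thesis by (rule that)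
qed

text \<open>A nonzero class has a positive limit \<open>r\<close> of absolute values, so the terms
  eventually exceed \<open>r / 2\<close> in absolute value and their reciprocals form a Cauchy
  sequence.\<close>

lemma field_L: "field L"
proof -
  interpret cring L by (rule cring_L)
  show ?thesis
  proof (rule cring_fieldI2)
    show "\<zero>\<^bsub>L\<^esub> \<noteq> \<one>\<^bsub>L\<^esub>" using labs_emb[of 0] labs_emb[of 1] v_zero v_one by (metis L_zero L_one one_K zero_K zero_neq_one)
    fix \<xi> assume \<xi>: "\<xi> \<in> carrier L" "\<xi> \<noteq> \<zero>\<^bsub>L\<^esub>"
    obtain x where x: "x \<in> Cau" "\<xi> = cls x" using L_cases[OF \<xi>(1)] .
    define r where "r = labs \<xi>"
    have "r > 0" using \<xi> labs_0_iff labs_nonneg by (force simp: r_def)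
    have "\<forall>\<^sub>F n in sequentially. v (x n) > r / 2"
      using order_tendstoD(1)[OF labs_cls[OF x(1)], of "r / 2"] \<open>r > 0\<close> x(2) by (simp add: r_def)
    then obtain M where M: "\<And>n. n \<ge> M \<Longrightarrow> v (x n) > r / 2" by (auto simp: eventually_sequentially)
    have nz: "x n \<noteq> 0" if "n \<ge> M" for n using M[OF that] \<open>r > 0\<close> v_zero by auto
    \<comment> \<open>The terms before \<open>M\<close> may vanish; \<open>inverse 0 = 0\<close>
      keeps the sequence in K, and finitely many terms do not change the class.\<close>
    define y where "y = (\<lambda>n. inverse (x n))"
    have "\<exists>N. \<forall>m\<ge>N. \<forall>n\<ge>N. v (y m - y n) < e" if e: "e > 0" for e
    proof -
      obtain N where N: "\<forall>m\<ge>N. \<forall>n\<ge>N. v (x m - x n) < e * (r / 2 * (r / 2))"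
        using CauD[OF x(1), of "e * (r / 2 * (r / 2))"] e \<open>r > 0\<close> by auto
      have "v (y m - y n) < e" if mn: "m \<ge> max N M" "n \<ge> max N M" for m n
      proof -
        have "(y m - y n) * (x m * x n) = x n - x m" using nz mn by (simp add: y_def field_simps)
        moreover have "v ((y m - y n) * (x m * x n)) = v (y m - y n) * (v (x m) * v (x n))"
          using x by (simp add: y_def v_mult)
        ultimately have eq: "v (y m - y n) * (v (x m) * v (x n)) = v (x n - x m)" by simp
        have low: "r / 2 * (r / 2) \<le> v (x m) * v (x n)"
          using M[of m] M[of n] mn \<open>r > 0\<close> by (intro mult_mono) auto
        have "v (y m - y n) * (r / 2 * (r / 2)) \<le> v (x n - x m)"
          unfolding eq[symmetric] using low x by (intro mult_left_mono v_nonneg) (auto simp: y_def)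
        also have "\<dots> < e * (r / 2 * (r / 2))" using N mn by auto
        finally show ?thesis by (rule mult_right_less_imp_less) (use \<open>r > 0\<close> in auto)
      qed
      thus ?thesis by blast
    qed
    hence y: "y \<in> Cau" using x by (simp add: Cau_iff y_def)
    have "(\<lambda>n. v (x n * y n - 1)) \<longlonglongrightarrow> 0"
    proof (rule tendsto_eventually)
      have "v (x n * y n - 1) = 0" if "n \<ge> M" for n using nz[OF that] v_zero by (simp add: y_def)
      thus "\<forall>\<^sub>F n in sequentially. v (x n * y n - 1) = 0" unfolding eventually_sequentially by blast
    qed
    hence "cls (\<lambda>n. x n * y n) = cls (\<lambda>_. 1)"
      using cls_eq_iff[OF Cau_mult[OF x(1) y] Cau_const[OF one_K]] by blast
    hence "\<xi> \<otimes>\<^bsub>L\<^esub> cls y = \<one>\<^bsub>L\<^esub>"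
      unfolding x(2) L_ops(2)[OF x(1) y] L_one emb_cls .
    thus "\<exists>\<zeta>\<in>carrier L. \<xi> \<otimes>\<^bsub>L\<^esub> \<zeta> = \<one>\<^bsub>L\<^esub>" by (rule bexI[OF _ cls_L[OF y]])
  qed
qed

end

section \<open>Traces of finite field extensions\<close>

context ring
begin

lemma combine_finsum:
  assumes "length Ks = length Us" "set Ks \<subseteq> carrier R" "set Us \<subseteq> carrier R"
  shows "combine Ks Us = (\<Oplus>i\<in>{..<length Us}. Ks ! i \<otimes> Us ! i)"
  using assms
proof (induction Us arbitrary: Ks rule: rev_induct)
  case (snoc x Us)
  obtain k Ks' where K: "Ks = Ks' @ [k]" using snoc.prems(1) by (cases Ks rule: rev_cases) auto
  have len: "length Ks' = length Us" using snoc.prems(1) K by simp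
  have mem: "i < length Us \<Longrightarrow> Ks' ! i \<in> carrier R \<and> Us ! i \<in> carrier R" for i
    using snoc.prems K len by (auto simp: subset_iff)
  have kx: "k \<in> carrier R" "x \<in> carrier R" using snoc.prems K by auto
  have "combine Ks (Us @ [x]) = combine Ks' Us \<oplus> combine [k] [x]"
    unfolding K using snoc.prems K len by (intro combine_append[symmetric]) auto
  also have "combine Ks' Us = (\<Oplus>i\<in>{..<length Us}. Ks' ! i \<otimes> Us ! i)"
    using snoc.prems K len by (intro snoc.IH) auto
  also have "\<dots> = (\<Oplus>i\<in>{..<length Us}. Ks ! i \<otimes> (Us @ [x]) ! i)"
    using mem len by (intro finsum_cong') (auto simp: K nth_append)
  also have "\<dots> \<oplus> combine [k] [x] = (\<Oplus>i\<in>{..<length (Us @ [x])}. Ks ! i \<otimes> (Us @ [x]) ! i)"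
    using mem len kx by (subst a_comm) (auto simp: K lessThan_Suc nth_append intro!: finsum_closed)
  finally show ?case .
qed simp

end

locale field_basis = R?: field R for R (structure) +
  fixes F :: "'a set" and bs :: "'a list"
  assumes F: "subfield F R" and indep: "independent F bs" and span: "Span F bs = carrier R"
begin

abbreviation N :: nat where "N \<equiv> length bs"

definition coord :: "nat \<Rightarrow> 'a \<Rightarrow> 'a" where
  "coord i x = (THE Ks. set Ks \<subseteq> F \<and> length Ks = N \<and> x = combine Ks bs) ! i"

lemma F_carrier: "k \<in> F \<Longrightarrow> k \<in> carrier R"
  using subfieldE(3)[OF F] by blast

lemma bs_carrier: "i < N \<Longrightarrow> bs ! i \<in> carrier R"
  using independent_in_carrier[OF indep] by auto

lemma coord_props:
  assumes "x \<in> carrier R"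
  shows "\<And>i. i < N \<Longrightarrow> coord i x \<in> F" "x = (\<Oplus>i\<in>{..<N}. coord i x \<otimes> bs ! i)"
proof -
  define Ks where "Ks = (THE Ks. set Ks \<subseteq> F \<and> length Ks = N \<and> x = combine Ks bs)"
  have "\<exists>!Ks. set Ks \<subseteq> F \<and> length Ks = N \<and> x = combine Ks bs"
    using unique_decomposition[OF F indep] assms span by blast
  from theI'[OF this] have Ks: "set Ks \<subseteq> F" "length Ks = N" "x = combine Ks bs"
    unfolding Ks_def[symmetric] by blast+
  have c: "coord i x = Ks ! i" for i by (simp add: coord_def Ks_def)
  show "coord i x \<in> F" if "i < N" for i using Ks that c by (auto simp: subset_iff)
  have "set Ks \<subseteq> carrier R" using Ks(1) F_carrier by blast
  from combine_finsum[OF Ks(2) this independent_in_carrier[OF indep]] Ks(3) c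
  show "x = (\<Oplus>i\<in>{..<N}. coord i x \<otimes> bs ! i)" by simp
qed

lemma coord_carrier: "x \<in> carrier R \<Longrightarrow> i < N \<Longrightarrow> coord i x \<in> carrier R"
  using coord_props(1) F_carrier by blast

lemma coord_eqI:
  assumes k: "\<And>i. i < N \<Longrightarrow> k i \<in> F" and x: "x = (\<Oplus>i\<in>{..<N}. k i \<otimes> bs ! i)" and i: "i < N"
  shows "coord i x = k i"
proof -
  have kc: "\<And>i. i < N \<Longrightarrow> k i \<in> carrier R" using k F_carrier by blast
  have xc: "x \<in> carrier R" unfolding x using kc bs_carrier by (intro finsum_closed) auto
  define Ks where "Ks = map k [0..<N]"
  define Cs where "Cs = map (\<lambda>i. coord i x) [0..<N]"
  have Ks: "set Ks \<subseteq> F" "length Ks = N" using k by (auto simp: Ks_def)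
  have Cs: "set Cs \<subseteq> F" "length Cs = N" using coord_props(1)[OF xc] by (auto simp: Cs_def)
  have bsc: "set bs \<subseteq> carrier R" by (rule independent_in_carrier[OF indep])
  have "combine Ks bs = (\<Oplus>i\<in>{..<N}. Ks ! i \<otimes> bs ! i)"
    using Ks F_carrier bsc by (intro combine_finsum) auto
  also have "\<dots> = x" unfolding x using kc bs_carrier by (intro finsum_cong') (auto simp: Ks_def)
  finally have 1: "x = combine Ks bs" by simp
  have "combine Cs bs = (\<Oplus>i\<in>{..<N}. Cs ! i \<otimes> bs ! i)"
    using Cs F_carrier bsc by (intro combine_finsum) auto
  also have "\<dots> = (\<Oplus>i\<in>{..<N}. coord i x \<otimes> bs ! i)"
    using coord_carrier[OF xc] bs_carrier by (intro finsum_cong') (auto simp: Cs_def)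
  also have "\<dots> = x" using coord_props(2)[OF xc] by simp
  finally have 2: "x = combine Cs bs" by simp
  have "\<exists>!Ks. set Ks \<subseteq> F \<and> length Ks = N \<and> x = combine Ks bs"
    using unique_decomposition[OF F indep] xc span by blast
  hence "Ks = Cs" using 1 2 Ks Cs by blast
  from arg_cong[OF this, of "\<lambda>xs. xs ! i"] show ?thesis using i by (simp add: Ks_def Cs_def)
qed

lemma F_ops: "a \<in> F \<Longrightarrow> b \<in> F \<Longrightarrow> a \<oplus> b \<in> F" "a \<in> F \<Longrightarrow> b \<in> F \<Longrightarrow> a \<otimes> b \<in> F" "\<zero> \<in> F"
  using subringE(2,6,7)[OF subfieldE(1)[OF F]] by blast+

lemma F_finsum: "(\<And>i. i \<in> I \<Longrightarrow> f i \<in> F) \<Longrightarrow> finsum R f I \<in> F"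
proof (induction I rule: infinite_finite_induct)
  case (insert i I)
  hence "finsum R f (insert i I) = f i \<oplus> finsum R f I"
    using F_carrier by (intro finsum_insert) auto
  thus ?case using insert F_ops by simp
qed (auto simp: F_ops finsum_infinite)

lemma coord_add: "x \<in> carrier R \<Longrightarrow> y \<in> carrier R \<Longrightarrow> i < N \<Longrightarrow> coord i (x \<oplus> y) = coord i x \<oplus> coord i y"
proof (rule coord_eqI[where k = "\<lambda>i. coord i x \<oplus> coord i y"])
  assume xy: "x \<in> carrier R" "y \<in> carrier R"
  show "coord i x \<oplus> coord i y \<in> F" if "i < N" for i using coord_props(1) xy that F_ops by blast
  have "x \<oplus> y = (\<Oplus>i\<in>{..<N}. coord i x \<otimes> bs ! i) \<oplus> (\<Oplus>i\<in>{..<N}. coord i y \<otimes> bs ! i)"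
    using coord_props(2) xy by simp
  also have "\<dots> = (\<Oplus>i\<in>{..<N}. coord i x \<otimes> bs ! i \<oplus> coord i y \<otimes> bs ! i)"
    using coord_carrier bs_carrier xy by (intro finsum_addf[symmetric]) auto
  also have "\<dots> = (\<Oplus>i\<in>{..<N}. (coord i x \<oplus> coord i y) \<otimes> bs ! i)"
    using coord_carrier bs_carrier xy by (intro finsum_cong') (auto simp: l_distr)
  finally show "x \<oplus> y = (\<Oplus>i\<in>{..<N}. (coord i x \<oplus> coord i y) \<otimes> bs ! i)" .
qed

lemma coord_smult: "a \<in> F \<Longrightarrow> x \<in> carrier R \<Longrightarrow> i < N \<Longrightarrow> coord i (a \<otimes> x) = a \<otimes> coord i x"
proof (rule coord_eqI[where k = "\<lambda>i. a \<otimes> coord i x"])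
  assume ax: "a \<in> F" "x \<in> carrier R"
  show "a \<otimes> coord i x \<in> F" if "i < N" for i using coord_props(1) ax that F_ops by blast
  have "a \<otimes> x = a \<otimes> (\<Oplus>i\<in>{..<N}. coord i x \<otimes> bs ! i)" using coord_props(2) ax by simp
  also have "\<dots> = (\<Oplus>i\<in>{..<N}. a \<otimes> (coord i x \<otimes> bs ! i))"
    using coord_carrier bs_carrier ax F_carrier by (intro finsum_rdistr) auto
  also have "\<dots> = (\<Oplus>i\<in>{..<N}. (a \<otimes> coord i x) \<otimes> bs ! i)"
    using coord_carrier bs_carrier ax F_carrier by (intro finsum_cong') (auto simp: m_assoc)
  finally show "a \<otimes> x = (\<Oplus>i\<in>{..<N}. (a \<otimes> coord i x) \<otimes> bs ! i)" .
qed

lemma coord_zero: "i < N \<Longrightarrow> coord i \<zero> = \<zero>"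
  using coord_smult[of \<zero> \<zero> i] F_ops(3) coord_carrier[of \<zero> i] by simp

lemma coord_finsum:
  assumes "finite I" "\<And>j. j \<in> I \<Longrightarrow> f j \<in> carrier R" "i < N"
  shows "coord i (finsum R f I) = (\<Oplus>j\<in>I. coord i (f j))"
  using assms(1,2)
proof (induction I rule: finite_induct)
  case empty
  show ?case using coord_zero assms(3) by simp
next
  case (insert j I)
  have "coord i (finsum R f (insert j I)) = coord i (f j \<oplus> finsum R f I)"
    using insert by (subst finsum_insert) auto
  also have "\<dots> = coord i (f j) \<oplus> coord i (finsum R f I)"
    using insert assms(3) by (intro coord_add finsum_closed) auto
  also have "\<dots> = (\<Oplus>j\<in>insert j I. coord i (f j))"
    using insert assms(3) coord_carrier by (subst finsum_insert) auto
  finally show ?case .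
qed

lemma coord_lin:
  assumes "finite I" "\<And>j. j \<in> I \<Longrightarrow> a j \<in> F" "\<And>j. j \<in> I \<Longrightarrow> x j \<in> carrier R" "i < N"
  shows "coord i (\<Oplus>j\<in>I. a j \<otimes> x j) = (\<Oplus>j\<in>I. a j \<otimes> coord i (x j))"
proof -
  have "coord i (\<Oplus>j\<in>I. a j \<otimes> x j) = (\<Oplus>j\<in>I. coord i (a j \<otimes> x j))"
    using assms F_carrier by (intro coord_finsum) auto
  also have "\<dots> = (\<Oplus>j\<in>I. a j \<otimes> coord i (x j))"
    using assms F_carrier coord_carrier coord_smult by (intro finsum_cong') auto
  finally show ?thesis .
qed

definition tr :: "'a \<Rightarrow> 'a" where "tr x = (\<Oplus>i\<in>{..<N}. coord i (x \<otimes> bs ! i))"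

lemma tr_F: "x \<in> carrier R \<Longrightarrow> tr x \<in> F"
  unfolding tr_def using coord_props(1) bs_carrier by (intro F_finsum) auto

lemma tr_add: "x \<in> carrier R \<Longrightarrow> y \<in> carrier R \<Longrightarrow> tr (x \<oplus> y) = tr x \<oplus> tr y"
proof -
  assume xy: "x \<in> carrier R" "y \<in> carrier R"
  have "tr (x \<oplus> y) = (\<Oplus>i\<in>{..<N}. coord i (x \<otimes> bs ! i) \<oplus> coord i (y \<otimes> bs ! i))"
    unfolding tr_def using xy bs_carrier coord_carrier by (intro finsum_cong') (auto simp: l_distr coord_add)
  also have "\<dots> = tr x \<oplus> tr y"
    unfolding tr_def using xy bs_carrier coord_carrier by (intro finsum_addf) auto
  finally show ?thesis .
qed

end

lemma (in cring) finsum_swap: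
  assumes "finite I" "finite J" "\<And>i j. i \<in> I \<Longrightarrow> j \<in> J \<Longrightarrow> f i j \<in> carrier R"
  shows "(\<Oplus>i\<in>I. \<Oplus>j\<in>J. f i j) = (\<Oplus>j\<in>J. \<Oplus>i\<in>I. f i j)"
  using assms(1,3)
proof (induction I rule: finite_induct)
  case empty
  show ?case by (simp add: finsum_zero)
next
  case (insert i I)
  have "(\<Oplus>i\<in>insert i I. \<Oplus>j\<in>J. f i j) = (\<Oplus>j\<in>J. f i j) \<oplus> (\<Oplus>j\<in>J. \<Oplus>i\<in>I. f i j)"
    using insert by (subst finsum_insert) (auto intro!: finsum_closed)
  also have "\<dots> = (\<Oplus>j\<in>J. f i j \<oplus> (\<Oplus>i\<in>I. f i j))"
    using insert by (intro finsum_addf[symmetric]) (auto intro!: finsum_closed)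
  also have "\<dots> = (\<Oplus>j\<in>J. \<Oplus>i\<in>insert i I. f i j)"
    using insert by (intro finsum_cong') (auto intro!: finsum_closed)
  finally show ?case .
qed

text \<open>When each basis is expanded in the other, both traces become the same double sum, taken
  in the two orders.\<close>

lemma tr_basis_independent:
  assumes "field_basis R F bs" "field_basis R F cs" "x \<in> carrier R"
  shows "field_basis.tr R F bs x = field_basis.tr R F cs x"
proof -
  interpret B: field_basis R F bs by fact
  interpret C: field_basis R F cs by fact
  note x = assms(3)
  have 1: "B.coord i (x \<otimes>\<^bsub>R\<^esub> bs ! i) = (\<Oplus>\<^bsub>R\<^esub>j\<in>{..<C.N}. C.coord j (bs ! i) \<otimes>\<^bsub>R\<^esub> B.coord i (x \<otimes>\<^bsub>R\<^esub> cs ! j))"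
    if i: "i < B.N" for i
  proof -
    have "x \<otimes>\<^bsub>R\<^esub> bs ! i = x \<otimes>\<^bsub>R\<^esub> (\<Oplus>\<^bsub>R\<^esub>j\<in>{..<C.N}. C.coord j (bs ! i) \<otimes>\<^bsub>R\<^esub> cs ! j)"
      using C.coord_props(2)[OF B.bs_carrier[OF i]] by simp
    also have "\<dots> = (\<Oplus>\<^bsub>R\<^esub>j\<in>{..<C.N}. x \<otimes>\<^bsub>R\<^esub> (C.coord j (bs ! i) \<otimes>\<^bsub>R\<^esub> cs ! j))"
      using x i B.bs_carrier C.bs_carrier C.coord_carrier by (intro B.finsum_rdistr) auto
    also have "\<dots> = (\<Oplus>\<^bsub>R\<^esub>j\<in>{..<C.N}. C.coord j (bs ! i) \<otimes>\<^bsub>R\<^esub> (x \<otimes>\<^bsub>R\<^esub> cs ! j))"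
      using x i B.bs_carrier C.bs_carrier C.coord_carrier by (intro B.finsum_cong') (auto simp: B.m_lcomm)
    finally have "x \<otimes>\<^bsub>R\<^esub> bs ! i = \<dots>" .
    moreover have "B.coord i \<dots> = (\<Oplus>\<^bsub>R\<^esub>j\<in>{..<C.N}. C.coord j (bs ! i) \<otimes>\<^bsub>R\<^esub> B.coord i (x \<otimes>\<^bsub>R\<^esub> cs ! j))"
      using x i B.bs_carrier C.bs_carrier C.coord_props(1) by (intro B.coord_lin) auto
    ultimately show ?thesis by simp
  qed
  have 2: "(\<Oplus>\<^bsub>R\<^esub>i\<in>{..<B.N}. C.coord j (bs ! i) \<otimes>\<^bsub>R\<^esub> B.coord i (x \<otimes>\<^bsub>R\<^esub> cs ! j)) = C.coord j (x \<otimes>\<^bsub>R\<^esub> cs ! j)"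
    if j: "j < C.N" for j
  proof -
    have xc: "x \<otimes>\<^bsub>R\<^esub> cs ! j \<in> carrier R" using x C.bs_carrier[OF j] by simp
    have "C.coord j (x \<otimes>\<^bsub>R\<^esub> cs ! j) = C.coord j (\<Oplus>\<^bsub>R\<^esub>i\<in>{..<B.N}. B.coord i (x \<otimes>\<^bsub>R\<^esub> cs ! j) \<otimes>\<^bsub>R\<^esub> bs ! i)"
      using B.coord_props(2)[OF xc] by simp
    also have "\<dots> = (\<Oplus>\<^bsub>R\<^esub>i\<in>{..<B.N}. B.coord i (x \<otimes>\<^bsub>R\<^esub> cs ! j) \<otimes>\<^bsub>R\<^esub> C.coord j (bs ! i))"
      using B.coord_props(1)[OF xc] B.bs_carrier j by (intro C.coord_lin) auto
    also have "\<dots> = (\<Oplus>\<^bsub>R\<^esub>i\<in>{..<B.N}. C.coord j (bs ! i) \<otimes>\<^bsub>R\<^esub> B.coord i (x \<otimes>\<^bsub>R\<^esub> cs ! j))"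
      using B.coord_carrier[OF xc] C.coord_carrier B.bs_carrier j by (intro B.finsum_cong') (auto simp: B.m_comm)
    finally show ?thesis by simp
  qed
  have mem: "C.coord j (bs ! i) \<otimes>\<^bsub>R\<^esub> B.coord i (x \<otimes>\<^bsub>R\<^esub> cs ! j) \<in> carrier R" if "i < B.N" "j < C.N" for i j
    using that x B.bs_carrier C.bs_carrier B.coord_carrier C.coord_carrier by simp
  have "B.tr x = (\<Oplus>\<^bsub>R\<^esub>i\<in>{..<B.N}. \<Oplus>\<^bsub>R\<^esub>j\<in>{..<C.N}. C.coord j (bs ! i) \<otimes>\<^bsub>R\<^esub> B.coord i (x \<otimes>\<^bsub>R\<^esub> cs ! j))"
    unfolding B.tr_def using 1 mem by (intro B.finsum_cong') (auto intro!: B.finsum_closed)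
  also have "\<dots> = (\<Oplus>\<^bsub>R\<^esub>j\<in>{..<C.N}. \<Oplus>\<^bsub>R\<^esub>i\<in>{..<B.N}. C.coord j (bs ! i) \<otimes>\<^bsub>R\<^esub> B.coord i (x \<otimes>\<^bsub>R\<^esub> cs ! j))"
    using mem by (intro B.finsum_swap) auto
  also have "\<dots> = C.tr x"
    unfolding C.tr_def using 2 x C.bs_carrier C.coord_carrier by (intro B.finsum_cong') auto
  finally show ?thesis .
qed

lemma ext_trace_eq:
  assumes "field_basis R F bs" "x \<in> carrier R"
  shows "ext_trace R F x = field_basis.tr R F bs x"
proof -
  interpret B: field_basis R F bs by fact
  note x = assms(2)
  have fb: "field_basis R F cs \<longleftrightarrow> B.independent F cs \<and> B.Span F cs = carrier R" for cs
    using B.F by (auto simp: field_basis_def field_basis_axioms_def B.field_axioms)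
  have tr_M: "(\<Oplus>\<^bsub>R\<^esub>i\<in>{..<length cs}. M i i) = field_basis.tr R F cs x"
    if cs: "field_basis R F cs" and M: "\<forall>i<length cs. \<forall>j<length cs. M i j \<in> F"
      and eq: "\<forall>j<length cs. x \<otimes>\<^bsub>R\<^esub> cs ! j = B.combine (map (\<lambda>i. M i j) [0..<length cs]) cs" for cs M
  proof -
    interpret C: field_basis R F cs by fact
    have "C.coord j (x \<otimes>\<^bsub>R\<^esub> cs ! j) = M j j" if j: "j < C.N" for j
    proof (rule C.coord_eqI[where k = "\<lambda>i. M i j", OF _ _ j])
      show "M i j \<in> F" if "i < C.N" for i using M that j by blast
      have "x \<otimes>\<^bsub>R\<^esub> cs ! j = (\<Oplus>\<^bsub>R\<^esub>i\<in>{..<C.N}. map (\<lambda>i. M i j) [0..<C.N] ! i \<otimes>\<^bsub>R\<^esub> cs ! i)"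
        unfolding eq[rule_format, OF j] using M j C.F_carrier B.independent_in_carrier[OF C.indep]
        by (intro B.combine_finsum) auto
      also have "\<dots> = (\<Oplus>\<^bsub>R\<^esub>i\<in>{..<C.N}. M i j \<otimes>\<^bsub>R\<^esub> cs ! i)"
        using M j C.F_carrier C.bs_carrier by (intro B.finsum_cong') auto
      finally show "x \<otimes>\<^bsub>R\<^esub> cs ! j = (\<Oplus>\<^bsub>R\<^esub>i\<in>{..<C.N}. M i j \<otimes>\<^bsub>R\<^esub> cs ! i)" .
    qed
    thus ?thesis unfolding C.tr_def using M C.F_carrier by (intro B.finsum_cong') auto
  qed
  define M where "M i j = B.coord i (x \<otimes>\<^bsub>R\<^esub> bs ! j)" for i j
  have MF: "M i j \<in> F" if "i < B.N" "j < B.N" for i j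
    unfolding M_def using that x B.bs_carrier by (intro B.coord_props) auto
  have Meq: "x \<otimes>\<^bsub>R\<^esub> bs ! j = B.combine (map (\<lambda>i. M i j) [0..<B.N]) bs" if j: "j < B.N" for j
  proof -
    have xb: "x \<otimes>\<^bsub>R\<^esub> bs ! j \<in> carrier R" using x B.bs_carrier[OF j] by simp
    have "B.combine (map (\<lambda>i. M i j) [0..<B.N]) bs = (\<Oplus>\<^bsub>R\<^esub>i\<in>{..<B.N}. map (\<lambda>i. M i j) [0..<B.N] ! i \<otimes>\<^bsub>R\<^esub> bs ! i)"
      using MF j B.F_carrier B.independent_in_carrier[OF B.indep] by (intro B.combine_finsum) auto
    also have "\<dots> = (\<Oplus>\<^bsub>R\<^esub>i\<in>{..<B.N}. M i j \<otimes>\<^bsub>R\<^esub> bs ! i)"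
      using MF j B.F_carrier B.bs_carrier by (intro B.finsum_cong') auto
    also have "\<dots> = x \<otimes>\<^bsub>R\<^esub> bs ! j" unfolding M_def using B.coord_props(2)[OF xb] by simp
    finally show ?thesis by simp
  qed
  show ?thesis
    unfolding ext_trace_def
  proof (rule the_equality)
    show "\<exists>bs M. set bs \<subseteq> carrier R \<and> B.independent F bs \<and> B.Span F bs = carrier R \<and>
      (\<forall>i<length bs. \<forall>j<length bs. M i j \<in> F) \<and>
      (\<forall>j<length bs. x \<otimes>\<^bsub>R\<^esub> bs ! j = B.combine (map (\<lambda>i. M i j) [0..<length bs]) bs) \<and>
      B.tr x = (\<Oplus>\<^bsub>R\<^esub>i\<in>{..<length bs}. M i i)"
      using B.independent_in_carrier[OF B.indep] B.indep B.span MF Meq tr_M[OF assms(1), of M]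
      by (intro exI[of _ bs] exI[of _ M]) auto
    fix s assume "\<exists>bs M. set bs \<subseteq> carrier R \<and> B.independent F bs \<and> B.Span F bs = carrier R \<and>
      (\<forall>i<length bs. \<forall>j<length bs. M i j \<in> F) \<and>
      (\<forall>j<length bs. x \<otimes>\<^bsub>R\<^esub> bs ! j = B.combine (map (\<lambda>i. M i j) [0..<length bs]) bs) \<and>
      s = (\<Oplus>\<^bsub>R\<^esub>i\<in>{..<length bs}. M i i)"
    then obtain cs M where "field_basis R F cs" "\<forall>i<length cs. \<forall>j<length cs. M i j \<in> F"
      "\<forall>j<length cs. x \<otimes>\<^bsub>R\<^esub> cs ! j = B.combine (map (\<lambda>i. M i j) [0..<length cs]) cs"
      "s = (\<Oplus>\<^bsub>R\<^esub>i\<in>{..<length cs}. M i i)" unfolding fb by blast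
    thus "s = B.tr x" using tr_M[of cs M] tr_basis_independent[OF assms(1) _ x, of cs] by simp
  qed
qed

text \<open>A vector is kept only if the span of the later ones misses it. Selecting from a given
  list matters: the local basis will consist of embedded entries of \<open>u\<close>.\<close>

lemma (in ring) sublist_basis:
  assumes F: "subfield F R" and "set Us \<subseteq> carrier R"
  obtains Vs where "set Vs \<subseteq> set Us" "independent F Vs" "Span F Vs = Span F Us"
proof -
  have "\<exists>Vs. set Vs \<subseteq> set Us \<and> independent F Vs \<and> Span F Vs = Span F Us"
    using assms(2)
  proof (induction Us)
    case Nil
    show ?case by (rule exI[of _ "[]"]) auto
  next
    case (Cons x Us)
    then obtain Vs where Vs: "set Vs \<subseteq> set Us" "independent F Vs" "Span F Vs = Span F Us" by auto
    have Vsc: "set Vs \<subseteq> carrier R" using Vs(1) Cons.prems by auto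
    show ?case
    proof (cases "x \<in> Span F Us")
      case True
      have Usc: "set Us \<subseteq> carrier R" and x: "x \<in> carrier R" using Cons.prems by auto
      have "Span F (x # Us) \<subseteq> Span F Us"
        using True Span_base_incl[OF F Usc] by (intro mono_Span_subset[OF F _ Usc]) auto
      hence "Span F (x # Us) = Span F Us" using mono_Span[OF F Usc x] by blast
      thus ?thesis using Vs by (intro exI[of _ Vs]) auto
    next
      case False
      have "independent F (x # Vs)" using False Vs Cons.prems by (intro li_Cons) auto
      moreover have "Span F (x # Vs) = Span F (x # Us)" using Vs(3) by simp
      ultimately show ?thesis using Vs(1) by (intro exI[of _ "x # Vs"]) auto
    qed
  qed
  thus thesis using that by blast
qed

section \<open>The local traces\<close>

lemma (in prime_place) valued: "valued_field K v"
  by unfold_locales (auto simp: v_mult intro: order_trans[OF v_add_le])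

lemma (in prime_place) v_power_int: "x \<in> K \<Longrightarrow> v (x powi k) = v x powi k"
  by (simp add: power_int_def v_power v_inverse)

section \<open>The p-adic numbers and their copy in a local field\<close>

locale rational_prime =
  fixes p :: nat assumes prime_p: "Factorial_Ring.prime p"
begin

abbreviation Pp :: "complex set" where "Pp \<equiv> PIdl\<^bsub>ring_of_integers \<rat>\<^esub> (of_nat p)"

lemma integers_of_Rats: "integers_of \<rat> = \<int>"
  using rational_algebraic_int_is_int by (auto simp: integers_of_def elim!: Ints_cases)

lemma Oint_Rats: "complex_subfield.Oint \<rat> = \<int>"
  using complex_subfield.Oint_def[OF Rats_complex_subfield] integers_of_Rats by simp

lemma p_pos [simp]: "p > 0" "p \<noteq> 0" "of_nat p \<noteq> (0::complex)"
  using prime_p prime_gt_0_nat by auto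

lemma mem_Pp: "x \<in> Pp \<longleftrightarrow> (\<exists>k::int. x = of_int k * of_nat p)"
  unfolding cgenideal_def complex_subfield.OR_simps[OF Rats_complex_subfield] Oint_Rats
  by (auto elim!: Ints_cases)

lemma of_int_mem_Pp: "of_int k \<in> Pp \<longleftrightarrow> int p dvd k"
proof -
  have "of_int k = of_int m * (of_nat p :: complex) \<longleftrightarrow> k = m * int p" for m
    by (metis of_int_eq_iff of_int_mult of_int_of_nat_eq)
  thus ?thesis unfolding mem_Pp by (auto simp: dvd_def mult.commute)
qed

lemma prime_p_int: "Factorial_Ring.prime (int p)"
  using prime_p by simp

lemma prime_place_Rats: "prime_place \<rat> Pp (1 / of_nat p)"
proof -
  interpret complex_subfield \<rat> by (rule Rats_complex_subfield)
  have O: "x \<in> Oint \<longleftrightarrow> (\<exists>k. x = of_int k)" for x using Oint_Rats by (auto elim!: Ints_cases)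
  interpret OR: cring OR by (rule cring_OR)
  have one: "1 \<notin> Pp" using of_int_mem_Pp[of 1] prime_gt_1_nat[OF prime_p] by simp
  have "ideal Pp OR" by (rule OR.cgenideal_ideal) simp
  hence prime: "primeideal Pp OR"
  proof (rule primeidealI[OF _ cring_OR])
    have "1 \<in> carrier OR" using Oint_of_nat[of 1] by simp
    thus "carrier OR \<noteq> Pp" using one by blast
    fix a b assume "a \<in> carrier OR" "b \<in> carrier OR" and ab: "a \<otimes>\<^bsub>OR\<^esub> b \<in> Pp"
    then obtain i j where ij: "a = of_int i" "b = of_int j" using O by auto
    hence "of_int (i * j) \<in> Pp" using ab by simp
    hence "int p dvd i * j" using of_int_mem_Pp by blast
    thus "a \<in> Pp \<or> b \<in> Pp" unfolding ij of_int_mem_Pp using prime_p_int prime_dvd_mult_iff by blast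
  qed
  show ?thesis
  proof (intro prime_place.intro prime_place_axioms.intro complex_subfield_axioms)
    show "primeideal Pp OR" by (rule prime)
    show "1 / of_nat p \<in> (\<rat> :: complex set)" by simp
    show "1 / of_nat p * x \<in> Oint" if "x \<in> Pp" for x
      using that unfolding mem_Pp by auto
    have "1 / of_nat p * of_nat p \<notin> Pp" "of_nat p \<in> Pp"
      using one of_int_mem_Pp[of "int p"] by simp_all
    thus "\<exists>q\<in>Pp. 1 / of_nat p * q \<notin> Pp" by blast
    show "\<exists>b\<in>Oint. 1 - a * b \<in> Pp" if a: "a \<in> Oint" "a \<notin> Pp" for a
    proof -
      obtain i where i: "a = of_int i" using a(1) O by blast
      hence "\<not> int p dvd i" using a(2) of_int_mem_Pp by simp
      hence "coprime (int p) i" by (rule prime_imp_coprime[OF prime_p_int])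
      then obtain x y where "x * int p + y * i = 1" by (metis bezout_int coprime_imp_gcd_eq_1)
      hence "1 - i * y = x * int p" by (simp add: algebra_simps)
      hence "of_int (1 - i * y) \<in> Pp" unfolding of_int_mem_Pp by simp
      thus ?thesis unfolding i by (intro bexI[of _ "of_int y"]) auto
    qed
    show "\<exists>m>0. of_nat m * x \<in> Oint" if "x \<in> \<rat>" for x
    proof -
      obtain r where "x = of_rat r" using \<open>x \<in> \<rat>\<close> by (auto elim: Rats_cases)
      moreover obtain a b where "r = Rat.Fract a b" "b > 0" by (cases r)
      ultimately show ?thesis
        by (intro exI[of _ "nat b"]) (auto simp: of_rat_rat)
    qed
    fix a assume a: "a \<in> Oint" "a \<noteq> 0"
    then obtain i where i: "a = of_int i" "i \<noteq> 0" using O by auto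
    \<comment> \<open>A nonzero integer divisible by \<open>p ^ k\<close> has absolute value at
      least \<open>p ^ k\<close>, so for this \<open>k\<close> the quotient is not integral.\<close>
    obtain k where k: "\<bar>i\<bar> < int p ^ k"
      using real_arch_pow[of "real p" "real_of_int \<bar>i\<bar>"] prime_gt_1_nat[OF prime_p]
      by (metis of_int_less_iff of_int_of_nat_eq of_int_power of_nat_1 of_nat_less_iff)
    have "(1 / of_nat p) ^ k * a \<notin> Oint"
    proof
      assume "(1 / of_nat p) ^ k * a \<in> Oint"
      then obtain j where j: "(1 / of_nat p) ^ k * a = of_int j" using O by blast
      have "a = of_nat p ^ k * ((1 / of_nat p) ^ k * a)" by (simp add: field_simps)
      hence "(of_int i :: complex) = of_int (int p ^ k * j)" unfolding j using i by simp
      hence ij: "i = int p ^ k * j" using of_int_eq_iff by blast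
      hence "\<bar>j\<bar> \<ge> 1" using i by auto
      hence "int p ^ k * 1 \<le> int p ^ k * \<bar>j\<bar>" by (intro mult_left_mono) auto
      thus False using ij k by (simp add: abs_mult)
    qed
    thus "\<exists>k. (1 / of_nat p) ^ k * a \<notin> Oint" by blast
  qed
qed

sublocale Q: prime_place \<rat> Pp "1 / of_nat p" by (rule prime_place_Rats)

lemma Qp_abs_eq: "Qp_abs p = padic_abs \<rat> Pp" by (simp add: Qp_abs_def)

sublocale Qv: valued_field \<rat> "Qp_abs p" unfolding Qp_abs_eq by (rule Q.valued)

lemma rational_form:
  assumes "q \<in> \<rat>" "q \<noteq> 0"
  obtains i j :: int and k :: int
  where "q = of_nat p powi k * of_int i / of_int j" "\<not> int p dvd i" "\<not> int p dvd j" "Qp_abs p q = 2 powi (- k)"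
proof -
  obtain s r where sr: "q * (1 / of_nat p) powi Q.val q = s / r" "s \<in> Q.Oint - Pp" "r \<in> Q.Oint - Pp"
    using Q.val_UP[OF assms] unfolding Q.UP_def by blast
  obtain i j where ij: "s = of_int i" "r = of_int j" using sr by (auto simp: Oint_Rats elim!: Ints_cases)
  have "q = of_nat p powi Q.val q * (q * (1 / of_nat p) powi Q.val q)"
    by (simp add: power_int_divide_distrib)
  hence "q = of_nat p powi Q.val q * of_int i / of_int j" unfolding sr(1) ij by simp
  thus thesis using sr ij assms(2) of_int_mem_Pp
    by (intro that[of "Q.val q" i j]) (auto simp: Qp_abs_eq padic_abs_def)
qed

lemma p_integral_form:
  assumes "Qp_abs p (of_int c / of_nat p ^ k) \<le> 1"
  shows "int p ^ k dvd c"
proof -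
  have "of_int c / of_nat p ^ k \<in> Q.OP"
    using assms Q.v_le_1_iff[of "of_int c / of_nat p ^ k"] unfolding Qp_abs_eq by simp
  then obtain s r where sr: "of_int c / of_nat p ^ k = s / r" "s \<in> Q.Oint" "r \<in> Q.Oint - Pp"
    unfolding Q.OP_def by blast
  then obtain i j where ij: "s = of_int i" "r = of_int j" by (auto simp: Oint_Rats elim!: Ints_cases)
  have j: "\<not> int p dvd j" using sr(3) ij of_int_mem_Pp by blast
  hence "j \<noteq> 0" by auto
  hence "of_int (c * j) = (of_int (i * int p ^ k) :: complex)" using sr(1) ij by (simp add: field_simps)
  hence "c * j = i * int p ^ k" using of_int_eq_iff by blast
  hence "int p ^ k dvd c * j" by simp
  moreover have "coprime (int p ^ k) j" using j prime_imp_coprime[OF prime_p_int] by simp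
  ultimately show ?thesis using coprime_dvd_mult_left_iff by blast
qed

end

locale local_place = integer_matrix A n l u + V: prime_place "simple_ext l" P t + rational_prime p
  for A n l u P t p +
  assumes P_Pl: "P \<in> Pl" and p_P: "of_nat p \<in> P"
begin

abbreviation (input) v :: "complex \<Rightarrow> real" where "v \<equiv> padic_abs (simple_ext l) P"

sublocale W: valued_field "simple_ext l" "padic_abs (simple_ext l) P" by (rule V.valued)

abbreviation local_add (infixl "+\<^sub>L" 65) where "a +\<^sub>L b \<equiv> a \<oplus>\<^bsub>W.L\<^esub> b"
abbreviation local_diff (infixl "-\<^sub>L" 65) where "a -\<^sub>L b \<equiv> a \<ominus>\<^bsub>W.L\<^esub> b"
abbreviation local_mult (infixl "*\<^sub>L" 70) where "a *\<^sub>L b \<equiv> a \<otimes>\<^bsub>W.L\<^esub> b"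

lemma of_int_notP: "\<not> int p dvd i \<Longrightarrow> of_int i \<notin> P"
proof
  assume i: "\<not> int p dvd i" "of_int i \<in> P"
  hence "coprime (int p) i" using prime_imp_coprime[OF prime_p_int] by blast
  then obtain x y where "x * int p + y * i = 1" by (metis bezout_int coprime_imp_gcd_eq_1)
  hence "of_int (x * int p + y * i) = (1 :: complex)" by simp
  hence "of_int x * of_nat p + of_int y * of_int i = (1 :: complex)" by simp
  moreover have "of_int x * of_nat p + of_int y * of_int i \<in> P"
    using i p_P by (intro V.P_add V.P_mult Oint_of_int)
  ultimately show False using V.P_1 by simp
qed

text \<open>The ramification index of \<open>P\<close> over \<open>p\<close>, kept as a real
  exponent: on rational numbers \<open>v\<close> is the e-th power of
  \<open>Qp_abs p\<close>.\<close>

definition e :: real where "e = - log 2 (v (of_nat p))"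

lemma e_ge_1: "e \<ge> 1"
proof -
  have "log 2 (v (of_nat p)) \<le> log 2 (1 / 2)" using V.v_P_le[OF p_P] by (subst log_le_cancel_iff) auto
  also have "\<dots> = - 1" by (simp add: log_divide)
  finally show ?thesis unfolding e_def by simp
qed

lemma v_p: "v (of_nat p) = 2 powr (- e)" unfolding e_def by simp

text \<open>Integers prime to \<open>p\<close> lie outside \<open>P\<close> and are units there, so
  only the power of \<open>p\<close> in \<open>q\<close> contributes to \<open>v q\<close>.\<close>

lemma v_rat: "q \<in> \<rat> \<Longrightarrow> v q = Qp_abs p q powr e"
proof (cases "q = 0")
  case True
  thus ?thesis by (simp add: Qp_abs_eq)
next
  case False
  assume q: "q \<in> \<rat>"
  obtain i j k where k: "q = of_nat p powi k * of_int i / of_int j" "\<not> int p dvd i" "\<not> int p dvd j"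
    "Qp_abs p q = 2 powi (- k)" using rational_form[OF q False] .
  have nz: "j \<noteq> 0" using k by auto
  have "v q = v (of_nat p) powi k * v (of_int i) * inverse (v (of_int j))"
    unfolding k(1) divide_inverse
    by (subst V.v_mult V.v_power_int V.v_inverse, simp_all add: of_nat_K of_int_K power_int_K inverse_K mult_K)+
  also have "\<dots> = v (of_nat p) powi k"
    using k of_int_notP by (simp add: V.v_notP)
  also have "\<dots> = (2 powr (- e)) powr real_of_int k" unfolding v_p by (subst powr_real_of_int') auto
  also have "\<dots> = (2 powr real_of_int (- k)) powr e" unfolding powr_powr by (simp add: mult.commute)
  also have "\<dots> = Qp_abs p q powr e" unfolding k(4) by (subst powr_real_of_int'[of 2]) auto
  finally show ?thesis .
qed

text \<open>The bounds \<open>d\<close> and \<open>d powr e\<close> range over the same positive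
  reals, so the two absolute values have the same Cauchy sequences of rationals.\<close>

lemma Cau_Rats: "q \<in> Qv.Cau \<longleftrightarrow> (\<forall>m. q m \<in> \<rat>) \<and> q \<in> W.Cau"
proof -
  have "(\<forall>d>0. \<exists>N. \<forall>i\<ge>N. \<forall>j\<ge>N. Qp_abs p (q i - q j) < d) \<longleftrightarrow>
        (\<forall>d>0. \<exists>N. \<forall>i\<ge>N. \<forall>j\<ge>N. v (q i - q j) < d)" if q: "\<And>m. q m \<in> \<rat>"
  proof -
    have eq: "v (q i - q j) < d powr e \<longleftrightarrow> Qp_abs p (q i - q j) < d" if "d > 0" for i j d
      using q that e_ge_1 powr_less_mono2[of e "Qp_abs p (q i - q j)" d] powr_mono2[of e d "Qp_abs p (q i - q j)"]
        Qv.v_nonneg[of "q i - q j"]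
      by (auto simp: v_rat not_less[symmetric])
    have "(\<forall>d>0. Pr (d powr e)) \<longleftrightarrow> (\<forall>d::real>0. Pr d)" for Pr :: "real \<Rightarrow> bool"
    proof (safe)
      fix d :: real assume "\<forall>d>0. Pr (d powr e)" "d > 0"
      thus "Pr d" using e_ge_1 by (auto simp: powr_powr dest!: spec[of _ "d powr (1 / e)"])
    qed auto
    from this[of "\<lambda>d. \<exists>N. \<forall>i\<ge>N. \<forall>j\<ge>N. v (q i - q j) < d"] show ?thesis by (simp add: eq cong: imp_cong)
  qed
  thus ?thesis unfolding Qv.Cau_iff W.Cau_iff using Rats_subset_K by blast
qed

lemma tendsto_0_Rats:
  assumes "\<And>m. q m \<in> \<rat>"
  shows "(\<lambda>m. v (q m)) \<longlonglongrightarrow> 0 \<longleftrightarrow> (\<lambda>m. Qp_abs p (q m)) \<longlonglongrightarrow> 0"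
proof
  assume "(\<lambda>m. Qp_abs p (q m)) \<longlonglongrightarrow> 0"
  hence "(\<lambda>m. Qp_abs p (q m) powr e) \<longlonglongrightarrow> 0"
    using e_ge_1 Qv.v_nonneg assms by (intro tendsto_zero_powrI[where b = e]) (auto intro: always_eventually)
  thus "(\<lambda>m. v (q m)) \<longlonglongrightarrow> 0" using assms by (simp add: v_rat)
next
  assume "(\<lambda>m. v (q m)) \<longlonglongrightarrow> 0"
  hence "(\<lambda>m. v (q m) powr (1 / e)) \<longlonglongrightarrow> 0"
    using e_ge_1 by (intro tendsto_zero_powrI[where b = "1 / e"]) auto
  thus "(\<lambda>m. Qp_abs p (q m)) \<longlonglongrightarrow> 0"
    using assms e_ge_1 Qv.v_nonneg by (simp add: v_rat powr_powr)
qed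

lemma labs_Rats:
  assumes "q \<in> Qv.Cau" shows "W.labs (W.cls q) = Qv.labs (Qv.cls q) powr e"
proof -
  have q: "\<And>m. q m \<in> \<rat>" "q \<in> W.Cau" using assms Cau_Rats by blast+
  have "(\<lambda>m. Qp_abs p (q m) powr e) \<longlonglongrightarrow> Qv.labs (Qv.cls q) powr e"
    using e_ge_1 Qv.v_nonneg q by (intro tendsto_powr' Qv.labs_cls assms tendsto_const) auto
  hence "(\<lambda>m. v (q m)) \<longlonglongrightarrow> Qv.labs (Qv.cls q) powr e" using q by (simp add: v_rat)
  thus ?thesis using W.labs_cls[OF q(2)] LIMSEQ_unique by blast
qed

abbreviation \<iota> :: "(nat \<Rightarrow> complex) set \<Rightarrow> (nat \<Rightarrow> complex) set" where
  "\<iota> \<equiv> Qp_to_completion (simple_ext l) (padic_abs (simple_ext l) P)"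

text \<open>Adding the null sequences of K enlarges a class of rational sequences to its class in
  the bigger completion, because null sequences of rationals are the same for both absolute
  values.\<close>

lemma iota_cls: assumes "q \<in> Qv.Cau" shows "\<iota> (Qv.cls q) = W.cls q"
proof -
  have q: "\<And>m. q m \<in> \<rat>" "q \<in> W.Cau" using assms Cau_Rats by blast+
  have eq: "\<iota> (Qv.cls q) = {\<lambda>m. x m + z m | x z. x \<in> Qv.cls q \<and> z \<in> W.Null}"
    unfolding Qp_to_completion_def set_add_def set_mult_def W.Null_def[symmetric] by (auto simp: W.CR_simps)
  show ?thesis
  proof (intro subset_antisym subsetI)
    fix y assume "y \<in> \<iota> (Qv.cls q)"
    then obtain x z where xz: "y = (\<lambda>m. x m + z m)" "x \<in> Qv.Cau" "(\<lambda>m. Qp_abs p (x m - q m)) \<longlonglongrightarrow> 0" "z \<in> W.Null"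
      unfolding eq using Qv.mem_cls_iff[OF assms] by blast
    have x: "\<And>m. x m \<in> \<rat>" "x \<in> W.Cau" using xz(2) Cau_Rats by blast+
    have z: "z \<in> W.Cau" "(\<lambda>m. v (z m)) \<longlonglongrightarrow> 0" using xz(4) W.Null_iff by blast+
    have "(\<lambda>m. v (x m - q m)) \<longlonglongrightarrow> 0" using xz(3) x q by (subst tendsto_0_Rats) auto
    hence "(\<lambda>m. x m - q m) \<in> W.Null" unfolding W.Null_iff using W.Cau_diff[OF x(2) q(2)] by blast
    from W.Null_add[OF this xz(4)] have "(\<lambda>m. v (y m - q m)) \<longlonglongrightarrow> 0"
      unfolding W.Null_iff xz(1) by (simp add: algebra_simps)
    thus "y \<in> W.cls q" unfolding W.mem_cls_iff[OF q(2)] xz(1) using W.Cau_add[OF x(2) z(1)] by blast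
  next
    fix y assume "y \<in> W.cls q"
    hence y: "y \<in> W.Cau" "(\<lambda>m. v (y m - q m)) \<longlonglongrightarrow> 0" using W.mem_cls_iff[OF q(2)] by blast+
    have "(\<lambda>m. y m - q m) \<in> W.Null" unfolding W.Null_iff using W.Cau_diff[OF y(1) q(2)] y by blast
    moreover have "q \<in> Qv.cls q" by (rule Qv.cls_self[OF assms])
    ultimately show "y \<in> \<iota> (Qv.cls q)" unfolding eq
      by (intro CollectI exI[of _ q] exI[of _ "\<lambda>m. y m - q m"]) auto
  qed
qed

definition F :: "(nat \<Rightarrow> complex) set set" where "F = \<iota> ` carrier (Qp p)"

lemma Qp_carrier: "carrier (Qp p) = Qv.cls ` Qv.Cau"
  unfolding Qp_def by (rule Qv.carrier_L)

lemma F_iff: "f \<in> F \<longleftrightarrow> (\<exists>q\<in>Qv.Cau. f = W.cls q)"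
  unfolding F_def Qp_carrier image_image by (simp add: iota_cls image_iff)

lemma iota_hom: "\<iota> \<in> Ring.ring_hom (Qp p) W.L"
proof (rule ring_hom_memI)
  fix x assume "x \<in> carrier (Qp p)"
  then obtain q where q: "q \<in> Qv.Cau" "x = Qv.cls q" unfolding Qp_carrier by blast
  thus "\<iota> x \<in> carrier W.L" using Cau_Rats by (auto simp: iota_cls)
  fix y assume "y \<in> carrier (Qp p)"
  then obtain r where r: "r \<in> Qv.Cau" "y = Qv.cls r" unfolding Qp_carrier by blast
  have W: "q \<in> W.Cau" "r \<in> W.Cau" using q r Cau_Rats by blast+
  show "\<iota> (x \<otimes>\<^bsub>Qp p\<^esub> y) = \<iota> x *\<^sub>L \<iota> y" "\<iota> (x \<oplus>\<^bsub>Qp p\<^esub> y) = \<iota> x +\<^sub>L \<iota> y"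
    using q r W Qv.Cau_mult Qv.Cau_add by (simp_all add: Qp_def Qv.L_ops W.L_ops iota_cls)
next
  show "\<iota> \<one>\<^bsub>Qp p\<^esub> = \<one>\<^bsub>W.L\<^esub>"
    unfolding Qp_def Qv.L_one W.L_one Qv.emb_cls W.emb_cls using Qv.Cau_const[of 1] by (simp add: iota_cls)
qed

lemma field_Qp: "field (Qp p)" unfolding Qp_def by (rule Qv.field_L)

lemma F_subfield: "subfield F W.L" and iota_inj: "inj_on \<iota> (carrier (Qp p))"
proof -
  interpret Qf: field "Qp p" by (rule field_Qp)
  interpret L: field W.L by (rule W.field_L)
  interpret h: ring_hom_ring "Qp p" W.L \<iota>
    by (rule ring_hom_ringI2[OF Qf.ring_axioms L.ring_axioms iota_hom])
  show "subfield F W.L" "inj_on \<iota> (carrier (Qp p))" unfolding F_def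
    using h.img_is_subfield[OF Qf.carrier_is_subfield L.one_not_zero] by blast+
qed

end

section \<open>Conjugates of the dual bases\<close>

context integer_matrix
begin

text \<open>Applying \<open>\<tau>\<close> to the expansion of \<open>x\<close> in \<open>u\<close>
  gives a relation between the embeddings whose coefficients are the differences of the two sides.
  Independence makes them vanish.\<close>

lemma emb_dual:
  assumes "\<sigma> \<in> Emb" "\<tau> \<in> Emb"
  shows "(\<Sum>j<n. \<sigma> (w j) * \<tau> (u $ j)) = (if \<sigma> = \<tau> then 1 else 0)"
proof -
  define z where "z \<sigma> = (\<Sum>j<n. \<sigma> (w j) * \<tau> (u $ j)) - (if \<sigma> = \<tau> then 1 else 0)" for \<sigma> :: "complex \<Rightarrow> complex"
  have "(\<Sum>\<sigma>\<in>Emb. z \<sigma> * \<sigma> x) = 0" if x: "x \<in> K" for x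
  proof -
    have TrK: "j < n \<Longrightarrow> Tr (x * w j) \<in> K \<and> \<tau> (Tr (x * w j)) = Tr (x * w j)" for j
      using Tr_rational[of "x * w j"] x emb_of_rat[OF assms(2)] of_rat_K by (auto simp: mult_K elim!: Rats_cases)
    have "(\<Sum>\<sigma>\<in>Emb. z \<sigma> * \<sigma> x)
        = (\<Sum>\<sigma>\<in>Emb. \<Sum>j<n. \<sigma> (x * w j) * \<tau> (u $ j)) - (\<Sum>\<sigma>\<in>Emb. if \<sigma> = \<tau> then \<sigma> x else 0)"
      unfolding z_def sum_subtractf[symmetric] using x
      by (intro sum.cong refl) (auto simp: emb_simps algebra_simps sum_distrib_left)
    also have "(\<Sum>\<sigma>\<in>Emb. \<Sum>j<n. \<sigma> (x * w j) * \<tau> (u $ j)) = (\<Sum>j<n. Tr (x * w j) * \<tau> (u $ j))"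
      by (subst sum.swap) (simp add: Tr_def sum_distrib_right)
    also have "\<dots> = (\<Sum>j<n. \<tau> (Tr (x * w j) * u $ j))"
      using TrK assms(2) by (intro sum.cong refl) (simp add: emb_simps)
    also have "\<dots> = \<tau> (\<Sum>j<n. Tr (x * w j) * u $ j)"
      using TrK by (intro emb_sum[OF assms(2), symmetric]) (simp add: simp_implies_def)
    also have "\<dots> = \<tau> x" using u_expansion[OF x] by simp
    finally show ?thesis using assms(2) by simp
  qed
  from emb_independent[OF this assms(1)] show ?thesis unfolding z_def by simp
qed

text \<open>The global trace as the trace of a matrix: the summands are the diagonal coordinates of
  multiplication by \<open>x\<close>. In this form it can be compared with the local trace.\<close>

lemma Tr_dual: assumes "x \<in> K" shows "Tr x = (\<Sum>j<n. Tr (x * w j * u $ j))"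
proof -
  have "(\<Sum>j<n. Tr (x * w j * u $ j)) = (\<Sum>\<sigma>\<in>Emb. \<Sum>j<n. \<sigma> (x * w j * u $ j))"
    unfolding Tr_def by (rule sum.swap)
  also have "\<dots> = (\<Sum>\<sigma>\<in>Emb. \<sigma> x * (\<Sum>j<n. \<sigma> (w j) * \<sigma> (u $ j)))"
    using assms by (intro sum.cong refl) (simp add: emb_simps sum_distrib_left mult.assoc)
  also have "\<dots> = Tr x" unfolding Tr_def by (simp add: emb_dual)
  finally show ?thesis by simp
qed

end

lemma (in valued_field) cls_finsum:
  assumes "finite I" "\<And>i. i \<in> I \<Longrightarrow> f i \<in> Cau"
  shows "(\<lambda>m. \<Sum>i\<in>I. f i m) \<in> Cau \<and> (\<Oplus>\<^bsub>L\<^esub>i\<in>I. cls (f i)) = cls (\<lambda>m. \<Sum>i\<in>I. f i m)"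
proof -
  interpret Lf: field L by (rule field_L)
  show ?thesis using assms
  proof (induction I rule: finite_induct)
    case empty
    show ?case using Cau_const[of 0] by (simp add: L_zero emb_cls)
  next
    case (insert i I)
    hence "(\<lambda>m. \<Sum>i\<in>I. f i m) \<in> Cau" "f i \<in> Cau" by auto
    moreover have "(\<Oplus>\<^bsub>L\<^esub>i\<in>insert i I. cls (f i)) = cls (f i) \<oplus>\<^bsub>L\<^esub> (\<Oplus>\<^bsub>L\<^esub>i\<in>I. cls (f i))"
      using insert by (intro Lf.finsum_insert) auto
    ultimately show ?case using insert by (simp add: Cau_add L_ops)
  qed
qed

lemma (in valued_field) emb_finsum:
  assumes "finite I" "\<And>i. i \<in> I \<Longrightarrow> f i \<in> K"
  shows "emb (\<Sum>i\<in>I. f i) = (\<Oplus>\<^bsub>L\<^esub>i\<in>I. emb (f i))"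
  using cls_finsum[of I "\<lambda>i _. f i"] assms Cau_const by (simp add: emb_cls)

section \<open>The local field as a finite extension of the p-adic numbers\<close>

context local_place
begin

sublocale L: field W.L by (rule W.field_L)

lemma v_sum_le:
  assumes "\<And>i. i \<in> I \<Longrightarrow> f i \<in> K" "\<And>i. i \<in> I \<Longrightarrow> v (f i) \<le> r" "r \<ge> 0"
  shows "v (\<Sum>i\<in>I. f i) \<le> r"
  using assms(1,2)
proof (induction I rule: infinite_finite_induct)
  case (insert i I)
  have "v (f i + (\<Sum>i\<in>I. f i)) \<le> r"
    using insert by (intro order_trans[OF V.v_add_le] max.boundedI sum_K) auto
  thus ?case using insert by simp
qed (use assms(3) in auto)

lemma labs_ultra:
  assumes "\<xi> \<in> carrier W.L" "\<zeta> \<in> carrier W.L" "W.labs \<xi> \<le> r" "W.labs \<zeta> \<le> r"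
  shows "W.labs (\<xi> +\<^sub>L \<zeta>) \<le> r"
proof -
  obtain x y where xy: "x \<in> W.Cau" "\<xi> = W.cls x" "y \<in> W.Cau" "\<zeta> = W.cls y"
    using assms(1,2) W.L_cases by metis
  have "(\<lambda>m. max (v (x m)) (v (y m))) \<longlonglongrightarrow> max (W.labs \<xi>) (W.labs \<zeta>)"
    unfolding xy by (intro tendsto_max W.labs_cls xy)
  moreover have "(\<lambda>m. v (x m + y m)) \<longlonglongrightarrow> W.labs (\<xi> +\<^sub>L \<zeta>)"
    unfolding xy W.L_ops[OF xy(1,3)] by (intro W.labs_cls W.Cau_add xy)
  moreover have "v (x m + y m) \<le> max (v (x m)) (v (y m))" for m using xy by (intro V.v_add_le) auto
  ultimately have "W.labs (\<xi> +\<^sub>L \<zeta>) \<le> max (W.labs \<xi>) (W.labs \<zeta>)" by (intro LIMSEQ_le) auto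
  thus ?thesis using assms by linarith
qed

lemma labs_diff_ultra:
  assumes "\<xi> \<in> carrier W.L" "\<zeta> \<in> carrier W.L" "W.labs \<xi> \<le> r" "W.labs \<zeta> \<le> r"
  shows "W.labs (\<xi> -\<^sub>L \<zeta>) \<le> r"
  unfolding L.minus_eq using assms W.labs_uminus by (intro labs_ultra) auto

lemma labs_finsum_le:
  assumes "\<And>i. i \<in> I \<Longrightarrow> f i \<in> carrier W.L" "\<And>i. i \<in> I \<Longrightarrow> W.labs (f i) \<le> r" "r \<ge> 0"
  shows "W.labs (\<Oplus>\<^bsub>W.L\<^esub>i\<in>I. f i) \<le> r"
  using assms(1,2)
proof (induction I rule: infinite_finite_induct)
  case (insert i I)
  have "W.labs (f i +\<^sub>L (\<Oplus>\<^bsub>W.L\<^esub>i\<in>I. f i)) \<le> r" using insert by (intro labs_ultra L.finsum_closed) auto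
  thus ?case using insert by (subst L.finsum_insert) auto
qed (use assms(3) in \<open>auto simp: L.finsum_infinite W.L_zero zero_K\<close>)

lemma v_p_less_1: "v (of_nat p) < 1" and v_p_pos: "v (of_nat p) > 0"
  using V.v_P_le[OF p_P] by auto

lemma power_below: "\<epsilon> > 0 \<Longrightarrow> \<exists>k. v (of_nat p) ^ k \<le> \<epsilon>" "\<epsilon> > 0 \<Longrightarrow> \<exists>k. (1 / 2 :: real) ^ k \<le> \<epsilon>"
  using real_arch_pow_inv[OF _ v_p_less_1, of \<epsilon>] real_arch_pow_inv[of \<epsilon> "1 / 2"] by (auto intro: less_imp_le)

lemma labs_scale:
  assumes "\<xi> \<in> carrier W.L" shows "\<exists>k. W.labs (W.emb (of_nat p ^ k) *\<^sub>L \<xi>) \<le> 1"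
proof -
  obtain k where "v (of_nat p) ^ k \<le> 1 / (W.labs \<xi> + 1)"
    using power_below(1)[of "1 / (W.labs \<xi> + 1)"] W.labs_nonneg[OF assms] by auto
  hence "v (of_nat p) ^ k * W.labs \<xi> \<le> 1 / (W.labs \<xi> + 1) * W.labs \<xi>"
    using W.labs_nonneg[OF assms] by (intro mult_right_mono) auto
  also have "\<dots> \<le> 1" using W.labs_nonneg[OF assms] by (simp add: field_simps)
  finally show ?thesis using assms by (intro exI[of _ k]) (simp add: W.labs_mult V.v_power)
qed

text \<open>Nonzero absolute values on K are integral powers of 2, so a value below 2 is at most 1.
  A bound on the limit is therefore inherited by the late terms without loss.\<close>

lemma eventually_v_le_1:
  assumes "x \<in> W.Cau" "W.labs (W.cls x) \<le> 1" shows "\<forall>\<^sub>F m in sequentially. v (x m) \<le> 1"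
proof -
  have "v y \<le> 1" if y: "y \<in> K" "v y < 2" for y
  proof (cases "y = 0")
    case False
    obtain k :: int where k: "v y = 2 powi (- k)" using V.v_discrete[OF y(1) False] .
    hence "\<not> 2 powi 1 \<le> (2 :: real) powi (- k)" using y by simp
    hence "- k \<le> 0" unfolding two_powi_le_iff by simp
    hence "2 powi (- k) \<le> (2 :: real) powi 0" unfolding two_powi_le_iff .
    thus ?thesis unfolding k by simp
  qed simp
  moreover have "\<forall>\<^sub>F m in sequentially. v (x m) < 2"
    using W.labs_cls[OF assms(1)] assms(2) by (intro order_tendstoD(2)) auto
  ultimately show ?thesis using assms(1) by (auto elim: eventually_mono)
qed

text \<open>
  Successive approximation: the expansion of a \<open>\<pp>\<close>-integral element in the generators \<open>u\<close>
  is corrected modulo increasing powers of \<open>p\<close>.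
\<close>

lemma unit_ball_span:
  obtains d :: nat where "d > 0" "\<And>\<xi>. \<xi> \<in> carrier W.L \<Longrightarrow> W.labs \<xi> \<le> 1 \<Longrightarrow>
    \<exists>c. (\<forall>j<n. c j \<in> F \<and> W.labs (c j) \<le> 1) \<and>
        W.emb (of_nat d) *\<^sub>L \<xi> = (\<Oplus>\<^bsub>W.L\<^esub>j\<in>{..<n}. c j *\<^sub>L W.emb (u $ j))"
proof -
  obtain d :: nat where d: "d > 0" "\<And>x. x \<in> Oint \<Longrightarrow> \<exists>c. of_nat d * x = (\<Sum>j<n. of_int (c j) * u $ j)"
    by (rule Oint_lattice) blast
  define q where "q = v (of_nat p)"
  have q: "0 < q" "q < 1" unfolding q_def using v_p_less_1 v_p_pos by blast+
  have dv: "v (of_nat d) > 0" using d(1) by simp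
  have "\<exists>c. (\<forall>j<n. c j \<in> F \<and> W.labs (c j) \<le> 1) \<and>
        W.emb (of_nat d) *\<^sub>L \<xi> = (\<Oplus>\<^bsub>W.L\<^esub>j\<in>{..<n}. c j *\<^sub>L W.emb (u $ j))"
    if xi: "\<xi> \<in> carrier W.L" "W.labs \<xi> \<le> 1" for \<xi>
  proof -
    obtain x where x: "x \<in> W.Cau" "\<xi> = W.cls x" using xi(1) by (rule W.L_cases)
    \<comment> \<open>The division by \<open>d\<close> reflects that \<open>d\<close> times an
      integer of K, and not the integer itself, is known to lie in the lattice of the
      \<open>u $ j\<close>.\<close>
    define S where "S c = (\<Sum>j<n. of_int (c j) * u $ j) / of_nat d" for c :: "nat \<Rightarrow> int"
    have SK: "S c \<in> K" for c unfolding S_def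
      by (intro divide_K sum_K mult_K of_int_K of_nat_K) auto
    have "\<exists>c. \<forall>k. (\<forall>\<^sub>F m in sequentially. v (x m - S (c k)) \<le> q ^ k) \<and> (\<forall>j. int p ^ k dvd c (Suc k) j - c k j)"
    proof (rule dependent_nat_choice)
      show "\<exists>c. \<forall>\<^sub>F m in sequentially. v (x m - S c) \<le> q ^ 0"
        using eventually_v_le_1[OF x(1)] xi x by (intro exI[of _ "\<lambda>_. 0"]) (simp add: S_def)
      fix c k assume c: "\<forall>\<^sub>F m in sequentially. v (x m - S c) \<le> q ^ k"
      obtain M0 where M0: "\<And>i j. i \<ge> M0 \<Longrightarrow> j \<ge> M0 \<Longrightarrow> v (x i - x j) < q ^ Suc k"
        using W.CauD[OF x(1), of "q ^ Suc k"] q by auto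
      obtain M1 where M1: "\<And>m. m \<ge> M1 \<Longrightarrow> v (x m - S c) \<le> q ^ k"
        using c unfolding eventually_sequentially by blast
      define M where "M = max M0 M1"
      have xK: "x m \<in> K" for m using x(1) by simp
      \<comment> \<open>The remainder is locally divisible by \<open>p ^ k\<close>. Its quotient is
        approximated by a global integer \<open>z\<close> with error at most \<open>q\<close>, and
        the lattice coordinates of \<open>d * z\<close> are the corrections of the
        coefficients.\<close>
      have "v ((x M - S c) / of_nat p ^ k) = v (x M - S c) / q ^ k"
        using xK SK by (simp add: q_def divide_inverse V.v_mult V.v_inverse V.v_power)
      also have "\<dots> \<le> 1" using M1[of M] q by (simp add: M_def)
      finally have le1: "v ((x M - S c) / of_nat p ^ k) \<le> 1" .
      have qK: "(x M - S c) / of_nat p ^ k \<in> K" using xK SK by (intro divide_K diff_K power_K of_nat_K)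
      obtain N where N: "(1 / 2) ^ N \<le> q" using power_below(2)[OF q(1)] by blast
      obtain z where z: "z \<in> Oint" "v ((x M - S c) / of_nat p ^ k - z) \<le> (1 / 2) ^ N"
        using V.Oint_dense[OF qK le1] .
      obtain a where a: "of_nat d * z = (\<Sum>j<n. of_int (a j) * u $ j)" using d(2)[OF z(1)] by blast
      define c' where "c' j = c j + int p ^ k * a j" for j
      have "S c' = S c + of_nat p ^ k * (\<Sum>j<n. of_int (a j) * u $ j) / of_nat d"
        unfolding S_def c'_def by (simp add: ring_distribs sum.distrib sum_distrib_left add_divide_distrib mult.assoc)
      hence S': "S c' = S c + of_nat p ^ k * z" unfolding a[symmetric] using d(1) by simp
      have "x M - S c' = of_nat p ^ k * ((x M - S c) / of_nat p ^ k - z)"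
        unfolding S' by (simp add: field_simps)
      hence "v (x M - S c') = q ^ k * v ((x M - S c) / of_nat p ^ k - z)"
        using diff_K[OF qK Oint_K[OF z(1)]] by (simp add: q_def V.v_mult V.v_power)
      also have "\<dots> \<le> q ^ k * q" using z(2) N q by (intro mult_left_mono) auto
      finally have SM: "v (x M - S c') \<le> q ^ Suc k" by (simp add: mult.commute)
      have "v (x m - S c') \<le> q ^ Suc k" if "m \<ge> M" for m
      proof -
        have "v ((x m - x M) + (x M - S c')) \<le> max (v (x m - x M)) (v (x M - S c'))"
          using xK SK by (intro V.v_add_le diff_K)
        also have "\<dots> \<le> q ^ Suc k" using SM M0[of m M] that by (auto simp: M_def)
        finally show ?thesis by simp
      qed
      thus "\<exists>c'. (\<forall>\<^sub>F m in sequentially. v (x m - S c') \<le> q ^ Suc k) \<and> (\<forall>j. int p ^ k dvd c' j - c j)"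
        unfolding eventually_sequentially by (intro exI[of _ c']) (auto simp: c'_def)
    qed
    then obtain c where c: "\<And>k. \<forall>\<^sub>F m in sequentially. v (x m - S (c k)) \<le> q ^ k"
      "\<And>k j. int p ^ k dvd c (Suc k) j - c k j" by blast
    have dvd: "int p ^ k dvd c m j - c k j" if "m \<ge> k" for m k j
      using that
    proof (induction m rule: dec_induct)
      case (step m)
      have "int p ^ k dvd c (Suc m) j - c m j" by (rule dvd_trans[OF le_imp_power_dvd[OF step(1)] c(2)])
      from dvd_add[OF this step(3)] show ?case by simp
    qed simp
    have vdvd: "v (of_int b) \<le> q ^ k" if "int p ^ k dvd b" for b k
    proof -
      from that obtain a where "b = int p ^ k * a" by (rule dvdE)
      hence "v (of_int b) = q ^ k * v (of_int a)"
        by (simp add: q_def V.v_mult V.v_power)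
      also have "\<dots> \<le> q ^ k * 1" using q by (intro mult_left_mono V.v_Oint_le Oint_of_int) auto
      finally show ?thesis by simp
    qed
    have vc: "v (of_int (c m j) - of_int (c k j)) \<le> q ^ k" if "m \<ge> k" for m k j
      using vdvd[OF dvd[OF that, of j]] by simp
    have small: "\<exists>k. q ^ k < \<epsilon>" if "\<epsilon> > 0" for \<epsilon> using real_arch_pow_inv[OF that q(2)] .
    \<comment> \<open>Later corrections are divisible by growing powers of \<open>p\<close>, so for
      each \<open>j\<close> the integer coefficients form a Cauchy sequence of rationals: an element
      of the copy \<open>F\<close> of the p-adic numbers.\<close>
    define cc where "cc j k = (of_int (c k j) :: complex)" for j k
    have ccW: "cc j \<in> W.Cau" for j
      unfolding W.Cau_iff
    proof (intro conjI allI impI)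
      show "cc j k \<in> K" for k by (simp add: cc_def)
      fix \<epsilon> :: real assume "\<epsilon> > 0"
      then obtain k where k: "q ^ k < \<epsilon>" using small by blast
      have "v (cc j a - cc j b) < \<epsilon>" if "a \<ge> k" "b \<ge> k" for a b
      proof -
        have "v ((cc j a - cc j k) + - (cc j b - cc j k)) \<le> max (v (cc j a - cc j k)) (v (- (cc j b - cc j k)))"
          unfolding cc_def by (intro V.v_add_le uminus_K diff_K of_int_K)
        also have "\<dots> \<le> q ^ k" using vc[OF that(1)] vc[OF that(2)] V.v_minus unfolding cc_def
          by (simp add: W.v_commute)
        finally show ?thesis using k by simp
      qed
      thus "\<exists>N. \<forall>a\<ge>N. \<forall>b\<ge>N. v (cc j a - cc j b) < \<epsilon>" by blast
    qed
    have ccQ: "cc j \<in> Qv.Cau" for j unfolding Cau_Rats using ccW by (auto simp: cc_def)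
    have "W.cls (cc j) \<in> F \<and> W.labs (W.cls (cc j)) \<le> 1" for j
      unfolding F_iff using ccQ V.v_Oint_le[OF Oint_of_int]
      by (auto intro!: LIMSEQ_le_const2[OF W.labs_cls[OF ccW]] simp: cc_def)
    moreover have "W.emb (of_nat d) *\<^sub>L \<xi> = (\<Oplus>\<^bsub>W.L\<^esub>j\<in>{..<n}. W.cls (cc j) *\<^sub>L W.emb (u $ j))"
    proof -
      have uC: "j < n \<Longrightarrow> (\<lambda>m. cc j m * u $ j) \<in> W.Cau" for j
        by (intro W.Cau_mult ccW W.Cau_const u_K)
      have "(\<Oplus>\<^bsub>W.L\<^esub>j\<in>{..<n}. W.cls (cc j) *\<^sub>L W.emb (u $ j)) = (\<Oplus>\<^bsub>W.L\<^esub>j\<in>{..<n}. W.cls (\<lambda>m. cc j m * u $ j))"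
        unfolding W.emb_cls using uC ccW W.Cau_const by (intro L.finsum_cong') (auto simp: W.L_ops)
      also have "\<dots> = W.cls (\<lambda>m. \<Sum>j<n. cc j m * u $ j)"
        using uC by (intro conjunct2[OF W.cls_finsum]) auto
      finally have rhs: "(\<Oplus>\<^bsub>W.L\<^esub>j\<in>{..<n}. W.cls (cc j) *\<^sub>L W.emb (u $ j)) = W.cls (\<lambda>m. \<Sum>j<n. cc j m * u $ j)" .
      have rC: "(\<lambda>m. \<Sum>j<n. cc j m * u $ j) \<in> W.Cau"
        using uC by (intro conjunct1[OF W.cls_finsum]) auto
      have lC: "(\<lambda>m. of_nat d * x m) \<in> W.Cau" using x(1) W.Cau_mult[OF W.Cau_const[of "of_nat d"]] of_nat_K by simp
      have lhs: "W.emb (of_nat d) *\<^sub>L \<xi> = W.cls (\<lambda>m. of_nat d * x m)"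
        unfolding x W.emb_cls using x(1) W.Cau_const[of "of_nat d"] of_nat_K by (simp add: W.L_ops)
      have "(\<lambda>m. v (of_nat d * x m - (\<Sum>j<n. cc j m * u $ j))) \<longlonglongrightarrow> 0"
      proof (rule LIMSEQ_I)
        fix r :: real assume "r > 0"
        then obtain k where k: "q ^ k < r" using small by blast
        obtain M where M: "\<And>m. m \<ge> M \<Longrightarrow> v (x m - S (c k)) \<le> q ^ k"
          using c(1)[of k] unfolding eventually_sequentially by blast
        have "v (of_nat d * x m - (\<Sum>j<n. cc j m * u $ j)) < r" if m: "m \<ge> max M k" for m
        proof -
          have "of_nat d * x m - (\<Sum>j<n. cc j m * u $ j)
              = of_nat d * (x m - S (c k)) + (\<Sum>j<n. (of_int (c k j) - of_int (c m j)) * u $ j)"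
            unfolding S_def cc_def using d(1)
            by (simp add: right_diff_distrib left_diff_distrib sum_subtractf)
          moreover have "v (of_nat d * (x m - S (c k))) \<le> 1 * q ^ k"
            using M[of m] m x(1) SK mult_mono[OF V.v_Oint_le[OF Oint_of_nat, of d], of "v (x m - S (c k))" "q ^ k"]
            by (subst V.v_mult) auto
          moreover have "v (\<Sum>j<n. (of_int (c k j) - of_int (c m j)) * u $ j) \<le> q ^ k"
          proof (rule v_sum_le)
            fix j assume j: "j \<in> {..<n}"
            thus "(of_int (c k j) - of_int (c m j)) * u $ j \<in> K" by (intro mult_K diff_K of_int_K) auto
            have "v ((of_int (c k j) - of_int (c m j)) * u $ j) \<le> q ^ k * 1"
              using m j q mult_mono[OF _ V.v_Oint_le[OF u_O, of j], of "v (of_int (c k j) - of_int (c m j))" "q ^ k"] vc[of k m j]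
              by (subst V.v_mult) (auto simp: W.v_commute)
            thus "v ((of_int (c k j) - of_int (c m j)) * u $ j) \<le> q ^ k" by simp
          qed (use q in simp)
          moreover have "of_nat d * (x m - S (c k)) \<in> K" "(\<Sum>j<n. (of_int (c k j) - of_int (c m j)) * u $ j) \<in> K"
            using x(1) SK by (auto intro!: mult_K diff_K sum_K of_int_K of_nat_K)
          ultimately have "v (of_nat d * x m - (\<Sum>j<n. cc j m * u $ j)) \<le> q ^ k"
            using V.v_add_le[of "of_nat d * (x m - S (c k))" "\<Sum>j<n. (of_int (c k j) - of_int (c m j)) * u $ j"] by simp
          thus ?thesis using k by simp
        qed
        thus "\<exists>no. \<forall>m\<ge>no. norm (v (of_nat d * x m - (\<Sum>j<n. cc j m * u $ j)) - 0) < r"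
          by (intro exI[of _ "max M k"]) auto
      qed
      thus ?thesis unfolding lhs rhs W.cls_eq_iff[OF lC rC] .
    qed
    ultimately show ?thesis by (intro exI[of _ "\<lambda>j. W.cls (cc j)"]) auto
  qed
  thus thesis using d(1) that by blast
qed

end

section \<open>A basis of the local field and continuity of the local trace\<close>

context local_place
begin

lemma emb_Rats_F: "q \<in> \<rat> \<Longrightarrow> W.emb q \<in> F"
  unfolding F_iff W.emb_cls using Qv.Cau_const by blast

lemma F_carrier: "f \<in> F \<Longrightarrow> f \<in> carrier W.L"
  using subfieldE(3)[OF F_subfield] by blast

lemma emb_nz: "a \<in> K \<Longrightarrow> a \<noteq> 0 \<Longrightarrow> W.emb a \<noteq> \<zero>\<^bsub>W.L\<^esub>"
  using W.labs_emb[of a] W.labs_0_iff[of "W.emb a"] by force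

text \<open>Scaling by a power of \<open>p\<close> moves any element into the unit ball, so
  \<open>unit_ball_span\<close> makes the embedded \<open>u $ j\<close> a generating list. A basis
  inside this list consists of images of global integers.\<close>

lemma basis_exists: "\<exists>bs. field_basis W.L F bs \<and> set bs \<subseteq> (\<lambda>j. W.emb (u $ j)) ` {..<n}"
proof -
  define Us where "Us = map (\<lambda>j. W.emb (u $ j)) [0..<n]"
  have Us: "set Us \<subseteq> carrier W.L" unfolding Us_def by auto
  obtain d :: nat where d: "d > 0" "\<And>\<xi>. \<xi> \<in> carrier W.L \<Longrightarrow> W.labs \<xi> \<le> 1 \<Longrightarrow>
    \<exists>c. (\<forall>j<n. c j \<in> F \<and> W.labs (c j) \<le> 1) \<and>
        W.emb (of_nat d) *\<^sub>L \<xi> = (\<Oplus>\<^bsub>W.L\<^esub>j\<in>{..<n}. c j *\<^sub>L W.emb (u $ j))"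
    by (rule unit_ball_span) blast
  have "\<xi> \<in> L.Span F Us" if xi: "\<xi> \<in> carrier W.L" for \<xi>
  proof -
    obtain k where k: "W.labs (W.emb (of_nat p ^ k) *\<^sub>L \<xi>) \<le> 1" using labs_scale[OF xi] by blast
    have pk: "W.emb (of_nat p ^ k) \<in> carrier W.L" by simp
    obtain c where c: "\<And>j. j < n \<Longrightarrow> c j \<in> F" "W.emb (of_nat d) *\<^sub>L (W.emb (of_nat p ^ k) *\<^sub>L \<xi>)
        = (\<Oplus>\<^bsub>W.L\<^esub>j\<in>{..<n}. c j *\<^sub>L W.emb (u $ j))"
      using d(2)[OF _ k] pk xi by blast
    define Ks where "Ks = map c [0..<n]"
    have Ks: "set Ks \<subseteq> F" unfolding Ks_def using c(1) by auto
    have "L.combine Ks Us = (\<Oplus>\<^bsub>W.L\<^esub>i\<in>{..<length Us}. Ks ! i *\<^sub>L Us ! i)"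
      using Ks Us F_carrier by (intro L.combine_finsum) (auto simp: Ks_def Us_def)
    also have "\<dots> = (\<Oplus>\<^bsub>W.L\<^esub>j\<in>{..<n}. c j *\<^sub>L W.emb (u $ j))"
      using c(1) F_carrier by (intro L.finsum_cong') (auto simp: Ks_def Us_def)
    also have "\<dots> = W.emb (of_nat d * of_nat p ^ k) *\<^sub>L \<xi>"
      unfolding c(2)[symmetric] using xi pk by (simp add: W.emb_mult L.m_assoc)
    finally have "W.emb (of_nat d * of_nat p ^ k) *\<^sub>L \<xi> \<in> L.Span F Us"
      using Ks unfolding L.Span_eq_combine_set[OF F_subfield Us] by blast
    moreover have "W.emb (of_nat d * of_nat p ^ k) \<noteq> \<zero>\<^bsub>W.L\<^esub>"
      using d(1) by (intro emb_nz mult_K power_K of_nat_K) auto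
    ultimately show ?thesis
      using L.Span_m_inv_simprule[OF F_subfield Us _ xi, of "W.emb (of_nat d * of_nat p ^ k)"]
      by (simp add: emb_Rats_F)
  qed
  hence span: "L.Span F Us = carrier W.L" using L.Span_in_carrier[OF subfieldE(3)[OF F_subfield] Us] by blast
  obtain bs where bs: "set bs \<subseteq> set Us" "L.independent F bs" "L.Span F bs = L.Span F Us"
    using L.sublist_basis[OF F_subfield Us] .
  have "field_basis W.L F bs"
    using bs span F_subfield by (intro field_basis.intro field_basis_axioms.intro L.field_axioms) auto
  thus ?thesis using bs(1) by (intro exI[of _ bs]) (simp add: Us_def lessThan_atLeast0)
qed

definition bs :: "(nat \<Rightarrow> complex) set list" where
  "bs = (SOME bs. field_basis W.L F bs \<and> set bs \<subseteq> (\<lambda>j. W.emb (u $ j)) ` {..<n})"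

sublocale B: field_basis W.L F bs
  unfolding bs_def using someI_ex[OF basis_exists] by blast

lemma bs_u: "i < B.N \<Longrightarrow> \<exists>j<n. bs ! i = W.emb (u $ j)"
  using someI_ex[OF basis_exists] nth_mem[of i bs] unfolding bs_def[symmetric] by blast

definition J :: "nat \<Rightarrow> nat" where "J i = (SOME j. j < n \<and> bs ! i = W.emb (u $ j))"

lemma J: "i < B.N \<Longrightarrow> J i < n" "i < B.N \<Longrightarrow> bs ! i = W.emb (u $ J i)"
  using someI_ex[OF bs_u] unfolding J_def by blast+

text \<open>By \<open>unit_ball_span\<close>, \<open>d\<close> times the unit ball consists of
  combinations of the \<open>u $ j\<close> with p-integral coefficients, so the coordinates of these
  finitely many generators bound all others.\<close>

lemma coord_bounded: "\<exists>C. \<forall>i<B.N. \<forall>\<xi>\<in>carrier W.L. W.labs \<xi> \<le> 1 \<longrightarrow> W.labs (B.coord i \<xi>) \<le> C"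
proof -
  obtain d :: nat where d: "d > 0" "\<And>\<xi>. \<xi> \<in> carrier W.L \<Longrightarrow> W.labs \<xi> \<le> 1 \<Longrightarrow>
    \<exists>c. (\<forall>j<n. c j \<in> F \<and> W.labs (c j) \<le> 1) \<and>
        W.emb (of_nat d) *\<^sub>L \<xi> = (\<Oplus>\<^bsub>W.L\<^esub>j\<in>{..<n}. c j *\<^sub>L W.emb (u $ j))"
    by (rule unit_ball_span) blast
  define C where "C = (\<Sum>i<B.N. \<Sum>j<n. W.labs (B.coord i (W.emb (u $ j))))"
  have dv: "v (of_nat d) > 0" using d(1) by simp
  have pos: "W.labs (B.coord i (W.emb (u $ j))) \<ge> 0" if "i < B.N" "j < n" for i j
    using that B.coord_carrier by (intro W.labs_nonneg) auto
  have C: "W.labs (B.coord i (W.emb (u $ j))) \<le> C" if ij: "i < B.N" "j < n" for i j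
  proof -
    have "W.labs (B.coord i (W.emb (u $ j))) \<le> (\<Sum>j<n. W.labs (B.coord i (W.emb (u $ j))))"
      using ij pos by (intro member_le_sum) auto
    also have "\<dots> \<le> C" unfolding C_def
      using ij pos by (intro member_le_sum[of i _ "\<lambda>i. \<Sum>j<n. W.labs (B.coord i (W.emb (u $ j)))"] sum_nonneg) auto
    finally show ?thesis .
  qed
  have C0: "C \<ge> 0" unfolding C_def using pos by (intro sum_nonneg) auto
  have "W.labs (B.coord i \<xi>) \<le> C / v (of_nat d)" if i: "i < B.N" and xi: "\<xi> \<in> carrier W.L" "W.labs \<xi> \<le> 1" for i \<xi>
  proof -
    obtain c where c: "\<And>j. j < n \<Longrightarrow> c j \<in> F" "\<And>j. j < n \<Longrightarrow> W.labs (c j) \<le> 1"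
      "W.emb (of_nat d) *\<^sub>L \<xi> = (\<Oplus>\<^bsub>W.L\<^esub>j\<in>{..<n}. c j *\<^sub>L W.emb (u $ j))"
      using d(2)[OF xi] by blast
    have cx: "B.coord i \<xi> \<in> carrier W.L" by (rule B.coord_carrier[OF xi(1) i])
    have "W.emb (of_nat d) *\<^sub>L B.coord i \<xi> = B.coord i (W.emb (of_nat d) *\<^sub>L \<xi>)"
      using xi i emb_Rats_F by (intro B.coord_smult[symmetric]) auto
    also have "\<dots> = (\<Oplus>\<^bsub>W.L\<^esub>j\<in>{..<n}. c j *\<^sub>L B.coord i (W.emb (u $ j)))"
      unfolding c(3) using c i by (intro B.coord_lin) auto
    also have "W.labs \<dots> \<le> C"
    proof (rule labs_finsum_le)
      fix j assume j: "j \<in> {..<n}"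
      hence cc: "c j \<in> carrier W.L" "B.coord i (W.emb (u $ j)) \<in> carrier W.L"
        using c(1) F_carrier B.coord_carrier i by auto
      thus "c j *\<^sub>L B.coord i (W.emb (u $ j)) \<in> carrier W.L" by simp
      have "W.labs (c j *\<^sub>L B.coord i (W.emb (u $ j))) \<le> 1 * C"
        unfolding W.labs_mult[OF cc] using c(2) C i j pos by (intro mult_mono) auto
      thus "W.labs (c j *\<^sub>L B.coord i (W.emb (u $ j))) \<le> C" by simp
    qed (rule C0)
    finally have "v (of_nat d) * W.labs (B.coord i \<xi>) \<le> C"
      using cx by (simp add: W.labs_mult)
    thus ?thesis using dv by (simp add: field_simps)
  qed
  thus ?thesis by blast
qed

lemma tr_smult:
  assumes "a \<in> F" "\<xi> \<in> carrier W.L"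
  shows "B.tr (a *\<^sub>L \<xi>) = a *\<^sub>L B.tr \<xi>"
proof -
  have a: "a \<in> carrier W.L" using assms F_carrier by blast
  have x: "\<xi> *\<^sub>L bs ! i \<in> carrier W.L" if "i < B.N" for i using assms B.bs_carrier that by simp
  have "B.tr (a *\<^sub>L \<xi>) = (\<Oplus>\<^bsub>W.L\<^esub>i\<in>{..<B.N}. a *\<^sub>L B.coord i (\<xi> *\<^sub>L bs ! i))"
    unfolding B.tr_def using assms a x B.bs_carrier B.coord_carrier
    by (intro L.finsum_cong') (simp_all add: L.m_assoc B.coord_smult)
  also have "\<dots> = a *\<^sub>L B.tr \<xi>"
    unfolding B.tr_def using a x B.coord_carrier by (intro L.finsum_rdistr[symmetric]) auto
  finally show ?thesis .
qed

text \<open>Continuity of the trace at 0: an element that is small enough is \<open>p ^ k\<close>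
  times one in the unit ball, and \<open>k\<close> is chosen to outweigh the bound on
  coordinates.\<close>

lemma tr_small: "\<exists>\<delta>>0. \<forall>\<xi>\<in>carrier W.L. W.labs \<xi> \<le> \<delta> \<longrightarrow> W.labs (B.tr \<xi>) \<le> 1"
proof -
  obtain C where C: "\<And>i \<xi>. i < B.N \<Longrightarrow> \<xi> \<in> carrier W.L \<Longrightarrow> W.labs \<xi> \<le> 1 \<Longrightarrow> W.labs (B.coord i \<xi>) \<le> C"
    using coord_bounded by blast
  have C1: "1 / (\<bar>C\<bar> + 1) > 0" by (simp add: add_nonneg_pos)
  obtain k where k: "v (of_nat p) ^ k \<le> 1 / (\<bar>C\<bar> + 1)" using power_below(1)[OF C1] by blast
  have pk: "v (of_nat p ^ k) = v (of_nat p) ^ k" by (simp add: V.v_power)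
  have pknz: "of_nat p ^ k \<noteq> (0 :: complex)" by simp
  have bs1: "bs ! i \<in> carrier W.L" "W.labs (bs ! i) \<le> 1" if "i < B.N" for i
    using J[OF that] V.v_Oint_le[OF u_O] by auto
  have "W.labs (B.tr \<xi>) \<le> 1" if xi: "\<xi> \<in> carrier W.L" "W.labs \<xi> \<le> v (of_nat p) ^ k" for \<xi>
  proof -
    define \<zeta> where "\<zeta> = W.emb (inverse (of_nat p ^ k)) *\<^sub>L \<xi>"
    have pK: "of_nat p ^ k \<in> K" "inverse (of_nat p ^ k) \<in> K" by (intro power_K of_nat_K inverse_K)+
    have z: "\<zeta> \<in> carrier W.L" unfolding \<zeta>_def using pK xi by simp
    have xz: "\<xi> = W.emb (of_nat p ^ k) *\<^sub>L \<zeta>"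
      unfolding \<zeta>_def using pK xi pknz
      by (subst L.m_assoc[symmetric]) (simp_all add: W.emb_mult[symmetric] W.L_one[symmetric])
    have "v (of_nat p) ^ k * W.labs \<zeta> \<le> v (of_nat p) ^ k * 1"
      using xi(2) z pK unfolding xz by (simp add: W.labs_mult pk)
    hence z1: "W.labs \<zeta> \<le> 1" using v_p_pos by (simp add: mult_le_cancel_left)
    have "W.labs (B.tr \<zeta>) \<le> \<bar>C\<bar>"
      unfolding B.tr_def
    proof (rule labs_finsum_le)
      fix i assume "i \<in> {..<B.N}"
      hence i: "i < B.N" by simp
      have zb: "\<zeta> *\<^sub>L bs ! i \<in> carrier W.L" using z bs1[OF i] by simp
      thus "B.coord i (\<zeta> *\<^sub>L bs ! i) \<in> carrier W.L" using B.coord_carrier i by blast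
      have "W.labs (\<zeta> *\<^sub>L bs ! i) \<le> 1 * 1"
        using z bs1[OF i] z1 by (subst W.labs_mult) (auto intro!: mult_le_one W.labs_nonneg)
      thus "W.labs (B.coord i (\<zeta> *\<^sub>L bs ! i)) \<le> \<bar>C\<bar>" using C[OF i zb] by simp
    qed simp
    hence "v (of_nat p) ^ k * W.labs (B.tr \<zeta>) \<le> 1 / (\<bar>C\<bar> + 1) * \<bar>C\<bar>"
      using k v_p_pos by (intro mult_mono W.labs_nonneg F_carrier B.tr_F z) auto
    also have "\<dots> \<le> 1" by (simp add: field_simps)
    finally show ?thesis unfolding xz
      using B.tr_F[OF z] F_carrier pK by (simp add: tr_smult z emb_Rats_F W.labs_mult pk)
  qed
  thus ?thesis using v_p_pos by (intro exI[of _ "v (of_nat p) ^ k"]) auto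
qed

text \<open>The rational terms of \<open>f\<close> are eventually p-integral, and integers are dense
  among such rationals. As \<open>e\<close> is at least 1, an error of \<open>(1 / 2) ^ N\<close>
  for \<open>Qp_abs p\<close> is at most that for \<open>v\<close>.\<close>

lemma F_int_approx:
  assumes "f \<in> F" "W.labs f \<le> 1"
  shows "\<exists>a::int. W.labs (f -\<^sub>L W.emb (of_int a)) \<le> (1 / 2) ^ N"
proof -
  obtain q where q: "q \<in> Qv.Cau" "f = W.cls q" using assms F_iff by blast
  have qW: "q \<in> W.Cau" "\<And>m. q m \<in> \<rat>" using q Cau_Rats by blast+
  obtain M where M: "\<And>m. m \<ge> M \<Longrightarrow> W.labs (W.cls q -\<^sub>L W.emb (q m)) < (1 / 2) ^ N"
    using W.cls_approx[OF qW(1), of "(1 / 2) ^ N"] by auto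
  obtain M' where M': "\<And>m. m \<ge> M' \<Longrightarrow> v (q m) \<le> 1"
    using eventually_v_le_1[OF qW(1)] assms q unfolding eventually_sequentially by blast
  define m where "m = max M M'"
  have "Qp_abs p (q m) powr e \<le> 1" using M'[of m] qW by (simp add: v_rat m_def)
  hence "Qp_abs p (q m) \<le> 1"
    using powr_less_mono2[of e 1 "Qp_abs p (q m)"] e_ge_1 by (auto simp: not_le[symmetric])
  then obtain z where z: "z \<in> Q.Oint" "Qp_abs p (q m - z) \<le> (1 / 2) ^ N"
    using Q.Oint_dense[of "q m" N] qW unfolding Qp_abs_eq by blast
  obtain a where a: "z = of_int a" using z(1) by (auto simp: Oint_Rats elim!: Ints_cases)
  have "v (q m - of_int a) = Qp_abs p (q m - z) powr e" unfolding a using qW by (intro v_rat) auto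
  also have "\<dots> \<le> ((1 / 2) ^ N) powr e" using z(2) e_ge_1 Qv.v_nonneg[of "q m - z"] qW a by (intro powr_mono2) auto
  also have "\<dots> \<le> ((1 / 2) ^ N) powr 1" using e_ge_1 by (intro powr_mono') (auto simp: power_le_one)
  finally have 1: "v (q m - of_int a) \<le> (1 / 2) ^ N" by simp
  have K: "q m \<in> K" "of_int a \<in> K" using qW of_int_K by auto
  have "f -\<^sub>L W.emb (of_int a) = (f -\<^sub>L W.emb (q m)) +\<^sub>L (W.emb (q m) -\<^sub>L W.emb (of_int a))"
    unfolding q using qW W.Cau_const K W.Cau_diff by (simp add: W.emb_cls W.L_diff W.L_ops)
  also have "W.labs \<dots> \<le> (1 / 2) ^ N"
    using M[of m] 1 K F_carrier[OF assms(1)] W.labs_emb[OF diff_K[OF K]]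
    by (intro labs_ultra) (auto simp: m_def q W.emb_diff)
  finally show ?thesis by blast
qed

text \<open>The denominator \<open>p ^ k\<close> depends on \<open>f\<close> alone and not on the
  precision \<open>N\<close>. The comparison of traces needs this in order to fix its denominators
  in advance.\<close>

lemma F_rat_approx:
  assumes "f \<in> F"
  shows "\<exists>k. \<forall>N. \<exists>a::int. W.labs (f -\<^sub>L W.emb (of_int a / of_nat p ^ k)) \<le> (1 / 2) ^ N"
proof -
  have fL: "f \<in> carrier W.L" using F_carrier assms by blast
  obtain k where k: "W.labs (W.emb (of_nat p ^ k) *\<^sub>L f) \<le> 1" using labs_scale[OF fL] by blast
  have pF: "W.emb (of_nat p ^ k) *\<^sub>L f \<in> F" using assms emb_Rats_F by (intro B.F_ops) auto
  have vpk: "v (of_nat p ^ k) > 0" by simp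
  have "\<exists>a::int. W.labs (f -\<^sub>L W.emb (of_int a / of_nat p ^ k)) \<le> (1 / 2) ^ N" for N
  proof -
    obtain M where M: "(1 / 2) ^ M \<le> v (of_nat p ^ k) * (1 / 2) ^ N"
      using power_below(2)[of "v (of_nat p ^ k) * (1 / 2) ^ N"] vpk by auto
    obtain a :: int where a: "W.labs (W.emb (of_nat p ^ k) *\<^sub>L f -\<^sub>L W.emb (of_int a)) \<le> (1 / 2) ^ M"
      using F_int_approx[OF pF k] by blast
    have K: "of_nat p ^ k \<in> K" "of_int a / of_nat p ^ k \<in> K" by (intro power_K of_nat_K divide_K of_int_K)+
    have "W.emb (of_int a) = W.emb (of_nat p ^ k) *\<^sub>L W.emb (of_int a / of_nat p ^ k)"
      using K by (simp add: W.emb_mult[symmetric])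
    hence eq: "W.emb (of_nat p ^ k) *\<^sub>L f -\<^sub>L W.emb (of_int a)
        = W.emb (of_nat p ^ k) *\<^sub>L (f -\<^sub>L W.emb (of_int a / of_nat p ^ k))"
      using K fL by (simp add: L.r_distr L.minus_eq L.r_minus)
    have eq': "W.labs (W.emb (of_nat p ^ k) *\<^sub>L (f -\<^sub>L W.emb (of_int a / of_nat p ^ k)))
        = v (of_nat p ^ k) * W.labs (f -\<^sub>L W.emb (of_int a / of_nat p ^ k))"
      using K fL by (simp add: W.labs_mult)
    have "v (of_nat p ^ k) * W.labs (f -\<^sub>L W.emb (of_int a / of_nat p ^ k)) \<le> v (of_nat p ^ k) * (1 / 2) ^ N"
      using order_trans[OF a M] unfolding eq eq' .
    thus ?thesis using vpk by (intro exI[of _ a]) (simp only: mult_le_cancel_left_pos[OF vpk])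
  qed
  thus ?thesis by blast
qed

lemma Tr_rat_v_le:
  assumes "x \<in> K" "of_nat D * x \<in> Oint" "\<epsilon> \<in> Oint"
  shows "v (Tr (x * \<epsilon>)) * v (of_nat D) \<le> 1"
proof -
  have x: "x * \<epsilon> \<in> K" by (rule mult_K[OF assms(1) Oint_K[OF assms(3)]])
  have "Tr (of_nat D * x * \<epsilon>) \<in> \<int>" by (rule Tr_Oint[OF Oint_mult[OF assms(2,3)]])
  moreover have "Tr (of_nat D * x * \<epsilon>) = Tr (x * \<epsilon>) * of_nat D" using Tr_of_nat_mult[OF x, of D] by (simp add: ac_simps)
  ultimately have "v (Tr (x * \<epsilon>) * of_nat D) \<le> 1" using V.v_Oint_le Ints_Oint by simp
  thus ?thesis using V.v_mult[of "Tr (x * \<epsilon>)" "of_nat D"] Rats_subset_K[OF Tr_rational[OF x]] by simp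
qed

end

section \<open>Local traces approximated by global traces\<close>

context local_place
begin

text \<open>Expanding \<open>\<epsilon> * u $ J i\<close> in \<open>u\<close> with global traces as
  coefficients separates the variables: \<open>\<epsilon>\<close> enters only through rational
  numbers, the local field only through the coordinates of \<open>x * u $ h\<close>.\<close>

lemma tr_emb_mult:
  assumes x: "x \<in> K" and \<epsilon>: "\<epsilon> \<in> K"
  shows "B.tr (W.emb (x * \<epsilon>)) = (\<Oplus>\<^bsub>W.L\<^esub>i\<in>{..<B.N}. \<Oplus>\<^bsub>W.L\<^esub>h\<in>{..<n}.
    W.emb (Tr (\<epsilon> * u $ J i * w h)) *\<^sub>L B.coord i (W.emb (x * u $ h)))"
proof -
  have "B.coord i (W.emb (x * \<epsilon>) *\<^sub>L bs ! i) = (\<Oplus>\<^bsub>W.L\<^esub>h\<in>{..<n}.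
      W.emb (Tr (\<epsilon> * u $ J i * w h)) *\<^sub>L B.coord i (W.emb (x * u $ h)))" if i: "i < B.N" for i
  proof -
    have eK: "\<epsilon> * u $ J i \<in> K" using \<epsilon> J(1)[OF i] by (intro mult_K) auto
    have T: "Tr (\<epsilon> * u $ J i * w h) \<in> \<rat>" if "h < n" for h by (rule Tr_rational[OF mult_K[OF eK w_K[OF that]]])
    have TK: "Tr (\<epsilon> * u $ J i * w h) \<in> K" if "h < n" for h by (rule Rats_subset_K[OF T[OF that]])
    have xK: "h < n \<Longrightarrow> x * u $ h \<in> K" for h using x by (intro mult_K) auto
    have "x * \<epsilon> * u $ J i = x * (\<epsilon> * u $ J i)" by simp
    also have "\<dots> = x * (\<Sum>h<n. Tr (\<epsilon> * u $ J i * w h) * u $ h)" using u_expansion[OF eK] by simp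
    also have "\<dots> = (\<Sum>h<n. Tr (\<epsilon> * u $ J i * w h) * (x * u $ h))" by (simp add: sum_distrib_left ac_simps)
    finally have eq: "x * \<epsilon> * u $ J i = \<dots>" .
    have "W.emb (x * \<epsilon>) *\<^sub>L bs ! i = W.emb (x * \<epsilon> * u $ J i)"
      unfolding J(2)[OF i] using x \<epsilon> J(1)[OF i] by (intro W.emb_mult[symmetric] mult_K) auto
    also have "\<dots> = (\<Oplus>\<^bsub>W.L\<^esub>h\<in>{..<n}. W.emb (Tr (\<epsilon> * u $ J i * w h) * (x * u $ h)))"
      unfolding eq by (intro W.emb_finsum) (auto intro: mult_K[OF TK xK])
    also have "\<dots> = (\<Oplus>\<^bsub>W.L\<^esub>h\<in>{..<n}. W.emb (Tr (\<epsilon> * u $ J i * w h)) *\<^sub>L W.emb (x * u $ h))"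
      using TK xK by (intro L.finsum_cong' refl) (auto simp: W.emb_mult)
    finally have "W.emb (x * \<epsilon>) *\<^sub>L bs ! i = \<dots>" .
    moreover have "B.coord i \<dots> = (\<Oplus>\<^bsub>W.L\<^esub>h\<in>{..<n}.
      W.emb (Tr (\<epsilon> * u $ J i * w h)) *\<^sub>L B.coord i (W.emb (x * u $ h)))"
      using T xK emb_Rats_F i by (intro B.coord_lin) auto
    ultimately show ?thesis by simp
  qed
  thus ?thesis unfolding B.tr_def
    using B.coord_carrier x \<epsilon> mult_K Tr_rational Rats_subset_K J(1)
    by (intro L.finsum_cong' refl) (auto intro!: L.finsum_closed L.m_closed W.emb_L)
qed

text \<open>
  The local trace is approximated by global traces: multiplication by a suitable \<open>\<epsilon>\<close> close to 1
  at \<open>P\<close> removes the contributions of the other primes above \<open>p\<close>.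
\<close>

lemma tr_Tr:
  assumes x: "x \<in> K"
  shows "\<exists>s. \<forall>N \<epsilon>. \<epsilon> \<in> Oint \<longrightarrow> v (1 - \<epsilon>) \<le> (1 / 2) ^ s \<longrightarrow>
    (\<forall>z\<in>Oint. v z \<le> (1 / 2) ^ N \<longrightarrow> (\<exists>y\<in>Oint. \<epsilon> * z = of_nat p ^ s * y)) \<longrightarrow>
    W.labs (B.tr (W.emb x) -\<^sub>L W.emb (Tr (x * \<epsilon>))) \<le> 1"
proof -
  obtain \<delta> where \<delta>: "\<delta> > 0" "\<And>\<xi>. \<xi> \<in> carrier W.L \<Longrightarrow> W.labs \<xi> \<le> \<delta> \<Longrightarrow> W.labs (B.tr \<xi>) \<le> 1"
    using tr_small by blast
  define cf where "cf h i = B.coord i (W.emb (x * u $ h))" for h i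
  have xK: "h < n \<Longrightarrow> x * u $ h \<in> K" for h using x by (intro mult_K) auto
  have cfF: "cf h i \<in> F" if "h < n" "i < B.N" for h i
    unfolding cf_def using that xK by (intro B.coord_props(1)) auto
  hence cfL: "cf h i \<in> carrier W.L" if "h < n" "i < B.N" for h i using that F_carrier by blast
  define k where "k h i = (SOME k. \<forall>N. \<exists>a::int. W.labs (cf h i -\<^sub>L W.emb (of_int a / of_nat p ^ k)) \<le> (1 / 2) ^ N)" for h i
  have k: "\<exists>a::int. W.labs (cf h i -\<^sub>L W.emb (of_int a / of_nat p ^ k h i)) \<le> (1 / 2) ^ N"
    if "h < n" "i < B.N" for h i N
    using someI_ex[OF F_rat_approx[OF cfF[OF that]]] unfolding k_def[symmetric] by blast
  \<comment> \<open>One denominator \<open>D\<close> for \<open>w\<close>, for the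
    \<open>x * u $ h\<close> and for all later rational approximations, whose denominators are fixed
    powers of \<open>p\<close>. It is chosen before \<open>N\<close> and
    \<open>\<epsilon>\<close>.\<close>
  define S where "S = w ` {..<n} \<union> (\<lambda>h. x * u $ h) ` {..<n} \<union> (\<lambda>(h, i). 1 / of_nat p ^ k h i) ` ({..<n} \<times> {..<B.N})"
  have SK: "S \<subseteq> K" unfolding S_def using xK by (auto intro!: divide_K power_K of_nat_K one_K)
  obtain D where D: "D > (0::nat)" "\<And>x. x \<in> S \<Longrightarrow> of_nat D * x \<in> Oint"
    using common_denominator[OF _ SK] unfolding S_def by blast
  have Dw: "h < n \<Longrightarrow> of_nat D * w h \<in> Oint" and Dx: "h < n \<Longrightarrow> of_nat D * (x * u $ h) \<in> Oint"
    and Dp: "h < n \<Longrightarrow> i < B.N \<Longrightarrow> of_nat D * (1 / of_nat p ^ k h i) \<in> Oint" for h i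
    by (rule D(2), force simp: S_def)+
  have vD: "v (of_nat D) > 0" using D(1) by simp
  obtain s1 where s1: "v (of_nat p) ^ s1 \<le> v (of_nat D) * v (of_nat D)"
    using power_below(1)[OF mult_pos_pos[OF vD vD]] by blast
  have vx1: "\<delta> / (v x + 1) > 0" using \<delta>(1) V.v_nonneg[of x] by (simp add: add_nonneg_pos)
  obtain s2 where s2: "(1 / 2) ^ s2 \<le> \<delta> / (v x + 1)" using power_below(2)[OF vx1] by blast
  \<comment> \<open>\<open>s1\<close> outweighs the square of \<open>D\<close> in the bound on
    \<open>Tr (w h * \<epsilon> * z h)\<close>; \<open>s2\<close> makes
    \<open>x * (1 - \<epsilon>)\<close> small enough for \<open>tr_small\<close>.\<close>
  define s where "s = s1 + s2"
  have s1': "v (of_nat p) ^ s \<le> v (of_nat D) * v (of_nat D)"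
    using v_p_less_1 v_p_pos by (intro order_trans[OF power_decreasing s1]) (auto simp: s_def)
  have "(1 / 2 :: real) ^ s \<le> \<delta> / (v x + 1)" by (intro order_trans[OF power_decreasing s2]) (auto simp: s_def)
  hence "v x * (1 / 2) ^ s \<le> (v x + 1) * (\<delta> / (v x + 1))" by (intro mult_mono) auto
  hence s2': "v x * (1 / 2) ^ s \<le> \<delta>" using V.v_nonneg[of x] by (simp add: add_nonneg_pos)
  have "W.labs (B.tr (W.emb x) -\<^sub>L W.emb (Tr (x * \<epsilon>))) \<le> 1"
    if \<epsilon>: "\<epsilon> \<in> Oint" "v (1 - \<epsilon>) \<le> (1 / 2) ^ s"
      and \<epsilon>N: "\<And>z. z \<in> Oint \<Longrightarrow> v z \<le> (1 / 2) ^ N \<Longrightarrow> \<exists>y\<in>Oint. \<epsilon> * z = of_nat p ^ s * y" for N \<epsilon>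
  proof -
    note \<epsilon>K = Oint_K[OF \<epsilon>(1)]
    obtain N1 where N1: "(1 / 2) ^ N1 \<le> v (of_nat D)" using power_below(2)[OF vD] by blast
    define N' where "N' = max N N1"
    have N': "(1 / 2) ^ N' \<le> v (of_nat D)" "(1 / 2 :: real) ^ N' \<le> (1 / 2) ^ N"
      unfolding N'_def by (intro order_trans[OF power_decreasing N1]; simp) (intro power_decreasing; simp)
    define a where "a h i = (SOME a::int. W.labs (cf h i -\<^sub>L W.emb (of_int a / of_nat p ^ k h i)) \<le> (1 / 2) ^ N')" for h i
    define r where "r h i = (of_int (a h i) / of_nat p ^ k h i :: complex)" for h i
    have r: "W.labs (cf h i -\<^sub>L W.emb (r h i)) \<le> (1 / 2) ^ N'" if "h < n" "i < B.N" for h i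
      using someI_ex[OF k[OF that, of N']] unfolding a_def[symmetric] r_def .
    have rQ: "r h i \<in> \<rat>" for h i by (simp add: r_def)
    hence rK: "r h i \<in> K" for h i by (rule Rats_subset_K)
    define T where "T h i = Tr (\<epsilon> * u $ J i * w h)" for h i
    have TQ: "T h i \<in> \<rat>" if "h < n" "i < B.N" for h i
      unfolding T_def using \<epsilon>K that J(1) by (intro Tr_rational mult_K) auto
    have TK: "T h i \<in> K" if "h < n" "i < B.N" for h i by (rule Rats_subset_K[OF TQ[OF that]])
    \<comment> \<open>The error made when rational numbers replace the local coordinates of
      \<open>x * u $ h\<close>. It is an element of K, small at \<open>P\<close>, with denominator
      dividing \<open>D\<close>.\<close>
    define z where "z h = x * u $ h - (\<Sum>i<B.N. r h i * u $ J i)" for h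
    have zK: "z h \<in> K" if "h < n" for h
      unfolding z_def using rK J(1) by (intro diff_K[OF xK[OF that]] sum_K mult_K) auto
    have zO: "of_nat D * z h \<in> Oint" if h: "h < n" for h
    proof -
      have "of_nat D * z h = of_nat D * (x * u $ h) - (\<Sum>i<B.N. of_int (a h i) * (of_nat D * (1 / of_nat p ^ k h i)) * u $ J i)"
        unfolding z_def r_def by (simp add: right_diff_distrib sum_distrib_left ac_simps)
      thus ?thesis using Dx[OF h] Dp[OF h] J(1) by (auto intro!: Oint_diff Oint_sum Oint_mult Oint_of_int simp del: times_divide_eq_right)
    qed
    have vz: "v (z h) \<le> (1 / 2) ^ N'" if h: "h < n" for h
    proof -
      have "W.emb (x * u $ h) = (\<Oplus>\<^bsub>W.L\<^esub>i\<in>{..<B.N}. cf h i *\<^sub>L bs ! i)"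
        unfolding cf_def using xK[OF h] by (intro B.coord_props(2)) simp
      also have "\<dots> = (\<Oplus>\<^bsub>W.L\<^esub>i\<in>{..<B.N}. cf h i *\<^sub>L W.emb (u $ J i))"
        using J cfL[OF h] by (intro L.finsum_cong' refl) simp_all
      finally have e1: "W.emb (x * u $ h) = \<dots>" .
      have e2: "W.emb (\<Sum>i<B.N. r h i * u $ J i) = (\<Oplus>\<^bsub>W.L\<^esub>i\<in>{..<B.N}. W.emb (r h i) *\<^sub>L W.emb (u $ J i))"
        using rK J(1) by (subst W.emb_finsum, simp_all add: mult_K)
          (intro L.finsum_cong' refl, simp_all add: W.emb_mult)
      have "(\<Oplus>\<^bsub>W.L\<^esub>i\<in>{..<B.N}. (cf h i -\<^sub>L W.emb (r h i)) *\<^sub>L W.emb (u $ J i))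
          +\<^sub>L (\<Oplus>\<^bsub>W.L\<^esub>i\<in>{..<B.N}. W.emb (r h i) *\<^sub>L W.emb (u $ J i))
          = (\<Oplus>\<^bsub>W.L\<^esub>i\<in>{..<B.N}. (cf h i -\<^sub>L W.emb (r h i)) *\<^sub>L W.emb (u $ J i) +\<^sub>L W.emb (r h i) *\<^sub>L W.emb (u $ J i))"
        using cfL[OF h] rK J(1) by (intro L.finsum_addf[symmetric]) auto
      also have "\<dots> = (\<Oplus>\<^bsub>W.L\<^esub>i\<in>{..<B.N}. cf h i *\<^sub>L W.emb (u $ J i))"
        using cfL[OF h] rK J(1)
        by (intro L.finsum_cong' refl) (simp_all add: L.l_distr[symmetric] L.minus_eq L.a_assoc L.l_neg)
      finally have "W.emb (x * u $ h) = (\<Oplus>\<^bsub>W.L\<^esub>i\<in>{..<B.N}. (cf h i -\<^sub>L W.emb (r h i)) *\<^sub>L W.emb (u $ J i)) +\<^sub>L W.emb (\<Sum>i<B.N. r h i * u $ J i)"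
        unfolding e1 e2 by simp
      moreover have "W.emb (z h) = W.emb (x * u $ h) -\<^sub>L W.emb (\<Sum>i<B.N. r h i * u $ J i)"
        unfolding z_def using xK[OF h] rK J(1) by (intro W.emb_diff sum_K mult_K[of "r h _"]) auto
      moreover have "c +\<^sub>L d -\<^sub>L d = c" if "c \<in> carrier W.L" "d \<in> carrier W.L" for c d
        using that by (simp add: L.minus_eq L.a_assoc L.r_neg)
      moreover have "(\<Oplus>\<^bsub>W.L\<^esub>i\<in>{..<B.N}. (cf h i -\<^sub>L W.emb (r h i)) *\<^sub>L W.emb (u $ J i)) \<in> carrier W.L" "W.emb (\<Sum>i<B.N. r h i * u $ J i) \<in> carrier W.L"
        using cfL[OF h] rK J(1) by (auto intro!: L.finsum_closed sum_K mult_K)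
      ultimately have "W.emb (z h) = (\<Oplus>\<^bsub>W.L\<^esub>i\<in>{..<B.N}. (cf h i -\<^sub>L W.emb (r h i)) *\<^sub>L W.emb (u $ J i))" by simp
      moreover have "W.labs \<dots> \<le> (1 / 2) ^ N'"
      proof (rule labs_finsum_le)
        fix i assume "i \<in> {..<B.N}"
        hence i: "i < B.N" by simp
        have m: "cf h i -\<^sub>L W.emb (r h i) \<in> carrier W.L" "W.emb (u $ J i) \<in> carrier W.L"
          using cfL[OF h i] rK J(1)[OF i] by auto
        thus "(cf h i -\<^sub>L W.emb (r h i)) *\<^sub>L W.emb (u $ J i) \<in> carrier W.L" by simp
        have "W.labs ((cf h i -\<^sub>L W.emb (r h i)) *\<^sub>L W.emb (u $ J i)) \<le> (1 / 2) ^ N' * 1"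
          unfolding W.labs_mult[OF m] using r[OF h i] V.v_Oint_le[OF u_O[OF J(1)[OF i]]] J(1)[OF i] W.labs_nonneg[OF m(2)]
          by (intro mult_mono) auto
        thus "W.labs ((cf h i -\<^sub>L W.emb (r h i)) *\<^sub>L W.emb (u $ J i)) \<le> (1 / 2) ^ N'" by simp
      qed simp
      ultimately show ?thesis using W.labs_emb[OF zK[OF h]] by simp
    qed
    \<comment> \<open>At other primes above \<open>p\<close> this error need not be small; the
      hypothesis on \<open>\<epsilon>\<close> makes its product with \<open>\<epsilon>\<close>
      divisible by \<open>p ^ s\<close> after clearing denominators, so its global trace is
      p-integral.\<close>
    have Tz: "v (Tr (w h * \<epsilon> * z h)) \<le> 1" if h: "h < n" for h
    proof -
      have "v (of_nat D * z h) \<le> 1 * (1 / 2) ^ N'"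
        using V.v_mult[OF of_nat_K zK[OF h], of D] mult_mono[OF V.v_Oint_le[OF Oint_of_nat[of D]] vz[OF h]] by simp
      hence "v (of_nat D * z h) \<le> (1 / 2) ^ N" using N' by linarith
      from \<epsilon>N[OF zO[OF h] this] obtain y where y: "y \<in> Oint" "\<epsilon> * (of_nat D * z h) = of_nat p ^ s * y" by blast
      have wz: "w h * \<epsilon> * z h \<in> K" using h zK \<epsilon>K by (intro mult_K) auto
      have "of_nat (D * D) * (w h * \<epsilon> * z h) = (of_nat D * w h) * (\<epsilon> * (of_nat D * z h))" by simp
      also have "\<dots> = of_nat (p ^ s) * (of_nat D * w h * y)" unfolding y(2) by simp
      finally have eq: "of_nat (D * D) * (w h * \<epsilon> * z h) = \<dots>" .
      have DO: "of_nat D * w h * y \<in> Oint" using Dw[OF h] y(1) by (rule Oint_mult)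
      have "of_nat (D * D) * Tr (w h * \<epsilon> * z h) = of_nat (p ^ s) * Tr (of_nat D * w h * y)"
        using arg_cong[OF eq, of Tr] Tr_of_nat_mult[OF wz, of "D * D"] Tr_of_nat_mult[OF Oint_K[OF DO], of "p ^ s"] by metis
      moreover have "v (of_nat (D * D) * Tr (w h * \<epsilon> * z h)) = v (of_nat D) * v (of_nat D) * v (Tr (w h * \<epsilon> * z h))"
        using Rats_subset_K[OF Tr_rational[OF wz]] by (simp add: V.v_mult)
      moreover have "v (of_nat (p ^ s) * Tr (of_nat D * w h * y)) = v (of_nat p) ^ s * v (Tr (of_nat D * w h * y))"
        using Rats_subset_K[OF Tr_rational[OF Oint_K[OF DO]]] by (simp add: V.v_mult V.v_power)
      moreover have "v (Tr (of_nat D * w h * y)) \<le> 1" by (rule V.v_Oint_le[OF Ints_Oint[OF Tr_Oint[OF DO]]])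
      ultimately have "v (of_nat D) * v (of_nat D) * v (Tr (w h * \<epsilon> * z h)) \<le> v (of_nat D) * v (of_nat D) * 1"
        using s1' mult_mono[OF s1', of "v (Tr (of_nat D * w h * y))" 1] by simp
      thus ?thesis using vD by (simp only: mult_le_cancel_left_pos[OF mult_pos_pos[OF vD vD]])
    qed
    \<comment> \<open>The local trace of \<open>x * \<epsilon>\<close> is \<open>E + Q\<close> and
      its global trace is \<open>Q + Z\<close>, with the same rational main term \<open>Q\<close>.
      Both error terms \<open>E\<close> and \<open>Z\<close> have absolute value at most 1.\<close>
    define E where "E = (\<Oplus>\<^bsub>W.L\<^esub>i\<in>{..<B.N}. \<Oplus>\<^bsub>W.L\<^esub>h\<in>{..<n}. W.emb (T h i) *\<^sub>L (cf h i -\<^sub>L W.emb (r h i)))"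
    have summand: "W.emb (T h i) *\<^sub>L (cf h i -\<^sub>L W.emb (r h i)) \<in> carrier W.L"
      "W.labs (W.emb (T h i) *\<^sub>L (cf h i -\<^sub>L W.emb (r h i))) \<le> 1" if h: "h < n" and i: "i < B.N" for h i
    proof -
      have m: "W.emb (T h i) \<in> carrier W.L" "cf h i -\<^sub>L W.emb (r h i) \<in> carrier W.L"
        using TK[OF that] cfL[OF that] rK by auto
      thus "W.emb (T h i) *\<^sub>L (cf h i -\<^sub>L W.emb (r h i)) \<in> carrier W.L" by simp
      have "v (Tr (w h * (\<epsilon> * u $ J i))) * v (of_nat D) \<le> 1"
        using h \<epsilon>(1) J(1)[OF i] by (intro Tr_rat_v_le[OF _ Dw[OF h]] Oint_mult) auto
      hence "v (T h i) * v (of_nat D) \<le> 1" by (simp add: T_def ac_simps)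
      moreover have "v (T h i) * W.labs (cf h i -\<^sub>L W.emb (r h i)) \<le> v (T h i) * v (of_nat D)"
        using r[OF that] N'(1) by (intro mult_left_mono) auto
      ultimately show "W.labs (W.emb (T h i) *\<^sub>L (cf h i -\<^sub>L W.emb (r h i))) \<le> 1"
        unfolding W.labs_mult[OF m] W.labs_emb[OF TK[OF that]] by linarith
    qed
    have E: "E \<in> carrier W.L" "W.labs E \<le> 1"
      unfolding E_def using summand by (auto intro!: L.finsum_closed labs_finsum_le)
    define Z where "Z = (\<Sum>h<n. Tr (w h * \<epsilon> * z h))"
    have TzK: "Tr (w h * \<epsilon> * z h) \<in> K" if "h < n" for h
      using that zK \<epsilon>K by (intro Rats_subset_K[OF Tr_rational] mult_K) auto
    have Z: "Z \<in> K" "v Z \<le> 1" unfolding Z_def using TzK Tz by (auto intro!: sum_K v_sum_le)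
    define Q where "Q = (\<Sum>i<B.N. \<Sum>h<n. T h i * r h i)"
    have QK: "Q \<in> K" unfolding Q_def using TK rK by (intro sum_K mult_K) auto
    have xe: "x * \<epsilon> \<in> K" using x \<epsilon>K by (rule mult_K)
    have "Tr (x * \<epsilon>) = (\<Sum>h<n. Tr (x * \<epsilon> * w h * u $ h))" by (rule Tr_dual[OF xe])
    also have "\<dots> = (\<Sum>h<n. (\<Sum>i<B.N. T h i * r h i) + Tr (w h * \<epsilon> * z h))"
    proof (intro sum.cong refl)
      fix h assume "h \<in> {..<n}"
      hence h: "h < n" by simp
      have "x * \<epsilon> * w h * u $ h = (\<Sum>i<B.N. r h i * (\<epsilon> * u $ J i * w h)) + w h * \<epsilon> * z h"
        unfolding z_def by (simp add: right_diff_distrib sum_distrib_left ac_simps)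
      also have "Tr \<dots> = Tr (\<Sum>i<B.N. r h i * (\<epsilon> * u $ J i * w h)) + Tr (w h * \<epsilon> * z h)"
        using h rK \<epsilon>K J(1) zK by (intro Tr_add sum_K mult_K) auto
      also have "Tr (\<Sum>i<B.N. r h i * (\<epsilon> * u $ J i * w h)) = (\<Sum>i<B.N. Tr (r h i * (\<epsilon> * u $ J i * w h)))"
        using h rK \<epsilon>K J(1) by (intro Tr_sum) (auto simp: simp_implies_def intro!: mult_K)
      also have "\<dots> = (\<Sum>i<B.N. T h i * r h i)"
      proof (intro sum.cong refl)
        fix i assume "i \<in> {..<B.N}"
        moreover obtain q where "r h i = of_rat q" using rQ[of h i] by (auto elim: Rats_cases)
        ultimately show "Tr (r h i * (\<epsilon> * u $ J i * w h)) = T h i * r h i"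
          unfolding T_def using h \<epsilon>K J(1) by (simp add: Tr_of_rat_mult)
      qed
      finally show "Tr (x * \<epsilon> * w h * u $ h) = (\<Sum>i<B.N. T h i * r h i) + Tr (w h * \<epsilon> * z h)" .
    qed
    also have "\<dots> = Q + Z" unfolding Q_def Z_def sum.distrib by (subst sum.swap) simp
    finally have TrE: "W.emb (Tr (x * \<epsilon>)) = W.emb Q +\<^sub>L W.emb Z" using QK Z by (simp add: W.emb_add)
    have embS: "W.emb (\<Sum>h<n. T h i * r h i) = (\<Oplus>\<^bsub>W.L\<^esub>h\<in>{..<n}. W.emb (T h i * r h i))" if "i < B.N" for i
      by (intro W.emb_finsum) (auto intro: mult_K[OF TK[OF _ that] rK])
    have TrK: "T h i * r h i \<in> K" if "h < n" "i < B.N" for h i by (rule mult_K[OF TK[OF that] rK])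
    have QE: "W.emb Q = (\<Oplus>\<^bsub>W.L\<^esub>i\<in>{..<B.N}. W.emb (\<Sum>h<n. T h i * r h i))"
      unfolding Q_def using TrK by (intro W.emb_finsum sum_K) auto
    have "B.tr (W.emb (x * \<epsilon>)) = (\<Oplus>\<^bsub>W.L\<^esub>i\<in>{..<B.N}. \<Oplus>\<^bsub>W.L\<^esub>h\<in>{..<n}.
        W.emb (T h i) *\<^sub>L (cf h i -\<^sub>L W.emb (r h i)) +\<^sub>L W.emb (T h i * r h i))"
      unfolding tr_emb_mult[OF x \<epsilon>K] T_def[symmetric] cf_def[symmetric] using TK cfL rK
      by (intro L.finsum_cong' refl L.finsum_closed funcsetI)
        (simp_all add: W.emb_mult L.r_distr[symmetric] L.minus_eq L.a_assoc L.l_neg)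
    also have "\<dots> = (\<Oplus>\<^bsub>W.L\<^esub>i\<in>{..<B.N}. (\<Oplus>\<^bsub>W.L\<^esub>h\<in>{..<n}.
        W.emb (T h i) *\<^sub>L (cf h i -\<^sub>L W.emb (r h i))) +\<^sub>L W.emb (\<Sum>h<n. T h i * r h i))"
      using summand TrK
      by (intro L.finsum_cong' refl) (simp_all add: embS L.finsum_addf)
    also have "\<dots> = E +\<^sub>L W.emb Q"
      unfolding E_def QE using summand TrK by (intro L.finsum_addf) (auto intro!: L.finsum_closed sum_K)
    finally have trE: "B.tr (W.emb (x * \<epsilon>)) = E +\<^sub>L W.emb Q" .
    \<comment> \<open>The price for passing from \<open>x * \<epsilon>\<close> back to
      \<open>x\<close> in the local trace.\<close>
    define H where "H = B.tr (W.emb (x * (1 - \<epsilon>)))"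
    have x1: "x * (1 - \<epsilon>) \<in> K" using x \<epsilon>K by (intro mult_K diff_K one_K)
    have "v (x * (1 - \<epsilon>)) = v x * v (1 - \<epsilon>)" using x \<epsilon>K by (intro V.v_mult diff_K one_K)
    also have "\<dots> \<le> v x * (1 / 2) ^ s" using \<epsilon>(2) by (intro mult_left_mono) auto
    finally have H: "H \<in> carrier W.L" "W.labs H \<le> 1"
      unfolding H_def using x1 s2' B.tr_F F_carrier by (auto intro!: \<delta>(2))
    have "W.emb x = W.emb (x * (1 - \<epsilon>)) +\<^sub>L W.emb (x * \<epsilon>)"
      using x1 xe by (simp add: W.emb_add[symmetric] algebra_simps)
    hence "B.tr (W.emb x) = H +\<^sub>L (E +\<^sub>L W.emb Q)" unfolding H_def trE[symmetric] using x1 xe by (simp add: B.tr_add)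
    moreover have "H +\<^sub>L (E +\<^sub>L q) -\<^sub>L (q +\<^sub>L y) = (H +\<^sub>L E) -\<^sub>L y"
      if "q \<in> carrier W.L" "y \<in> carrier W.L" for q y
      using that H(1) E(1) by (simp add: L.minus_eq L.minus_add L.a_ac L.r_neg L.r_neg2)
    ultimately have "B.tr (W.emb x) -\<^sub>L W.emb (Tr (x * \<epsilon>)) = (H +\<^sub>L E) -\<^sub>L W.emb Z"
      unfolding TrE using QK Z by simp
    thus ?thesis using H E Z by (auto intro!: labs_diff_ultra labs_ultra)
  qed
  thus ?thesis by blast
qed

end

lemma place_abs_Fin: "place_abs K (Fin_place P) = padic_abs K P"
  by (simp add: fun_eq_iff)

section \<open>p-integral rationals and p-adic fractional parts\<close>

context rational_prime
begin

text \<open>The integers localized at \<open>p\<close>. Congruences modulo this ring let reciprocity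
  be checked at one prime number at a time.\<close>

definition qint :: "complex \<Rightarrow> bool" where "qint z \<longleftrightarrow> z \<in> \<rat> \<and> Qp_abs p z \<le> 1"

lemma qint_Rats: "qint z \<Longrightarrow> z \<in> \<rat>"
  by (simp add: qint_def)

lemma qint_Ints: "z \<in> \<int> \<Longrightarrow> qint z"
  using Q.v_Oint_le[of z] by (auto simp: qint_def Oint_Rats Qp_abs_eq elim!: Ints_cases)

lemma qint_add: "qint z \<Longrightarrow> qint z' \<Longrightarrow> qint (z + z')"
  and qint_diff: "qint z \<Longrightarrow> qint z' \<Longrightarrow> qint (z - z')"
  using Q.v_add_le[of z z'] Q.v_add_le[of z "- z'"] Q.v_minus[of z'] by (auto simp: qint_def Qp_abs_eq)

lemma qint_sum: "(\<And>i. i \<in> I \<Longrightarrow> qint (f i)) \<Longrightarrow> qint (\<Sum>i\<in>I. f i)"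
  by (induction I rule: infinite_finite_induct) (auto simp: qint_Ints qint_add)

lemma qint_coprime_denominator:
  assumes "\<not> int p dvd b" shows "qint (of_int a / of_int b)"
proof -
  have "Q.v (of_int b) = 1" using assms of_int_mem_Pp by (intro Q.v_notP) (auto simp: Oint_Rats)
  moreover have "Q.v (of_int a) \<le> 1" by (intro Q.v_Oint_le) (auto simp: Oint_Rats)
  ultimately show ?thesis using assms
    by (auto simp: qint_def Qp_abs_eq divide_inverse Q.v_mult Q.v_inverse)
qed

text \<open>The only prime that can occur in the denominator is \<open>p\<close>, so integrality at
  \<open>p\<close> is integrality.\<close>

lemma p_fraction_integral:
  fixes a a' :: int
  assumes "qint (of_real (of_int a / of_nat p ^ k - of_int a' / of_nat p ^ k'))"
  shows "of_int a / of_nat p ^ k - of_int a' / of_nat p ^ k' \<in> (\<int> :: real set)"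
proof -
  define c where "c = a * int p ^ k' - a' * int p ^ k"
  have eq: "of_int a / of_nat p ^ k - of_int a' / of_nat p ^ k' = (of_int c / of_nat p ^ (k + k') :: real)"
    by (simp add: c_def field_simps power_add)
  have "of_real (of_int c / of_nat p ^ (k + k')) = (of_int c / of_nat p ^ (k + k') :: complex)" by simp
  hence "int p ^ (k + k') dvd c"
    using assms unfolding eq qint_def by (intro p_integral_form) auto
  then obtain b where b: "c = int p ^ (k + k') * b" by (rule dvdE)
  have "(of_int c / of_nat p ^ (k + k') :: real) = of_int b" unfolding b by simp
  thus ?thesis unfolding eq by simp
qed

end

text \<open>A prime factor of the reduced denominator would make the number non-integral at that
  prime, since it cannot divide the numerator.\<close>

lemma integral_at_all_primes:
  assumes "z \<in> \<rat>" "\<And>q. Factorial_Ring.prime q \<Longrightarrow> rational_prime.qint q z"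
  shows "z \<in> \<int>"
proof -
  obtain r where r: "z = of_rat r" using assms(1) by (auto elim: Rats_cases)
  obtain a b where ab: "r = Rat.Fract a b" "b > 0" "coprime a b" by (cases r)
  have z: "z = of_int a / of_int b" unfolding r ab(1) using ab(2) by (simp add: of_rat_rat)
  show ?thesis
  proof (cases "b = 1")
    case False
    hence "nat b \<noteq> 1" by simp
    then obtain q :: nat where "Factorial_Ring.prime q" "q dvd nat b" using prime_factor_nat by blast
    moreover from this(2) have "int q dvd int (nat b)" unfolding int_dvd_int_iff .
    ultimately have q: "Factorial_Ring.prime q" "int q dvd b" using ab(2) by simp_all
    interpret rational_prime q by unfold_locales (rule q)
    have "\<not> int q dvd a"
    proof
      assume "int q dvd a"
      from coprime_common_divisor[OF ab(3) this q(2)] show False using prime_gt_1_nat[OF q(1)] by simp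
    qed
    hence va: "Q.v (of_int a) = 1" using of_int_mem_Pp by (intro Q.v_notP) (auto simp: Oint_Rats)
    have "Q.v z \<le> 1" using assms(2)[OF q(1)] by (simp add: qint_def Qp_abs_eq)
    moreover have "Q.v (of_int a) = Q.v z * Q.v (of_int b)"
      using ab(2) assms(1) by (subst Q.v_mult[symmetric]) (auto simp: z)
    moreover have "Q.v (of_int b) \<le> 1 / 2" using q(2) of_int_mem_Pp by (intro Q.v_P_le) auto
    ultimately have "1 \<le> 1 * (1 / 2 :: real)" using va mult_mono[of "Q.v z" 1 "Q.v (of_int b)" "1 / 2"] by simp
    thus ?thesis by simp
  qed (simp add: z)
qed

context local_place
begin

lemma qint_iff_v: "z \<in> \<rat> \<Longrightarrow> qint z \<longleftrightarrow> v z \<le> 1"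
  using e_ge_1 powr_mono2[of e "Qp_abs p z" 1] powr_less_mono2[of e 1 "Qp_abs p z"] Qv.v_nonneg[of z]
  by (auto simp: qint_def v_rat not_le[symmetric])

lemma local_trace_props:
  assumes "\<xi> \<in> carrier W.L"
  shows "local_trace (simple_ext l) (padic_abs (simple_ext l) P) p \<xi> \<in> carrier (Qp p)"
    and "\<iota> (local_trace (simple_ext l) (padic_abs (simple_ext l) P) p \<xi>) = B.tr \<xi>"
proof -
  have eq: "ext_trace W.L (\<iota> ` carrier (Qp p)) \<xi> = B.tr \<xi>"
    unfolding F_def[symmetric] by (rule ext_trace_eq[OF B.field_basis_axioms assms])
  obtain y where y: "y \<in> carrier (Qp p)" "\<iota> y = B.tr \<xi>" using B.tr_F[OF assms] unfolding F_def by auto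
  have "local_trace (simple_ext l) (padic_abs (simple_ext l) P) p \<xi> = y"
    unfolding local_trace_def eq using y iota_inj by (intro the_equality) (auto dest: inj_onD)
  thus "local_trace (simple_ext l) (padic_abs (simple_ext l) P) p \<xi> \<in> carrier (Qp p)"
    "\<iota> (local_trace (simple_ext l) (padic_abs (simple_ext l) P) p \<xi>) = B.tr \<xi>" using y by simp_all
qed

text \<open>The two absolute values differ by the positive exponent \<open>e\<close>, so being at
  most 1 can be tested in the local field. All later work with fractional parts takes place
  there.\<close>

lemma Zp_iff:
  assumes "y \<in> carrier (Qp p)" "r \<in> \<rat>"
  shows "y \<ominus>\<^bsub>Qp p\<^esub> Qv.emb r \<in> Zp p \<longleftrightarrow> W.labs (\<iota> y -\<^sub>L W.emb r) \<le> 1"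
proof -
  obtain q where q: "q \<in> Qv.Cau" "y = Qv.cls q" using assms(1) unfolding Qp_carrier by blast
  have W: "q \<in> W.Cau" "(\<lambda>_. r) \<in> W.Cau" "(\<lambda>_. r) \<in> Qv.Cau"
    using q Cau_Rats assms(2) Rats_subset_K W.Cau_const Qv.Cau_const by blast+
  have d: "(\<lambda>m. q m - r) \<in> Qv.Cau" using q W by (intro Qv.Cau_diff)
  have "W.labs (\<iota> y -\<^sub>L W.emb r) = Qv.labs (Qv.cls (\<lambda>m. q m - r)) powr e"
    unfolding q iota_cls[OF q(1)] W.emb_cls W.L_diff[OF W(1,2)] by (rule labs_Rats[OF d])
  moreover have "y \<ominus>\<^bsub>Qp p\<^esub> Qv.emb r = Qv.cls (\<lambda>m. q m - r)"
    unfolding q Qv.emb_cls Qp_def using q W by (intro Qv.L_diff)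
  moreover have "Qv.cls (\<lambda>m. q m - r) \<in> carrier Qv.L" using d by simp
  moreover have "x powr e \<le> 1 \<longleftrightarrow> x \<le> 1" if "x \<ge> 0" for x
    using e_ge_1 powr_mono2[of e x 1] powr_less_mono2[of e 1 x] that by (auto simp: not_le[symmetric])
  ultimately show ?thesis unfolding Zp_def Qp_def using Qv.labs_nonneg by auto
qed

definition pfrac :: "real \<Rightarrow> bool" where "pfrac r \<longleftrightarrow> (\<exists>(a::int) k::nat. r = of_int a / of_nat p ^ k)"

lemma pfrac_Rats: "pfrac r \<Longrightarrow> (of_real r :: complex) \<in> \<rat>"
  unfolding pfrac_def by auto

text \<open>Two fractions with p-power denominator that approximate \<open>f\<close> up to integral
  error differ by a p-integral fraction of the same kind. Values of \<open>lam\<close> are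
  determined modulo integers by this test.\<close>

lemma pfrac_cong:
  assumes "pfrac r" "pfrac r'" "f \<in> F"
    and "W.labs (f -\<^sub>L W.emb (of_real r)) \<le> 1" "W.labs (f -\<^sub>L W.emb (of_real r')) \<le> 1"
  shows "r - r' \<in> \<int>"
proof -
  obtain a a' :: int and k k' where a: "r = of_int a / of_nat p ^ k" "r' = of_int a' / of_nat p ^ k'"
    using assms(1,2) unfolding pfrac_def by blast
  have rQ: "(of_real r :: complex) \<in> \<rat>" "(of_real r' :: complex) \<in> \<rat>" using assms(1,2) pfrac_Rats by blast+
  have rK: "of_real r \<in> K" "of_real r' \<in> K" using rQ Rats_subset_K by blast+
  have rL: "W.emb (of_real r) \<in> carrier W.L" "W.emb (of_real r') \<in> carrier W.L" using rK by simp_all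
  have fL: "f \<in> carrier W.L" using assms(3) F_carrier by blast
  have "W.emb (of_real r - of_real r') = (f -\<^sub>L W.emb (of_real r')) -\<^sub>L (f -\<^sub>L W.emb (of_real r))"
    unfolding W.emb_diff[OF rK] using rL fL
    by (simp add: L.minus_eq L.minus_add L.a_ac L.r_neg L.r_neg2 L.r_neg1)
  moreover have "W.labs ((f -\<^sub>L W.emb (of_real r')) -\<^sub>L (f -\<^sub>L W.emb (of_real r))) \<le> 1"
    using assms(4,5) fL rL by (intro labs_diff_ultra[of "f -\<^sub>L _" "f -\<^sub>L _"]) simp_all
  ultimately have "v (of_real r - of_real r') \<le> 1" using W.labs_emb[OF diff_K[OF rK]] by simp
  hence "qint (of_real (r - r'))" using rQ qint_iff_v[of "of_real (r - r')"] by simp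
  thus ?thesis unfolding a by (rule p_fraction_integral)
qed

text \<open>A fraction approximating the trace exists, and reducing its numerator modulo
  \<open>p ^ k\<close> moves it into [0, 1). Any two candidates in that interval differ by an
  integer of absolute value below 1, so the description is unique.\<close>

lemma padic_frac_props:
  assumes "\<xi> \<in> carrier W.L"
  shows "pfrac (padic_frac p (local_trace (simple_ext l) (padic_abs (simple_ext l) P) p \<xi>))"
    and "W.labs (B.tr \<xi> -\<^sub>L W.emb (of_real (padic_frac p (local_trace (simple_ext l) (padic_abs (simple_ext l) P) p \<xi>)))) \<le> 1"
proof -
  define y where "y = local_trace (simple_ext l) (padic_abs (simple_ext l) P) p \<xi>"
  have y: "y \<in> carrier (Qp p)" "\<iota> y = B.tr \<xi>" unfolding y_def using local_trace_props[OF assms] by blast+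
  have trF: "B.tr \<xi> \<in> F" "B.tr \<xi> \<in> carrier W.L" using B.tr_F[OF assms] F_carrier by blast+
  define Pr where "Pr r \<longleftrightarrow> 0 \<le> r \<and> r < 1 \<and> pfrac r \<and> W.labs (B.tr \<xi> -\<^sub>L W.emb (of_real r)) \<le> 1" for r
  have Pr_iff: "(0 \<le> r \<and> r < 1 \<and> (\<exists>(a::int) k::nat. r = of_int a / of_nat p ^ k) \<and>
      y \<ominus>\<^bsub>Qp p\<^esub> Qv.emb (of_real r) \<in> Zp p) \<longleftrightarrow> Pr r" for r
    unfolding Pr_def pfrac_def[symmetric] using Zp_iff[OF y(1) pfrac_Rats] y(2) by auto
  \<comment> \<open>Precision \<open>(1 / 2) ^ 0 = 1\<close> is enough: only the integrality of the
    difference matters.\<close>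
  obtain k and a :: int where a: "W.labs (B.tr \<xi> -\<^sub>L W.emb (of_int a / of_nat p ^ k)) \<le> (1 / 2) ^ 0"
    using F_rat_approx[OF trF(1)] by blast
  define r where "r = (of_int (a mod int p ^ k) / of_nat p ^ k :: real)"
  have "Pr r"
  proof -
    have "0 \<le> a mod int p ^ k" "a mod int p ^ k < int p ^ k" by simp_all
    hence "of_int (a mod int p ^ k) < (of_int (int p ^ k) :: real)" "0 \<le> (of_int (a mod int p ^ k) :: real)"
      by (simp_all only: of_int_less_iff of_int_0_le_iff)
    hence "0 \<le> r" "r < 1" unfolding r_def by simp_all
    moreover have "pfrac r" unfolding pfrac_def r_def by blast
    moreover have "W.labs (B.tr \<xi> -\<^sub>L W.emb (of_real r)) \<le> 1"
    proof -
      define b where "b = a div int p ^ k"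
      have "a = b * int p ^ k + a mod int p ^ k" unfolding b_def by (simp only: div_mult_mod_eq)
      hence "(of_int a :: complex) = of_int (b * int p ^ k + a mod int p ^ k)" by presburger
      also have "\<dots> = of_int b * of_nat p ^ k + of_int (a mod int p ^ k)" by simp
      finally have "of_int a / of_nat p ^ k = (of_int b * of_nat p ^ k + of_int (a mod int p ^ k)) / (of_nat p ^ k :: complex)"
        by presburger
      hence eq: "of_int a / of_nat p ^ k = (of_real r + of_int b :: complex)"
        unfolding r_def by (simp add: add_divide_distrib)
      have rK: "of_real r \<in> K" "of_int b \<in> K" using Rats_subset_K[OF pfrac_Rats[OF \<open>pfrac r\<close>]] of_int_K by auto
      have "B.tr \<xi> -\<^sub>L W.emb (of_real r) = (B.tr \<xi> -\<^sub>L W.emb (of_int a / of_nat p ^ k)) +\<^sub>L W.emb (of_int b)"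
        unfolding eq using rK trF by (simp add: W.emb_add L.minus_eq L.minus_add L.a_assoc L.l_neg)
      thus ?thesis using a trF rK add_K[OF rK] V.v_Oint_le[OF Oint_of_int[of b]] unfolding eq by (auto intro!: labs_ultra)
    qed
    ultimately show ?thesis unfolding Pr_def by blast
  qed
  moreover have "r' = r" if "Pr r'" for r'
  proof -
    have "r' - r \<in> \<int>" using that \<open>Pr r\<close> trF unfolding Pr_def by (intro pfrac_cong) auto
    moreover have "\<bar>r' - r\<bar> < 1" using that \<open>Pr r\<close> unfolding Pr_def by auto
    ultimately show ?thesis using Ints_nonzero_abs_ge1[of "r' - r"] by force
  qed
  ultimately have "padic_frac p y = r" unfolding padic_frac_def Pr_iff by (rule the_equality)
  thus "pfrac (padic_frac p y)" "W.labs (B.tr \<xi> -\<^sub>L W.emb (of_real (padic_frac p y))) \<le> 1"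
    using \<open>Pr r\<close> unfolding Pr_def by auto
qed

abbreviation lam :: "(nat \<Rightarrow> complex) set \<Rightarrow> real" where "lam \<equiv> Lam (simple_ext l) (Fin_place P)"

lemma lam_eq: "lam \<xi> = padic_frac p (local_trace (simple_ext l) (padic_abs (simple_ext l) P) p \<xi>)"
proof -
  have "(THE p::nat. Factorial_Ring.prime p \<and> of_nat p \<in> P) = p"
    using Pl_prime_number[OF P_Pl] prime_p p_P by (intro the1_equality) auto
  thus ?thesis by (simp add: place_abs_Fin Let_def)
qed

lemma lam_pfrac: "\<xi> \<in> carrier W.L \<Longrightarrow> pfrac (lam \<xi>)"
  and lam_tr: "\<xi> \<in> carrier W.L \<Longrightarrow> W.labs (B.tr \<xi> -\<^sub>L W.emb (of_real (lam \<xi>))) \<le> 1"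
  unfolding lam_eq by (rule padic_frac_props; assumption)+

text \<open>Fractional parts add only modulo integers. Both expressions are fractions that
  approximate the trace of the sum, so \<open>pfrac_cong\<close> applies.\<close>

lemma lam_add:
  assumes "\<xi> \<in> carrier W.L" "\<zeta> \<in> carrier W.L"
  shows "lam (\<xi> +\<^sub>L \<zeta>) - (lam \<xi> + lam \<zeta>) \<in> \<int>"
proof (rule pfrac_cong)
  show "pfrac (lam (\<xi> +\<^sub>L \<zeta>))" using assms by (intro lam_pfrac) simp
  obtain a a' :: int and k k' where a: "lam \<xi> = of_int a / of_nat p ^ k" "lam \<zeta> = of_int a' / of_nat p ^ k'"
    using lam_pfrac assms unfolding pfrac_def by metis
  have "lam \<xi> + lam \<zeta> = of_int (a * int p ^ k' + a' * int p ^ k) / of_nat p ^ (k + k')"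
    unfolding a by (simp add: add_frac_eq power_add)
  thus "pfrac (lam \<xi> + lam \<zeta>)" unfolding pfrac_def by blast
  show "B.tr (\<xi> +\<^sub>L \<zeta>) \<in> F" "W.labs (B.tr (\<xi> +\<^sub>L \<zeta>) -\<^sub>L W.emb (of_real (lam (\<xi> +\<^sub>L \<zeta>)))) \<le> 1"
    using assms B.tr_F lam_tr by simp_all
  have K: "of_real (lam \<xi>) \<in> K" "of_real (lam \<zeta>) \<in> K"
    using lam_pfrac[OF assms(1)] lam_pfrac[OF assms(2)] pfrac_Rats Rats_subset_K by blast+
  have T: "B.tr \<xi> \<in> carrier W.L" "B.tr \<zeta> \<in> carrier W.L" using assms B.tr_F F_carrier by blast+
  have "B.tr (\<xi> +\<^sub>L \<zeta>) -\<^sub>L W.emb (of_real (lam \<xi> + lam \<zeta>))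
      = (B.tr \<xi> -\<^sub>L W.emb (of_real (lam \<xi>))) +\<^sub>L (B.tr \<zeta> -\<^sub>L W.emb (of_real (lam \<zeta>)))"
    unfolding B.tr_add[OF assms] of_real_add W.emb_add[OF K] using T W.emb_L[OF K(1)] W.emb_L[OF K(2)]
    by (simp add: L.minus_eq L.minus_add L.a_ac)
  also have "W.labs \<dots> \<le> 1" using lam_tr assms T W.emb_L[OF K(1)] W.emb_L[OF K(2)] by (intro labs_ultra) auto
  finally show "W.labs (B.tr (\<xi> +\<^sub>L \<zeta>) -\<^sub>L W.emb (of_real (lam \<xi> + lam \<zeta>))) \<le> 1" .
qed

lemma lam_small: "\<exists>\<delta>>0. \<forall>\<xi>\<in>carrier W.L. W.labs \<xi> \<le> \<delta> \<longrightarrow> lam \<xi> \<in> \<int>"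
proof -
  obtain \<delta> where \<delta>: "\<delta> > 0" "\<And>\<xi>. \<xi> \<in> carrier W.L \<Longrightarrow> W.labs \<xi> \<le> \<delta> \<Longrightarrow> W.labs (B.tr \<xi>) \<le> 1"
    using tr_small by blast
  have "lam \<xi> - 0 \<in> \<int>" if xi: "\<xi> \<in> carrier W.L" "W.labs \<xi> \<le> \<delta>" for \<xi>
  proof (rule pfrac_cong)
    have T: "B.tr \<xi> \<in> carrier W.L" using xi B.tr_F F_carrier by blast
    show "pfrac 0" unfolding pfrac_def by (intro exI[of _ 0]) simp
    show "W.labs (B.tr \<xi> -\<^sub>L W.emb (of_real 0)) \<le> 1"
      using \<delta>(2)[OF xi] T by (simp add: W.L_zero[symmetric] L.minus_eq)
  qed (use xi lam_pfrac lam_tr B.tr_F in auto)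
  thus ?thesis using \<delta>(1) by auto
qed

end

section \<open>The reciprocity law\<close>

context integer_matrix
begin

lemma Pl_local_place:
  assumes "P \<in> Pl" obtains t p where "local_place A n l u P t p"
proof -
  obtain t where t: "prime_place K P t" using Pl_prime_place[OF assms] .
  obtain p :: nat where p: "Factorial_Ring.prime p" "of_nat p \<in> P" using Pl_prime_number[OF assms] by blast
  have "local_place A n l u P t p"
    using t p assms integer_matrix_axioms
    by (intro local_place.intro local_place_axioms.intro rational_prime.intro) auto
  thus thesis by (rule that)
qed

lemma Pl_local_place':
  assumes "P \<in> Pl" "Factorial_Ring.prime p" "of_nat p \<in> P" obtains t where "local_place A n l u P t p"
proof -
  obtain t where t: "prime_place K P t" using Pl_prime_place[OF assms(1)] .
  have "local_place A n l u P t p"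
    using t assms integer_matrix_axioms
    by (intro local_place.intro local_place_axioms.intro rational_prime.intro) auto
  thus thesis by (rule that)
qed

text \<open>Modulo \<open>q\<close> the powers of \<open>l\<close> become periodic. At an exponent
  that is a multiple of the period and lies beyond the preperiod, doubling the exponent does not
  change the residue.\<close>

lemma power_idempotent:
  assumes "q > (0::nat)"
  obtains M g where "M \<ge> B" "g \<in> Oint" "(1 - l ^ M) * l ^ M = of_nat q * g"
proof -
  obtain i j where ij: "i < j" "\<exists>z\<in>Oint. l ^ j - l ^ i = of_nat q * z"
    using residue_pigeonhole[of "of_nat q" "\<lambda>k. l ^ k"] assms Oint_of_nat Oint_power by auto
  then obtain z where z: "z \<in> Oint" "l ^ j - l ^ i = of_nat q * z" by blast
  define d where "d = j - i"
  have step: "\<exists>g\<in>Oint. l ^ (m + d * k) - l ^ m = of_nat q * g" if "m \<ge> i" for m k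
  proof (induction k)
    case (Suc k)
    then obtain g where g: "g \<in> Oint" "l ^ (m + d * k) - l ^ m = of_nat q * g" by blast
    define c where "c = m + d * k - i"
    have mk: "m + d * k = c + i" "m + d * Suc k = c + j" using that ij by (auto simp: c_def d_def)
    have "l ^ (m + d * Suc k) - l ^ m = l ^ c * (l ^ j - l ^ i) + (l ^ (m + d * k) - l ^ m)"
      unfolding mk by (simp add: power_add algebra_simps)
    also have "\<dots> = of_nat q * (l ^ c * z + g)" unfolding z(2) g(2) by (simp add: algebra_simps)
    finally show ?case using z g by (intro bexI[of _ "l ^ c * z + g"] Oint_add Oint_mult Oint_power) auto
  qed (auto intro: bexI[of _ 0] simp: Oint_of_nat[of 0, simplified])
  \<comment> \<open>A multiple of the period \<open>d\<close> that exceeds both the preperiod bound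
    \<open>i\<close> and the requested \<open>B\<close>; \<open>M + M\<close> then lies a whole
    number of periods beyond \<open>M\<close>.\<close>
  define M where "M = d * (i + B)"
  have d: "d > 0" using ij by (simp add: d_def)
  hence "1 * (i + B) \<le> d * (i + B)" by (intro mult_right_mono) auto
  hence "i + B \<le> M" unfolding M_def mult_1 .
  hence M: "M \<ge> i" "M \<ge> B" by simp_all
  obtain g where g: "g \<in> Oint" "l ^ (M + d * (i + B)) - l ^ M = of_nat q * g" using step[OF M(1)] by blast
  have "(1 - l ^ M) * l ^ M = - (l ^ (M + M) - l ^ M)" by (simp add: power_add algebra_simps)
  also have "\<dots> = of_nat q * (- g)" using g(2) unfolding M_def[symmetric] by simp
  finally show thesis using g(1) M(2) by (intro that[of M "- g"] Oint_uminus) auto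
qed

text \<open>A high power of \<open>q\<close> absorbs the \<open>q\<close>-part of a denominator of
  \<open>x\<close>; the remaining trace is that of an algebraic integer.\<close>

lemma Tr_qint:
  assumes x: "x \<in> K" and q: "Factorial_Ring.prime q"
  shows "\<exists>s0. \<forall>s\<ge>s0. \<forall>y\<in>Oint. rational_prime.qint q (Tr (x * (of_nat q ^ s * y)))"
proof -
  interpret rational_prime q by unfold_locales (rule q)
  obtain D where D: "D > (0::nat)" "of_nat D * x \<in> Oint" using common_denominator[of "{x}"] x by auto
  have vD: "Q.v (of_nat D) > 0" using D(1) by simp
  have vq: "Q.v (of_nat q) \<le> 1 / 2" using of_int_mem_Pp[of "int q"] by (intro Q.v_P_le) auto
  obtain s0 where s0: "(1 / 2) ^ s0 \<le> Q.v (of_nat D)" using real_arch_pow_inv[OF vD, of "1 / 2"] by (auto intro: less_imp_le)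
  have "qint (Tr (x * (of_nat q ^ s * y)))" if "s \<ge> s0" "y \<in> Oint" for s y
  proof -
    have y: "of_nat q ^ s * y \<in> Oint" "x * y \<in> K" "x * (of_nat q ^ s * y) \<in> K"
      using Oint_K[OF that(2)] that(2) x by (auto intro!: Oint_mult Oint_power Oint_of_nat mult_K power_K of_nat_K)
    have Dy: "of_nat D * x * y \<in> Oint" by (rule Oint_mult[OF D(2) that(2)])
    have "of_nat (q ^ s) * Tr (of_nat D * x * y) = Tr (of_nat (q ^ s) * (of_nat D * x * y))"
      by (rule Tr_of_nat_mult[symmetric, OF Oint_K[OF Dy]])
    also have "of_nat (q ^ s) * (of_nat D * x * y) = of_nat D * (x * (of_nat q ^ s * y))" by simp
    also have "Tr \<dots> = of_nat D * Tr (x * (of_nat q ^ s * y))" by (rule Tr_of_nat_mult[OF y(3)])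
    finally have eq: "of_nat (q ^ s) * Tr (of_nat D * x * y) = of_nat D * Tr (x * (of_nat q ^ s * y))" .
    have TQ: "Tr (x * (of_nat q ^ s * y)) \<in> \<rat>" by (rule Tr_rational[OF y(3)])
    have TZ: "Tr (of_nat D * x * y) \<in> \<int>" by (rule Tr_Oint[OF Dy])
    have "Q.v (of_nat D) * Q.v (Tr (x * (of_nat q ^ s * y))) = Q.v (of_nat (q ^ s) * Tr (of_nat D * x * y))"
      unfolding eq using TQ by (simp add: Q.v_mult)
    also have "\<dots> = Q.v (of_nat q) ^ s * Q.v (Tr (of_nat D * x * y))"
      using TZ Ints_subset_Rats by (subst Q.v_mult) (auto simp: Q.v_power)
    also have "\<dots> \<le> (1 / 2) ^ s * 1"
      using vq Q.v_Oint_le[of "Tr (of_nat D * x * y)"] TZ by (intro mult_mono power_mono) (auto simp: Oint_Rats)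
    also have "\<dots> \<le> (1 / 2) ^ s0" using that power_decreasing[of s0 s "1 / 2 :: real"] by simp
    also have "\<dots> \<le> Q.v (of_nat D) * 1" using s0 by simp
    finally have "Q.v (Tr (x * (of_nat q ^ s * y))) \<le> 1" by (simp only: mult_le_cancel_left_pos[OF vD])
    thus ?thesis unfolding qint_def Qp_abs_eq using TQ by blast
  qed
  thus ?thesis by blast
qed

lemma finite_max_nat:
  assumes "finite S" "\<And>s. s \<in> S \<Longrightarrow> \<exists>N0. \<forall>N\<ge>N0. R s (N::nat)"
  shows "\<exists>N0. \<forall>N\<ge>N0. \<forall>s\<in>S. R s N"
proof -
  have "\<forall>\<^sub>F N in sequentially. R s N" if "s \<in> S" for s
    using assms(2)[OF that] unfolding eventually_sequentially .
  hence "\<forall>\<^sub>F N in sequentially. \<forall>s\<in>S. R s N" by (intro eventually_ball_finite[OF assms(1)]) blast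
  thus ?thesis unfolding eventually_sequentially .
qed

text \<open>
  Modulo \<open>q\<close>-integral numbers, the idempotent-like elements \<open>(1 - l ^ M) * \<delta> P\<close> split the trace into
  local contributions; those of the primes not above \<open>q\<close> vanish.
\<close>

lemma sum_lam_local:
  assumes x: "x \<in> K" and xl: "\<And>m. m \<ge> M0 \<Longrightarrow> Tr (x * l ^ m) \<in> \<int>" and q: "Factorial_Ring.prime q"
  shows "rational_prime.qint q ((\<Sum>P\<in>Pl. of_real (Lam K (Fin_place P) (completion_embed K (padic_abs K P) x))) - Tr x)"
proof -
  interpret R: rational_prime q by unfold_locales (rule q)
  let ?lam = "\<lambda>P. complex_of_real (Lam K (Fin_place P) (completion_embed K (padic_abs K P) x))"
  \<comment> \<open>\<open>good P s\<close> states the conclusion of \<open>tr_Tr\<close> modulo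
    \<open>q\<close>-integral numbers, with the local value in place of the local trace. It persists
    for larger \<open>s\<close>, so one \<open>s\<close> serves all primes above
    \<open>q\<close>.\<close>
  define good where "good P s \<longleftrightarrow> (\<forall>N \<epsilon>. \<epsilon> \<in> Oint \<longrightarrow> padic_abs K P (1 - \<epsilon>) \<le> (1 / 2) ^ s \<longrightarrow>
    (\<forall>z\<in>Oint. padic_abs K P z \<le> (1 / 2) ^ N \<longrightarrow> (\<exists>y\<in>Oint. \<epsilon> * z = of_nat q ^ s * y)) \<longrightarrow>
    R.qint (?lam P - Tr (x * \<epsilon>)))" for P s
  have good: "\<exists>s0. \<forall>s\<ge>s0. good P s" if P: "P \<in> Pl" "of_nat q \<in> P" for P
  proof -
    obtain t where "local_place A n l u P t q" using Pl_local_place'[OF P(1) q P(2)] .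
    then interpret LP: local_place A n l u P t q .
    obtain s0 where s0: "\<And>N \<epsilon>. \<epsilon> \<in> Oint \<Longrightarrow> padic_abs K P (1 - \<epsilon>) \<le> (1 / 2) ^ s0 \<Longrightarrow>
      (\<forall>z\<in>Oint. padic_abs K P z \<le> (1 / 2) ^ N \<longrightarrow> (\<exists>y\<in>Oint. \<epsilon> * z = of_nat q ^ s0 * y)) \<Longrightarrow>
      LP.W.labs (LP.B.tr (LP.W.emb x) \<ominus>\<^bsub>LP.W.L\<^esub> LP.W.emb (Tr (x * \<epsilon>))) \<le> 1"
      using LP.tr_Tr[OF x] by blast
    have "good P s" if s: "s \<ge> s0" for s
      unfolding good_def
    proof (intro allI impI)
      fix N \<epsilon>
      assume \<epsilon>: "\<epsilon> \<in> Oint" "padic_abs K P (1 - \<epsilon>) \<le> (1 / 2) ^ s"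
        "\<forall>z\<in>Oint. padic_abs K P z \<le> (1 / 2) ^ N \<longrightarrow> (\<exists>y\<in>Oint. \<epsilon> * z = of_nat q ^ s * y)"
      have 1: "padic_abs K P (1 - \<epsilon>) \<le> (1 / 2) ^ s0"
        by (intro order_trans[OF \<epsilon>(2) power_decreasing[OF s]]) auto
      have 2: "\<exists>y\<in>Oint. \<epsilon> * z = of_nat q ^ s0 * y" if z: "z \<in> Oint" "padic_abs K P z \<le> (1 / 2) ^ N" for z
      proof -
        obtain y where y: "y \<in> Oint" "\<epsilon> * z = of_nat q ^ s * y" using \<epsilon>(3) z by blast
        have "(of_nat q ^ s :: complex) = of_nat q ^ s0 * of_nat q ^ (s - s0)" using s by (simp add: power_add[symmetric])
        thus ?thesis using y by (intro bexI[of _ "of_nat q ^ (s - s0) * y"] Oint_mult Oint_power Oint_of_nat) auto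
      qed
      let ?T = "LP.B.tr (LP.W.emb x)"
      have T: "?T \<in> carrier LP.W.L" using LP.B.tr_F[of "LP.W.emb x"] x LP.F_carrier by simp
      have TK: "Tr (x * \<epsilon>) \<in> \<rat>" by (rule Tr_rational[OF mult_K[OF x Oint_K[OF \<epsilon>(1)]]])
      have lQ: "?lam P \<in> \<rat>" using LP.pfrac_Rats[OF LP.lam_pfrac[of "LP.W.emb x"]] x by simp
      note KK = Rats_subset_K[OF TK] Rats_subset_K[OF lQ]
      have "LP.W.emb (?lam P - Tr (x * \<epsilon>)) = (?T \<ominus>\<^bsub>LP.W.L\<^esub> LP.W.emb (Tr (x * \<epsilon>))) \<ominus>\<^bsub>LP.W.L\<^esub> (?T \<ominus>\<^bsub>LP.W.L\<^esub> LP.W.emb (?lam P))"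
        unfolding LP.W.emb_diff[OF KK(2,1)] using T LP.W.emb_L[OF KK(1)] LP.W.emb_L[OF KK(2)]
        by (simp add: LP.L.minus_eq LP.L.minus_add LP.L.a_ac LP.L.r_neg LP.L.r_neg2 LP.L.r_neg1)
      moreover have "LP.W.labs \<dots> \<le> 1"
        using s0[OF \<epsilon>(1) 1, of N] 2 LP.lam_tr[of "LP.W.emb x"] x T LP.W.emb_L[OF KK(1)] LP.W.emb_L[OF KK(2)]
        by (intro LP.labs_diff_ultra[of "?T \<ominus>\<^bsub>LP.W.L\<^esub> _" "?T \<ominus>\<^bsub>LP.W.L\<^esub> _"]) auto
      ultimately have "LP.V.v (?lam P - Tr (x * \<epsilon>)) \<le> 1" using LP.W.labs_emb[OF diff_K[OF KK(2,1)]] by simp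
      thus "R.qint (?lam P - Tr (x * \<epsilon>))" using LP.qint_iff_v[of "?lam P - Tr (x * \<epsilon>)"] lQ TK by simp
    qed
    thus ?thesis by blast
  qed
  have "\<exists>s1. \<forall>s\<ge>s1. \<forall>P\<in>{P \<in> Pl. of_nat q \<in> P}. good P s"
    using good by (intro finite_max_nat) auto
  then obtain s1 where s1: "\<And>s P. s \<ge> s1 \<Longrightarrow> P \<in> Pl \<Longrightarrow> of_nat q \<in> P \<Longrightarrow> good P s" by blast
  obtain s2 where s2: "\<And>s y. s \<ge> s2 \<Longrightarrow> y \<in> Oint \<Longrightarrow> R.qint (Tr (x * (of_nat q ^ s * y)))"
    using Tr_qint[OF x q] by blast
  define s where "s = max s1 s2"
  have s: "\<And>P. P \<in> Pl \<Longrightarrow> of_nat q \<in> P \<Longrightarrow> good P s" "\<And>y. y \<in> Oint \<Longrightarrow> R.qint (Tr (x * (of_nat q ^ s * y)))"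
    using s1[of s] s2[of s] by (auto simp: s_def)
  obtain M g where M: "M \<ge> max M0 s" "g \<in> Oint" "(1 - l ^ M) * l ^ M = of_nat (q ^ s) * g"
    using power_idempotent[of "q ^ s" "max M0 s"] by auto
  have lO: "1 - l ^ M \<in> Oint" using Oint_of_nat[of 1] by (intro Oint_diff Oint_power) auto
  have "\<exists>N0. \<forall>N\<ge>N0. \<forall>P\<in>Pl. (1 / 2) ^ N \<le> padic_abs K P l ^ M"
  proof (rule finite_max_nat)
    fix P assume "P \<in> Pl"
    then obtain t where "prime_place K P t" by (rule Pl_prime_place)
    then interpret V: prime_place K P t .
    have "V.v l ^ M > 0" by simp
    then obtain N0 where N0: "(1 / 2) ^ N0 < V.v l ^ M" using real_arch_pow_inv[of "V.v l ^ M" "1 / 2"] by auto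
    have "(1 / 2) ^ N \<le> V.v l ^ M" if "N \<ge> N0" for N
      using power_decreasing[OF that, of "1 / 2 :: real"] N0 by linarith
    thus "\<exists>N0. \<forall>N\<ge>N0. (1 / 2) ^ N \<le> V.v l ^ M" by blast
  qed simp
  then obtain N0 where N0: "\<And>N P. N \<ge> N0 \<Longrightarrow> P \<in> Pl \<Longrightarrow> (1 / 2) ^ N \<le> padic_abs K P l ^ M" by blast
  define N where "N = max N0 s"
  \<comment> \<open>An integer small at every prime dividing \<open>l\<close> is divisible by
    \<open>l ^ M\<close>, and \<open>1 - l ^ M\<close> converts this factor into
    \<open>q ^ s\<close>. The primes above \<open>q\<close> outside \<open>Pl\<close> are thereby
    taken care of.\<close>
  have small: "\<exists>y\<in>Oint. (1 - l ^ M) * z = of_nat q ^ s * y"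
    if z: "z \<in> Oint" "\<And>P. P \<in> Pl \<Longrightarrow> padic_abs K P z \<le> (1 / 2) ^ N" for z
  proof -
    have "padic_abs K P z \<le> padic_abs K P l ^ M" if "P \<in> Pl" for P
      by (intro order_trans[OF z(2) N0] that) (simp add: N_def)
    then obtain y where y: "y \<in> Oint" "z = l ^ M * y" using Pl_le_power[OF z(1), of M] by blast
    have "(1 - l ^ M) * z = of_nat q ^ s * (g * y)" using M(3) unfolding y(2) by (simp add: mult.assoc[symmetric])
    thus ?thesis using M(2) y(1) Oint_mult by blast
  qed
  have smallT: "R.qint (Tr (x * ((1 - l ^ M) * z)))"
    if "z \<in> Oint" "\<And>P. P \<in> Pl \<Longrightarrow> padic_abs K P z \<le> (1 / 2) ^ N" for z
    using small[OF that] s(2) by auto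
  have "\<exists>\<delta>. \<delta> \<in> Oint \<and> padic_abs K P (1 - \<delta>) \<le> (1 / 2) ^ N \<and> (\<forall>Q\<in>Pl. Q \<noteq> P \<longrightarrow> padic_abs K Q \<delta> \<le> (1 / 2) ^ N)"
    if "P \<in> Pl" for P using crt_idempotent[OF that, of N] by metis
  then obtain \<delta> where \<delta>: "\<forall>P\<in>Pl. \<delta> P \<in> Oint \<and> padic_abs K P (1 - \<delta> P) \<le> (1 / 2) ^ N \<and>
      (\<forall>Q\<in>Pl. Q \<noteq> P \<longrightarrow> padic_abs K Q (\<delta> P) \<le> (1 / 2) ^ N)"
    using bchoice[of Pl "\<lambda>P \<delta>. \<delta> \<in> Oint \<and> padic_abs K P (1 - \<delta>) \<le> (1 / 2) ^ N \<and> (\<forall>Q\<in>Pl. Q \<noteq> P \<longrightarrow> padic_abs K Q \<delta> \<le> (1 / 2) ^ N)"] by blast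
  have \<delta>O: "\<delta> P \<in> Oint" if "P \<in> Pl" for P using \<delta> that by blast
  have \<delta>small: "padic_abs K Q (\<delta> P) \<le> (1 / 2) ^ N" if "P \<in> Pl" "Q \<in> Pl" "Q \<noteq> P" for P Q using \<delta> that by blast
  have \<delta>1: "padic_abs K P (1 - \<delta> P) \<le> (1 / 2) ^ N" if "P \<in> Pl" for P using \<delta> that by blast
  have \<delta>z: "padic_abs K Q (\<delta> P * z) \<le> (1 / 2) ^ N"
    if PQ: "P \<in> Pl" "Q \<in> Pl" and z: "z \<in> Oint" "padic_abs K P z \<le> (1 / 2) ^ N" for P Q z
  proof -
    obtain t where "prime_place K Q t" using PQ(2) by (rule Pl_prime_place)
    then interpret V: prime_place K Q t .
    note m = V.v_mult[OF Oint_K[OF \<delta>O[OF PQ(1)]] Oint_K[OF z(1)]]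
    show ?thesis
    proof (cases "Q = P")
      case True
      thus ?thesis unfolding m using mult_mono[OF V.v_Oint_le[OF \<delta>O[OF PQ(1)]] z(2)[folded True]] V.v_nonneg[of z] True by simp
    next
      case False
      thus ?thesis unfolding m using mult_mono[OF \<delta>small[OF PQ] V.v_Oint_le[OF z(1)]] by simp
    qed
  qed
  \<comment> \<open>The defect of the approximate partition of unity: it is small at every prime
    dividing \<open>l\<close>.\<close>
  define \<delta>0 where "\<delta>0 = 1 - (\<Sum>P\<in>Pl. \<delta> P)"
  have \<delta>0O: "\<delta>0 \<in> Oint" unfolding \<delta>0_def using \<delta>O Oint_of_nat[of 1] by (auto intro!: Oint_diff Oint_sum)
  have \<delta>0s: "padic_abs K P \<delta>0 \<le> (1 / 2) ^ N" if P: "P \<in> Pl" for P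
  proof -
    obtain t p where "local_place A n l u P t p" using P by (rule Pl_local_place)
    then interpret LP: local_place A n l u P t p .
    have eq: "\<delta>0 = (1 - \<delta> P) + - (\<Sum>Q\<in>Pl - {P}. \<delta> Q)"
      unfolding \<delta>0_def using P by (simp add: sum.remove)
    have K: "1 - \<delta> P \<in> K" "(\<Sum>Q\<in>Pl - {P}. \<delta> Q) \<in> K"
      using \<delta>O P Oint_K one_K by (auto intro!: diff_K sum_K)
    have "LP.V.v (\<Sum>Q\<in>Pl - {P}. \<delta> Q) \<le> (1 / 2) ^ N"
      using \<delta>O P Oint_K \<delta>small by (intro LP.v_sum_le) auto
    thus ?thesis unfolding eq using \<delta>1[OF P] LP.V.v_minus[OF K(2)] K
      by (intro order_trans[OF LP.V.v_add_le]) (auto intro: uminus_K)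
  qed
  \<comment> \<open>\<open>\<delta> P\<close> singles out \<open>P\<close> among the primes dividing
    \<open>l\<close>; the factor \<open>1 - l ^ M\<close> suppresses the other primes above
    \<open>q\<close>.\<close>
  define \<epsilon> where "\<epsilon> P = (1 - l ^ M) * \<delta> P" for P
  have \<epsilon>O: "\<epsilon> P \<in> Oint" if "P \<in> Pl" for P unfolding \<epsilon>_def using lO \<delta>O[OF that] by (rule Oint_mult)
  have \<epsilon>K: "x * \<epsilon> P \<in> K" if "P \<in> Pl" for P using x Oint_K[OF \<epsilon>O[OF that]] by (rule mult_K)
  have local: "R.qint (?lam P - Tr (x * \<epsilon> P))" if P: "P \<in> Pl" for P
  proof -
    obtain t p where "local_place A n l u P t p" using P by (rule Pl_local_place)
    then interpret LP: local_place A n l u P t p .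
    show ?thesis
    proof (cases "of_nat q \<in> P")
      case True
      have "LP.V.v (1 - \<epsilon> P) \<le> (1 / 2) ^ s"
      proof -
        have eq: "1 - \<epsilon> P = (1 - \<delta> P) + l ^ M * \<delta> P" unfolding \<epsilon>_def by (simp add: algebra_simps)
        have "LP.V.v (l ^ M * \<delta> P) \<le> (1 / 2) ^ M * 1"
          using v_l_le[OF P] LP.V.v_Oint_le[OF \<delta>O[OF P]] Oint_K[OF \<delta>O[OF P]]
          by (simp only: LP.V.v_mult LP.V.v_power l_K power_K) (intro mult_mono power_mono, auto)
        moreover have "(1 / 2 :: real) ^ M \<le> (1 / 2) ^ s" "(1 / 2 :: real) ^ N \<le> (1 / 2) ^ s"
          using M(1) by (auto intro!: power_decreasing simp: N_def)
        moreover have "LP.V.v (1 - \<delta> P + l ^ M * \<delta> P) \<le> max (LP.V.v (1 - \<delta> P)) (LP.V.v (l ^ M * \<delta> P))"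
          using Oint_K[OF \<delta>O[OF P]] by (intro LP.V.v_add_le mult_K diff_K one_K power_K l_K)
        ultimately show ?thesis using \<delta>1[OF P] unfolding eq by linarith
      qed
      moreover have "\<exists>y\<in>Oint. \<epsilon> P * z = of_nat q ^ s * y" if "z \<in> Oint" "LP.V.v z \<le> (1 / 2) ^ N" for z
        using small[of "\<delta> P * z"] \<delta>z[OF P _ that] that \<delta>O[OF P] by (auto simp: \<epsilon>_def mult.assoc intro: Oint_mult)
      ultimately show ?thesis using s(1)[OF P True] \<epsilon>O[OF P] unfolding good_def by blast
    next
      case False
      \<comment> \<open>Here \<open>q\<close> is a unit at \<open>P\<close>. The local value has a
        denominator prime to \<open>q\<close>, and with \<open>1 = q ^ s * h + r ^ N\<close> the
        trace of \<open>x * \<epsilon> P\<close> splits into a part divisible by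
        \<open>q ^ s\<close> and a part that is small at all primes dividing \<open>l\<close>; both
        are \<open>q\<close>-integral.\<close>
      hence "p \<noteq> q" using LP.p_P by auto
      hence "\<not> q dvd p" using primes_dvd_imp_eq[OF q LP.prime_p] by blast
      hence "\<not> q dvd p ^ k" for k using prime_dvd_power[OF q] by blast
      hence "\<not> int q dvd int p ^ k" for k unfolding of_nat_power[symmetric] int_dvd_int_iff .
      moreover obtain a :: int and k where "Lam K (Fin_place P) (LP.W.emb x) = of_int a / of_nat p ^ k"
        using LP.lam_pfrac[of "LP.W.emb x"] x unfolding LP.pfrac_def by auto
      ultimately have 1: "R.qint (?lam P)"
        using R.qint_coprime_denominator[of "int p ^ k" a] by simp
      have qs: "of_nat (q ^ s) \<in> Oint" "of_nat (q ^ s) \<notin> P"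
        using Oint_of_nat LP.V.notP_power[OF Oint_of_nat False] by auto
      obtain r h where rh: "r \<in> P" "h \<in> Oint" "1 - of_nat (q ^ s) * h = r ^ N"
        using LP.V.coprime_power[OF qs, of N] .
      have rO: "r ^ N \<in> Oint" using LP.V.P_Oint[OF rh(1)] by (rule Oint_power)
      have "LP.V.v (r ^ N) \<le> (1 / 2) ^ N"
        using LP.V.v_P_le[OF rh(1)] LP.V.v_power[OF LP.V.P_K[OF rh(1)], of N] by (auto intro: power_mono)
      hence 2: "R.qint (Tr (x * ((1 - l ^ M) * (\<delta> P * r ^ N))))"
        using \<delta>z[OF P _ rO] rO \<delta>O[OF P] by (intro smallT Oint_mult) auto
      have O: "(1 - l ^ M) * \<delta> P * h \<in> Oint" "(1 - l ^ M) * (\<delta> P * r ^ N) \<in> Oint"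
        using lO \<delta>O[OF P] rh(2) rO by (auto intro!: Oint_mult)
      have "x * \<epsilon> P = x * (of_nat q ^ s * ((1 - l ^ M) * \<delta> P * h)) + x * ((1 - l ^ M) * (\<delta> P * r ^ N))"
        unfolding \<epsilon>_def rh(3)[symmetric] by (simp add: algebra_simps)
      also have "Tr \<dots> = Tr (x * (of_nat q ^ s * ((1 - l ^ M) * \<delta> P * h))) + Tr (x * ((1 - l ^ M) * (\<delta> P * r ^ N)))"
        by (intro Tr_add mult_K[OF x] Oint_K[OF O(2)] mult_K[OF _ Oint_K[OF O(1)]] power_K of_nat_K)
      finally have "R.qint (Tr (x * \<epsilon> P))" using s(2)[OF O(1)] 2 R.qint_add by simp
      thus ?thesis using 1 by (intro R.qint_diff)
    qed
  qed
  \<comment> \<open>The decomposition of 1 into \<open>l ^ M\<close>, the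
    \<open>\<epsilon> P\<close> and \<open>(1 - l ^ M) * \<delta>0\<close>. The first contributes an
    integral trace by hypothesis, the last a \<open>q\<close>-integral one.\<close>
  have "x = x * l ^ M + ((\<Sum>P\<in>Pl. x * \<epsilon> P) + x * ((1 - l ^ M) * \<delta>0))"
    unfolding \<epsilon>_def \<delta>0_def by (simp add: algebra_simps sum_distrib_left sum_subtractf)
  hence "Tr x = Tr (x * l ^ M + ((\<Sum>P\<in>Pl. x * \<epsilon> P) + x * ((1 - l ^ M) * \<delta>0)))" by (rule arg_cong)
  also have "\<dots> = Tr (x * l ^ M) + (Tr (\<Sum>P\<in>Pl. x * \<epsilon> P) + Tr (x * ((1 - l ^ M) * \<delta>0)))"
    using \<epsilon>K Oint_K[OF Oint_mult[OF lO \<delta>0O]] x by (simp add: Tr_add simp_implies_def)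
  also have "Tr (\<Sum>P\<in>Pl. x * \<epsilon> P) = (\<Sum>P\<in>Pl. Tr (x * \<epsilon> P))"
    using \<epsilon>K by (intro Tr_sum) (simp add: simp_implies_def)
  finally have "(\<Sum>P\<in>Pl. ?lam P) - Tr x = (\<Sum>P\<in>Pl. ?lam P - Tr (x * \<epsilon> P)) - Tr (x * l ^ M) - Tr (x * ((1 - l ^ M) * \<delta>0))"
    by (simp add: sum_subtractf)
  moreover have "R.qint (Tr (x * l ^ M))" using xl M(1) by (intro R.qint_Ints) auto
  ultimately show ?thesis using local smallT[OF \<delta>0O \<delta>0s] by (simp add: R.qint_diff R.qint_sum)
qed

text \<open>The local statements at all prime numbers combine into integrality; rationality is read
  off at the prime 2.\<close>

lemma sum_lam:
  assumes x: "x \<in> K" and xl: "\<And>m. m \<ge> M0 \<Longrightarrow> Tr (x * l ^ m) \<in> \<int>"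
  shows "(\<Sum>P\<in>Pl. of_real (Lam K (Fin_place P) (completion_embed K (padic_abs K P) x))) - Tr x \<in> \<int>"
proof (rule integral_at_all_primes)
  show "rational_prime.qint q ((\<Sum>P\<in>Pl. of_real (Lam K (Fin_place P) (completion_embed K (padic_abs K P) x))) - Tr x)"
    if "Factorial_Ring.prime q" for q using sum_lam_local[OF x xl that] .
  from rational_prime.qint_Rats[OF rational_prime.intro[OF two_is_prime_nat] sum_lam_local[OF x xl two_is_prime_nat]]
  show "(\<Sum>P\<in>Pl. of_real (Lam K (Fin_place P) (completion_embed K (padic_abs K P) x))) - Tr x \<in> \<rat>" .
qed

end

section \<open>The infinite places\<close>

context integer_matrix
begin

definition conj_emb :: "(complex \<Rightarrow> complex) \<Rightarrow> complex \<Rightarrow> complex" where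
  "conj_emb \<sigma> = restrict (\<lambda>x. cnj (\<sigma> x)) K"

lemma Emb_iff: "\<sigma> \<in> Emb \<longleftrightarrow> \<sigma> \<in> extensional K \<and> \<sigma> 1 = 1 \<and>
    (\<forall>x\<in>K. \<forall>y\<in>K. \<sigma> (x + y) = \<sigma> x + \<sigma> y \<and> \<sigma> (x * y) = \<sigma> x * \<sigma> y)"
  unfolding embeddings_def Ring.ring_hom_def subring_of_C_def ring_of_type_algebra_def by auto

lemma conj_emb_apply: "x \<in> K \<Longrightarrow> conj_emb \<sigma> x = cnj (\<sigma> x)"
  by (simp add: conj_emb_def)

lemma conj_emb_Emb: "\<sigma> \<in> Emb \<Longrightarrow> conj_emb \<sigma> \<in> Emb"
  unfolding Emb_iff by (simp add: conj_emb_def)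

lemma conj_conj_emb: "\<sigma> \<in> Emb \<Longrightarrow> conj_emb (conj_emb \<sigma>) = \<sigma>"
  by (intro extensionalityI[of _ K]) (auto simp: conj_emb_apply Emb_iff conj_emb_def)

lemma infinite_places_eq: "infinite_places K = (\<lambda>\<sigma>. Inf_place {\<sigma>, conj_emb \<sigma>}) ` Emb"
  unfolding infinite_places_def conj_emb_def by auto

lemma real_place_iff:
  assumes "\<sigma> \<in> Emb" shows "real_place K {\<sigma>, conj_emb \<sigma>} \<longleftrightarrow> conj_emb \<sigma> = \<sigma>"
proof
  assume r: "real_place K {\<sigma>, conj_emb \<sigma>}"
  have "conj_emb \<sigma> x = \<sigma> x" if "x \<in> K" for x
    using r that unfolding real_place_def by (auto simp: conj_emb_apply complex_is_Real_iff complex_eq_iff)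
  thus "conj_emb \<sigma> = \<sigma>"
    using assms by (intro extensionalityI[of _ K]) (auto simp: Emb_iff conj_emb_def)
next
  assume eq: "conj_emb \<sigma> = \<sigma>"
  have "\<sigma> x \<in> \<real>" if "x \<in> K" for x
    using conj_emb_apply[OF that, of \<sigma>] unfolding eq by (simp add: Reals_cnj_iff)
  thus "real_place K {\<sigma>, conj_emb \<sigma>}" unfolding eq real_place_def by auto
qed

end

locale infinite_place = integer_matrix A n l u for A n l u +
  fixes \<sigma> :: "complex \<Rightarrow> complex" assumes sigma: "\<sigma> \<in> embeddings (simple_ext l)"
begin

lemma place_abs_Inf: "place_abs K (Inf_place {\<sigma>, conj_emb \<sigma>}) = (\<lambda>x. cmod (\<sigma> x))"
proof
  fix x
  have "cmod (conj_emb \<sigma> x) = cmod (\<sigma> x)"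
    using sigma by (cases "x \<in> K") (auto simp: conj_emb_apply conj_emb_def Emb_iff extensional_def)
  thus "place_abs K (Inf_place {\<sigma>, conj_emb \<sigma>}) x = cmod (\<sigma> x)" by simp
qed

sublocale W: valued_field "simple_ext l" "\<lambda>x. cmod (\<sigma> x)"
  using emb_eq_0_iff[OF sigma] emb_simps[OF sigma]
  by unfold_locales (auto simp: norm_mult intro: norm_triangle_ineq)

lemma Cauchy_emb:
  assumes "x \<in> W.Cau" shows "convergent (\<lambda>m. \<sigma> (x m))"
proof -
  have "Cauchy (\<lambda>m. \<sigma> (x m))"
    unfolding Cauchy_def dist_norm using W.CauD[OF assms] emb_diff[OF sigma W.Cau_K[OF assms] W.Cau_K[OF assms]] by metis
  thus ?thesis by (rule Cauchy_convergent)
qed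

lemma E_cls:
  assumes x: "x \<in> W.Cau"
  shows "(\<lambda>m. \<sigma> (x m)) \<longlonglongrightarrow> extend_embedding \<sigma> (W.cls x)"
    and "extend_embedding (conj_emb \<sigma>) (W.cls x) = cnj (extend_embedding \<sigma> (W.cls x))"
proof -
  obtain z where z: "(\<lambda>m. \<sigma> (x m)) \<longlonglongrightarrow> z" using Cauchy_emb[OF x] unfolding convergent_def by blast
  have all: "(\<lambda>m. \<sigma> (y m)) \<longlonglongrightarrow> z" if y: "y \<in> W.cls x" for y
  proof -
    have yC: "y \<in> W.Cau" and d: "(\<lambda>m. cmod (\<sigma> (y m - x m))) \<longlonglongrightarrow> 0" using W.mem_cls_iff[OF x] y by blast+
    have "(\<lambda>m. \<sigma> (y m - x m)) \<longlonglongrightarrow> 0" using d by (rule tendsto_norm_zero_cancel)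
    from tendsto_add[OF this z] show ?thesis by (simp add: emb_diff[OF sigma W.Cau_K[OF yC] W.Cau_K[OF x]])
  qed
  have E: "extend_embedding \<sigma> (W.cls x) = z"
    unfolding extend_embedding_def
  proof (rule the_equality)
    fix z' assume "\<forall>y\<in>W.cls x. (\<lambda>m. \<sigma> (y m)) \<longlonglongrightarrow> z'"
    thus "z' = z" using W.cls_self[OF x] z LIMSEQ_unique by blast
  qed (use all in blast)
  thus "(\<lambda>m. \<sigma> (x m)) \<longlonglongrightarrow> extend_embedding \<sigma> (W.cls x)" using z by simp
  have conj: "(\<lambda>m. conj_emb \<sigma> (y m)) = (\<lambda>m. cnj (\<sigma> (y m)))" if "y \<in> W.cls x" for y
    using that W.mem_cls_iff[OF x] by (auto simp: conj_emb_apply)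
  have "extend_embedding (conj_emb \<sigma>) (W.cls x) = cnj z"
    unfolding extend_embedding_def
  proof (rule the_equality)
    show "\<forall>y\<in>W.cls x. (\<lambda>m. conj_emb \<sigma> (y m)) \<longlonglongrightarrow> cnj z"
      using all conj by (simp add: tendsto_cnj)
    fix z' assume "\<forall>y\<in>W.cls x. (\<lambda>m. conj_emb \<sigma> (y m)) \<longlonglongrightarrow> z'"
    hence "(\<lambda>m. cnj (\<sigma> (x m))) \<longlonglongrightarrow> z'" using W.cls_self[OF x] conj by auto
    thus "z' = cnj z" using tendsto_cnj[OF z] LIMSEQ_unique by blast
  qed
  thus "extend_embedding (conj_emb \<sigma>) (W.cls x) = cnj (extend_embedding \<sigma> (W.cls x))" unfolding E .
qed

abbreviation E :: "(nat \<Rightarrow> complex) set \<Rightarrow> complex" where "E \<equiv> extend_embedding \<sigma>"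

lemma E_conj: "\<xi> \<in> carrier W.L \<Longrightarrow> extend_embedding (conj_emb \<sigma>) \<xi> = cnj (E \<xi>)"
  using E_cls(2) by (auto elim: W.L_cases)

lemma E_add: assumes "\<xi> \<in> carrier W.L" "\<zeta> \<in> carrier W.L" shows "E (\<xi> \<oplus>\<^bsub>W.L\<^esub> \<zeta>) = E \<xi> + E \<zeta>"
proof -
  obtain x y where xy: "x \<in> W.Cau" "\<xi> = W.cls x" "y \<in> W.Cau" "\<zeta> = W.cls y"
    using assms W.L_cases by metis
  have "(\<lambda>m. \<sigma> (x m) + \<sigma> (y m)) \<longlonglongrightarrow> E \<xi> + E \<zeta>" unfolding xy by (intro tendsto_add E_cls xy)
  moreover have "(\<lambda>m. \<sigma> (x m + y m)) \<longlonglongrightarrow> E (\<xi> \<oplus>\<^bsub>W.L\<^esub> \<zeta>)"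
    unfolding xy W.L_ops[OF xy(1,3)] by (intro E_cls W.Cau_add xy)
  ultimately show ?thesis using xy by (simp add: emb_simps[OF sigma] LIMSEQ_unique)
qed

lemma E_mult: assumes "\<xi> \<in> carrier W.L" "\<zeta> \<in> carrier W.L" shows "E (\<xi> \<otimes>\<^bsub>W.L\<^esub> \<zeta>) = E \<xi> * E \<zeta>"
proof -
  obtain x y where xy: "x \<in> W.Cau" "\<xi> = W.cls x" "y \<in> W.Cau" "\<zeta> = W.cls y"
    using assms W.L_cases by metis
  have "(\<lambda>m. \<sigma> (x m) * \<sigma> (y m)) \<longlonglongrightarrow> E \<xi> * E \<zeta>" unfolding xy by (intro tendsto_mult E_cls xy)
  moreover have "(\<lambda>m. \<sigma> (x m * y m)) \<longlonglongrightarrow> E (\<xi> \<otimes>\<^bsub>W.L\<^esub> \<zeta>)"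
    unfolding xy W.L_ops[OF xy(1,3)] by (intro E_cls W.Cau_mult xy)
  ultimately show ?thesis using xy by (simp add: emb_simps[OF sigma] LIMSEQ_unique)
qed

lemma E_emb: "a \<in> K \<Longrightarrow> E (W.emb a) = \<sigma> a"
  using E_cls(1)[OF W.Cau_const[of a]] by (auto simp: W.emb_cls LIMSEQ_const_iff)

lemma E_norm: assumes "\<xi> \<in> carrier W.L" shows "cmod (E \<xi>) = W.labs \<xi>"
proof -
  obtain x where x: "x \<in> W.Cau" "\<xi> = W.cls x" using assms by (rule W.L_cases)
  show ?thesis using LIMSEQ_unique[OF tendsto_norm[OF E_cls(1)[OF x(1)]] W.labs_cls[OF x(1)]] unfolding x .
qed

text \<open>The sum runs over a set, which collapses to one element exactly at a real place. This
  unifies the two normalizations of the real part.\<close>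

lemma Lam_Inf:
  assumes "\<xi> \<in> carrier W.L"
  shows "Lam K (Inf_place {\<sigma>, conj_emb \<sigma>}) \<xi> = - (\<Sum>\<tau>\<in>{\<sigma>, conj_emb \<sigma>}. Re (extend_embedding \<tau> \<xi>))"
  using E_conj[OF assms] real_place_iff[OF sigma] by (cases "conj_emb \<sigma> = \<sigma>") (auto simp: Let_def)

text \<open>The approximating sequence does not depend on the place.\<close>

lemma E_real_combination:
  fixes q :: "nat \<Rightarrow> nat \<Rightarrow> rat"
  assumes q: "\<And>j. j < n \<Longrightarrow> (\<lambda>m. real_of_rat (q j m)) \<longlonglongrightarrow> t j" and a: "a \<in> K"
  shows "(\<lambda>m. \<Sum>j<n. of_rat (q j m) * (a * u $ j)) \<in> W.Cau"
    and "E (W.cls (\<lambda>m. \<Sum>j<n. of_rat (q j m) * (a * u $ j))) = (\<Sum>j<n. of_real (t j) * \<sigma> (a * u $ j))"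
proof -
  define x where "x m = (\<Sum>j<n. of_rat (q j m) * (a * u $ j))" for m
  have memb: "j < n \<Longrightarrow> of_rat (q j m) * (a * u $ j) \<in> K" for j m
    using a by (intro mult_K of_rat_K) auto
  have xK: "x m \<in> K" for m unfolding x_def using memb by (intro sum_K) auto
  have sx: "\<sigma> (x m) = (\<Sum>j<n. of_rat (q j m) * \<sigma> (a * u $ j))" for m
    unfolding x_def using memb a
    by (subst emb_sum[OF sigma]) (auto simp: simp_implies_def emb_simps[OF sigma] emb_of_rat[OF sigma] mult_K of_rat_K)
  have ofr: "(of_rat r :: complex) = of_real (of_rat r)" for r by (cases r) (simp add: of_rat_rat)
  have lim: "(\<lambda>m. \<sigma> (x m)) \<longlonglongrightarrow> (\<Sum>j<n. of_real (t j) * \<sigma> (a * u $ j))"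
    unfolding sx ofr using q by (intro tendsto_sum tendsto_mult tendsto_of_real tendsto_const) auto
  hence "Cauchy (\<lambda>m. \<sigma> (x m))" by (rule LIMSEQ_imp_Cauchy)
  hence xC: "x \<in> W.Cau" unfolding W.Cau_iff Cauchy_def dist_norm using xK by (simp add: emb_diff[OF sigma])
  thus "(\<lambda>m. \<Sum>j<n. of_rat (q j m) * (a * u $ j)) \<in> W.Cau" unfolding x_def .
  show "E (W.cls (\<lambda>m. \<Sum>j<n. of_rat (q j m) * (a * u $ j))) = (\<Sum>j<n. of_real (t j) * \<sigma> (a * u $ j))"
    using LIMSEQ_unique[OF E_cls(1)[OF xC] lim] unfolding x_def .
qed

end

section \<open>The adele group and the total character\<close>

context integer_matrix
begin

abbreviation S :: "place set" where "S \<equiv> S_places l"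
abbreviation Lv :: "place \<Rightarrow> (nat \<Rightarrow> complex) set ring" where "Lv \<equiv> local_field l"
abbreviation ev :: "place \<Rightarrow> complex \<Rightarrow> (nat \<Rightarrow> complex) set" where "ev \<equiv> local_embed l"
abbreviation lab :: "place \<Rightarrow> (nat \<Rightarrow> complex) set \<Rightarrow> real" where
  "lab v \<equiv> completion_abs (place_abs (simple_ext l) v)"
abbreviation AG :: "(place \<Rightarrow> (nat \<Rightarrow> complex) set) monoid" where "AG \<equiv> adele_group l"

abbreviation AG_add (infixl "+\<^sub>A" 65) where "\<eta> +\<^sub>A \<zeta> \<equiv> \<eta> \<otimes>\<^bsub>adele_group l\<^esub> \<zeta>"
abbreviation LP :: "complex set \<Rightarrow> (nat \<Rightarrow> complex) set ring" where "LP P \<equiv> local_field l (Fin_place P)"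
abbreviation labP :: "complex set \<Rightarrow> (nat \<Rightarrow> complex) set \<Rightarrow> real" where
  "labP P \<equiv> completion_abs (place_abs (simple_ext l) (Fin_place P))"

lemma S_eq: "S = (\<lambda>\<sigma>. Inf_place {\<sigma>, conj_emb \<sigma>}) ` Emb \<union> Fin_place ` Pl"
  unfolding S_places_def infinite_places_eq places_dividing_eq ..

lemma finite_S [simp]: "finite S"
  unfolding S_eq by simp

lemma S_cases:
  assumes "v \<in> S"
  obtains \<sigma> where "\<sigma> \<in> Emb" "v = Inf_place {\<sigma>, conj_emb \<sigma>}" "infinite_place A n l u \<sigma>"
  | P t p where "P \<in> Pl" "v = Fin_place P" "local_place A n l u P t p"
  using assms unfolding S_eq
proof (elim UnE imageE)
  fix \<sigma> assume "\<sigma> \<in> Emb" "v = Inf_place {\<sigma>, conj_emb \<sigma>}"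
  moreover from this(1) have "infinite_place A n l u \<sigma>"
    using integer_matrix_axioms by (intro infinite_place.intro infinite_place_axioms.intro)
  ultimately show thesis using that(1) by blast
next
  fix P assume P: "v = Fin_place P" "P \<in> Pl"
  obtain t p where "local_place A n l u P t p" using P(2) by (rule Pl_local_place)
  thus thesis using P that(2) by blast
qed

lemma place_valued: assumes "v \<in> S" shows "valued_field K (place_abs K v)"
  using assms
proof (cases rule: S_cases)
  case (1 \<sigma>)
  then interpret infinite_place A n l u \<sigma> by simp
  show ?thesis unfolding 1(2) place_abs_Inf by (rule W.valued_field_axioms)
next
  case (2 P t p)
  then interpret local_place A n l u P t p by simp
  show ?thesis unfolding 2(2) place_abs_Fin by (rule W.valued_field_axioms)
qed

lemma Lv_eq: "Lv v = completion K (place_abs K v)" and ev_eq: "ev v = completion_embed K (place_abs K v)"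
  by (simp_all add: local_field_def local_embed_def)

lemma field_Lv: "v \<in> S \<Longrightarrow> field (Lv v)"
  unfolding Lv_eq by (rule valued_field.field_L[OF place_valued])

lemma ev_L [simp]: "v \<in> S \<Longrightarrow> a \<in> K \<Longrightarrow> ev v a \<in> carrier (Lv v)"
  unfolding Lv_eq ev_eq by (rule valued_field.emb_L[OF place_valued])

lemma ev_add: "v \<in> S \<Longrightarrow> a \<in> K \<Longrightarrow> b \<in> K \<Longrightarrow> ev v (a + b) = ev v a \<oplus>\<^bsub>Lv v\<^esub> ev v b"
  and ev_mult: "v \<in> S \<Longrightarrow> a \<in> K \<Longrightarrow> b \<in> K \<Longrightarrow> ev v (a * b) = ev v a \<otimes>\<^bsub>Lv v\<^esub> ev v b"
  unfolding Lv_eq ev_eq by (rule valued_field.emb_add[OF place_valued] valued_field.emb_mult[OF place_valued]; assumption)+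

lemma lab_mult: "v \<in> S \<Longrightarrow> \<xi> \<in> carrier (Lv v) \<Longrightarrow> \<zeta> \<in> carrier (Lv v) \<Longrightarrow> lab v (\<xi> \<otimes>\<^bsub>Lv v\<^esub> \<zeta>) = lab v \<xi> * lab v \<zeta>"
  and lab_nonneg: "v \<in> S \<Longrightarrow> \<xi> \<in> carrier (Lv v) \<Longrightarrow> lab v \<xi> \<ge> 0"
  and lab_uminus: "v \<in> S \<Longrightarrow> \<xi> \<in> carrier (Lv v) \<Longrightarrow> lab v (\<ominus>\<^bsub>Lv v\<^esub> \<xi>) = lab v \<xi>"
  and lab_0_iff: "v \<in> S \<Longrightarrow> \<xi> \<in> carrier (Lv v) \<Longrightarrow> lab v \<xi> = 0 \<longleftrightarrow> \<xi> = \<zero>\<^bsub>Lv v\<^esub>"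
  unfolding Lv_eq using valued_field.labs_mult[OF place_valued] valued_field.labs_nonneg[OF place_valued]
    valued_field.labs_uminus[OF place_valued] valued_field.labs_0_iff[OF place_valued] by auto

lemma Lam_add:
  assumes "v \<in> S" "\<xi> \<in> carrier (Lv v)" "\<zeta> \<in> carrier (Lv v)"
  shows "Lam K v (\<xi> \<oplus>\<^bsub>Lv v\<^esub> \<zeta>) - (Lam K v \<xi> + Lam K v \<zeta>) \<in> \<int>"
  using assms(1)
proof (cases rule: S_cases)
  case (1 \<sigma>)
  then interpret infinite_place A n l u \<sigma> by simp
  have L: "Lv v = W.L" unfolding Lv_eq 1(2) place_abs_Inf ..
  interpret I: field W.L by (rule W.field_L)
  note xz = assms(2,3)[unfolded L]
  have "extend_embedding \<tau> (\<xi> \<oplus>\<^bsub>W.L\<^esub> \<zeta>) = extend_embedding \<tau> \<xi> + extend_embedding \<tau> \<zeta>" if "\<tau> \<in> {\<sigma>, conj_emb \<sigma>}" for \<tau>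
    using that E_add[OF xz] E_conj[OF xz(1)] E_conj[OF xz(2)] E_conj[OF I.a_closed[OF xz]] by auto
  hence "(\<Sum>\<tau>\<in>{\<sigma>, conj_emb \<sigma>}. Re (extend_embedding \<tau> (\<xi> \<oplus>\<^bsub>W.L\<^esub> \<zeta>)))
      = (\<Sum>\<tau>\<in>{\<sigma>, conj_emb \<sigma>}. Re (extend_embedding \<tau> \<xi>) + Re (extend_embedding \<tau> \<zeta>))" by (intro sum.cong) auto
  thus ?thesis unfolding L unfolding 1(2) using xz by (simp add: Lam_Inf sum.distrib del: Lam.simps)
next
  case (2 P t p)
  then interpret local_place A n l u P t p by simp
  have L: "Lv v = W.L" unfolding Lv_eq 2(2) place_abs_Fin ..
  show ?thesis using lam_add[of \<xi> \<zeta>] assms(2,3) unfolding L unfolding 2(2) by (simp del: Lam.simps)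
qed

lemma Lam_small:
  assumes "v \<in> S" "e > 0"
  shows "\<exists>\<delta>>0. \<forall>\<xi>\<in>carrier (Lv v). lab v \<xi> \<le> \<delta> \<longrightarrow> (\<exists>z\<in>\<int>. \<bar>Lam K v \<xi> - z\<bar> < e)"
  using assms(1)
proof (cases rule: S_cases)
  case (1 \<sigma>)
  then interpret infinite_place A n l u \<sigma> by simp
  have L: "Lv v = W.L" "lab v = W.labs" unfolding Lv_eq 1(2) place_abs_Inf by simp_all
  \<comment> \<open>The place carries at most two embeddings, so a third of \<open>e\<close> leaves
    a strict inequality.\<close>
  have "\<bar>Lam K v \<xi> - 0\<bar> < e" if xi: "\<xi> \<in> carrier W.L" "W.labs \<xi> \<le> e / 3" for \<xi>
  proof -
    have "\<bar>\<Sum>\<tau>\<in>{\<sigma>, conj_emb \<sigma>}. Re (extend_embedding \<tau> \<xi>)\<bar> \<le> (\<Sum>\<tau>\<in>{\<sigma>, conj_emb \<sigma>}. e / 3)"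
      using xi E_conj[OF xi(1)] E_norm[OF xi(1)] abs_Re_le_cmod[of "E \<xi>"]
      by (intro order_trans[OF sum_abs] sum_mono) auto
    also have "\<dots> \<le> 2 * (e / 3)" using assms(2) card_insert_le_m1[of 2 "{conj_emb \<sigma>}" \<sigma>] by (simp add: mult_right_mono)
    finally show ?thesis unfolding 1(2) Lam_Inf[OF xi(1)] using assms(2) by simp
  qed
  thus ?thesis unfolding L using assms(2) by (intro exI[of _ "e / 3"]) (auto intro!: bexI[of _ 0])
next
  case (2 P t p)
  then interpret local_place A n l u P t p by simp
  have L: "Lv v = W.L" "lab v = W.labs" unfolding Lv_eq 2(2) place_abs_Fin by simp_all
  show ?thesis using lam_small assms(2) unfolding L unfolding 2(2) by (force simp del: Lam.simps)
qed

lemma carrier_AG: "\<eta> \<in> carrier AG \<longleftrightarrow> \<eta> \<in> extensional S \<and> (\<forall>v\<in>S. \<eta> v \<in> carrier (Lv v))"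
  by (auto simp: adele_group_def PiE_iff)

lemma AG_mult: "\<eta> +\<^sub>A \<zeta> = (\<lambda>v\<in>S. \<eta> v \<oplus>\<^bsub>Lv v\<^esub> \<zeta> v)"
  by (simp add: adele_group_def)

lemma AG_apply: "v \<in> S \<Longrightarrow> (\<eta> +\<^sub>A \<zeta>) v = \<eta> v \<oplus>\<^bsub>Lv v\<^esub> \<zeta> v"
  by (simp add: AG_mult)

lemma AG_in: "\<eta> \<in> carrier AG \<Longrightarrow> v \<in> S \<Longrightarrow> \<eta> v \<in> carrier (Lv v)"
  by (simp add: carrier_AG)

lemma comm_group_AG: "comm_group AG"
proof (rule group.group_comm_groupI)
  show "group AG" unfolding adele_group_def
  proof (rule product_group)
    fix v assume "v \<in> S"
    then interpret field "Lv v" by (rule field_Lv)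
    show "group (add_monoid (Lv v))" by (rule add.is_group)
  qed
  fix \<eta> \<zeta> assume e: "\<eta> \<in> carrier AG" "\<zeta> \<in> carrier AG"
  have "\<eta> v \<oplus>\<^bsub>Lv v\<^esub> \<zeta> v = \<zeta> v \<oplus>\<^bsub>Lv v\<^esub> \<eta> v" if "v \<in> S" for v
  proof -
    interpret field "Lv v" using that by (rule field_Lv)
    show ?thesis using e that by (intro a_comm AG_in)
  qed
  thus "\<eta> +\<^sub>A \<zeta> = \<zeta> +\<^sub>A \<eta>" unfolding AG_mult by (intro restrict_ext)
qed

sublocale AG: comm_group "adele_group l" by (rule comm_group_AG)

lemma AG_eqI: "\<eta> \<in> carrier AG \<Longrightarrow> \<zeta> \<in> carrier AG \<Longrightarrow> (\<And>v. v \<in> S \<Longrightarrow> \<eta> v = \<zeta> v) \<Longrightarrow> \<eta> = \<zeta>"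
  unfolding carrier_AG by (auto intro: extensionalityI)

section \<open>Scaling, the diagonal and the total character\<close>

definition smul :: "(place \<Rightarrow> (nat \<Rightarrow> complex) set) \<Rightarrow> complex \<Rightarrow> place \<Rightarrow> (nat \<Rightarrow> complex) set" where
  "smul \<eta> a = (\<lambda>v\<in>S. \<eta> v \<otimes>\<^bsub>Lv v\<^esub> ev v a)"

lemma smul_closed: assumes "\<eta> \<in> carrier AG" "a \<in> K" shows "smul \<eta> a \<in> carrier AG"
  unfolding carrier_AG
proof (intro conjI ballI)
  fix v assume v: "v \<in> S"
  then interpret field "Lv v" by (rule field_Lv)
  show "smul \<eta> a v \<in> carrier (Lv v)" using assms v by (simp add: smul_def AG_in)
qed (simp add: smul_def)

lemma diag_closed: "a \<in> K \<Longrightarrow> diag l a \<in> carrier AG"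
  unfolding carrier_AG diag_def by simp

lemma smul_simps:
  assumes "\<eta> \<in> carrier AG" "\<zeta> \<in> carrier AG" "a \<in> K" "b \<in> K"
  shows smul_AG: "smul (\<eta> +\<^sub>A \<zeta>) a = smul \<eta> a +\<^sub>A smul \<zeta> a"
    and smul_add: "smul \<eta> (a + b) = smul \<eta> a +\<^sub>A smul \<eta> b"
    and smul_diag: "smul (diag l a) b = diag l (a * b)"
    and diag_add: "diag l (a + b) = diag l a +\<^sub>A diag l b"
proof -
  have "(\<eta> v \<oplus>\<^bsub>Lv v\<^esub> \<zeta> v) \<otimes>\<^bsub>Lv v\<^esub> ev v a = \<eta> v \<otimes>\<^bsub>Lv v\<^esub> ev v a \<oplus>\<^bsub>Lv v\<^esub> \<zeta> v \<otimes>\<^bsub>Lv v\<^esub> ev v a \<and>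
    \<eta> v \<otimes>\<^bsub>Lv v\<^esub> ev v (a + b) = \<eta> v \<otimes>\<^bsub>Lv v\<^esub> ev v a \<oplus>\<^bsub>Lv v\<^esub> \<eta> v \<otimes>\<^bsub>Lv v\<^esub> ev v b" if v: "v \<in> S" for v
  proof -
    interpret field "Lv v" using v by (rule field_Lv)
    show ?thesis using assms v by (simp add: AG_in ev_add l_distr r_distr)
  qed
  thus "smul (\<eta> +\<^sub>A \<zeta>) a = smul \<eta> a +\<^sub>A smul \<zeta> a" "smul \<eta> (a + b) = smul \<eta> a +\<^sub>A smul \<eta> b"
    by (auto simp: smul_def AG_mult intro!: restrict_ext)
  show "smul (diag l a) b = diag l (a * b)" "diag l (a + b) = diag l a +\<^sub>A diag l b"
    using assms(3,4) by (auto simp: smul_def diag_def AG_mult ev_mult ev_add intro!: restrict_ext)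
qed

definition \<Lambda> :: "(place \<Rightarrow> (nat \<Rightarrow> complex) set) \<Rightarrow> real" where "\<Lambda> \<eta> = (\<Sum>v\<in>S. Lam K v (\<eta> v))"

lemma Lambda_add:
  assumes "\<eta> \<in> carrier AG" "\<zeta> \<in> carrier AG" shows "\<Lambda> (\<eta> +\<^sub>A \<zeta>) - (\<Lambda> \<eta> + \<Lambda> \<zeta>) \<in> \<int>"
proof -
  have "\<Lambda> (\<eta> +\<^sub>A \<zeta>) - (\<Lambda> \<eta> + \<Lambda> \<zeta>) = (\<Sum>v\<in>S. Lam K v (\<eta> v \<oplus>\<^bsub>Lv v\<^esub> \<zeta> v) - (Lam K v (\<eta> v) + Lam K v (\<zeta> v)))"
    unfolding \<Lambda>_def by (simp add: sum_subtractf sum.distrib AG_apply)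
  also have "\<dots> \<in> \<int>" using assms by (intro Ints_sum Lam_add AG_in)
  finally show ?thesis .
qed

text \<open>The infinite components indexed by embeddings instead of places. Sums over embeddings
  behave like traces, and conjugate embeddings carry conjugate values by
  \<open>Z_conj\<close>.\<close>

definition Z :: "(place \<Rightarrow> (nat \<Rightarrow> complex) set) \<Rightarrow> (complex \<Rightarrow> complex) \<Rightarrow> complex" where
  "Z \<eta> \<tau> = extend_embedding \<tau> (\<eta> (Inf_place {\<tau>, conj_emb \<tau>}))"

lemma Inf_place_S [simp]: "\<tau> \<in> Emb \<Longrightarrow> Inf_place {\<tau>, conj_emb \<tau>} \<in> S"
  and Fin_place_S [simp]: "P \<in> Pl \<Longrightarrow> Fin_place P \<in> S"
  unfolding S_eq by auto

lemma Inf_place_conj: "\<tau> \<in> Emb \<Longrightarrow> Inf_place {conj_emb \<tau>, conj_emb (conj_emb \<tau>)} = Inf_place {\<tau>, conj_emb \<tau>}"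
  by (simp add: conj_conj_emb insert_commute)

lemma Lv_Inf:
  assumes "\<tau> \<in> Emb"
  shows "infinite_place A n l u \<tau>" "Lv (Inf_place {\<tau>, conj_emb \<tau>}) = completion K (\<lambda>x. cmod (\<tau> x))"
    "ev (Inf_place {\<tau>, conj_emb \<tau>}) = completion_embed K (\<lambda>x. cmod (\<tau> x))"
    "lab (Inf_place {\<tau>, conj_emb \<tau>}) = completion_abs (\<lambda>x. cmod (\<tau> x))"
proof -
  show *: "infinite_place A n l u \<tau>" using assms integer_matrix_axioms by (intro infinite_place.intro infinite_place_axioms.intro)
  note eq = infinite_place.place_abs_Inf[OF *]
  show "Lv (Inf_place {\<tau>, conj_emb \<tau>}) = completion K (\<lambda>x. cmod (\<tau> x))"
    "ev (Inf_place {\<tau>, conj_emb \<tau>}) = completion_embed K (\<lambda>x. cmod (\<tau> x))"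
    "lab (Inf_place {\<tau>, conj_emb \<tau>}) = completion_abs (\<lambda>x. cmod (\<tau> x))"
    unfolding Lv_eq ev_eq eq by simp_all
qed

lemma Lv_Fin: "Lv (Fin_place P) = completion K (padic_abs K P)" "ev (Fin_place P) = completion_embed K (padic_abs K P)"
  "lab (Fin_place P) = completion_abs (padic_abs K P)"
  unfolding Lv_eq ev_eq place_abs_Fin by simp_all

lemma Z_props:
  assumes "\<tau> \<in> Emb" "\<eta> \<in> carrier AG" "\<zeta> \<in> carrier AG" "a \<in> K"
  shows Z_AG: "Z (\<eta> +\<^sub>A \<zeta>) \<tau> = Z \<eta> \<tau> + Z \<zeta> \<tau>" and Z_smul: "Z (smul \<eta> a) \<tau> = Z \<eta> \<tau> * \<tau> a"
    and Z_diag: "Z (diag l a) \<tau> = \<tau> a" and Z_conj: "Z \<eta> (conj_emb \<tau>) = cnj (Z \<eta> \<tau>)"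
    and Z_norm: "lab (Inf_place {\<tau>, conj_emb \<tau>}) (\<eta> (Inf_place {\<tau>, conj_emb \<tau>})) = cmod (Z \<eta> \<tau>)"
proof -
  interpret infinite_place A n l u \<tau> by (rule Lv_Inf[OF assms(1)])
  note L = Lv_Inf(2-)[OF assms(1)] and S = Inf_place_S[OF assms(1)]
  have c: "\<eta> (Inf_place {\<tau>, conj_emb \<tau>}) \<in> carrier W.L" "\<zeta> (Inf_place {\<tau>, conj_emb \<tau>}) \<in> carrier W.L"
    using assms S AG_in unfolding L[symmetric] by blast+
  show "Z (\<eta> +\<^sub>A \<zeta>) \<tau> = Z \<eta> \<tau> + Z \<zeta> \<tau>" "Z (smul \<eta> a) \<tau> = Z \<eta> \<tau> * \<tau> a" "Z (diag l a) \<tau> = \<tau> a"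
    "Z \<eta> (conj_emb \<tau>) = cnj (Z \<eta> \<tau>)"
    using c assms(4) S by (simp_all add: Z_def AG_apply smul_def diag_def L E_add E_mult E_emb E_conj Inf_place_conj[OF assms(1)])
  show "lab (Inf_place {\<tau>, conj_emb \<tau>}) (\<eta> (Inf_place {\<tau>, conj_emb \<tau>})) = cmod (Z \<eta> \<tau>)"
    unfolding L Z_def using c by (simp add: E_norm)
qed

text \<open>The embeddings that induce the place of \<open>\<sigma>\<close> are
  \<open>\<sigma>\<close> and its conjugate, so grouping the sum over embeddings by places matches
  \<open>Lam_Inf\<close>.\<close>

lemma Lambda_split:
  assumes "\<eta> \<in> carrier AG"
  shows "\<Lambda> \<eta> = - (\<Sum>\<tau>\<in>Emb. Re (Z \<eta> \<tau>)) + (\<Sum>P\<in>Pl. Lam K (Fin_place P) (\<eta> (Fin_place P)))"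
proof -
  let ?g = "\<lambda>\<sigma>. Inf_place {\<sigma>, conj_emb \<sigma>}"
  have "(\<Sum>v\<in>?g ` Emb. Lam K v (\<eta> v)) = (\<Sum>v\<in>?g ` Emb. \<Sum>\<tau>\<in>{\<tau> \<in> Emb. ?g \<tau> = v}. - Re (Z \<eta> \<tau>))"
  proof (intro sum.cong refl)
    fix v assume "v \<in> ?g ` Emb"
    then obtain \<sigma> where s: "\<sigma> \<in> Emb" "v = ?g \<sigma>" by blast
    interpret infinite_place A n l u \<sigma> by (rule Lv_Inf[OF s(1)])
    have "{\<tau> \<in> Emb. ?g \<tau> = v} = {\<sigma>, conj_emb \<sigma>}"
      unfolding s using s(1) conj_emb_Emb conj_conj_emb by (auto simp: doubleton_eq_iff)
    moreover have "?g \<tau> = v" if "\<tau> \<in> {\<sigma>, conj_emb \<sigma>}" for \<tau>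
      using that Inf_place_conj[OF s(1)] unfolding s by auto
    moreover have "Lam K v (\<eta> v) = - (\<Sum>\<tau>\<in>{\<sigma>, conj_emb \<sigma>}. Re (extend_embedding \<tau> (\<eta> v)))"
      unfolding s(2) using AG_in[OF assms Inf_place_S[OF s(1)]] Lv_Inf(2)[OF s(1)] by (intro Lam_Inf) simp
    ultimately show "Lam K v (\<eta> v) = (\<Sum>\<tau>\<in>{\<tau> \<in> Emb. ?g \<tau> = v}. - Re (Z \<eta> \<tau>))"
      unfolding sum_negf by (auto simp: Z_def intro!: sum.cong)
  qed
  also have "\<dots> = (\<Sum>\<tau>\<in>Emb. - Re (Z \<eta> \<tau>))" by (rule sum.image_gen[symmetric]) simp
  finally have "(\<Sum>v\<in>?g ` Emb. Lam K v (\<eta> v)) = - (\<Sum>\<tau>\<in>Emb. Re (Z \<eta> \<tau>))" by (simp add: sum_negf)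
  moreover have "(\<Sum>v\<in>Fin_place ` Pl. Lam K v (\<eta> v)) = (\<Sum>P\<in>Pl. Lam K (Fin_place P) (\<eta> (Fin_place P)))"
    by (rule sum.reindex_cong[of Fin_place]) (auto simp: inj_on_def)
  ultimately show ?thesis unfolding \<Lambda>_def S_eq by (subst sum.union_disjoint) auto
qed

text \<open>The infinite places contribute minus the global trace, which cancels the finite
  contribution modulo integers by \<open>sum_lam\<close>.\<close>

lemma Lambda_diag:
  assumes x: "x \<in> K" and xl: "\<And>m. m \<ge> M0 \<Longrightarrow> Tr (x * l ^ m) \<in> \<int>"
  shows "\<Lambda> (diag l x) \<in> \<int>"
proof -
  obtain q where q: "Tr x = of_rat q" using Tr_rational[OF x] by (auto elim: Rats_cases)
  have "complex_of_real (\<Sum>\<tau>\<in>Emb. Re (\<tau> x)) = of_real (Re (Tr x))" unfolding Tr_def by (simp add: Re_sum)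
  also have "\<dots> = Tr x" unfolding q by (cases q) (simp add: of_rat_rat)
  finally have T: "complex_of_real (\<Sum>\<tau>\<in>Emb. Re (\<tau> x)) = Tr x" .
  have "complex_of_real (\<Lambda> (diag l x)) = (\<Sum>P\<in>Pl. of_real (Lam K (Fin_place P) (completion_embed K (padic_abs K P) x))) - Tr x"
    unfolding Lambda_split[OF diag_closed[OF x]] T[symmetric]
    using Z_diag[OF _ diag_closed[OF x] diag_closed[OF x] x] by (simp add: diag_def Lv_Fin del: Lam.simps)
  hence "complex_of_real (\<Lambda> (diag l x)) \<in> \<int>" using sum_lam[OF x xl] by simp
  thus ?thesis by (metis Ints_cases Ints_of_int of_real_eq_iff of_real_of_int_eq)
qed

end

section \<open>The kernel\<close>

lemma Ints_choice:
  assumes "\<And>j. j < n \<Longrightarrow> f j \<in> \<int>"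
  shows "\<exists>b :: nat \<Rightarrow> int. \<forall>j<n. f j = of_int (b j)"
  using assms unfolding Ints_def by (auto simp: image_iff intro!: choice)

context integer_matrix
begin

text \<open>Membership is tested by traces against \<open>f\<close>, so the set is spanned by the
  family dual to \<open>f\<close>, up to powers of \<open>l\<close>: \<open>Mset\<close> comes from
  \<open>w\<close> and will be the image of \<open>mu\<close>, while \<open>Ymod\<close> comes from
  \<open>u\<close>.\<close>

definition lat :: "(nat \<Rightarrow> complex) \<Rightarrow> complex set" where
  "lat f = {m \<in> K. \<exists>k. \<forall>j<n. Tr (l ^ k * m * f j) \<in> \<int>}"

abbreviation Mset :: "complex set" where "Mset \<equiv> lat (vec_index u)"
abbreviation Ymod :: "complex set" where "Ymod \<equiv> lat w"

lemma Mset_K: "m \<in> Mset \<Longrightarrow> m \<in> K" and Ymod_K: "y \<in> Ymod \<Longrightarrow> y \<in> K"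
  by (auto simp: lat_def)

lemma Tr_l_u: assumes "x \<in> K" "j < n" shows "Tr (l * x * u $ j) = (\<Sum>i<n. of_int (A $$ (j, i)) * Tr (x * u $ i))"
proof -
  have "l * x * u $ j = (\<Sum>i<n. of_int (A $$ (j, i)) * (x * u $ i))"
    using arg_cong[OF l_mult_u[OF assms(2)], of "\<lambda>z. x * z"] by (simp add: sum_distrib_left ac_simps)
  also have "Tr \<dots> = (\<Sum>i<n. Tr (of_int (A $$ (j, i)) * (x * u $ i)))"
    using assms(1) by (intro Tr_sum) (auto simp: simp_implies_def intro!: mult_K of_int_K)
  also have "\<dots> = (\<Sum>i<n. of_int (A $$ (j, i)) * Tr (x * u $ i))"
    using assms(1) by (intro sum.cong refl Tr_of_int_mult) (auto intro!: mult_K)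
  finally show ?thesis .
qed

lemma Tr_expand: assumes "x \<in> K" "y \<in> K" shows "Tr (x * y) = (\<Sum>j<n. Tr (x * w j) * Tr (y * u $ j))"
proof -
  have TQ: "j < n \<Longrightarrow> Tr (x * w j) \<in> \<rat>" for j using assms(1) by (intro Tr_rational mult_K) auto
  have "x * y = (\<Sum>j<n. Tr (x * w j) * u $ j) * y" using u_expansion[OF assms(1)] by simp
  also have "\<dots> = (\<Sum>j<n. Tr (x * w j) * (y * u $ j))" by (simp add: sum_distrib_left ac_simps)
  also have "Tr \<dots> = (\<Sum>j<n. Tr (Tr (x * w j) * (y * u $ j)))"
    using assms(2) TQ Rats_subset_K by (intro Tr_sum) (auto simp: simp_implies_def intro!: mult_K)
  also have "\<dots> = (\<Sum>j<n. Tr (x * w j) * Tr (y * u $ j))"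
  proof (intro sum.cong refl)
    fix j assume "j \<in> {..<n}"
    moreover from this obtain q where "Tr (x * w j) = of_rat q" using TQ[of j] by (auto elim: Rats_cases)
    ultimately show "Tr (Tr (x * w j) * (y * u $ j)) = Tr (x * w j) * Tr (y * u $ j)"
      using assms(2) by (simp add: Tr_of_rat_mult)
  qed
  finally show ?thesis .
qed

lemma Tr_l_w:
  assumes "y \<in> K" "\<forall>j<n. Tr (y * w j) \<in> \<int>" "j < n" shows "Tr (l * y * w j) \<in> \<int>"
proof -
  have A: "Tr (l * w j * u $ i) \<in> \<int>" if "i < n" for i
    using Tr_l_u[OF w_K[OF assms(3)] that] Tr_u_w assms(3) by (auto simp: mult.commute[of "w j"] intro!: Ints_sum Ints_mult)
  have "Tr (y * (l * w j)) = (\<Sum>i<n. Tr (y * w i) * Tr (l * w j * u $ i))"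
    using assms by (intro Tr_expand mult_K) auto
  also have "\<dots> \<in> \<int>" using assms(2) A by (intro Ints_sum Ints_mult) auto
  finally show ?thesis by (simp add: ac_simps)
qed

text \<open>Multiplication by \<open>l\<close> preserves both lattices because its matrix in either
  basis has integer entries. So any larger power of \<open>l\<close> clears the denominator as
  well.\<close>

lemma integral_le:
  assumes f: "f = w \<or> f = vec_index u" and "m \<in> K" "\<forall>j<n. Tr (l ^ k * m * f j) \<in> \<int>" "k \<le> k'"
  shows "\<forall>j<n. Tr (l ^ k' * m * f j) \<in> \<int>"
  using assms(4)
proof (induction k' rule: dec_induct)
  case (step i)
  have i: "l ^ i * m \<in> K" using assms(2) by (intro mult_K power_K) auto
  show ?case using f
  proof
    assume "f = w"
    thus ?thesis using Tr_l_w[OF i] step(3) by (simp add: mult.assoc)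
  next
    assume "f = vec_index u"
    thus ?thesis using Tr_l_u[OF i] step(3) by (auto simp: mult.assoc intro!: Ints_sum Ints_mult)
  qed
qed (use assms(3) in simp)

text \<open>Once the power of \<open>l\<close> covers both denominators, \<open>Tr_expand\<close>
  writes the trace as a sum of products of integral coordinates. This is the hypothesis of the
  reciprocity law.\<close>

lemma pairing_integral:
  assumes "y \<in> Ymod" "m \<in> Mset"
  obtains M0 where "\<And>k. k \<ge> M0 \<Longrightarrow> Tr (y * m * l ^ k) \<in> \<int>"
proof -
  obtain a where a: "y \<in> K" "\<forall>j<n. Tr (l ^ a * y * w j) \<in> \<int>" using assms(1) unfolding lat_def by blast
  obtain b where b: "m \<in> K" "\<forall>j<n. Tr (l ^ b * m * u $ j) \<in> \<int>" using assms(2) unfolding lat_def by blast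
  have "Tr (y * m * l ^ k) \<in> \<int>" if "k \<ge> a + b" for k
  proof -
    define c where "c = k - b"
    have c: "a \<le> c" "k = c + b" using that by (auto simp: c_def)
    have "Tr (l ^ c * y * (l ^ b * m)) = (\<Sum>j<n. Tr (l ^ c * y * w j) * Tr (l ^ b * m * u $ j))"
      using a b by (intro Tr_expand mult_K power_K) auto
    also have "\<dots> \<in> \<int>" using integral_le[OF disjI1[OF refl] a c(1)] b(2) by (intro Ints_sum Ints_mult) auto
    finally show ?thesis unfolding c(2) power_add by (simp add: ac_simps)
  qed
  thus thesis by (rule that)
qed

lemma Lambda_pairing: "y \<in> Ymod \<Longrightarrow> m \<in> Mset \<Longrightarrow> \<Lambda> (diag l (y * m)) \<in> \<int>"
  using pairing_integral[of y m] Lambda_diag[OF mult_K[OF Ymod_K Mset_K], of y m] by metis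

lemma lat_closed:
  assumes f: "f = w \<or> f = vec_index u"
  shows lat_add: "x \<in> lat f \<Longrightarrow> y \<in> lat f \<Longrightarrow> x + y \<in> lat f"
    and lat_uminus: "y \<in> lat f \<Longrightarrow> - y \<in> lat f" and lat_0: "0 \<in> lat f"
proof -
  have fK: "j < n \<Longrightarrow> f j \<in> K" for j using f by auto
  show "x + y \<in> lat f" if xy: "x \<in> lat f" "y \<in> lat f" for x y
  proof -
    obtain a where a: "x \<in> K" "\<forall>j<n. Tr (l ^ a * x * f j) \<in> \<int>" using xy(1) unfolding lat_def by blast
    obtain b where b: "y \<in> K" "\<forall>j<n. Tr (l ^ b * y * f j) \<in> \<int>" using xy(2) unfolding lat_def by blast
    have "Tr (l ^ (max a b) * (x + y) * f j) \<in> \<int>" if j: "j < n" for j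
    proof -
      have "l ^ (max a b) * (x + y) * f j = l ^ (max a b) * x * f j + l ^ (max a b) * y * f j" by (simp add: algebra_simps)
      also have "Tr \<dots> = Tr (l ^ (max a b) * x * f j) + Tr (l ^ (max a b) * y * f j)"
        using a(1) b(1) fK[OF j] by (intro Tr_add mult_K power_K) auto
      also have "\<dots> \<in> \<int>" using integral_le[OF f a, of "max a b"] integral_le[OF f b, of "max a b"] j by (intro Ints_add) auto
      finally show ?thesis .
    qed
    thus ?thesis unfolding lat_def using add_K[OF a(1) b(1)] by blast
  qed
  show "- y \<in> lat f" if y: "y \<in> lat f" for y
  proof -
    obtain b where b: "y \<in> K" "\<forall>j<n. Tr (l ^ b * y * f j) \<in> \<int>" using y unfolding lat_def by blast
    have "Tr (l ^ b * - y * f j) \<in> \<int>" if "j < n" for j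
      using b that Tr_minus[of "l ^ b * y * f j"] fK by auto
    thus ?thesis unfolding lat_def using uminus_K[OF b(1)] by blast
  qed
  show "0 \<in> lat f" unfolding lat_def using zero_K by auto
qed

lemmas Ymod_add = lat_add[OF disjI1[OF refl]] and Ymod_uminus = lat_uminus[OF disjI1[OF refl]]
lemmas Mset_add = lat_add[OF disjI2[OF refl]] and Mset_uminus = lat_uminus[OF disjI2[OF refl]] and Mset_0 = lat_0[OF disjI2[OF refl]]

lemma integral_combination_Ymod:
  assumes "y = (\<Sum>j<n. of_int (c j) * u $ j)"
  shows "y \<in> K" "j < n \<Longrightarrow> Tr (y * w j) = of_int (c j)" "l ^ k * y \<in> Ymod" "y / l ^ k \<in> Ymod"
proof -
  show yK: "y \<in> K" unfolding assms by (intro sum_K mult_K of_int_K) auto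
  show T: "Tr (y * w j) = of_int (c j)" if j: "j < n" for j
  proof -
    have "y * w j = (\<Sum>i<n. of_int (c i) * (u $ i * w j))" unfolding assms by (simp add: sum_distrib_right mult.assoc)
    also have "Tr \<dots> = (\<Sum>i<n. Tr (of_int (c i) * (u $ i * w j)))"
      using j by (intro Tr_sum) (auto simp: simp_implies_def intro!: mult_K of_int_K)
    also have "\<dots> = (\<Sum>i<n. of_int (c i) * (if i = j then 1 else 0))"
      using j Tr_u_w by (intro sum.cong refl) (simp add: Tr_of_int_mult)
    also have "\<dots> = of_int (c j)" using j by (simp add: if_distrib cong: if_cong)
    finally show ?thesis .
  qed
  hence "\<forall>j<n. Tr (l ^ 0 * y * w j) \<in> \<int>" by simp
  from integral_le[OF disjI1[OF refl] yK this, of k] have "\<forall>j<n. Tr (l ^ 0 * (l ^ k * y) * w j) \<in> \<int>" by simp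
  thus "l ^ k * y \<in> Ymod" unfolding lat_def using mult_K[OF power_K[OF l_K] yK] by blast
  have "\<forall>j<n. Tr (l ^ k * (y / l ^ k) * w j) \<in> \<int>" using T by simp
  thus "y / l ^ k \<in> Ymod" unfolding lat_def using divide_K[OF yK power_K[OF l_K]] by blast
qed

lemma w_l_Mset: "j < n \<Longrightarrow> w j / l ^ k \<in> Mset"
  unfolding lat_def using Tr_u_w by (auto intro!: exI[of _ k] divide_K power_K simp: mult.commute[of "w j"])

lemma fin_small:
  assumes "m \<in> K"
  shows "\<exists>N0. \<forall>N\<ge>N0. \<forall>P\<in>Pl. \<forall>\<xi>\<in>carrier (LP P). labP P \<xi> \<le> (1 / 2) ^ N \<longrightarrow>
    Lam K (Fin_place P) (\<xi> \<otimes>\<^bsub>LP P\<^esub> ev (Fin_place P) m) \<in> \<int>"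
proof (rule finite_max_nat)
  fix P assume P: "P \<in> Pl"
  obtain t p where "local_place A n l u P t p" using P by (rule Pl_local_place)
  then interpret local_place A n l u P t p .
  obtain \<delta> where \<delta>: "\<delta> > 0" "\<And>\<xi>. \<xi> \<in> carrier W.L \<Longrightarrow> W.labs \<xi> \<le> \<delta> \<Longrightarrow> lam \<xi> \<in> \<int>" using lam_small by blast
  have pos: "\<delta> / (v m + 1) > 0" using \<delta>(1) V.v_nonneg[of m] by (simp add: add_nonneg_pos)
  obtain N0 where N0: "(1 / 2) ^ N0 \<le> \<delta> / (v m + 1)" using power_below(2)[OF pos] by blast
  have "lam (\<xi> \<otimes>\<^bsub>W.L\<^esub> W.emb m) \<in> \<int>" if "N \<ge> N0" "\<xi> \<in> carrier W.L" "W.labs \<xi> \<le> (1 / 2) ^ N" for N \<xi>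
  proof (rule \<delta>(2))
    have "(1 / 2 :: real) ^ N \<le> (1 / 2) ^ N0" using that(1) by (intro power_decreasing) auto
    hence "W.labs \<xi> \<le> \<delta> / (v m + 1)" using that(3) N0 by linarith
    hence "W.labs \<xi> * v m \<le> \<delta> / (v m + 1) * (v m + 1)" using \<delta>(1) V.v_nonneg[of m] by (intro mult_mono) auto
    also have "\<dots> = \<delta>" using V.v_nonneg[of m] by (simp add: add_nonneg_eq_0_iff)
    finally show "W.labs (\<xi> \<otimes>\<^bsub>W.L\<^esub> W.emb m) \<le> \<delta>" using that(2) assms by (simp add: W.labs_mult)
  qed (use that assms in simp)
  thus "\<exists>N0. \<forall>N\<ge>N0. \<forall>\<xi>\<in>carrier (LP P). labP P \<xi> \<le> (1 / 2) ^ N \<longrightarrow>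
      Lam K (Fin_place P) (\<xi> \<otimes>\<^bsub>LP P\<^esub> ev (Fin_place P) m) \<in> \<int>"
    unfolding Lv_Fin by blast
qed simp

text \<open>The components are first approximated in K. Weak approximation is applied to these
  values divided by \<open>d\<close>; multiplying back by \<open>d\<close> puts the result into
  \<open>Ymod\<close> and does not enlarge the error, \<open>d\<close> being integral.\<close>

lemma Ymod_approximation:
  assumes "\<eta> \<in> carrier AG"
  obtains y where "y \<in> Ymod" "\<And>P. P \<in> Pl \<Longrightarrow> labP P ((\<eta> +\<^sub>A diag l (- y)) (Fin_place P)) \<le> (1 / 2) ^ N"
proof -
  obtain d :: nat where d: "d > 0" "\<And>x. x \<in> Oint \<Longrightarrow> \<exists>c. of_nat d * x = (\<Sum>j<n. of_int (c j) * u $ j)"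
    by (rule Oint_lattice) blast
  define f where "f P = (SOME a. a \<in> K \<and> labP P (\<eta> (Fin_place P) \<ominus>\<^bsub>LP P\<^esub> ev (Fin_place P) a) \<le> (1 / 2) ^ N)" for P
  have f: "f P \<in> K \<and> labP P (\<eta> (Fin_place P) \<ominus>\<^bsub>LP P\<^esub> ev (Fin_place P) (f P)) \<le> (1 / 2) ^ N"
    if P: "P \<in> Pl" for P
    unfolding f_def
  proof (rule someI_ex)
    obtain t p where "local_place A n l u P t p" using P by (rule Pl_local_place)
    then interpret local_place A n l u P t p .
    have "\<eta> (Fin_place P) \<in> carrier W.L" using AG_in[OF assms Fin_place_S[OF P]] unfolding Lv_Fin .
    then obtain x where x: "x \<in> W.Cau" "\<eta> (Fin_place P) = W.cls x" by (rule W.L_cases)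
    obtain M where M: "\<And>m. m \<ge> M \<Longrightarrow> W.labs (W.cls x \<ominus>\<^bsub>W.L\<^esub> W.emb (x m)) < (1 / 2) ^ N"
      using W.cls_approx[OF x(1), of "(1 / 2) ^ N"] by auto
    thus "\<exists>a. a \<in> K \<and> labP P (\<eta> (Fin_place P) \<ominus>\<^bsub>LP P\<^esub> ev (Fin_place P) a) \<le> (1 / 2) ^ N"
      unfolding Lv_Fin x(2) using x(1) less_imp_le[OF M[of M]] by (intro exI[of _ "x M"]) auto
  qed
  obtain z k where z: "z \<in> Oint" "\<And>P. P \<in> Pl \<Longrightarrow> padic_abs K P (f P / of_nat d - z / l ^ k) \<le> (1 / 2) ^ N"
    using weak_approximation[of "\<lambda>P. f P / of_nat d" N] f by (metis divide_K of_nat_K)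
  obtain c where c: "of_nat d * z = (\<Sum>j<n. of_int (c j) * u $ j)" using d(2)[OF z(1)] by blast
  define y where "y = of_nat d * z / l ^ k"
  have yY: "y \<in> Ymod" unfolding y_def by (rule integral_combination_Ymod(4)[OF c])
  have "labP P ((\<eta> +\<^sub>A diag l (- y)) (Fin_place P)) \<le> (1 / 2) ^ N" if P: "P \<in> Pl" for P
  proof -
    obtain t p where "local_place A n l u P t p" using P by (rule Pl_local_place)
    then interpret local_place A n l u P t p .
    define \<xi> where "\<xi> = \<eta> (Fin_place P)"
    have x: "\<xi> \<in> carrier W.L" using AG_in[OF assms Fin_place_S[OF P]] unfolding Lv_Fin \<xi>_def .
    have K: "f P \<in> K" "y \<in> K" "- y \<in> K" "f P - y \<in> K" using f[OF P] Ymod_K[OF yY] uminus_K diff_K by blast+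
    have "f P - y = of_nat d * (f P / of_nat d - z / l ^ k)" unfolding y_def using d(1) by (simp add: right_diff_distrib)
    also have "v \<dots> = v (of_nat d) * v (f P / of_nat d - z / l ^ k)"
      by (rule V.v_mult[OF of_nat_K diff_K[OF divide_K[OF K(1) of_nat_K] divide_K[OF Oint_K[OF z(1)] power_K[OF l_K]]]])
    also have "\<dots> \<le> 1 * (1 / 2) ^ N" using z(2)[OF P] V.v_Oint_le[OF Oint_of_nat] by (intro mult_mono) auto
    finally have 1: "v (f P - y) \<le> (1 / 2) ^ N" by simp
    have "(\<eta> +\<^sub>A diag l (- y)) (Fin_place P) = \<xi> \<oplus>\<^bsub>W.L\<^esub> W.emb (- y)"
      using P by (simp add: AG_apply diag_def Lv_Fin \<xi>_def)
    also have "\<dots> = (\<xi> \<ominus>\<^bsub>W.L\<^esub> W.emb (f P)) \<oplus>\<^bsub>W.L\<^esub> W.emb (f P - y)"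
      using x K by (simp add: W.emb_diff W.emb_uminus L.minus_eq L.a_assoc L.r_neg1)
    also have "W.labs \<dots> \<le> (1 / 2) ^ N"
      using f[OF P] 1 x K unfolding Lv_Fin \<xi>_def[symmetric] by (intro labs_ultra) auto
    finally show ?thesis unfolding Lv_Fin .
  qed
  thus thesis using yY that by blast
qed

section \<open>The annihilator of Mset\<close>

definition annihilates :: "(place \<Rightarrow> (nat \<Rightarrow> complex) set) \<Rightarrow> bool" where
  "annihilates \<eta> \<longleftrightarrow> (\<forall>m\<in>Mset. \<Lambda> (smul \<eta> m) \<in> \<int>)"

lemma Lambda_smul_add:
  assumes "\<eta> \<in> carrier AG" "\<zeta> \<in> carrier AG" "m \<in> K"
  shows "\<Lambda> (smul (\<eta> +\<^sub>A \<zeta>) m) - (\<Lambda> (smul \<eta> m) + \<Lambda> (smul \<zeta> m)) \<in> \<int>"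
  using Lambda_add[OF smul_closed[OF assms(1,3)] smul_closed[OF assms(2,3)]] assms by (simp add: smul_AG[OF assms assms(3)])

lemma annihilates_add:
  assumes "\<eta> \<in> carrier AG" "\<zeta> \<in> carrier AG" "annihilates \<eta>" "annihilates \<zeta>"
  shows "annihilates (\<eta> +\<^sub>A \<zeta>)"
  unfolding annihilates_def
proof
  fix m assume m: "m \<in> Mset"
  have "(\<Lambda> (smul (\<eta> +\<^sub>A \<zeta>) m) - (\<Lambda> (smul \<eta> m) + \<Lambda> (smul \<zeta> m))) + (\<Lambda> (smul \<eta> m) + \<Lambda> (smul \<zeta> m)) \<in> \<int>"
    using assms m Lambda_smul_add[OF assms(1,2) Mset_K[OF m]] unfolding annihilates_def by (intro Ints_add) auto
  thus "\<Lambda> (smul (\<eta> +\<^sub>A \<zeta>) m) \<in> \<int>" by simp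
qed

lemma annihilates_diag: assumes "y \<in> Ymod" shows "annihilates (diag l y)"
  unfolding annihilates_def
proof
  fix m assume m: "m \<in> Mset"
  show "\<Lambda> (smul (diag l y) m) \<in> \<int>"
    using Lambda_pairing[OF assms m] smul_diag[OF diag_closed diag_closed] Ymod_K[OF assms] Mset_K[OF m] by simp
qed

text \<open>Conjugation permutes the embeddings, and the components respect it, so the sum is its
  own conjugate.\<close>

lemma Z_sum_real:
  assumes "\<eta> \<in> carrier AG" "a \<in> K"
  shows "(\<Sum>\<tau>\<in>Emb. Z \<eta> \<tau> * \<tau> a) = of_real (\<Sum>\<tau>\<in>Emb. Re (Z (smul \<eta> a) \<tau>))"
proof -
  have "cnj (\<Sum>\<tau>\<in>Emb. Z \<eta> \<tau> * \<tau> a) = (\<Sum>\<tau>\<in>Emb. Z \<eta> (conj_emb \<tau>) * conj_emb \<tau> a)"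
    using assms Z_conj[OF _ assms(1,1,2)] by (simp add: conj_emb_apply)
  also have "\<dots> = (\<Sum>\<tau>\<in>Emb. Z \<eta> \<tau> * \<tau> a)"
    by (rule sum.reindex_bij_witness[of _ conj_emb conj_emb]) (auto simp: conj_conj_emb conj_emb_Emb)
  finally have "(\<Sum>\<tau>\<in>Emb. Z \<eta> \<tau> * \<tau> a) \<in> \<real>" by (simp only: Reals_cnj_iff)
  hence "(\<Sum>\<tau>\<in>Emb. Z \<eta> \<tau> * \<tau> a) = of_real (Re (\<Sum>\<tau>\<in>Emb. Z \<eta> \<tau> * \<tau> a))" by (rule of_real_Re[symmetric])
  thus ?thesis using Z_smul[OF _ assms(1,1,2)] by (simp add: Re_sum)
qed

text \<open>By \<open>emb_dual\<close> the conjugates of \<open>w\<close> invert those of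
  \<open>u\<close>; the infinite components are therefore recovered from their pairings with the
  \<open>w j\<close>.\<close>

lemma Z_expansion:
  assumes "\<eta> \<in> carrier AG" "\<sigma> \<in> Emb"
  shows "Z \<eta> \<sigma> = (\<Sum>j<n. (\<Sum>\<tau>\<in>Emb. Z \<eta> \<tau> * \<tau> (w j)) * \<sigma> (u $ j))"
proof -
  have "(\<Sum>j<n. (\<Sum>\<tau>\<in>Emb. Z \<eta> \<tau> * \<tau> (w j)) * \<sigma> (u $ j)) = (\<Sum>\<tau>\<in>Emb. Z \<eta> \<tau> * (\<Sum>j<n. \<tau> (w j) * \<sigma> (u $ j)))"
    unfolding sum_distrib_right sum_distrib_left mult.assoc by (rule sum.swap)
  also have "\<dots> = (\<Sum>\<tau>\<in>Emb. if \<tau> = \<sigma> then Z \<eta> \<tau> else 0)" using assms(2) by (intro sum.cong refl) (simp add: emb_dual)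
  also have "\<dots> = Z \<eta> \<sigma>" using assms(2) by simp
  finally show ?thesis by simp
qed

lemma Lambda_smul:
  assumes "\<eta> \<in> carrier AG" "m \<in> K"
  shows "\<Lambda> (smul \<eta> m) = - (\<Sum>\<tau>\<in>Emb. Re (Z (smul \<eta> m) \<tau>))
    + (\<Sum>P\<in>Pl. Lam K (Fin_place P) (\<eta> (Fin_place P) \<otimes>\<^bsub>LP P\<^esub> ev (Fin_place P) m))"
  unfolding Lambda_split[OF smul_closed[OF assms]] by (simp add: smul_def del: Lam.simps)

theorem annihilator_diag:
  assumes \<eta>: "\<eta> \<in> carrier AG" and ann: "annihilates \<eta>"
  shows "\<exists>y\<in>Ymod. \<eta> = diag l y"
proof -
  note wM = w_l_Mset
  have "\<exists>N0. \<forall>N\<ge>N0. \<forall>j\<in>{..<n}. \<forall>P\<in>Pl. \<forall>\<xi>\<in>carrier (LP P). labP P \<xi> \<le> (1 / 2) ^ N \<longrightarrow>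
    Lam K (Fin_place P) (\<xi> \<otimes>\<^bsub>LP P\<^esub> ev (Fin_place P) (w j / l ^ k)) \<in> \<int>" for k
    by (rule finite_max_nat, simp, rule fin_small) (auto intro!: divide_K power_K)
  then obtain N0 where N0: "\<And>k N j P \<xi>. N \<ge> N0 k \<Longrightarrow> j < n \<Longrightarrow> P \<in> Pl \<Longrightarrow> \<xi> \<in> carrier (LP P) \<Longrightarrow>
      labP P \<xi> \<le> (1 / 2) ^ N \<Longrightarrow>
      Lam K (Fin_place P) (\<xi> \<otimes>\<^bsub>LP P\<^esub> ev (Fin_place P) (w j / l ^ k)) \<in> \<int>"
    by (metis lessThan_iff)
  \<comment> \<open>When the finite components are this small, their contributions at
    \<open>w j / l ^ k\<close> are integers; since the total is an integer, so is the infinite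
    contribution.\<close>
  have inf_int: "(\<Sum>\<tau>\<in>Emb. Re (Z (smul \<zeta> (w j / l ^ k)) \<tau>)) \<in> \<int>"
    if z: "\<zeta> \<in> carrier AG" "annihilates \<zeta>" "\<And>P. P \<in> Pl \<Longrightarrow> labP P (\<zeta> (Fin_place P)) \<le> (1 / 2) ^ N"
      and N: "N \<ge> N0 k" and j: "j < n" for \<zeta> N j k
  proof -
    have "(\<Sum>P\<in>Pl. Lam K (Fin_place P) (\<zeta> (Fin_place P) \<otimes>\<^bsub>LP P\<^esub> ev (Fin_place P) (w j / l ^ k))) \<in> \<int>"
      using z by (intro Ints_sum N0[OF N j] AG_in) auto
    moreover have "\<Lambda> (smul \<zeta> (w j / l ^ k)) \<in> \<int>" using z(2) wM[OF j] unfolding annihilates_def by blast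
    ultimately have "(\<Sum>P\<in>Pl. Lam K (Fin_place P) (\<zeta> (Fin_place P) \<otimes>\<^bsub>LP P\<^esub> ev (Fin_place P) (w j / l ^ k)))
        - \<Lambda> (smul \<zeta> (w j / l ^ k)) \<in> \<int>" by (rule Ints_diff)
    thus ?thesis unfolding Lambda_smul[OF z(1) Mset_K[OF wM[OF j]]] by simp
  qed
  obtain y0 where y0: "y0 \<in> Ymod" "\<And>P. P \<in> Pl \<Longrightarrow> labP P ((\<eta> +\<^sub>A diag l (- y0)) (Fin_place P)) \<le> (1 / 2) ^ N0 0"
    using Ymod_approximation[OF \<eta>] by blast
  define \<eta>1 where "\<eta>1 = \<eta> +\<^sub>A diag l (- y0)"
  have d0: "diag l (- y) \<in> carrier AG" "annihilates (diag l (- y))" "- y \<in> K" if "y \<in> Ymod" for y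
    using diag_closed[OF Ymod_K[OF Ymod_uminus[OF that]]] annihilates_diag[OF Ymod_uminus[OF that]] Ymod_K[OF Ymod_uminus[OF that]] by blast+
  have \<eta>1: "\<eta>1 \<in> carrier AG" "annihilates \<eta>1"
    unfolding \<eta>1_def using \<eta> ann d0[OF y0(1)] by (auto intro: annihilates_add)
  have "\<exists>c::int. (\<Sum>\<tau>\<in>Emb. Re (Z (smul \<eta>1 (w j)) \<tau>)) = of_int c" if "j < n" for j
    using inf_int[OF \<eta>1 y0(2)[folded \<eta>1_def] order_refl that] by (auto elim: Ints_cases)
  then obtain c :: "nat \<Rightarrow> int" where c: "\<And>j. j < n \<Longrightarrow> (\<Sum>\<tau>\<in>Emb. Re (Z (smul \<eta>1 (w j)) \<tau>)) = of_int (c j)" by metis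
  \<comment> \<open>The integers \<open>c j\<close> are the pairings with the dual basis, that is,
    the coordinates of the infinite component in \<open>u\<close>.\<close>
  define y1 where "y1 = (\<Sum>j<n. of_int (c j) * u $ j)"
  have y1Y: "y1 \<in> Ymod" using integral_combination_Ymod(3)[OF y1_def, of 0] by simp
  have Z1: "Z \<eta>1 \<sigma> = \<sigma> y1" if s: "\<sigma> \<in> Emb" for \<sigma>
  proof -
    have "Z \<eta>1 \<sigma> = (\<Sum>j<n. of_int (c j) * \<sigma> (u $ j))"
      unfolding Z_expansion[OF \<eta>1(1) s] using c by (intro sum.cong refl) (simp add: Z_sum_real[OF \<eta>1(1)])
    also have "\<dots> = (\<Sum>j<n. \<sigma> (of_int (c j) * u $ j))"
      using s by (intro sum.cong refl) (simp add: emb_simps emb_of_int)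
    also have "\<dots> = \<sigma> y1" unfolding y1_def
      using s by (intro emb_sum[symmetric]) (auto simp: simp_implies_def intro!: mult_K of_int_K)
    finally show ?thesis .
  qed
  define \<eta>2 where "\<eta>2 = \<eta>1 +\<^sub>A diag l (- y1)"
  have \<eta>2: "\<eta>2 \<in> carrier AG" "annihilates \<eta>2"
    unfolding \<eta>2_def using \<eta>1 d0[OF y1Y] by (auto intro: annihilates_add)
  have Z2: "Z \<eta>2 \<sigma> = 0" if "\<sigma> \<in> Emb" for \<sigma>
    unfolding \<eta>2_def using that Z1 Z_AG[OF that \<eta>1(1) d0(1)[OF y1Y] zero_K] Z_diag[OF that \<eta> \<eta> d0(3)[OF y1Y]]
    by (simp add: emb_minus Ymod_K[OF y1Y])
  \<comment> \<open>Translate \<open>\<eta>2\<close> by some \<open>- y\<close> that makes its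
    finite components tiny. Its infinite component vanishes, so the translate has that of
    \<open>- y\<close>; integrality at \<open>w j / l ^ k\<close> then says that
    \<open>y / l ^ k\<close> has integer coordinates in \<open>u\<close>. Hence \<open>y\<close> is
    small at \<open>P\<close>, and so is \<open>\<eta>2\<close>.\<close>
  have fin0: "labP P (\<eta>2 (Fin_place P)) \<le> 2 * (1 / 2) ^ k" if P: "P \<in> Pl" for P k
  proof -
    define N where "N = max (N0 k) k"
    obtain y where y: "y \<in> Ymod" "\<And>P. P \<in> Pl \<Longrightarrow> labP P ((\<eta>2 +\<^sub>A diag l (- y)) (Fin_place P)) \<le> (1 / 2) ^ N"
      using Ymod_approximation[OF \<eta>2(1)] by blast
    define \<zeta> where "\<zeta> = \<eta>2 +\<^sub>A diag l (- y)"
    note yK = Ymod_K[OF y(1)]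
    have \<zeta>: "\<zeta> \<in> carrier AG" "annihilates \<zeta>"
      unfolding \<zeta>_def using \<eta>2 d0[OF y(1)] by (auto intro: annihilates_add)
    have Zz: "Z \<zeta> \<tau> = - \<tau> y" if "\<tau> \<in> Emb" for \<tau>
      unfolding \<zeta>_def using that Z2 Z_AG[OF that \<eta>2(1) d0(1)[OF y(1)] zero_K] Z_diag[OF that \<eta> \<eta> d0(3)[OF y(1)]]
      by (simp add: emb_minus yK)
    have "Tr (y / l ^ k * w j) \<in> \<int>" if j: "j < n" for j
    proof -
      have mK: "w j / l ^ k \<in> K" by (rule Mset_K[OF wM[OF j]])
      have "(\<Sum>\<tau>\<in>Emb. Z \<zeta> \<tau> * \<tau> (w j / l ^ k)) = - Tr (y * (w j / l ^ k))"
        unfolding Tr_def sum_negf[symmetric] using Zz yK mK by (intro sum.cong refl) (simp add: emb_simps(2)[symmetric])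
      moreover obtain z where "(\<Sum>\<tau>\<in>Emb. Re (Z (smul \<zeta> (w j / l ^ k)) \<tau>)) = of_int z"
        using inf_int[OF \<zeta> y(2)[folded \<zeta>_def] _ j, of k] by (auto simp: N_def elim: Ints_cases)
      ultimately have "- Tr (y * (w j / l ^ k)) = of_real (of_int z)"
        unfolding Z_sum_real[OF \<zeta>(1) mK] by simp
      hence "Tr (y * (w j / l ^ k)) = of_int (- z)" by (simp add: minus_equation_iff)
      hence "Tr (y * (w j / l ^ k)) \<in> \<int>" by (simp only: Ints_of_int)
      thus ?thesis by simp
    qed
    then obtain b where b: "\<And>j. j < n \<Longrightarrow> Tr (y / l ^ k * w j) = of_int (b j)" using Ints_choice[of n "\<lambda>j. Tr (y / l ^ k * w j)"] by blast
    have ylK: "y / l ^ k \<in> K" using yK by (intro divide_K power_K) auto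
    have "y / l ^ k = (\<Sum>j<n. Tr (y / l ^ k * w j) * u $ j)" by (rule u_expansion[OF ylK])
    also have "\<dots> = (\<Sum>j<n. of_int (b j) * u $ j)" using b by (intro sum.cong refl) (simp only: lessThan_iff)
    finally have "y / l ^ k = (\<Sum>j<n. of_int (b j) * u $ j)" .
    hence O: "y / l ^ k \<in> Oint" by (auto intro!: Oint_sum Oint_mult Oint_of_int)
    obtain t p where "local_place A n l u P t p" using P by (rule Pl_local_place)
    then interpret local_place A n l u P t p .
    have "y = l ^ k * (y / l ^ k)" by simp
    also have "v \<dots> = v l ^ k * v (y / l ^ k)" using ylK by (subst V.v_mult) (auto simp: V.v_power)
    also have "\<dots> \<le> (1 / 2) ^ k * 1" using v_l_le[OF P] V.v_Oint_le[OF O] by (intro mult_mono power_mono) auto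
    finally have vy: "v y \<le> (1 / 2) ^ k" by simp
    define \<xi> where "\<xi> = \<eta>2 (Fin_place P)"
    have x: "\<xi> \<in> carrier W.L" using AG_in[OF \<eta>2(1) Fin_place_S[OF P]] unfolding Lv_Fin \<xi>_def .
    have "W.labs (\<xi> \<oplus>\<^bsub>W.L\<^esub> W.emb (- y)) \<le> (1 / 2) ^ N"
      using y(2)[OF P] P by (simp add: AG_apply diag_def Lv_Fin \<xi>_def)
    also have "\<dots> \<le> (1 / 2) ^ k" by (intro power_decreasing) (auto simp: N_def)
    finally have 1: "W.labs (\<xi> \<oplus>\<^bsub>W.L\<^esub> W.emb (- y)) \<le> (1 / 2) ^ k" .
    have eq: "(\<xi> \<oplus>\<^bsub>W.L\<^esub> W.emb (- y)) \<oplus>\<^bsub>W.L\<^esub> W.emb y = \<xi>"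
      using x yK uminus_K[OF yK] by (simp add: W.emb_uminus L.a_assoc L.l_neg)
    have "W.labs ((\<xi> \<oplus>\<^bsub>W.L\<^esub> W.emb (- y)) \<oplus>\<^bsub>W.L\<^esub> W.emb y) \<le> W.labs (\<xi> \<oplus>\<^bsub>W.L\<^esub> W.emb (- y)) + W.labs (W.emb y)"
      using x yK uminus_K[OF yK] by (intro W.labs_triangle) auto
    moreover have "W.labs (W.emb y) \<le> (1 / 2) ^ k" using vy yK by simp
    ultimately have "W.labs \<xi> \<le> (1 / 2) ^ k + (1 / 2) ^ k" using 1 unfolding eq by linarith
    thus ?thesis unfolding Lv_Fin \<xi>_def by simp
  qed
  have "\<eta>2 v = \<zero>\<^bsub>Lv v\<^esub>" if v: "v \<in> S" for v
  proof -
    have "lab v (\<eta>2 v) = 0"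
      using v
    proof (cases rule: S_cases)
      case (1 \<sigma>)
      thus ?thesis using Z_norm[OF 1(1) \<eta>2(1) \<eta>2(1) zero_K] Z2[OF 1(1)] by simp
    next
      case (2 P t p)
      have "(\<lambda>k. 2 * (1 / 2 :: real) ^ k) \<longlonglongrightarrow> 2 * 0" by (intro tendsto_mult tendsto_const LIMSEQ_power_zero) auto
      hence "lab v (\<eta>2 v) \<le> 2 * 0" by (rule LIMSEQ_le_const) (use fin0[OF 2(1)] in \<open>auto simp: 2(2)\<close>)
      thus ?thesis using lab_nonneg[OF v AG_in[OF \<eta>2(1) v]] by simp
    qed
    thus ?thesis using lab_0_iff[OF v AG_in[OF \<eta>2(1) v]] by simp
  qed
  hence "\<eta>2 = \<one>\<^bsub>AG\<^esub>" by (intro AG_eqI \<eta>2(1) AG.one_closed) (simp add: adele_group_def)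
  have inv: "\<xi> +\<^sub>A diag l (- y) +\<^sub>A diag l y = \<xi>" if "y \<in> Ymod" "\<xi> \<in> carrier AG" for \<xi> y
  proof -
    have "diag l (- y) +\<^sub>A diag l y = diag l 0"
      using diag_add[OF \<eta> \<eta> d0(3)[OF that(1)] Ymod_K[OF that(1)]] by simp
    moreover have "diag l 0 = \<one>\<^bsub>AG\<^esub>"
      by (auto simp: diag_def adele_group_def Lv_eq ev_eq valued_field.L_zero[OF place_valued] intro!: restrict_ext)
    ultimately show ?thesis using that d0(1) diag_closed[OF Ymod_K[OF that(1)]] by (simp add: AG.m_assoc)
  qed
  have "\<eta>2 +\<^sub>A diag l y1 = \<eta>1" unfolding \<eta>2_def by (rule inv[OF y1Y \<eta>1(1)])
  hence "\<eta> = (\<eta>2 +\<^sub>A diag l y1) +\<^sub>A diag l y0" using inv[OF y0(1) \<eta>] by (simp add: \<eta>1_def)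
  also have "\<dots> = diag l (y1 + y0)"
    unfolding \<open>\<eta>2 = \<one>\<^bsub>AG\<^esub>\<close> using diag_closed Ymod_K y1Y y0(1) by (simp add: diag_add[OF \<eta> \<eta>])
  finally show ?thesis using Ymod_add[OF y1Y y0(1)] by blast
qed

end

section \<open>Realizing characters\<close>

definition ec :: "real \<Rightarrow> complex" where "ec t = exp (2 * of_real pi * \<i> * of_real t)"

lemma ec_add: "ec (s + t) = ec s * ec t"
  by (simp add: ec_def ring_distribs exp_add)

lemma ec_cis: "ec t = cis (2 * pi * t)"
  by (simp add: ec_def cis_conv_exp ac_simps)

lemma norm_ec [simp]: "cmod (ec t) = 1"
  by (simp add: ec_cis)

lemma ec_nz [simp]: "ec t \<noteq> 0"
  using norm_ec[of t] by force

lemma ec_eq_1_iff: "ec t = 1 \<longleftrightarrow> t \<in> \<int>"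
proof
  assume "ec t = 1"
  hence "cos (2 * pi * t) = 1" by (simp add: ec_cis complex_eq_iff)
  then obtain k :: int where "2 * pi * t = of_int k * 2 * pi" unfolding cos_one_2pi_int by blast
  thus "t \<in> \<int>" by simp
qed (simp add: ec_cis cis_multiple_2pi)

lemma ec_uminus: "ec (- t) = inverse (ec t)"
  using ec_add[of t "- t"] ec_eq_1_iff[of 0] by (simp add: inverse_unique)

lemma ec_eq_iff: "ec s = ec t \<longleftrightarrow> s - t \<in> \<int>"
  using ec_add[of s "- t"] ec_eq_1_iff[of "s - t"] by (auto simp: ec_uminus field_simps)

lemma ec_exists: "cmod z = 1 \<Longrightarrow> \<exists>t. z = ec t"
  using cis_Arg[of z] by (intro exI[of _ "Arg z / (2 * pi)"]) (force simp: ec_cis sgn_eq)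

context integer_matrix
begin

lemma sum_Emb_lattice:
  assumes "m \<in> K"
  shows "(\<Sum>\<tau>\<in>Emb. (\<Sum>i<n. of_real (t i) * \<tau> (l ^ k * u $ i)) * \<tau> m) = (\<Sum>i<n. of_real (t i) * Tr (l ^ k * m * u $ i))"
proof -
  have "(\<Sum>i<n. of_real (t i) * \<tau> (l ^ k * u $ i)) * \<tau> m = (\<Sum>i<n. of_real (t i) * \<tau> (l ^ k * m * u $ i))"
    if "\<tau> \<in> Emb" for \<tau>
    unfolding sum_distrib_right using that assms
    by (intro sum.cong refl) (simp add: emb_simps ac_simps)
  hence "(\<Sum>\<tau>\<in>Emb. (\<Sum>i<n. of_real (t i) * \<tau> (l ^ k * u $ i)) * \<tau> m) = (\<Sum>\<tau>\<in>Emb. \<Sum>i<n. of_real (t i) * \<tau> (l ^ k * m * u $ i))"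
    by (intro sum.cong refl)
  also have "\<dots> = (\<Sum>i<n. of_real (t i) * Tr (l ^ k * m * u $ i))"
    unfolding Tr_def sum_distrib_left by (rule sum.swap)
  finally show ?thesis .
qed

text \<open>The explicit infinite components and the bound at finite places are part of the
  statement so that characters close to 1 come from elements close to 0.\<close>

theorem character_realized:
  fixes c :: "complex \<Rightarrow> complex"
  assumes hom: "\<And>m m'. m \<in> Mset \<Longrightarrow> m' \<in> Mset \<Longrightarrow> c (m + m') = c m * c m'"
    and norm: "\<And>m. m \<in> Mset \<Longrightarrow> cmod (c m) = 1" and t: "\<And>j. j < n \<Longrightarrow> c (w j / l ^ k) = ec (t j)"
  shows "\<exists>\<eta>\<in>carrier AG. (\<forall>m\<in>Mset. ec (\<Lambda> (smul \<eta> m)) = c m) \<and>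
    (\<forall>\<tau>\<in>Emb. Z \<eta> \<tau> = - (\<Sum>j<n. of_real (t j) * \<tau> (l ^ k * u $ j))) \<and>
    (\<forall>P\<in>Pl. labP P (\<eta> (Fin_place P)) \<le> (1 / 2) ^ k)"
proof -
  \<comment> \<open>\<open>lg m s\<close> says that \<open>s\<close> is a logarithm of
    \<open>c m\<close>: unique modulo integers, and additive in \<open>m\<close>.\<close>
  define lg where "lg m s \<longleftrightarrow> m \<in> Mset \<and> c m = ec s" for m s
  have lg_add: "lg (m + m') (s + s')" if "lg m s" "lg m' s'" for m m' s s'
    using that hom Mset_add by (auto simp: lg_def ec_add)
  have "c 0 = c 0 * c 0" "cmod (c 0) = 1" using hom[OF Mset_0 Mset_0] norm[OF Mset_0] by simp_all
  hence c0: "c 0 = 1" by auto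
  hence lg_0: "lg 0 0" using ec_eq_1_iff[of 0] Mset_0 by (simp add: lg_def)
  have lg_neg: "lg (- m) (- s)" if "lg m s" for m s
    using that hom[of m "- m"] c0 Mset_uminus by (auto simp: lg_def ec_uminus intro: inverse_unique[symmetric])
  have lg_nat: "lg (of_nat a * m) (of_nat a * s)" if "lg m s" for a m s
    by (induction a) (use that lg_0 lg_add in \<open>auto simp: ring_distribs\<close>)
  have lg_int: "lg (of_int a * m) (of_int a * s)" if "lg m s" for a m s
    using lg_nat[OF that, of "nat a"] lg_neg[OF lg_nat[OF that, of "nat (- a)"]] by (cases "a \<ge> 0") auto
  have lg_sum: "lg (\<Sum>i\<in>I. f i) (\<Sum>i\<in>I. g i)" if "\<And>i. i \<in> I \<Longrightarrow> lg (f i) (g i)" for f g and I :: "nat set"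
    using that by (induction I rule: infinite_finite_induct) (auto intro: lg_0 lg_add)
  \<comment> \<open>Level 0 carries the prescribed lifts, on which the infinite components depend;
    lifts at higher levels are arbitrary and influence only the digits.\<close>
  define T where "T r j = (if r = 0 then t j else (SOME s. c (w j / l ^ (k + r)) = ec s))" for r j
  have T: "lg (w j / l ^ (k + r)) (T r j)" if "j < n" for r j
    using t[OF that] someI_ex[OF ec_exists[OF norm[OF w_l_Mset[OF that, of "k + r"]]]] w_l_Mset[OF that]
    unfolding lg_def T_def by auto
  have TA: "Tr (l * w j * u $ i) = of_int (A $$ (i, j))" if "i < n" "j < n" for i j
    using Tr_l_u[OF w_K[OF that(2)] that(1)] Tr_u_w that by (simp add: mult.commute[of "w j"] if_distrib cong: if_cong)
  \<comment> \<open>The columns of \<open>A\<close> express \<open>l * w j\<close> in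
    \<open>w\<close>, so lifts at level \<open>r + 1\<close> induce lifts at level \<open>r\<close>.
    The induced and the chosen lift differ by an integer, so the floor is exact.\<close>
  define a where "a r j = \<lfloor>(\<Sum>i<n. of_int (A $$ (i, j)) * T (Suc r) i) - T r j\<rfloor>" for r j
  have a: "(\<Sum>i<n. of_int (A $$ (i, j)) * T (Suc r) i) - T r j = of_int (a r j)" if j: "j < n" for r j
  proof -
    have "l * w j = (\<Sum>i<n. of_int (A $$ (i, j)) * w i)"
      using w_expansion[of "l * w j"] TA[OF _ j] j by simp
    hence "w j / l ^ (k + r) = (\<Sum>i<n. of_int (A $$ (i, j)) * w i) / l ^ (k + Suc r)" by (simp add: field_simps)
    also have "\<dots> = (\<Sum>i<n. of_int (A $$ (i, j)) * (w i / l ^ (k + Suc r)))" by (simp add: sum_divide_distrib)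
    finally have eq: "w j / l ^ (k + r) = \<dots>" .
    have "lg (w j / l ^ (k + r)) (\<Sum>i<n. of_int (A $$ (i, j)) * T (Suc r) i)"
      unfolding eq by (intro lg_sum lg_int T) simp
    hence "(\<Sum>i<n. of_int (A $$ (i, j)) * T (Suc r) i) - T r j \<in> \<int>"
      using T[OF j, of r] unfolding lg_def by (simp add: ec_eq_iff[symmetric])
    thus ?thesis unfolding a_def by (auto elim: Ints_cases)
  qed
  define d where "d r = l ^ (k + r) * (\<Sum>j<n. of_int (a r j) * u $ j)" for r
  define y where "y r = (\<Sum>s<r. d s)" for r
  have dY: "d r \<in> Ymod" for r unfolding d_def by (rule integral_combination_Ymod(3)[OF refl])
  have yY: "y r \<in> Ymod" for r unfolding y_def by (induction r) (auto intro: lat_0 Ymod_add dY)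
  note dK = Ymod_K[OF dY] and yK = Ymod_K[OF yY]
  \<comment> \<open>Passing from one level to the next adds exactly the digit \<open>d r\<close>.
    This ties the infinite components, computed with level 0, to the partial sums \<open>y r\<close>
    of the finite ones.\<close>
  have formal: "(\<Sum>i<n. of_real (T r i) * \<tau> (l ^ (k + r) * u $ i)) = (\<Sum>i<n. of_real (t i) * \<tau> (l ^ k * u $ i)) + \<tau> (y r)"
    if \<tau>: "\<tau> \<in> Emb" for \<tau> r
  proof (induction r)
    case 0
    show ?case using \<tau> by (simp add: T_def y_def emb_0)
  next
    case (Suc r)
    have lu: "\<tau> (l * u $ i) = (\<Sum>j<n. of_int (A $$ (i, j)) * \<tau> (u $ j))" if "i < n" for i
      unfolding l_mult_u[OF that] using \<tau>
      by (subst emb_sum) (auto simp: simp_implies_def emb_simps emb_of_int)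
    have "\<tau> (l ^ (k + Suc r) * u $ i) = \<tau> (l ^ (k + r)) * (\<Sum>j<n. of_int (A $$ (i, j)) * \<tau> (u $ j))" if "i < n" for i
      unfolding lu[OF that, symmetric] using \<tau> that by (subst emb_simps(2)[OF \<tau>, symmetric]) (auto simp: ac_simps)
    hence "(\<Sum>i<n. of_real (T (Suc r) i) * \<tau> (l ^ (k + Suc r) * u $ i))
        = (\<Sum>i<n. \<Sum>j<n. \<tau> (l ^ (k + r)) * (of_real (of_int (A $$ (i, j)) * T (Suc r) i) * \<tau> (u $ j)))"
      by (intro sum.cong refl) (simp add: sum_distrib_left ac_simps)
    also have "\<dots> = (\<Sum>j<n. \<tau> (l ^ (k + r)) * (of_real (\<Sum>i<n. of_int (A $$ (i, j)) * T (Suc r) i) * \<tau> (u $ j)))"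
      by (subst sum.swap) (simp only: sum_distrib_left sum_distrib_right of_real_sum)
    also have "\<dots> = (\<Sum>j<n. of_real (T r j) * \<tau> (l ^ (k + r) * u $ j) + \<tau> (l ^ (k + r) * (of_int (a r j) * u $ j)))"
    proof (intro sum.cong refl)
      fix j assume "j \<in> {..<n}"
      hence j: "j < n" by simp
      have "(\<Sum>i<n. of_int (A $$ (i, j)) * T (Suc r) i) = T r j + of_int (a r j)" using a[OF j, of r] by simp
      thus "\<tau> (l ^ (k + r)) * (of_real (\<Sum>i<n. of_int (A $$ (i, j)) * T (Suc r) i) * \<tau> (u $ j))
          = of_real (T r j) * \<tau> (l ^ (k + r) * u $ j) + \<tau> (l ^ (k + r) * (of_int (a r j) * u $ j))"
        using \<tau> j by (simp add: emb_simps emb_of_int algebra_simps)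
    qed
    also have "\<dots> = (\<Sum>i<n. of_real (T r i) * \<tau> (l ^ (k + r) * u $ i)) + \<tau> (d r)"
      unfolding sum.distrib d_def sum_distrib_left using \<tau>
      by (subst emb_sum[OF \<tau>]) (auto simp: simp_implies_def)
    finally show ?case unfolding Suc using \<tau> by (simp add: y_def[of "Suc r"] y_def[of r, symmetric] emb_simps yK dK add.assoc)
  qed
  \<comment> \<open>The completions consist of classes of sequences in K, so the real coefficients
    are replaced by rational sequences; one sequence \<open>x\<close> serves all infinite
    places.\<close>
  define q where "q j m = (SOME q. - t j < real_of_rat q \<and> real_of_rat q < - t j + 1 / Suc m)" for j m
  have q': "- t j < real_of_rat (q j m) \<and> real_of_rat (q j m) < - t j + 1 / Suc m" for j m
    unfolding q_def by (rule someI_ex[OF of_rat_dense]) simp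
  have q: "(\<lambda>m. real_of_rat (q j m)) \<longlonglongrightarrow> - t j" for j
  proof -
    have lim: "(\<lambda>m. - t j + 1 / Suc m) \<longlonglongrightarrow> - t j + 0"
      by (intro tendsto_add tendsto_const) (rule lim_1_over_n[THEN LIMSEQ_Suc])
    show ?thesis
    proof (rule tendsto_sandwich)
      show "\<forall>\<^sub>F m in sequentially. - t j \<le> real_of_rat (q j m)" "\<forall>\<^sub>F m in sequentially. real_of_rat (q j m) \<le> - t j + 1 / Suc m"
        using q'[of j] by (auto intro!: always_eventually less_imp_le)
    qed (use lim in simp_all)
  qed
  define x where "x m = (\<Sum>j<n. of_rat (q j m) * (l ^ k * u $ j))" for m
  define \<eta> where "\<eta> = (\<lambda>v\<in>S. valued_field.cls K (place_abs K v) (case v of Fin_place P \<Rightarrow> y | Inf_place s \<Rightarrow> x))"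
  have fin: "\<eta> (Fin_place P) \<in> carrier (LP P) \<and>
      labP P (\<eta> (Fin_place P) \<oplus>\<^bsub>LP P\<^esub> ev (Fin_place P) (- y r)) \<le> (1 / 2) ^ (k + r)" if P: "P \<in> Pl" for P r
  proof -
    obtain t p where "local_place A n l u P t p" using P by (rule Pl_local_place)
    then interpret local_place A n l u P t p .
    have vd: "v (d s) \<le> (1 / 2) ^ (k + s)" for s
    proof -
      have o: "(\<Sum>j<n. of_int (a s j) * u $ j) \<in> Oint" by (auto intro!: Oint_sum Oint_mult Oint_of_int)
      have "v (d s) = v l ^ (k + s) * v (\<Sum>j<n. of_int (a s j) * u $ j)"
        unfolding d_def using Oint_K[OF o] by (simp add: V.v_mult V.v_power)
      also have "\<dots> \<le> (1 / 2) ^ (k + s) * 1"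
        using v_l_le[OF P] V.v_Oint_le[OF o] by (intro mult_mono power_mono) auto
      finally show ?thesis by simp
    qed
    have vy: "v (y i - y r) \<le> (1 / 2) ^ (k + r)" if "i \<ge> r" for i r
    proof -
      have "y i - y r = (\<Sum>s\<in>{r..<i}. d s)"
        using sum.atLeastLessThan_concat[of 0 r i d] that
        by (simp add: y_def lessThan_atLeast0 diff_eq_eq add.commute)
      also have "v \<dots> \<le> (1 / 2) ^ (k + r)"
        by (intro v_sum_le dK order_trans[OF vd power_decreasing]) auto
      finally show ?thesis .
    qed
    have yC: "y \<in> W.Cau" unfolding W.Cau_iff
    proof (intro conjI allI impI yK)
      fix \<epsilon> :: real assume "\<epsilon> > 0"
      hence "\<epsilon> / 3 > 0" by simp
      then obtain r where r: "(1 / 2) ^ r \<le> \<epsilon> / 3" using power_below(2) by blast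
      have "(1 / 2 :: real) ^ (k + r) \<le> (1 / 2) ^ r" by (intro power_decreasing) auto
      hence "v (y i - y j) < \<epsilon>" if "i \<ge> r" "j \<ge> r" for i j
        using W.v_dist_triangle[OF yK[of i] yK[of r] yK[of j]] vy[OF that(1)] vy[OF that(2)] W.v_commute[OF yK[of r] yK[of j]] r \<open>\<epsilon> > 0\<close>
        by linarith
      thus "\<exists>N. \<forall>i\<ge>N. \<forall>j\<ge>N. v (y i - y j) < \<epsilon>" by blast
    qed
    have \<eta>P: "\<eta> (Fin_place P) = W.cls y" using P by (simp add: \<eta>_def place_abs_Fin)
    have "\<eta> (Fin_place P) \<oplus>\<^bsub>LP P\<^esub> ev (Fin_place P) (- y r) = W.cls (\<lambda>i. y i - y r)"
      unfolding \<eta>P Lv_Fin W.emb_cls using yC W.Cau_const[OF uminus_K[OF yK[of r]]] by (simp add: W.L_ops)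
    moreover have "(\<lambda>i. y i - y r) \<in> W.Cau" using W.Cau_diff[OF yC W.Cau_const[OF yK]] .
    moreover from this have "W.labs (W.cls (\<lambda>i. y i - y r)) \<le> (1 / 2) ^ (k + r)"
      using vy by (intro LIMSEQ_le_const2[OF W.labs_cls]) auto
    ultimately show ?thesis using yC unfolding \<eta>P Lv_Fin by simp
  qed
  have inf: "\<eta> (Inf_place {\<tau>, conj_emb \<tau>}) \<in> carrier (Lv (Inf_place {\<tau>, conj_emb \<tau>})) \<and>
      Z \<eta> \<tau> = - (\<Sum>j<n. of_real (t j) * \<tau> (l ^ k * u $ j))" if \<tau>: "\<tau> \<in> Emb" for \<tau>
  proof -
    interpret infinite_place A n l u \<tau> by (rule Lv_Inf[OF \<tau>])
    have *: "\<eta> (Inf_place {\<tau>, conj_emb \<tau>}) = W.cls x"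
      using Inf_place_S[OF \<tau>] by (simp only: \<eta>_def place_abs_Inf restrict_apply if_True place.case)
    show ?thesis unfolding Z_def * Lv_Inf(2)[OF \<tau>]
      using E_real_combination[of q "\<lambda>j. - t j" "l ^ k", folded x_def] q by (simp add: sum_negf)
  qed
  have \<eta>: "\<eta> \<in> carrier AG" unfolding carrier_AG
  proof (intro conjI ballI)
    fix v assume "v \<in> S"
    thus "\<eta> v \<in> carrier (Lv v)" by (cases rule: S_cases) (use fin inf in blast)+
  qed (simp add: \<eta>_def)
  have "ec (\<Lambda> (smul \<eta> m)) = c m" if m: "m \<in> Mset" for m
  proof -
    note mK = Mset_K[OF m]
    obtain k0 where k0: "\<forall>j<n. Tr (l ^ k0 * m * u $ j) \<in> \<int>" using m unfolding lat_def by blast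
    obtain N0 where N0: "\<And>N P \<xi>. N \<ge> N0 \<Longrightarrow> P \<in> Pl \<Longrightarrow> \<xi> \<in> carrier (LP P) \<Longrightarrow> labP P \<xi> \<le> (1 / 2) ^ N \<Longrightarrow>
        Lam K (Fin_place P) (\<xi> \<otimes>\<^bsub>LP P\<^esub> ev (Fin_place P) m) \<in> \<int>"
      using fin_small[OF mK] by blast
    define r where "r = max k0 N0"
    have "\<forall>j<n. Tr (l ^ (k + r) * m * u $ j) \<in> \<int>"
      by (rule integral_le[OF disjI2[OF refl] mK k0]) (simp add: r_def)
    then obtain b where b: "\<And>j. j < n \<Longrightarrow> Tr (l ^ (k + r) * m * u $ j) = of_int (b j)" using Ints_choice[of n "\<lambda>j. Tr (l ^ (k + r) * m * u $ j)"] by blast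
    have "l ^ (k + r) * m = (\<Sum>j<n. Tr (l ^ (k + r) * m * u $ j) * w j)"
      by (rule w_expansion[OF mult_K[OF power_K[OF l_K] mK]])
    also have "\<dots> = (\<Sum>j<n. of_int (b j) * w j)" by (intro sum.cong refl) (simp only: b lessThan_iff)
    finally have "m = (\<Sum>j<n. of_int (b j) * w j) / l ^ (k + r)" by (simp add: field_simps)
    also have "\<dots> = (\<Sum>j<n. of_int (b j) * (w j / l ^ (k + r)))" by (simp add: sum_divide_distrib)
    finally have m_eq: "m = \<dots>" .
    have lgm: "lg m (\<Sum>j<n. of_int (b j) * T r j)" by (subst m_eq) (intro lg_sum lg_int T, simp)
    \<comment> \<open>Subtracting the diagonal of \<open>y r\<close> changes no value of the
      character. At level \<open>k + r\<close> the finite part of the result contributes an integer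
      at \<open>m\<close>, and its infinite part is given by the level-r lifts, which describe
      \<open>c m\<close> since \<open>m\<close> has integer coordinates there.\<close>
    define \<zeta> where "\<zeta> = \<eta> +\<^sub>A diag l (- y r)"
    have nK: "- y r \<in> K" "- y r \<in> Ymod" using yY[of r] Ymod_uminus Ymod_K by blast+
    note dg = diag_closed[OF nK(1)]
    have \<zeta>: "\<zeta> \<in> carrier AG" unfolding \<zeta>_def using \<eta> dg by simp
    have Zz: "Z \<zeta> \<tau> = - (\<Sum>i<n. of_real (T r i) * \<tau> (l ^ (k + r) * u $ i))" if "\<tau> \<in> Emb" for \<tau>
      unfolding \<zeta>_def formal[OF that] Z_AG[OF that \<eta> dg nK(1)] Z_diag[OF that \<eta> \<eta> nK(1)]
      using inf[OF that] that by (simp add: emb_minus yK)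
    have "of_real (\<Sum>\<tau>\<in>Emb. Re (Z (smul \<zeta> m) \<tau>)) = - (\<Sum>\<tau>\<in>Emb. (\<Sum>i<n. of_real (T r i) * \<tau> (l ^ (k + r) * u $ i)) * \<tau> m)"
      unfolding Z_sum_real[OF \<zeta> mK, symmetric] sum_negf[symmetric] by (intro sum.cong refl) (simp add: Zz)
    also have "\<dots> = of_real (- (\<Sum>j<n. of_int (b j) * T r j))"
      unfolding sum_Emb_lattice[OF mK] using b by (simp add: mult.commute)
    finally have inf': "(\<Sum>\<tau>\<in>Emb. Re (Z (smul \<zeta> m) \<tau>)) = - (\<Sum>j<n. of_int (b j) * T r j)"
      unfolding of_real_eq_iff .
    have "Lam K (Fin_place P) (\<zeta> (Fin_place P) \<otimes>\<^bsub>LP P\<^esub> ev (Fin_place P) m) \<in> \<int>" if P: "P \<in> Pl" for P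
    proof (rule N0[OF _ P])
      show "labP P (\<zeta> (Fin_place P)) \<le> (1 / 2) ^ (k + r)" using fin[OF P, of r] P by (simp add: \<zeta>_def AG_apply diag_def)
    qed (use P in \<open>auto simp: r_def intro: AG_in[OF \<zeta>]\<close>)
    hence fI: "(\<Sum>P\<in>Pl. Lam K (Fin_place P) (\<zeta> (Fin_place P) \<otimes>\<^bsub>LP P\<^esub> ev (Fin_place P) m)) \<in> \<int>"
      by (intro Ints_sum)
    have dI: "\<Lambda> (smul (diag l (- y r)) m) \<in> \<int>" using annihilates_diag[OF nK(2)] m unfolding annihilates_def by blast
    have "\<Lambda> (smul \<zeta> m) - (\<Lambda> (smul \<eta> m) + \<Lambda> (smul (diag l (- y r)) m)) \<in> \<int>"
      unfolding \<zeta>_def by (rule Lambda_smul_add[OF \<eta> dg mK])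
    from Ints_diff[OF fI Ints_add[OF this dI]] have "\<Lambda> (smul \<eta> m) - (\<Sum>j<n. of_int (b j) * T r j) \<in> \<int>"
      unfolding Lambda_smul[OF \<zeta> mK] inf' by (simp add: algebra_simps)
    thus ?thesis using lgm unfolding lg_def by (simp add: ec_eq_iff[symmetric])
  qed
  moreover have "labP P (\<eta> (Fin_place P)) \<le> (1 / 2) ^ k" if P: "P \<in> Pl" for P
  proof -
    interpret field "LP P" by (rule field_Lv[OF Fin_place_S[OF P]])
    have "ev (Fin_place P) 0 = \<zero>\<^bsub>LP P\<^esub>"
      unfolding Lv_eq ev_eq using valued_field.L_zero[OF place_valued[OF Fin_place_S[OF P]]] by simp
    thus ?thesis using conjunct1[OF fin[OF P, of 0]] conjunct2[OF fin[OF P, of 0]] by (simp add: y_def)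
  qed
  ultimately show ?thesis using inf by (intro bexI[OF _ \<eta>] conjI ballI) simp_all
qed

end

section \<open>The group of the matrix\<close>

context integer_matrix
begin

text \<open>The inverse of \<open>mu\<close> on the group of the matrix. Traces are complex numbers
  with rational values, hence the inverse of \<open>of_rat\<close>.\<close>

definition vecM :: "complex \<Rightarrow> rat vec" where "vecM m = vec n (\<lambda>j. inv_into UNIV of_rat (Tr (m * vec_index u j)))"

lemma vecM_carrier [simp]: "vecM m \<in> carrier_vec n"
  by (simp add: vecM_def)

lemma vecM_nth: assumes "m \<in> K" "j < n" shows "of_rat (vecM m $ j) = Tr (m * u $ j)"
proof -
  have "Tr (m * u $ j) \<in> \<rat>" using assms by (intro Tr_rational mult_K) auto
  thus ?thesis using assms(2) by (auto simp: vecM_def f_inv_into_f Rats_def)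
qed

lemma vecM_eqI:
  fixes y :: "rat vec"
  assumes "m \<in> K" "y \<in> carrier_vec n" "\<And>j. j < n \<Longrightarrow> of_rat (y $ j) = Tr (m * u $ j)"
  shows "vecM m = y"
  using assms vecM_nth[OF assms(1)] by (intro eq_vecI) (auto simp flip: of_rat_eq_iff[where 'a = complex])

lemma mu_vecM: assumes "m \<in> K" shows "mu l u (vecM m) = m"
  unfolding mu_def
proof (rule the_equality)
  show "m \<in> K \<and> (\<forall>j<dim_vec u. of_rat (vecM m $ j) = (\<Sum>\<sigma>\<in>Emb. \<sigma> (m * u $ j)))"
    using assms vecM_nth by (simp add: Tr_def)
  fix x assume x: "x \<in> K \<and> (\<forall>j<dim_vec u. of_rat (vecM m $ j) = (\<Sum>\<sigma>\<in>Emb. \<sigma> (x * u $ j)))"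
  hence "Tr (x * u $ j) = Tr (m * u $ j)" if "j < n" for j using that vecM_nth[OF assms that] by (simp add: Tr_def)
  thus "x = m" using w_expansion[of x] w_expansion[OF assms] x by simp
qed

lemma vecM_add: assumes "a \<in> K" "b \<in> K" shows "vecM a + vecM b = vecM (a + b)"
  using assms by (intro vecM_eqI[symmetric] add_K) (auto simp: of_rat_add vecM_nth ring_distribs Tr_add mult_K carrier_vecD[OF vecM_carrier])

abbreviation (input) AQ :: "rat mat" where "AQ \<equiv> map_mat rat_of_int A"
abbreviation (input) MR :: "rat mat ring" where "MR \<equiv> ring_mat TYPE(rat) n ()"

lemma AQ_carrier: "AQ \<in> carrier_mat n n"
  using A_carrier by simp

text \<open>The eigenvector equation for \<open>u\<close> turns the action of the matrix on trace
  vectors into multiplication by \<open>l\<close>.\<close>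

lemma AQ_mult: assumes "m \<in> K" shows "AQ *\<^sub>v vecM m = vecM (l * m)"
proof (rule vecM_eqI[symmetric])
  fix i assume i: "i < n"
  have "of_rat ((AQ *\<^sub>v vecM m) $ i) = (\<Sum>j<n. of_int (A $$ (i, j)) * of_rat (vecM m $ j))"
    using i A_carrier by (auto simp: scalar_prod_def of_rat_sum of_rat_mult lessThan_atLeast0 vecM_def intro!: sum.cong)
  also have "\<dots> = Tr (l * m * u $ i)" unfolding Tr_l_u[OF assms i] using vecM_nth[OF assms] by simp
  finally show "of_rat ((AQ *\<^sub>v vecM m) $ i) = Tr (l * m * u $ i)" .
qed (use assms A_carrier in \<open>auto intro: mult_K mult_mat_vec_carrier\<close>)

lemma power_AQ:
  fixes k :: nat
  shows "AQ [^]\<^bsub>MR\<^esub> k \<in> carrier_mat n n" and "m \<in> K \<Longrightarrow> (AQ [^]\<^bsub>MR\<^esub> k) *\<^sub>v vecM m = vecM (l ^ k * m)"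
proof -
  interpret R: ring MR by (rule ring_mat)
  show car: "AQ [^]\<^bsub>MR\<^esub> k \<in> carrier_mat n n" for k :: nat
    using R.nat_pow_closed[of AQ k] AQ_carrier by (simp add: ring_mat_simps)
  show "(AQ [^]\<^bsub>MR\<^esub> k) *\<^sub>v vecM m = vecM (l ^ k * m)" if "m \<in> K" for m
    using that
  proof (induction k arbitrary: m)
    case (Suc k)
    have "(AQ [^]\<^bsub>MR\<^esub> Suc k) *\<^sub>v vecM m = (AQ [^]\<^bsub>MR\<^esub> k) *\<^sub>v (AQ *\<^sub>v vecM m)"
      using car[of k] AQ_carrier by (simp add: ring_mat_simps)
    thus ?case using Suc by (simp add: AQ_mult ac_simps)
  qed (simp add: ring_mat_simps)
qed

lemma int_power_AQ:
  fixes k :: int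
  assumes "m \<in> K" shows "(AQ [^]\<^bsub>MR\<^esub> k) *\<^sub>v vecM m = vecM (l powi k * m)"
proof (cases "k < 0")
  case False
  thus ?thesis unfolding int_pow_def2 using power_AQ(2)[OF assms, of "nat k"] by (simp add: power_int_def)
next
  case True
  interpret R: ring MR by (rule ring_mat)
  define B where "B = AQ [^]\<^bsub>MR\<^esub> nat (- k)"
  have "det AQ \<noteq> 0" using det_A by simp
  hence "AQ \<in> Units MR" by (rule det_non_zero_imp_unit[OF AQ_carrier])
  hence U: "B \<in> Units MR" unfolding B_def by (rule R.Units_pow_closed)
  have car: "inv\<^bsub>MR\<^esub> B \<in> carrier_mat n n" "B \<in> carrier_mat n n"
    using R.Units_inv_closed[OF U] R.Units_closed[OF U] by (simp_all add: ring_mat_simps)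
  define m' where "m' = l powi k * m"
  have m': "m' \<in> K" "m = l ^ nat (- k) * m'" using True assms by (auto simp: m'_def power_int_def field_simps intro!: mult_K power_int_K)
  have "B *\<^sub>v vecM m' = vecM m" unfolding B_def power_AQ(2)[OF m'(1)] m'(2)[symmetric] ..
  hence "inv\<^bsub>MR\<^esub> B *\<^sub>v vecM m = (inv\<^bsub>MR\<^esub> B * B) *\<^sub>v vecM m'" using car by simp
  also have "inv\<^bsub>MR\<^esub> B * B = 1\<^sub>m n" using R.Units_l_inv[OF U] by (simp add: ring_mat_simps)
  finally show ?thesis unfolding int_pow_def2 B_def m'_def using True by simp
qed

text \<open>Integer vectors correspond to integer combinations of the dual basis \<open>w\<close>,
  and powers of the matrix to powers of \<open>l\<close>; the union over all exponents is
  \<open>Mset\<close>.\<close>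

lemma G_set_eq: "G_set A = vecM ` Mset"
proof (intro subset_antisym subsetI)
  have dim: "dim_row A = n" using A_carrier by simp
  fix g assume "g \<in> G_set A"
  then obtain x k where x: "x \<in> carrier_vec n" and g: "g = (AQ [^]\<^bsub>MR\<^esub> (k :: int)) *\<^sub>v map_vec rat_of_int x"
    unfolding G_set_def dim by blast
  define m where "m = (\<Sum>i<n. of_int (x $ i) * w i)"
  have mK: "m \<in> K" unfolding m_def by (intro sum_K mult_K of_int_K) auto
  have Tm: "Tr (m * u $ j) = of_int (x $ j)" if j: "j < n" for j
  proof -
    have "m * u $ j = (\<Sum>i<n. of_int (x $ i) * (u $ j * w i))" unfolding m_def by (simp add: sum_distrib_left ac_simps)
    also have "Tr \<dots> = (\<Sum>i<n. of_int (x $ i) * Tr (u $ j * w i))"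
      using j by (subst Tr_sum) (auto simp: simp_implies_def Tr_of_int_mult)
    also have "\<dots> = of_int (x $ j)" using j by (simp add: Tr_u_w if_distrib cong: if_cong)
    finally show ?thesis .
  qed
  have "vecM m = map_vec rat_of_int x" using x Tm by (intro vecM_eqI mK) auto
  hence "g = vecM (l powi k * m)" unfolding g using int_power_AQ[OF mK] by metis
  moreover have "l powi k * m \<in> Mset"
  proof -
    have "\<forall>j<n. Tr (l ^ 0 * m * u $ j) \<in> \<int>" using Tm by simp
    hence "\<forall>j<n. Tr (l ^ nat k * m * u $ j) \<in> \<int>" by (rule integral_le[OF disjI2[OF refl] mK]) simp
    moreover have "l ^ nat (- k) * (l powi k * m) = l ^ nat k * m"
      by (cases "k < 0") (auto simp: power_int_def field_simps)
    ultimately have "\<forall>j<n. Tr (l ^ nat (- k) * (l powi k * m) * u $ j) \<in> \<int>" by metis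
    thus ?thesis unfolding lat_def using mult_K[OF power_int_K[OF l_K] mK] by blast
  qed
  ultimately show "g \<in> vecM ` Mset" by blast
next
  have dim: "dim_row A = n" using A_carrier by simp
  fix g assume "g \<in> vecM ` Mset"
  then obtain m k where m: "g = vecM m" "m \<in> K" "\<forall>j<n. Tr (l ^ k * m * u $ j) \<in> \<int>" unfolding lat_def by blast
  then obtain b where b: "\<And>j. j < n \<Longrightarrow> Tr (l ^ k * m * u $ j) = of_int (b j)" using Ints_choice[of n "\<lambda>j. Tr (l ^ k * m * u $ j)"] by blast
  have lm: "l ^ k * m \<in> K" using m(2) by (intro mult_K power_K) auto
  have "vecM (l ^ k * m) = map_vec rat_of_int (vec n b)" using b by (intro vecM_eqI lm) auto
  moreover have "(AQ [^]\<^bsub>MR\<^esub> (- int k)) *\<^sub>v vecM (l ^ k * m) = vecM m"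
    unfolding int_power_AQ[OF lm] by (simp add: power_int_minus mult.assoc[symmetric])
  ultimately show "g \<in> G_set A" unfolding G_set_def dim m(1)
    by (intro CollectI exI[of _ "vec n b"] exI[of _ "- int k"]) simp
qed

lemma Y_set_eq: "Y_set u l = Ymod"
proof (intro subset_antisym subsetI)
  fix y assume "y \<in> Y_set u l"
  then obtain m k where y: "y = (\<Sum>i<n. of_int (m i) * l powi (k i) * u $ i)" unfolding Y_set_def by auto
  have memb: "of_int (m i) * l powi (k i) * u $ i \<in> Ymod" if i: "i < n" for i
  proof -
    have "of_int (m i) * u $ i = (\<Sum>j<n. of_int (if j = i then m i else 0) * u $ j)"
      using i by (simp add: if_distrib[of of_int] if_distrib[of "\<lambda>x. x * _"] cong: if_cong)
    from integral_combination_Ymod(3,4)[OF this] show ?thesis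
      by (cases "k i < 0") (auto simp: power_int_def field_simps)
  qed
  have "finite I \<Longrightarrow> I \<subseteq> {..<n} \<Longrightarrow> (\<Sum>i\<in>I. of_int (m i) * l powi (k i) * u $ i) \<in> Ymod" for I
    by (induction I rule: finite_induct) (auto intro: lat_0 Ymod_add memb)
  thus "y \<in> Ymod" unfolding y by blast
next
  fix y assume "y \<in> Ymod"
  then obtain k where y: "y \<in> K" "\<forall>j<n. Tr (l ^ k * y * w j) \<in> \<int>" unfolding lat_def by blast
  then obtain b where b: "\<And>j. j < n \<Longrightarrow> Tr (l ^ k * y * w j) = of_int (b j)" using Ints_choice[of n "\<lambda>j. Tr (l ^ k * y * w j)"] by blast
  have "l ^ k * y = (\<Sum>j<n. of_int (b j) * u $ j)"
    using u_expansion[OF mult_K[OF power_K[OF l_K] y(1)], of k] b by (simp cong: sum.cong_simp)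
  hence "y = (\<Sum>j<n. of_int (b j) * u $ j) / l ^ k" by (simp add: field_simps)
  also have "\<dots> = (\<Sum>j<n. of_int (b j) * l powi (- int k) * u $ j)"
    by (simp add: sum_divide_distrib power_int_minus field_simps)
  finally show "y \<in> Y_set u l" unfolding Y_set_def dim_u by (intro CollectI exI[of _ b] exI[of _ "\<lambda>_. - int k"]) simp
qed

section \<open>The map phi: homomorphism, surjectivity, kernel\<close>

abbreviation GD :: "(rat vec \<Rightarrow> complex) monoid" where "GD \<equiv> G_dual A"
abbreviation \<phi> :: "(place \<Rightarrow> (nat \<Rightarrow> complex) set) \<Rightarrow> rat vec \<Rightarrow> complex" where "\<phi> \<equiv> phi A u l"

lemma phi_vecM: "m \<in> Mset \<Longrightarrow> \<phi> \<eta> (vecM m) = ec (\<Lambda> (smul \<eta> m))"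
proof -
  assume m: "m \<in> Mset"
  have "\<Lambda> (smul \<eta> m) = (\<Sum>v\<in>S. Lam K v (\<eta> v \<otimes>\<^bsub>Lv v\<^esub> ev v m))"
    unfolding \<Lambda>_def smul_def by (intro sum.cong) auto
  thus ?thesis using m mu_vecM[OF Mset_K[OF m]]
    by (simp add: phi_def G_set_eq ec_def exp_sum sum_distrib_left del: Lam.simps)
qed

lemma phi_extensional: "\<phi> \<eta> \<in> extensional (G_set A)"
  by (simp add: phi_def)

lemma GD_carrier: "\<chi> \<in> carrier GD \<longleftrightarrow> \<chi> \<in> extensional (G_set A) \<and>
  (\<forall>m\<in>Mset. cmod (\<chi> (vecM m)) = 1 \<and> (\<forall>m'\<in>Mset. \<chi> (vecM (m + m')) = \<chi> (vecM m) * \<chi> (vecM m')))"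
proof -
  have "vecM m \<otimes>\<^bsub>G_group A\<^esub> vecM m' = vecM (m + m')" if "m \<in> Mset" "m' \<in> Mset" for m m'
    using vecM_add[OF Mset_K Mset_K] that by (simp add: G_group_def monoid_vec_def)
  thus ?thesis
    by (auto simp: pontryagin_dual_def hom_def G_group_def circle_group_def G_set_eq Pi_iff)
qed

lemma GD_mult: "\<chi> \<otimes>\<^bsub>GD\<^esub> \<chi>' = (\<lambda>x\<in>G_set A. \<chi> x * \<chi>' x)"
  by (simp add: pontryagin_dual_def G_group_def)

lemma GD_eqI:
  assumes "\<chi> \<in> carrier GD" "\<chi>' \<in> carrier GD" "\<And>m. m \<in> Mset \<Longrightarrow> \<chi> (vecM m) = \<chi>' (vecM m)" shows "\<chi> = \<chi>'"
  using assms unfolding GD_carrier by (intro extensionalityI[of _ "G_set A"]) (auto simp: G_set_eq)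

lemma phi_closed: assumes "\<eta> \<in> carrier AG" shows "\<phi> \<eta> \<in> carrier GD"
  unfolding GD_carrier
proof (intro conjI ballI phi_extensional)
  fix m assume m: "m \<in> Mset"
  thus "cmod (\<phi> \<eta> (vecM m)) = 1" by (simp add: phi_vecM)
  fix m' assume m': "m' \<in> Mset"
  have "\<Lambda> (smul \<eta> (m + m')) - (\<Lambda> (smul \<eta> m) + \<Lambda> (smul \<eta> m')) \<in> \<int>"
    using Lambda_add[OF smul_closed smul_closed] assms m m' Mset_K by (simp add: smul_add[OF assms assms])
  thus "\<phi> \<eta> (vecM (m + m')) = \<phi> \<eta> (vecM m) * \<phi> \<eta> (vecM m')"
    using m m' Mset_add[OF m m'] by (simp add: phi_vecM ec_add[symmetric] ec_eq_iff)
qed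

lemma phi_mult: assumes "\<eta> \<in> carrier AG" "\<zeta> \<in> carrier AG" shows "\<phi> (\<eta> +\<^sub>A \<zeta>) = \<phi> \<eta> \<otimes>\<^bsub>GD\<^esub> \<phi> \<zeta>"
proof (rule extensionalityI)
  show "\<phi> (\<eta> +\<^sub>A \<zeta>) x = (\<phi> \<eta> \<otimes>\<^bsub>GD\<^esub> \<phi> \<zeta>) x" if "x \<in> G_set A" for x
    unfolding GD_mult using that assms Lambda_smul_add[OF assms Mset_K]
    by (auto simp: G_set_eq phi_vecM ec_add[symmetric] ec_eq_iff)
qed (simp_all add: phi_extensional GD_mult)

lemma phi_hom: "\<phi> \<in> hom AG GD"
  using phi_closed phi_mult by (auto simp: hom_def)

text \<open>Realizes the quotient of \<open>\<chi>\<close> by \<open>\<phi> \<eta>\<close> and moves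
  \<open>\<eta>\<close> accordingly. Surjectivity is the case of the neutral \<open>\<eta>\<close>
  with arbitrary lifts; openness needs the bounds on the displacement
  \<open>\<zeta>\<close>.\<close>

lemma phi_correct:
  assumes \<eta>: "\<eta> \<in> carrier AG" and \<chi>: "\<chi> \<in> carrier GD"
    and t: "\<And>j. j < n \<Longrightarrow> \<chi> (vecM (w j / l ^ k)) = \<phi> \<eta> (vecM (w j / l ^ k)) * ec (t j)"
  shows "\<exists>\<zeta>\<in>carrier AG. \<phi> (\<eta> +\<^sub>A \<zeta>) = \<chi> \<and>
    (\<forall>\<tau>\<in>Emb. Z \<zeta> \<tau> = - (\<Sum>j<n. of_real (t j) * \<tau> (l ^ k * u $ j))) \<and>
    (\<forall>P\<in>Pl. labP P (\<zeta> (Fin_place P)) \<le> (1 / 2) ^ k)"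
proof -
  define c where "c m = \<chi> (vecM m) / \<phi> \<eta> (vecM m)" for m
  have nz: "\<phi> \<eta> (vecM m) \<noteq> 0" if "m \<in> Mset" for m using that by (simp add: phi_vecM)
  have "\<exists>\<zeta>\<in>carrier AG. (\<forall>m\<in>Mset. ec (\<Lambda> (smul \<zeta> m)) = c m) \<and>
    (\<forall>\<tau>\<in>Emb. Z \<zeta> \<tau> = - (\<Sum>j<n. of_real (t j) * \<tau> (l ^ k * u $ j))) \<and>
    (\<forall>P\<in>Pl. labP P (\<zeta> (Fin_place P)) \<le> (1 / 2) ^ k)"
  proof (rule character_realized)
    show "c (m + m') = c m * c m'" "cmod (c m) = 1" if "m \<in> Mset" "m' \<in> Mset" for m m'
      using that \<chi> phi_closed[OF \<eta>] unfolding c_def GD_carrier by (simp_all add: norm_divide)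
    show "c (w j / l ^ k) = ec (t j)" if "j < n" for j
      unfolding c_def t[OF that] using nz[OF w_l_Mset[OF that]] by simp
  qed
  then obtain \<zeta> where \<zeta>: "\<zeta> \<in> carrier AG" "\<And>m. m \<in> Mset \<Longrightarrow> ec (\<Lambda> (smul \<zeta> m)) = c m"
    "\<forall>\<tau>\<in>Emb. Z \<zeta> \<tau> = - (\<Sum>j<n. of_real (t j) * \<tau> (l ^ k * u $ j))"
    "\<forall>P\<in>Pl. labP P (\<zeta> (Fin_place P)) \<le> (1 / 2) ^ k" by blast
  have "\<phi> (\<eta> +\<^sub>A \<zeta>) = \<chi>"
  proof (rule GD_eqI[OF phi_closed \<chi>])
    show "\<eta> +\<^sub>A \<zeta> \<in> carrier AG" using \<eta> \<zeta>(1) by simp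
    fix m assume m: "m \<in> Mset"
    have "\<phi> (\<eta> +\<^sub>A \<zeta>) (vecM m) = \<phi> \<eta> (vecM m) * \<phi> \<zeta> (vecM m)"
      unfolding phi_mult[OF \<eta> \<zeta>(1)] GD_mult using m by (simp add: G_set_eq)
    also have "\<dots> = \<chi> (vecM m)" using nz[OF m] \<zeta>(2)[OF m] by (simp add: phi_vecM[OF m, of \<zeta>] c_def)
    finally show "\<phi> (\<eta> +\<^sub>A \<zeta>) (vecM m) = \<chi> (vecM m)" .
  qed
  thus ?thesis using \<zeta> by blast
qed

lemma GD_norm: "\<chi> \<in> carrier GD \<Longrightarrow> m \<in> Mset \<Longrightarrow> cmod (\<chi> (vecM m)) = 1"
  unfolding GD_carrier by blast

lemma phi_surj: "\<phi> ` carrier AG = carrier GD"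
proof (intro subset_antisym subsetI)
  fix \<chi> assume \<chi>: "\<chi> \<in> carrier GD"
  have "\<exists>s. \<chi> (vecM (w j / l ^ 0)) = \<phi> \<one>\<^bsub>AG\<^esub> (vecM (w j / l ^ 0)) * ec s" if j: "j < n" for j
  proof -
    note W = w_l_Mset[OF j, of 0]
    have nz: "\<phi> \<one>\<^bsub>AG\<^esub> (vecM (w j / l ^ 0)) \<noteq> 0" using phi_vecM[OF W] by simp
    have "cmod (\<chi> (vecM (w j / l ^ 0)) / \<phi> \<one>\<^bsub>AG\<^esub> (vecM (w j / l ^ 0))) = 1"
      using GD_norm[OF \<chi> W] GD_norm[OF phi_closed[OF AG.one_closed] W] by (simp add: norm_divide)
    from ec_exists[OF this] nz show ?thesis by (auto simp: field_simps)
  qed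
  then obtain t where "\<And>j. j < n \<Longrightarrow> \<chi> (vecM (w j / l ^ 0)) = \<phi> \<one>\<^bsub>AG\<^esub> (vecM (w j / l ^ 0)) * ec (t j)" by metis
  from phi_correct[OF AG.one_closed \<chi> this] show "\<chi> \<in> \<phi> ` carrier AG" using AG.l_one by force
qed (use phi_closed in blast)

lemma phi_kernel: "kernel AG GD \<phi> = diag l ` Y_set u l"
proof -
  have "\<phi> \<eta> = \<one>\<^bsub>GD\<^esub> \<longleftrightarrow> annihilates \<eta>" for \<eta>
  proof -
    have "\<phi> \<eta> = \<one>\<^bsub>GD\<^esub> \<longleftrightarrow> (\<forall>x\<in>G_set A. \<phi> \<eta> x = 1)"
      using phi_extensional[of \<eta>] by (auto simp: pontryagin_dual_def G_group_def fun_eq_iff extensional_def restrict_def)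
    thus ?thesis unfolding G_set_eq annihilates_def by (simp add: phi_vecM ec_eq_1_iff)
  qed
  thus ?thesis unfolding kernel_def Y_set_eq
    using annihilator_diag annihilates_diag diag_closed[OF Ymod_K] by auto
qed

text \<open>The dual is a group as the homomorphic image of the adele group, since
  \<open>phi\<close> is onto.\<close>

lemma group_hom_phi: "group_hom AG GD \<phi>"
proof -
  have "annihilates \<one>\<^bsub>AG\<^esub>"
  proof -
    have "diag l 0 = \<one>\<^bsub>AG\<^esub>"
      by (auto simp: diag_def adele_group_def Lv_eq ev_eq valued_field.L_zero[OF place_valued] intro!: restrict_ext)
    thus ?thesis using annihilates_diag[OF lat_0[OF disjI1[OF refl]]] by simp
  qed
  hence "\<phi> \<one>\<^bsub>AG\<^esub> = \<one>\<^bsub>GD\<^esub>"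
    using phi_extensional by (auto simp: pontryagin_dual_def G_group_def fun_eq_iff extensional_def restrict_def G_set_eq phi_vecM ec_eq_1_iff annihilates_def)
  hence "group GD" using AG.hom_imp_img_group[OF phi_hom] unfolding phi_surj by simp
  thus ?thesis using phi_hom by (intro group_hom.intro group_hom_axioms.intro AG.is_group)
qed

end

section \<open>Topology\<close>

lemma finite_min_real:
  assumes "finite I" "\<And>v. v \<in> I \<Longrightarrow> \<exists>\<delta>>0. Q v (\<delta> :: real)" "\<And>v \<delta> \<delta>'. Q v \<delta> \<Longrightarrow> \<delta>' \<le> \<delta> \<Longrightarrow> Q v \<delta>'"
  shows "\<exists>\<delta>>0. \<forall>v\<in>I. Q v \<delta>"
  using assms(1,2)
proof (induction I rule: finite_induct)
  case (insert v I)
  then obtain a b where "a > 0" "\<forall>v\<in>I. Q v a" "b > 0" "Q v b" by (meson insertCI)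
  thus ?case using assms(3) by (intro exI[of _ "min a b"]) (auto intro: min.cobounded1 min.cobounded2)
qed (auto intro: exI[of _ 1])

lemma (in valued_field) metric: "Metric_space (carrier L) (completion_dist K v)"
proof -
  interpret Lf: field L by (rule field_L)
  have swap: "labs (\<zeta> \<ominus>\<^bsub>L\<^esub> \<xi>) = labs (\<xi> \<ominus>\<^bsub>L\<^esub> \<zeta>)" if "\<xi> \<in> carrier L" "\<zeta> \<in> carrier L" for \<xi> \<zeta>
    using labs_uminus[of "\<xi> \<ominus>\<^bsub>L\<^esub> \<zeta>"] that by (simp add: Lf.minus_eq Lf.minus_add Lf.a_comm)
  show ?thesis
  proof
    fix \<xi> \<zeta> \<theta>
    show "0 \<le> completion_dist K v \<xi> \<zeta>" by (simp add: completion_dist_def labs_nonneg)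
    show "completion_dist K v \<xi> \<zeta> = completion_dist K v \<zeta> \<xi>" by (simp add: completion_dist_def swap)
    assume c: "\<xi> \<in> carrier L" "\<zeta> \<in> carrier L"
    thus "completion_dist K v \<xi> \<zeta> = 0 \<longleftrightarrow> \<xi> = \<zeta>" by (simp add: completion_dist_def labs_0_iff Lf.r_right_minus_eq)
    assume t: "\<theta> \<in> carrier L"
    have "\<xi> \<ominus>\<^bsub>L\<^esub> \<theta> = (\<xi> \<ominus>\<^bsub>L\<^esub> \<zeta>) \<oplus>\<^bsub>L\<^esub> (\<zeta> \<ominus>\<^bsub>L\<^esub> \<theta>)"
      using c t by (simp add: Lf.minus_eq Lf.a_assoc Lf.r_neg1)
    thus "completion_dist K v \<xi> \<theta> \<le> completion_dist K v \<xi> \<zeta> + completion_dist K v \<zeta> \<theta>"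
      using c t labs_triangle[of "\<xi> \<ominus>\<^bsub>L\<^esub> \<zeta>" "\<zeta> \<ominus>\<^bsub>L\<^esub> \<theta>"] by (simp add: completion_dist_def)
  qed
qed

lemma ec_near_1: "e > 0 \<Longrightarrow> \<exists>d>0. \<forall>t. \<bar>t\<bar> < d \<longrightarrow> cmod (ec t - 1) < e"
proof -
  assume "e > 0"
  have "(ec \<longlongrightarrow> ec 0) (at 0)" unfolding ec_def by (intro tendsto_intros)
  hence "ec \<midarrow>0\<rightarrow> 1" using ec_eq_1_iff[of 0] by simp
  from LIM_D[OF this \<open>e > 0\<close>] obtain d where d: "d > 0" "\<And>t. t \<noteq> 0 \<and> norm (t - 0) < d \<longrightarrow> norm (ec t - 1) < e" by blast
  have "cmod (ec t - 1) < e" if "\<bar>t\<bar> < d" for t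
    using d(2)[of t] that \<open>e > 0\<close> ec_eq_1_iff[of 0] by (cases "t = 0") auto
  thus ?thesis using d(1) by blast
qed

text \<open>Within distance 1 of 1 the real part is positive, so the angle of a point of the circle
  is the arcsine of its imaginary part, which is continuous at 0.\<close>

lemma ec_lift_near_1: "\<rho> > 0 \<Longrightarrow> \<exists>e>0. \<forall>z. cmod z = 1 \<and> cmod (z - 1) < e \<longrightarrow> (\<exists>t. \<bar>t\<bar> < \<rho> \<and> z = ec t)"
proof -
  assume \<rho>: "\<rho> > 0"
  have "isCont arcsin 0" by (rule isCont_arcsin) auto
  hence "arcsin \<midarrow>0\<rightarrow> 0" unfolding isCont_def by simp
  from LIM_D[OF this, of "2 * pi * \<rho>"] obtain d where d: "d > 0" "\<And>y. y \<noteq> 0 \<and> norm (y - 0) < d \<longrightarrow> norm (arcsin y - 0) < 2 * pi * \<rho>"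
    using \<rho> by auto
  have "\<exists>t. \<bar>t\<bar> < \<rho> \<and> z = ec t" if z: "cmod z = 1" "cmod (z - 1) < min d 1" for z
  proof -
    have "\<bar>Im z\<bar> < d" "\<bar>Re z - 1\<bar> < 1"
      using abs_Im_le_cmod[of "z - 1"] abs_Re_le_cmod[of "z - 1"] z(2) by auto
    hence im: "\<bar>arcsin (Im z)\<bar> < 2 * pi * \<rho>" and re: "Re z > 0"
      using d(2)[of "Im z"] \<rho> by (cases "Im z = 0"; auto)+
    have n: "(Re z)\<^sup>2 + (Im z)\<^sup>2 = 1" using z(1) by (simp add: cmod_def)
    have im1: "- 1 \<le> Im z" "Im z \<le> 1" using abs_Im_le_cmod[of z] z(1) by auto
    have "cos (arcsin (Im z)) = Re z"
      using cos_arcsin[OF im1] n re by (simp add: real_sqrt_unique)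
    hence "z = cis (arcsin (Im z))" using im1 by (simp add: complex_eq_iff)
    thus ?thesis using im by (intro exI[of _ "arcsin (Im z) / (2 * pi)"]) (simp add: ec_cis field_simps)
  qed
  thus ?thesis using d(1) by (intro exI[of _ "min d 1"]) auto
qed

lemma openin_quotient:
  "openin (quotient_group_topology G T H) U \<longleftrightarrow> U \<subseteq> carrier (G Mod H) \<and> openin T {x \<in> carrier G. H #>\<^bsub>G\<^esub> x \<in> U}"
proof -
  let ?P = "\<lambda>U. U \<subseteq> carrier (G Mod H) \<and> openin T {x \<in> carrier G. H #>\<^bsub>G\<^esub> x \<in> U}"
  have "istopology ?P"
    unfolding istopology_def
  proof (intro conjI allI impI)
    fix U V assume "?P U" "?P V"
    moreover have "{x \<in> carrier G. H #>\<^bsub>G\<^esub> x \<in> U \<inter> V} = {x \<in> carrier G. H #>\<^bsub>G\<^esub> x \<in> U} \<inter> {x \<in> carrier G. H #>\<^bsub>G\<^esub> x \<in> V}" by blast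
    ultimately show "U \<inter> V \<subseteq> carrier (G Mod H)" "openin T {x \<in> carrier G. H #>\<^bsub>G\<^esub> x \<in> U \<inter> V}" by auto
  next
    fix \<U> assume U: "\<forall>U\<in>\<U>. ?P U"
    have "{x \<in> carrier G. H #>\<^bsub>G\<^esub> x \<in> \<Union>\<U>} = (\<Union>U\<in>\<U>. {x \<in> carrier G. H #>\<^bsub>G\<^esub> x \<in> U})" by blast
    thus "\<Union>\<U> \<subseteq> carrier (G Mod H)" "openin T {x \<in> carrier G. H #>\<^bsub>G\<^esub> x \<in> \<Union>\<U>}" using U by auto
  qed
  thus ?thesis unfolding quotient_group_topology_def by (simp add: topology_inverse')
qed

context integer_matrix
begin

abbreviation AT :: "(place \<Rightarrow> (nat \<Rightarrow> complex) set) topology" where "AT \<equiv> adele_topology l"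
abbreviation dv :: "place \<Rightarrow> (nat \<Rightarrow> complex) set \<Rightarrow> (nat \<Rightarrow> complex) set \<Rightarrow> real" where
  "dv v \<equiv> completion_dist (simple_ext l) (place_abs (simple_ext l) v)"

lemma metric_Lv: "v \<in> S \<Longrightarrow> Metric_space (carrier (Lv v)) (dv v)"
  unfolding Lv_eq by (rule valued_field.metric[OF place_valued])

lemma completion_topology_eq: "completion_topology K (place_abs K v) = Metric_space.mtopology (carrier (Lv v)) (dv v)"
  by (simp add: completion_topology_def Lv_eq)

lemma dv_eq: "\<xi> \<in> carrier (Lv v) \<Longrightarrow> \<zeta> \<in> carrier (Lv v) \<Longrightarrow> dv v \<xi> \<zeta> = lab v (\<xi> \<ominus>\<^bsub>Lv v\<^esub> \<zeta>)"
  by (simp add: completion_dist_def Lv_eq)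

lemma dv_add: assumes "v \<in> S" "\<xi> \<in> carrier (Lv v)" "\<zeta> \<in> carrier (Lv v)" shows "dv v \<xi> (\<xi> \<oplus>\<^bsub>Lv v\<^esub> \<zeta>) = lab v \<zeta>"
proof -
  interpret field "Lv v" using assms(1) by (rule field_Lv)
  have "\<xi> \<ominus>\<^bsub>Lv v\<^esub> (\<xi> \<oplus>\<^bsub>Lv v\<^esub> \<zeta>) = \<ominus>\<^bsub>Lv v\<^esub> \<zeta>" using assms by (simp add: minus_eq minus_add a_assoc[symmetric] r_neg)
  thus ?thesis using assms by (simp add: dv_eq lab_uminus)
qed

lemma topspace_AT: "topspace AT = carrier AG"
  by (auto simp: adele_topology_def adele_group_def completion_topology_eq
    Metric_space.topspace_mtopology[OF metric_Lv] PiE_iff)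

text \<open>The set of places is finite, so boxes of balls with one common radius generate the
  neighbourhoods, and translation by the center turns balls into bounds on absolute values.\<close>

lemma openin_AT:
  "openin AT U \<longleftrightarrow> U \<subseteq> carrier AG \<and>
    (\<forall>\<eta>\<in>U. \<exists>\<delta>>0. \<forall>\<zeta>\<in>carrier AG. (\<forall>v\<in>S. lab v (\<zeta> v) < \<delta>) \<longrightarrow> \<eta> +\<^sub>A \<zeta> \<in> U)"
proof (intro iffI conjI ballI)
  assume U: "openin AT U"
  show sub: "U \<subseteq> carrier AG" using openin_subset[OF U] topspace_AT by simp
  fix \<eta> assume \<eta>: "\<eta> \<in> U"
  hence \<eta>A: "\<eta> \<in> carrier AG" using sub by blast
  obtain W where W: "\<And>v. v \<in> S \<Longrightarrow> openin (completion_topology K (place_abs K v)) (W v)" "\<eta> \<in> Pi\<^sub>E S W" "Pi\<^sub>E S W \<subseteq> U"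
    using bspec[OF U[unfolded adele_topology_def openin_product_topology_alt] \<eta>] by blast
  have "\<exists>\<delta>>0. \<forall>v\<in>S. \<forall>\<xi>\<in>carrier (Lv v). lab v \<xi> < \<delta> \<longrightarrow> \<eta> v \<oplus>\<^bsub>Lv v\<^esub> \<xi> \<in> W v"
  proof (rule finite_min_real)
    fix v assume v: "v \<in> S"
    interpret Metric_space "carrier (Lv v)" "dv v" by (rule metric_Lv[OF v])
    interpret F: field "Lv v" using v by (rule field_Lv)
    have "\<eta> v \<in> W v" using W(2) v by (auto simp: PiE_iff)
    then obtain r where r: "r > 0" "mball (\<eta> v) r \<subseteq> W v"
      using W(1)[OF v] unfolding completion_topology_eq openin_mtopology by blast
    have "\<eta> v \<oplus>\<^bsub>Lv v\<^esub> \<xi> \<in> W v" if "\<xi> \<in> carrier (Lv v)" "lab v \<xi> < r" for \<xi>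
      using r(2) that AG_in[OF \<eta>A v] dv_add[OF v AG_in[OF \<eta>A v] that(1)] by (auto simp: subset_iff)
    thus "\<exists>\<delta>>0. \<forall>\<xi>\<in>carrier (Lv v). lab v \<xi> < \<delta> \<longrightarrow> \<eta> v \<oplus>\<^bsub>Lv v\<^esub> \<xi> \<in> W v" using r(1) by blast
  qed auto
  then obtain \<delta> where \<delta>: "\<delta> > 0" "\<And>v \<xi>. v \<in> S \<Longrightarrow> \<xi> \<in> carrier (Lv v) \<Longrightarrow> lab v \<xi> < \<delta> \<Longrightarrow> \<eta> v \<oplus>\<^bsub>Lv v\<^esub> \<xi> \<in> W v" by blast
  have "\<eta> +\<^sub>A \<zeta> \<in> U" if "\<zeta> \<in> carrier AG" "\<forall>v\<in>S. lab v (\<zeta> v) < \<delta>" for \<zeta>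
    using W(3) \<delta>(2) that by (auto simp: AG_mult PiE_iff AG_in subset_iff)
  thus "\<exists>\<delta>>0. \<forall>\<zeta>\<in>carrier AG. (\<forall>v\<in>S. lab v (\<zeta> v) < \<delta>) \<longrightarrow> \<eta> +\<^sub>A \<zeta> \<in> U" using \<delta>(1) by blast
next
  assume U: "U \<subseteq> carrier AG \<and> (\<forall>\<eta>\<in>U. \<exists>\<delta>>0. \<forall>\<zeta>\<in>carrier AG. (\<forall>v\<in>S. lab v (\<zeta> v) < \<delta>) \<longrightarrow> \<eta> +\<^sub>A \<zeta> \<in> U)"
  show "openin AT U" unfolding adele_topology_def openin_product_topology_alt
  proof
    fix \<eta> assume \<eta>: "\<eta> \<in> U"
    hence \<eta>A: "\<eta> \<in> carrier AG" using U by blast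
    obtain \<delta> where \<delta>: "\<delta> > 0" "\<And>\<zeta>. \<zeta> \<in> carrier AG \<Longrightarrow> \<forall>v\<in>S. lab v (\<zeta> v) < \<delta> \<Longrightarrow> \<eta> +\<^sub>A \<zeta> \<in> U" using U \<eta> by blast
    define W where "W v = Metric_space.mball (carrier (Lv v)) (dv v) (\<eta> v) \<delta>" for v
    have mb: "\<xi> \<in> W v \<longleftrightarrow> \<xi> \<in> carrier (Lv v) \<and> dv v (\<eta> v) \<xi> < \<delta>" if "v \<in> S" for v \<xi>
      unfolding W_def Metric_space.in_mball[OF metric_Lv[OF that]] using AG_in[OF \<eta>A that] by blast
    have "openin (completion_topology K (place_abs K v)) (W v)" if "v \<in> S" for v
      unfolding W_def completion_topology_eq by (rule Metric_space.openin_mball[OF metric_Lv[OF that]])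
    moreover have "\<eta> \<in> Pi\<^sub>E S W"
      using \<eta>A \<delta>(1) mb metric_Lv[THEN Metric_space.mdist_zero] AG_in[OF \<eta>A] by (auto simp: PiE_iff carrier_AG)
    moreover have "Pi\<^sub>E S W \<subseteq> U"
    proof
      fix \<theta> assume \<theta>: "\<theta> \<in> Pi\<^sub>E S W"
      define \<zeta> where "\<zeta> = (\<lambda>v\<in>S. \<theta> v \<ominus>\<^bsub>Lv v\<^esub> \<eta> v)"
      have *: "\<zeta> v \<in> carrier (Lv v) \<and> lab v (\<zeta> v) < \<delta> \<and> \<eta> v \<oplus>\<^bsub>Lv v\<^esub> \<zeta> v = \<theta> v" if v: "v \<in> S" for v
      proof -
        interpret field "Lv v" using v by (rule field_Lv)
        have t: "\<theta> v \<in> carrier (Lv v)" "dv v (\<eta> v) (\<theta> v) < \<delta>" using \<theta> v mb by (auto simp: PiE_iff)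
        have "lab v (\<theta> v \<ominus>\<^bsub>Lv v\<^esub> \<eta> v) = dv v (\<eta> v) (\<theta> v)"
          using dv_eq[OF t(1) AG_in[OF \<eta>A v]] Metric_space.commute[OF metric_Lv[OF v]] by simp
        moreover have "\<eta> v \<oplus>\<^bsub>Lv v\<^esub> (\<theta> v \<ominus>\<^bsub>Lv v\<^esub> \<eta> v) = \<theta> v"
          using t AG_in[OF \<eta>A v] by (simp add: minus_eq a_comm[of _ "\<ominus>\<^bsub>Lv v\<^esub> _"] r_neg2)
        ultimately show ?thesis using t AG_in[OF \<eta>A v] v by (simp add: \<zeta>_def)
      qed
      have \<zeta>: "\<zeta> \<in> carrier AG" unfolding carrier_AG using * by (simp add: \<zeta>_def)
      have "\<eta> +\<^sub>A \<zeta> = \<theta>"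
        using * \<theta> by (intro extensionalityI[of _ S]) (auto simp: AG_mult PiE_iff)
      thus "\<theta> \<in> U" using \<delta>(2)[OF \<zeta>] * by simp
    qed
    ultimately show "\<exists>W. finite {v \<in> S. W v \<noteq> topspace (completion_topology K (place_abs K v))} \<and>
        (\<forall>v\<in>S. openin (completion_topology K (place_abs K v)) (W v)) \<and> \<eta> \<in> Pi\<^sub>E S W \<and> Pi\<^sub>E S W \<subseteq> U"
      by (intro exI[of _ W]) auto
  qed
qed

lemma phi_near_1:
  assumes m: "m \<in> Mset" and "e > 0"
  shows "\<exists>\<delta>>0. \<forall>\<zeta>\<in>carrier AG. (\<forall>v\<in>S. lab v (\<zeta> v) < \<delta>) \<longrightarrow> cmod (\<phi> \<zeta> (vecM m) - 1) < e"
proof -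
  note mK = Mset_K[OF m]
  obtain d where d: "d > 0" "\<And>t. \<bar>t\<bar> < d \<Longrightarrow> cmod (ec t - 1) < e" using ec_near_1[OF \<open>e > 0\<close>] by blast
  \<comment> \<open>Each place may contribute an error \<open>d'\<close>; dividing by
    \<open>card S + 1\<close> keeps the sum strictly below \<open>d\<close>.\<close>
  define d' where "d' = d / (card S + 1)"
  have d': "d' > 0" "card S * d' < d" using d(1) by (auto simp: d'_def field_simps)
  have "\<exists>\<delta>>0. \<forall>v\<in>S. \<forall>\<xi>\<in>carrier (Lv v). lab v \<xi> < \<delta> \<longrightarrow> (\<exists>z\<in>\<int>. \<bar>Lam K v (\<xi> \<otimes>\<^bsub>Lv v\<^esub> ev v m) - z\<bar> < d')"
  proof (rule finite_min_real)
    fix v assume v: "v \<in> S"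
    interpret field "Lv v" using v by (rule field_Lv)
    obtain \<delta> where \<delta>: "\<delta> > 0" "\<And>\<xi>. \<xi> \<in> carrier (Lv v) \<Longrightarrow> lab v \<xi> \<le> \<delta> \<Longrightarrow> \<exists>z\<in>\<int>. \<bar>Lam K v \<xi> - z\<bar> < d'"
      using Lam_small[OF v d'(1)] by blast
    define a where "a = lab v (ev v m)"
    have a: "a \<ge> 0" unfolding a_def using v mK by (intro lab_nonneg) auto
    have "\<exists>z\<in>\<int>. \<bar>Lam K v (\<xi> \<otimes>\<^bsub>Lv v\<^esub> ev v m) - z\<bar> < d'" if xi: "\<xi> \<in> carrier (Lv v)" "lab v \<xi> < \<delta> / (a + 1)" for \<xi>
    proof (rule \<delta>(2))
      have "lab v \<xi> * a \<le> \<delta> / (a + 1) * (a + 1)" using xi a \<delta>(1) lab_nonneg[OF v xi(1)] by (intro mult_mono) auto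
      also have "\<dots> = \<delta>" using a by simp
      finally show "lab v (\<xi> \<otimes>\<^bsub>Lv v\<^esub> ev v m) \<le> \<delta>" using xi v mK by (simp add: lab_mult a_def)
    qed (use xi v mK in simp)
    thus "\<exists>\<delta>>0. \<forall>\<xi>\<in>carrier (Lv v). lab v \<xi> < \<delta> \<longrightarrow> (\<exists>z\<in>\<int>. \<bar>Lam K v (\<xi> \<otimes>\<^bsub>Lv v\<^esub> ev v m) - z\<bar> < d')"
      using \<delta>(1) a by (intro exI[of _ "\<delta> / (a + 1)"]) auto
  qed auto
  then obtain \<delta> where \<delta>: "\<delta> > 0" "\<And>v \<xi>. v \<in> S \<Longrightarrow> \<xi> \<in> carrier (Lv v) \<Longrightarrow> lab v \<xi> < \<delta> \<Longrightarrow>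
      \<exists>z\<in>\<int>. \<bar>Lam K v (\<xi> \<otimes>\<^bsub>Lv v\<^esub> ev v m) - z\<bar> < d'" by blast
  have "cmod (\<phi> \<zeta> (vecM m) - 1) < e" if \<zeta>: "\<zeta> \<in> carrier AG" "\<forall>v\<in>S. lab v (\<zeta> v) < \<delta>" for \<zeta>
  proof -
    have "\<forall>v\<in>S. \<exists>z. z \<in> \<int> \<and> \<bar>Lam K v (\<zeta> v \<otimes>\<^bsub>Lv v\<^esub> ev v m) - z\<bar> < d'" using \<delta>(2) \<zeta> AG_in by blast
    from bchoice[OF this] obtain z where z: "\<And>v. v \<in> S \<Longrightarrow> z v \<in> \<int>"
      "\<And>v. v \<in> S \<Longrightarrow> \<bar>Lam K v (\<zeta> v \<otimes>\<^bsub>Lv v\<^esub> ev v m) - z v\<bar> < d'" by blast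
    have "\<Lambda> (smul \<zeta> m) - (\<Sum>v\<in>S. z v) = (\<Sum>v\<in>S. Lam K v (\<zeta> v \<otimes>\<^bsub>Lv v\<^esub> ev v m) - z v)"
      unfolding \<Lambda>_def sum_subtractf smul_def by (simp del: Lam.simps)
    also have "\<bar>\<dots>\<bar> \<le> (\<Sum>v\<in>S. d')" using z(2) by (intro order_trans[OF sum_abs] sum_mono) (simp add: less_imp_le)
    also have "\<dots> < d" using d'(2) by simp
    finally have "cmod (ec (\<Lambda> (smul \<zeta> m) - (\<Sum>v\<in>S. z v)) - 1) < e" by (rule d(2))
    moreover have "ec (\<Lambda> (smul \<zeta> m) - (\<Sum>v\<in>S. z v)) = ec (\<Lambda> (smul \<zeta> m))"
      using z(1) by (simp add: ec_eq_iff Ints_sum)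
    ultimately show ?thesis using m by (simp add: phi_vecM)
  qed
  thus ?thesis using \<delta>(1) by blast
qed

abbreviation DB :: "(rat vec \<Rightarrow> complex) set set" where
  "DB \<equiv> {{f \<in> carrier GD. f ` C \<subseteq> U} | C U. compactin (discrete_topology (G_set A)) C \<and> open U}"

lemma GDT_eq: "G_dual_topology A = topology_generated_by DB"
  by (simp add: dual_topology_def)

lemma topspace_GDT: "topspace (G_dual_topology A) = carrier GD"
proof -
  have "{f \<in> carrier GD. f ` {} \<subseteq> UNIV} \<in> DB" by (intro CollectI exI[of _ "{}"] exI[of _ UNIV]) auto
  thus ?thesis unfolding GDT_eq topology_generated_by_topspace by auto
qed

text \<open>Compact subsets of a discrete group are finite, so a basic open set constrains finitely
  many values, each of which moves little by \<open>phi_near_1\<close>.\<close>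

lemma phi_continuous: "continuous_map AT (G_dual_topology A) \<phi>"
  unfolding GDT_eq
proof (rule continuous_on_generated_topo)
  show "\<phi> ` topspace AT \<subseteq> \<Union>DB"
    using phi_surj topspace_GDT unfolding topspace_AT GDT_eq topology_generated_by_topspace by simp
  fix B assume "B \<in> DB"
  then obtain C V where B: "B = {f \<in> carrier GD. f ` C \<subseteq> V}" "C \<subseteq> G_set A" "finite C" "open V"
    by (auto simp: compactin_discrete_topology)
  show "openin AT (\<phi> -` B \<inter> topspace AT)"
    unfolding openin_AT topspace_AT
  proof (intro conjI ballI)
    fix \<eta> assume "\<eta> \<in> \<phi> -` B \<inter> carrier AG"
    hence \<eta>: "\<eta> \<in> carrier AG" "\<And>x. x \<in> C \<Longrightarrow> \<phi> \<eta> x \<in> V" using B(1) by auto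
    have "\<exists>\<delta>>0. \<forall>x\<in>C. \<forall>\<zeta>\<in>carrier AG. (\<forall>v\<in>S. lab v (\<zeta> v) < \<delta>) \<longrightarrow> \<phi> (\<eta> +\<^sub>A \<zeta>) x \<in> V"
    proof (rule finite_min_real[OF B(3)])
      fix x assume x: "x \<in> C"
      then obtain m where m: "m \<in> Mset" "x = vecM m" using B(2) G_set_eq by blast
      obtain e where e: "e > 0" "ball (\<phi> \<eta> x) e \<subseteq> V" using \<eta>(2)[OF x] B(4) open_contains_ball by blast
      obtain \<delta> where \<delta>: "\<delta> > 0" "\<And>\<zeta>. \<zeta> \<in> carrier AG \<Longrightarrow> \<forall>v\<in>S. lab v (\<zeta> v) < \<delta> \<Longrightarrow> cmod (\<phi> \<zeta> (vecM m) - 1) < e"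
        using phi_near_1[OF m(1) e(1)] by blast
      have "\<phi> (\<eta> +\<^sub>A \<zeta>) x \<in> V" if \<zeta>: "\<zeta> \<in> carrier AG" "\<forall>v\<in>S. lab v (\<zeta> v) < \<delta>" for \<zeta>
      proof -
        have "\<phi> (\<eta> +\<^sub>A \<zeta>) x = \<phi> \<eta> x * \<phi> \<zeta> x"
          unfolding phi_mult[OF \<eta>(1) \<zeta>(1)] GD_mult using x B(2) by auto
        hence "dist (\<phi> \<eta> x) (\<phi> (\<eta> +\<^sub>A \<zeta>) x) = cmod (\<phi> \<eta> x * (1 - \<phi> \<zeta> x))" by (simp add: dist_norm right_diff_distrib)
        also have "\<dots> = cmod (\<phi> \<zeta> x - 1)"
          using GD_norm[OF phi_closed[OF \<eta>(1)] m(1)] m(2) by (simp add: norm_mult norm_minus_commute)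
        also have "\<dots> < e" using \<delta>(2)[OF \<zeta>] m(2) by simp
        finally show ?thesis using e(2) by (auto simp: subset_iff)
      qed
      thus "\<exists>\<delta>>0. \<forall>\<zeta>\<in>carrier AG. (\<forall>v\<in>S. lab v (\<zeta> v) < \<delta>) \<longrightarrow> \<phi> (\<eta> +\<^sub>A \<zeta>) x \<in> V" using \<delta>(1) by blast
    qed force
    then obtain \<delta> where "\<delta> > 0" "\<forall>x\<in>C. \<forall>\<zeta>\<in>carrier AG. (\<forall>v\<in>S. lab v (\<zeta> v) < \<delta>) \<longrightarrow> \<phi> (\<eta> +\<^sub>A \<zeta>) x \<in> V" by blast
    thus "\<exists>\<delta>>0. \<forall>\<zeta>\<in>carrier AG. (\<forall>v\<in>S. lab v (\<zeta> v) < \<delta>) \<longrightarrow> \<eta> +\<^sub>A \<zeta> \<in> \<phi> -` B \<inter> carrier AG"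
      using \<eta>(1) phi_closed unfolding B(1) by (intro exI[of _ \<delta>]) auto
  qed blast
qed

text \<open>A character close to \<open>\<phi> \<eta>\<close> at finitely many points differs from
  it by one with small lifts, and \<open>phi_correct\<close> realizes this difference by a small
  element.\<close>

lemma phi_open: assumes U: "openin AT U" shows "openin (G_dual_topology A) (\<phi> ` U)"
proof (rule iffD2[OF openin_subopen], rule ballI)
  fix \<chi> assume "\<chi> \<in> \<phi> ` U"
  then obtain \<eta> where \<eta>: "\<eta> \<in> U" "\<chi> = \<phi> \<eta>" "\<eta> \<in> carrier AG" using U openin_AT by blast
  obtain \<delta> where \<delta>: "\<delta> > 0" "\<And>\<zeta>. \<zeta> \<in> carrier AG \<Longrightarrow> \<forall>v\<in>S. lab v (\<zeta> v) < \<delta> \<Longrightarrow> \<eta> +\<^sub>A \<zeta> \<in> U"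
    using U \<eta>(1) unfolding openin_AT by blast
  \<comment> \<open>\<open>k\<close> settles the finite places; afterwards \<open>\<rho>\<close>,
    which depends on \<open>k\<close> through \<open>b\<close>, bounds the lifts so that the
    infinite components stay below \<open>\<delta>\<close>.\<close>
  obtain k where k: "(1 / 2) ^ k < \<delta>" using real_arch_pow_inv[OF \<delta>(1), of "1 / 2"] by auto
  define b where "b = (\<Sum>\<tau>\<in>Emb. \<Sum>j<n. cmod (\<tau> (l ^ k * u $ j)))"
  have b0: "b \<ge> 0" unfolding b_def by (intro sum_nonneg) auto
  define \<rho> where "\<rho> = \<delta> / (b + 1)"
  have \<rho>: "\<rho> > 0" "\<rho> * b < \<delta>" using \<delta>(1) b0 by (auto simp: \<rho>_def field_simps)
  obtain e where e: "e > 0" "\<And>z. cmod z = 1 \<Longrightarrow> cmod (z - 1) < e \<Longrightarrow> \<exists>t. \<bar>t\<bar> < \<rho> \<and> z = ec t"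
    using ec_lift_near_1[OF \<rho>(1)] by blast
  \<comment> \<open>Nearness is demanded only at the points \<open>w j / l ^ k\<close>, where the
    lifts are taken.\<close>
  define W where "W = (\<Inter>j\<in>{..<n}. {f \<in> carrier GD. f ` {vecM (w j / l ^ k)} \<subseteq> ball (\<chi> (vecM (w j / l ^ k))) e})"
  have \<chi>: "\<chi> \<in> carrier GD" using \<eta> phi_closed by simp
  have "openin (G_dual_topology A) {f \<in> carrier GD. f ` {vecM (w j / l ^ k)} \<subseteq> ball (\<chi> (vecM (w j / l ^ k))) e}" if "j < n" for j
    unfolding GDT_eq using w_l_Mset[OF that]
    by (intro topology_generated_by_Basis CollectI exI[of _ "{vecM (w j / l ^ k)}"] exI[of _ "ball (\<chi> (vecM (w j / l ^ k))) e"] conjI refl)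
      (simp_all add: compactin_discrete_topology G_set_eq)
  hence "openin (G_dual_topology A) W" unfolding W_def using n_pos by (intro openin_INT2) auto
  moreover have "\<chi> \<in> W" unfolding W_def using \<chi> e(1) by auto
  moreover have "W \<subseteq> \<phi> ` U"
  proof
    fix \<chi>' assume W': "\<chi>' \<in> W"
    hence \<chi>': "\<chi>' \<in> carrier GD" unfolding W_def using n_pos by auto
    have "\<exists>t. \<bar>t\<bar> < \<rho> \<and> \<chi>' (vecM (w j / l ^ k)) = \<phi> \<eta> (vecM (w j / l ^ k)) * ec t" if j: "j < n" for j
    proof -
      let ?g = "vecM (w j / l ^ k)"
      have n1: "cmod (\<chi> ?g) = 1" "cmod (\<chi>' ?g) = 1" using GD_norm[OF _ w_l_Mset[OF j]] \<chi> \<chi>' by blast+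
      hence nz: "\<chi> ?g \<noteq> 0" by force
      have "cmod (\<chi>' ?g / \<chi> ?g - 1) = cmod ((\<chi>' ?g - \<chi> ?g) / \<chi> ?g)" using nz by (simp add: diff_divide_distrib)
      also have "\<dots> < e" using W' j n1 by (auto simp: W_def norm_divide dist_norm norm_minus_commute)
      finally obtain t where "\<bar>t\<bar> < \<rho>" "\<chi>' ?g / \<chi> ?g = ec t" using e(2)[of "\<chi>' ?g / \<chi> ?g"] n1 by (auto simp: norm_divide)
      thus ?thesis using nz \<eta>(2) by (intro exI[of _ t]) (simp add: field_simps)
    qed
    then obtain t where t: "\<And>j. j < n \<Longrightarrow> \<bar>t j\<bar> < \<rho>"
      "\<And>j. j < n \<Longrightarrow> \<chi>' (vecM (w j / l ^ k)) = \<phi> \<eta> (vecM (w j / l ^ k)) * ec (t j)" by metis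
    from phi_correct[OF \<eta>(3) \<chi>' t(2)] obtain \<zeta> where \<zeta>: "\<zeta> \<in> carrier AG" "\<phi> (\<eta> +\<^sub>A \<zeta>) = \<chi>'"
      "\<And>\<tau>. \<tau> \<in> Emb \<Longrightarrow> Z \<zeta> \<tau> = - (\<Sum>j<n. of_real (t j) * \<tau> (l ^ k * u $ j))"
      "\<And>P. P \<in> Pl \<Longrightarrow> labP P (\<zeta> (Fin_place P)) \<le> (1 / 2) ^ k" by blast
    have "lab v (\<zeta> v) < \<delta>" if v: "v \<in> S" for v
      using v
    proof (cases rule: S_cases)
      case (1 \<tau>)
      have "cmod (Z \<zeta> \<tau>) \<le> (\<Sum>j<n. \<rho> * cmod (\<tau> (l ^ k * u $ j)))"
        unfolding \<zeta>(3)[OF 1(1)] norm_minus_cancel using t(1)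
        by (intro order_trans[OF norm_sum] sum_mono) (auto simp: norm_mult less_imp_le intro!: mult_right_mono)
      also have "\<dots> \<le> \<rho> * b"
        unfolding b_def sum_distrib_left[symmetric] using 1(1) \<rho>(1)
        by (intro mult_left_mono member_le_sum[of \<tau> Emb "\<lambda>\<tau>. \<Sum>j<n. cmod (\<tau> (l ^ k * u $ j))"] sum_nonneg) auto
      finally show ?thesis unfolding 1(2) using Z_norm[OF 1(1) \<zeta>(1) \<zeta>(1) zero_K] \<rho>(2) by simp
    next
      case (2 P t p)
      thus ?thesis using \<zeta>(4)[OF 2(1)] k by simp
    qed
    hence "\<eta> +\<^sub>A \<zeta> \<in> U" using \<delta>(2) \<zeta>(1) by blast
    thus "\<chi>' \<in> \<phi> ` U" using \<zeta>(2) by blast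
  qed
  ultimately show "\<exists>T. openin (G_dual_topology A) T \<and> \<chi> \<in> T \<and> T \<subseteq> \<phi> ` U" by blast
qed

text \<open>The isomorphism induced by \<open>phi\<close> on cosets of its kernel. It inherits
  continuity and openness because open sets of the quotient correspond to their preimages in the
  adele group.\<close>

lemma quotient_homeomorphism:
  defines "H \<equiv> diag l ` Y_set u l"
  shows "\<exists>\<psi>. \<psi> \<in> iso (AG Mod H) GD \<and>
    homeomorphic_map (quotient_group_topology AG AT H) (G_dual_topology A) \<psi> \<and>
    (\<forall>\<eta>\<in>carrier AG. \<psi> (H #>\<^bsub>AG\<^esub> \<eta>) = \<phi> \<eta>)"
proof -
  interpret group_hom AG GD \<phi> by (rule group_hom_phi)
  define \<psi> where "\<psi> C = the_elem (\<phi> ` C)" for C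
  have H: "kernel AG GD \<phi> = H" unfolding H_def by (rule phi_kernel)
  have iso: "\<psi> \<in> iso (AG Mod H) GD"
    using FactGroup_iso_set[OF phi_surj] unfolding H \<psi>_def .
  have \<psi>: "\<psi> (H #>\<^bsub>AG\<^esub> \<eta>) = \<phi> \<eta>" if \<eta>: "\<eta> \<in> carrier AG" for \<eta>
  proof -
    have "\<phi> (h +\<^sub>A \<eta>) = \<phi> \<eta>" if "h \<in> H" for h
      using that \<eta> unfolding H[symmetric] kernel_def by simp
    moreover have "H \<noteq> {}" unfolding H[symmetric] kernel_def using hom_one by blast
    ultimately have "\<phi> ` (H #>\<^bsub>AG\<^esub> \<eta>) = {\<phi> \<eta>}" unfolding r_coset_def by (auto simp: image_UN)
    thus ?thesis unfolding \<psi>_def by simp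
  qed
  have Mod: "carrier (AG Mod H) = (\<lambda>\<eta>. H #>\<^bsub>AG\<^esub> \<eta>) ` carrier AG"
    unfolding FactGroup_def RCOSETS_def by auto
  let ?Q = "quotient_group_topology AG AT H"
  have all: "{\<eta> \<in> carrier AG. H #>\<^bsub>AG\<^esub> \<eta> \<in> carrier (AG Mod H)} = topspace AT" unfolding Mod topspace_AT by blast
  have top: "topspace ?Q = carrier (AG Mod H)"
  proof
    show "topspace ?Q \<subseteq> carrier (AG Mod H)" using openin_quotient[of AG AT H "topspace ?Q"] by simp
    show "carrier (AG Mod H) \<subseteq> topspace ?Q"
      using openin_quotient[of AG AT H "carrier (AG Mod H)"] all openin_topspace[of AT] by (intro openin_subset) simp
  qed
  have bij: "bij_betw \<psi> (carrier (AG Mod H)) (carrier GD)" using iso by (simp add: iso_def)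
  have "homeomorphic_map ?Q (G_dual_topology A) \<psi>"
  proof (rule bijective_open_imp_homeomorphic_map)
    show "continuous_map ?Q (G_dual_topology A) \<psi>"
      unfolding continuous_map_def top topspace_GDT
    proof (intro conjI allI impI)
      show "\<psi> \<in> carrier (AG Mod H) \<rightarrow> carrier GD" using bij by (auto simp: bij_betw_def)
      fix V assume V: "openin (G_dual_topology A) V"
      have "{\<eta> \<in> carrier AG. H #>\<^bsub>AG\<^esub> \<eta> \<in> {C \<in> carrier (AG Mod H). \<psi> C \<in> V}} = {\<eta> \<in> topspace AT. \<phi> \<eta> \<in> V}"
        unfolding Mod topspace_AT using \<psi> by auto
      thus "openin ?Q {C \<in> carrier (AG Mod H). \<psi> C \<in> V}"
        unfolding openin_quotient using openin_continuous_map_preimage[OF phi_continuous V] by auto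
    qed
    show "open_map ?Q (G_dual_topology A) \<psi>" unfolding open_map_def
    proof (intro allI impI)
      fix U assume "openin ?Q U"
      hence U: "U \<subseteq> carrier (AG Mod H)" "openin AT {\<eta> \<in> carrier AG. H #>\<^bsub>AG\<^esub> \<eta> \<in> U}" unfolding openin_quotient by blast+
      have "\<psi> ` U = \<phi> ` {\<eta> \<in> carrier AG. H #>\<^bsub>AG\<^esub> \<eta> \<in> U}"
      proof (intro subset_antisym subsetI)
        fix \<chi> assume "\<chi> \<in> \<psi> ` U"
        then obtain C where C: "C \<in> U" "\<chi> = \<psi> C" by blast
        then obtain \<eta> where "\<eta> \<in> carrier AG" "C = H #>\<^bsub>AG\<^esub> \<eta>" using U(1) Mod by blast
        thus "\<chi> \<in> \<phi> ` {\<eta> \<in> carrier AG. H #>\<^bsub>AG\<^esub> \<eta> \<in> U}" using C \<psi> by auto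
      next
        fix \<chi> assume "\<chi> \<in> \<phi> ` {\<eta> \<in> carrier AG. H #>\<^bsub>AG\<^esub> \<eta> \<in> U}"
        then obtain \<eta> where "\<eta> \<in> carrier AG" "H #>\<^bsub>AG\<^esub> \<eta> \<in> U" "\<chi> = \<phi> \<eta>" by blast
        thus "\<chi> \<in> \<psi> ` U" using \<psi>[of \<eta>] by (intro image_eqI[of _ _ "H #>\<^bsub>AG\<^esub> \<eta>"]) auto
      qed
      thus "openin (G_dual_topology A) (\<psi> ` U)" using phi_open[OF U(2)] by simp
    qed
  qed (use bij in \<open>auto simp: top topspace_GDT bij_betw_def\<close>)
  thus ?thesis using iso \<psi> by blast
qed

end

theorem theorem5p5:
  fixes A :: "int mat" and n :: nat and l :: complex and u :: "complex vec"
  assumes "A \<in> carrier_mat n n"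
    and "det A \<noteq> 0"
    and "Factorial_Ring.irreducible (map_poly rat_of_int (char_poly A))"
    and "eigenvalue (map_mat complex_of_int A) l"
    and "eigenvector (map_mat complex_of_int A) u l"
    and "\<forall>i<n. u $ i \<in> integers_of (simple_ext l)"
  shows "phi A u l \<in> hom (adele_group l) (G_dual A)
    \<and> phi A u l ` carrier (adele_group l) = carrier (G_dual A)
    \<and> kernel (adele_group l) (G_dual A) (phi A u l) = diag l ` Y_set u l
    \<and> (\<exists>\<psi>. \<psi> \<in> iso (adele_group l Mod diag l ` Y_set u l) (G_dual A)
          \<and> homeomorphic_map
              (quotient_group_topology (adele_group l) (adele_topology l) (diag l ` Y_set u l))
              (G_dual_topology A) \<psi>
          \<and> (\<forall>\<eta> \<in> carrier (adele_group l).
               \<psi> (diag l ` Y_set u l #>\<^bsub>adele_group l\<^esub> \<eta>) = phi A u l \<eta>))"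
proof -
  interpret integer_matrix A n l u by (rule integer_matrix.intro[OF assms])
  show ?thesis
    using phi_hom phi_surj phi_kernel quotient_homeomorphism by (intro conjI)
qed

end
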